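(* Let $A=\mathrm{diag}(a_1,a_2,a_3)$ be a real diagonal $3\times 3$ matrix with pairwise distinct diagonal entries, and let $\infty_i=(1:a_i:0)\in\mathbb{CP}^2$ for $i=1,2,3$. Let $C\subset\mathbb{CP}^2$ be a smooth real cubic curve passing through $\infty_1,\infty_2,\infty_3$, and let $\mathcal T_C=\{X\in\mathfrak{gl}(3,\mathbb R) : C_X=C\}$, where $C_X$ is the spectral curve of $X$. Then the following statements hold. 1. If the real part of $C$ has one oval, then $\mathcal T_C$ has four connected components, each diffeomorphic to $\mathbb R^3$. 2. If the real part of $C$ has two ovals and one of them is bounded, then $\mathcal T_C$ has four connected components diffeomorphic to $\mathbb R^3$ and four connected components diffeomorphic to $S^1\times\mathbb R^2$ (and no others). 3. If the real part of $C$ has two unbounded ovals, then $\mathcal T_C$ has four connected components diffeomorphic to $\mathbb R^3$ and two connected components diffeomorphic to $S^1\times\mathbb R^2$ (and no others). Furthermore, all solutions of the differential equation $\frac{d}{dt}X=[X^2,A]$ lying on components of $\mathcal T_C$ diffeomorphic to $\mathbb R^3$ blow up, while all solutions lying on components diffeomorphic to $S^1\times\mathbb R^2$ exist for all times $t\in\mathbb R$.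
   Context: $\mathfrak{gl}(3,\mathbb R)$ is the space of real $3\times3$ matrices. The spectral curve of $X\in\mathfrak{gl}(3,\mathbb R)$ (with respect to $A$) is $$C_X=\{(z_1:z_2:z_3)\in\mathbb{CP}^2 : \det(z_3X+z_1A-z_2\,\mathrm{Id})=0\}.$$ It is conserved along solutions of $\frac{d}{dt}X=[X^2,A]$, so each solution lies in a single set $\mathcal T_C$. A curve in $\mathbb{CP}^2$ is real if it is the zero locus of a real homogeneous polynomial (equivalently, invariant under complex conjugation). Its real part is $C_{\mathbb R}=C\cap\mathbb{RP}^2$; for smooth $C$ the connected components of $C_{\mathbb R}$ are closed curves called ovals. An oval is bounded if it does not intersect the line at infinity $\{z_3=0\}$, and unbounded otherwise. (A smooth real cubic has either one oval, which is unbounded, or two ovals, at least one of which is unbounded.) "A solution blows up" means that it blows up in finite time both forward and backward in time. *)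

theory Defs
  imports "HOL-Analysis.Analysis"
begin

section \<open>The complex projective plane\<close>

definition proj_rel :: "complex^3 \<Rightarrow> complex^3 \<Rightarrow> bool" where
  "proj_rel u v \<longleftrightarrow> u \<noteq> 0 \<and> v \<noteq> 0 \<and> (\<exists>c. v = c *s u)"

lemma part_equivp_proj_rel: "part_equivp proj_rel"
proof (rule part_equivpI)
  show "\<exists>x. proj_rel x x"
  proof (rule exI[of _ "1 :: complex^3"])
    have "(1 :: complex^3) = 1 *s 1" by (simp only: vector_smult_lid)
    then show "proj_rel 1 1"
      unfolding proj_rel_def using one_neq_zero by blast
  qed
  show "symp proj_rel"
  proof (rule sympI)
    fix u v assume "proj_rel u v"
    then obtain c where c: "u \<noteq> 0" "v \<noteq> 0" "v = c *s u"
      by (auto simp: proj_rel_def)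
    have "c \<noteq> 0"
    proof
      assume "c = 0"
      then have "v = 0" by (simp only: c(3) vector_smult_lzero)
      then show False using c(2) by contradiction
    qed
    then have "inverse c *s v = u"
      by (simp only: c(3) vector_smult_assoc left_inverse[OF \<open>c \<noteq> 0\<close>] vector_smult_lid)
    then have "u = inverse c *s v" by (rule sym)
    then show "proj_rel v u"
      unfolding proj_rel_def using c(1,2) by blast
  qed
  show "transp proj_rel"
  proof (rule transpI)
    fix u v w assume "proj_rel u v" "proj_rel v w"
    then obtain c d where "u \<noteq> 0" "w \<noteq> 0" "v = c *s u" "w = d *s v"
      by (auto simp: proj_rel_def)
    then have "w = (d * c) *s u" by (simp add: vector_smult_assoc)
    then show "proj_rel u w"
      unfolding proj_rel_def using \<open>u \<noteq> 0\<close> \<open>w \<noteq> 0\<close> by blast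
  qed
qed

quotient_type cp2 = "complex^3" / partial: proj_rel
  by (rule part_equivp_proj_rel)

text \<open>\<open>hpoint z\<close> is the point with homogeneous coordinates \<open>(z\<^sub>1 : z\<^sub>2 : z\<^sub>3)\<close>; it is meaningful
  only for \<open>z \<noteq> 0\<close>.\<close>

definition hpoint :: "complex^3 \<Rightarrow> cp2" where
  "hpoint z = abs_cp2 z"

text \<open>The quotient topology with respect to the projection from the nonzero vectors.\<close>

instantiation cp2 :: topological_space
begin

definition open_cp2 :: "cp2 set \<Rightarrow> bool" where
  "open_cp2 U \<longleftrightarrow> open {z :: complex^3. z \<noteq> 0 \<and> hpoint z \<in> U}"

instance
proof
  have "{z :: complex^3. z \<noteq> 0} = - {0}" by auto
  then show "open (UNIV :: cp2 set)"
    by (simp add: open_cp2_def open_Compl)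
next
  fix S T :: "cp2 set"
  assume "open S" "open T"
  have "{z. z \<noteq> 0 \<and> hpoint z \<in> S \<inter> T} =
      {z. z \<noteq> 0 \<and> hpoint z \<in> S} \<inter> {z. z \<noteq> 0 \<and> hpoint z \<in> T}" by auto
  then show "open (S \<inter> T)"
    using \<open>open S\<close> \<open>open T\<close> by (simp only: open_cp2_def open_Int)
next
  fix K :: "cp2 set set"
  assume K: "\<forall>S\<in>K. open S"
  have "{z. z \<noteq> 0 \<and> hpoint z \<in> \<Union>K} = (\<Union>S\<in>K. {z. z \<noteq> 0 \<and> hpoint z \<in> S})" by auto
  moreover have "open (\<Union>S\<in>K. {z. z \<noteq> 0 \<and> hpoint z \<in> S})"
    using K by (intro open_UN) (simp add: open_cp2_def)
  ultimately show "open (\<Union>K)"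
    by (simp only: open_cp2_def)
qed

end

definition RP2 :: "cp2 set" where
  "RP2 = {hpoint z | z. z \<noteq> 0 \<and> (\<forall>i. z $ i \<in> \<real>)}"

definition line_at_infinity :: "cp2 set" where
  "line_at_infinity = {hpoint z | z. z \<noteq> 0 \<and> z $ 3 = 0}"


section \<open>Plane curves\<close>

text \<open>The homogeneous polynomial of degree \<open>d\<close> whose coefficient at
  \<open>z\<^sub>1\<^sup>i z\<^sub>2\<^sup>j z\<^sub>3\<^sup>k\<close>, \<open>i + j + k = d\<close>, is \<open>c i j k\<close>.\<close>

definition hpoly :: "nat \<Rightarrow> (nat \<Rightarrow> nat \<Rightarrow> nat \<Rightarrow> complex) \<Rightarrow> complex^3 \<Rightarrow> complex" where
  "hpoly d c z = (\<Sum>(i, j, k) \<in> {(i, j, k). i + j + k = d}.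
      c i j k * (z $ 1) ^ i * (z $ 2) ^ j * (z $ 3) ^ k)"

definition zero_locus :: "(complex^3 \<Rightarrow> complex) \<Rightarrow> cp2 set" where
  "zero_locus F = {hpoint z | z. z \<noteq> 0 \<and> F z = 0}"

text \<open>A real homogeneous polynomial is one with real coefficients; the zero polynomial does not
  define a curve.\<close>

definition real_curve :: "cp2 set \<Rightarrow> bool" where
  "real_curve C \<longleftrightarrow> (\<exists>d (c :: nat \<Rightarrow> nat \<Rightarrow> nat \<Rightarrow> real).
      (\<exists>i j k. i + j + k = d \<and> c i j k \<noteq> 0) \<and>
      C = zero_locus (hpoly d (\<lambda>i j k. of_real (c i j k))))"

text \<open>The differential of the defining cubic form vanishes at no point of the curve. (For a
  holomorphic function, the real Frechet derivative vanishes iff all complex partial derivatives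
  do.)\<close>

definition smooth_cubic :: "cp2 set \<Rightarrow> bool" where
  "smooth_cubic C \<longleftrightarrow> (\<exists>c. C = zero_locus (hpoly 3 c) \<and>
      (\<forall>z. z \<noteq> 0 \<and> hpoly 3 c z = 0 \<longrightarrow> \<not> (hpoly 3 c has_derivative (\<lambda>_. 0)) (at z)))"

definition ovals :: "cp2 set \<Rightarrow> cp2 set set" where
  "ovals C = components (C \<inter> RP2)"

definition bounded_oval :: "cp2 set \<Rightarrow> bool" where
  "bounded_oval Q \<longleftrightarrow> Q \<inter> line_at_infinity = {}"


section \<open>Spectral curves\<close>

definition diag :: "real^3 \<Rightarrow> real^3^3" where
  "diag a = (\<chi> i j. if i = j then a $ i else 0)"

definition spectral_curve :: "real^3^3 \<Rightarrow> real^3^3 \<Rightarrow> cp2 set" where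
  "spectral_curve A X = zero_locus (\<lambda>z. det (\<chi> i j.
      z $ 3 * of_real (X $ i $ j) + z $ 1 * of_real (A $ i $ j) - z $ 2 * mat 1 $ i $ j))"

definition isospectral_set :: "real^3^3 \<Rightarrow> cp2 set \<Rightarrow> (real^3^3) set" where
  "isospectral_set A C = {X. spectral_curve A X = C}"

definition infinity_pt :: "real^3 \<Rightarrow> 3 \<Rightarrow> cp2" where
  "infinity_pt a i = hpoint (vector [1, of_real (a $ i), 0])"


section \<open>Diffeomorphisms between subsets of Euclidean spaces\<close>

text \<open>\<open>C_on n f U\<close>, meant for open \<open>U\<close>: \<open>f\<close> is \<open>n\<close> times continuously differentiable on \<open>U\<close>.\<close>

fun C_on :: "nat \<Rightarrow> ('a::euclidean_space \<Rightarrow> 'b::euclidean_space) \<Rightarrow> 'a set \<Rightarrow> bool" where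
  "C_on 0 f U \<longleftrightarrow> continuous_on U f"
| "C_on (Suc n) f U \<longleftrightarrow> (\<forall>x\<in>U. f differentiable (at x)) \<and>
     (\<forall>v. C_on n (\<lambda>x. frechet_derivative f (at x) v) U)"

text \<open>A map on an arbitrary subset is smooth if it extends locally to a \<open>C\<^sup>\<infinity>\<close> map on an open set.
  On embedded submanifolds this is smoothness for the induced structure, and a set that is
  diffeomorphic in the sense below to a submanifold is itself one.\<close>

definition smooth_map :: "'a::euclidean_space set \<Rightarrow> ('a \<Rightarrow> 'b::euclidean_space) \<Rightarrow> bool" where
  "smooth_map S f \<longleftrightarrow> (\<forall>x\<in>S. \<exists>U g. open U \<and> x \<in> U \<and> (\<forall>n. C_on n g U) \<and>
      (\<forall>y\<in>S \<inter> U. g y = f y))"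

definition diffeomorphic :: "'a::euclidean_space set \<Rightarrow> 'b::euclidean_space set \<Rightarrow> bool" where
  "diffeomorphic S T \<longleftrightarrow> (\<exists>f g. homeomorphism S T f g \<and> smooth_map S f \<and> smooth_map T g)"

definition diffeo_R3 :: "'a::euclidean_space set \<Rightarrow> bool" where
  "diffeo_R3 K \<longleftrightarrow> diffeomorphic K (UNIV :: (real^3) set)"

definition diffeo_S1_R2 :: "'a::euclidean_space set \<Rightarrow> bool" where
  "diffeo_S1_R2 K \<longleftrightarrow> diffeomorphic K (sphere (0 :: real^2) 1 \<times> (UNIV :: (real^2) set))"


section \<open>Solutions of the differential equation\<close>

definition commutator :: "real^3^3 \<Rightarrow> real^3^3 \<Rightarrow> real^3^3" where
  "commutator X Y = X ** Y - Y ** X"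

definition solution :: "real^3^3 \<Rightarrow> real set \<Rightarrow> (real \<Rightarrow> real^3^3) \<Rightarrow> bool" where
  "solution A J X \<longleftrightarrow> open J \<and> is_interval J \<and> J \<noteq> {} \<and>
      (\<forall>t\<in>J. (X has_vector_derivative commutator (X t ** X t) A) (at t))"

definition maximal_solution :: "real^3^3 \<Rightarrow> real set \<Rightarrow> (real \<Rightarrow> real^3^3) \<Rightarrow> bool" where
  "maximal_solution A J X \<longleftrightarrow> solution A J X \<and>
      (\<forall>J' Y. solution A J' Y \<and> J \<subseteq> J' \<and> (\<forall>t\<in>J. Y t = X t) \<longrightarrow> J' = J)"

definition blows_up :: "real set \<Rightarrow> (real \<Rightarrow> real^3^3) \<Rightarrow> bool" where
  "blows_up J X \<longleftrightarrow> (\<exists>\<alpha> \<beta>. \<alpha> < \<beta> \<and> J = {\<alpha><..<\<beta>} \<and>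
      filterlim (\<lambda>t. norm (X t)) at_top (at_right \<alpha>) \<and>
      filterlim (\<lambda>t. norm (X t)) at_top (at_left \<beta>))"

end

theory Submission
  imports Defs "HOL-Real_Asymp.Real_Asymp" "HOL-Computational_Algebra.Fundamental_Theorem_Algebra"
begin

text \<open>
  Put \<open>L\<^sub>i = x\<^sub>i z\<^sub>3 + a\<^sub>i z\<^sub>1 - z\<^sub>2\<close>. A real cubic through the points \<open>\<infinity>\<^sub>i\<close>, suitably normalized, is
  \<open>L\<^sub>1 L\<^sub>2 L\<^sub>3 - z\<^sub>3\<^sup>2 (q\<^sub>1 L\<^sub>1 + q\<^sub>2 L\<^sub>2 + q\<^sub>3 L\<^sub>3) + g z\<^sub>3\<^sup>3\<close>, and the only linear relation
  \<open>w\<^sub>1 L\<^sub>1 + w\<^sub>2 L\<^sub>2 + w\<^sub>3 L\<^sub>3 = \<kappa> z\<^sub>3\<close> has \<open>w\<close> proportional to \<open>(a\<^sub>2 - a\<^sub>3, a\<^sub>3 - a\<^sub>1, a\<^sub>1 - a\<^sub>2)\<close>. Hence \<open>X\<close> has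
  spectral curve \<open>C\<close> iff its diagonal is \<open>x\<close> and, for some \<open>s\<close>, \<open>X\<^sub>j\<^sub>k X\<^sub>k\<^sub>j = P\<^sub>i(s) = q\<^sub>i + s w\<^sub>i\<close> and
  \<open>u + v = \<l>(s) = g + \<kappa> s\<close>, where \<open>u = X\<^sub>1\<^sub>2 X\<^sub>2\<^sub>3 X\<^sub>3\<^sub>1\<close> and \<open>v = X\<^sub>1\<^sub>3 X\<^sub>3\<^sub>2 X\<^sub>2\<^sub>1\<close>. So the isospectral set
  lies over the reduced curve \<open>(u - v)\<^sup>2 = D(s) = \<l>\<^sup>2 - 4 P\<^sub>1 P\<^sub>2 P\<^sub>3\<close>, and conjugation by diagonal matrices acts simply
  transitively on its fibres. Smoothness of \<open>C\<close> means that the cubic \<open>D\<close> has no double root, so the reduced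
  curve is a line, or a line and a circle. The signs in a fibre are governed by two square roots \<open>M12\<close>,
  \<open>M13\<close> of nowhere vanishing functions on the reduced curve. The line contributes four copies of \<open>\<real>\<^sup>3\<close>, the circle four or two
  copies of \<open>S\<^sup>1 \<times> \<real>\<^sup>2\<close> according to the monodromy of \<open>M12\<close> and \<open>M13\<close>. The same square roots parametrize the real points
  of \<open>C\<close>, and the monodromy is trivial iff the oval of \<open>C\<close> over the circle avoids the line at infinity.

  Along a solution \<open>s' = \<plusminus>(u - v)\<close>, hence \<open>s'\<^sup>2 = D(s)\<close>: on the line \<open>s\<close> reaches infinity in finite time in both
  directions. On the circle \<open>s\<close> is bounded, and as the entries of \<open>X\<close> satisfy linear equations with coefficients
  depending on \<open>s\<close>, the solution is global.
\<close>

section \<open>Smooth functions\<close>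

text \<open>Any off-diagonal entry of \<open>X\<close> can vanish, so no entry and no sign of an
  entry serves as a coordinate on the whole isospectral set. The vectors
  \<open>(X\<^sub>1\<^sub>2, X\<^sub>1\<^sub>3 X\<^sub>3\<^sub>2)\<close> and
  \<open>(X\<^sub>1\<^sub>3, X\<^sub>1\<^sub>2 X\<^sub>2\<^sub>3)\<close> never vanish, because
  \<open>D\<close> has no double root. Read as complex numbers, they have squares that are positive
  multiples of \<open>G12\<close> and \<open>G13\<close>, which depend on the reduced curve alone;
  this is the origin of the square roots. On the circle the real part of \<open>M12\<close> (or of
  \<open>M13\<close>) has at most one zero per turn and crosses it with nonzero speed. So the sign
  of the root flips after a turn exactly if such a zero exists, and these zeros are where the oval
  meets the line at infinity. Geometrically, \<open>s\<close> is a function of degree two on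
  \<open>C\<close> whose only pole, a double one, is \<open>\<infinity>\<^sub>1\<close>, and
  \<open>y\<^sup>2 = D(s)\<close> is the corresponding Weierstrass form. The real reduced curve is
  thus the real part of \<open>C\<close> without \<open>\<infinity>\<^sub>1\<close>, and that point
  has to be added to the oval over the line by hand.\<close>

lemma C_on_cong:
  assumes "open U" "\<And>x. x \<in> U \<Longrightarrow> f x = g x" "C_on n f U"
  shows "C_on n g U"
  using assms(2,3)
proof (induction n arbitrary: f g)
  case 0
  then show ?case by (simp cong: continuous_on_cong)
next
  case (Suc n)
  have d: "(g has_derivative frechet_derivative f (at x)) (at x)" if "x \<in> U" for x
  proof (rule has_derivative_transform_within_open[OF _ \<open>open U\<close> that])
    show "(f has_derivative frechet_derivative f (at x)) (at x)"
      using Suc.prems(2) that by (auto simp: frechet_derivative_works)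
    show "\<And>x. x \<in> U \<Longrightarrow> f x = g x" by (fact Suc.prems(1))
  qed
  have "frechet_derivative f (at x) v = frechet_derivative g (at x) v" if "x \<in> U" for x v
    using frechet_derivative_at[OF d[OF that]] by simp
  then have "C_on n (\<lambda>x. frechet_derivative g (at x) v) U" for v
    using Suc.IH[of "\<lambda>x. frechet_derivative f (at x) v" "\<lambda>x. frechet_derivative g (at x) v"] Suc.prems(2)
    by simp
  then show ?case
    using d by (auto simp: differentiable_def)
qed

lemma C_on_SucI:
  assumes "open U" "\<And>x. x \<in> U \<Longrightarrow> (f has_derivative f' x) (at x)"
    and "\<And>v. C_on n (\<lambda>x. f' x v) U"
  shows "C_on (Suc n) f U"
proof -
  have "f' x v = frechet_derivative f (at x) v" if "x \<in> U" for x v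
    using frechet_derivative_at[OF assms(2)[OF that]] by simp
  then have "C_on n (\<lambda>x. frechet_derivative f (at x) v) U" for v
    using C_on_cong[OF assms(1), of "\<lambda>x. f' x v" "\<lambda>x. frechet_derivative f (at x) v" n] assms(3)
    by blast
  then show ?thesis
    using assms(2) by (auto simp: differentiable_def)
qed

lemma C_on_imp_continuous: "C_on n f U \<Longrightarrow> continuous_on U f"
  by (cases n) (auto intro: continuous_at_imp_continuous_on differentiable_imp_continuous_within)

lemma C_on_SucD: "C_on (Suc n) f U \<Longrightarrow> C_on n f U"
  by (induction n arbitrary: f) (use C_on_imp_continuous[of "Suc 0"] in auto)

lemma C_on_SucE:
  assumes "C_on (Suc n) f U"
  shows "\<And>x. x \<in> U \<Longrightarrow> (f has_derivative frechet_derivative f (at x)) (at x)"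
    "\<And>v. C_on n (\<lambda>x. frechet_derivative f (at x) v) U"
  using assms by (auto simp: frechet_derivative_works)

lemma C_on_const: "C_on n (\<lambda>x. c) U"
proof (induction n arbitrary: c)
  case (Suc n)
  have "frechet_derivative (\<lambda>x. c) (at x) = (\<lambda>v. 0)" for x :: 'a
    by simp
  then show ?case using Suc by (simp del: frechet_derivative_const)
qed simp

lemma C_on_linear: "bounded_linear f \<Longrightarrow> C_on n f U"
proof (cases n)
  case (Suc m)
  assume f: "bounded_linear f"
  then have "frechet_derivative f (at x) = f" for x
    using frechet_derivative_at bounded_linear_imp_has_derivative by metis
  then show ?thesis using f Suc
    by (auto simp: C_on_const bounded_linear_imp_differentiable)
qed (simp add: linear_continuous_on)

lemma C_on_subset: "C_on n f U \<Longrightarrow> V \<subseteq> U \<Longrightarrow> C_on n f V"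
  by (induction n arbitrary: f) (auto intro: continuous_on_subset)

lemma C_on_local:
  assumes "\<And>x. x \<in> U \<Longrightarrow> \<exists>V. open V \<and> x \<in> V \<and> C_on n f V"
  shows "C_on n f U"
  using assms
proof (induction n arbitrary: f)
  case 0
  then show ?case
    by (metis C_on.simps(1) continuous_at_imp_continuous_on continuous_on_eq_continuous_at)
next
  case (Suc n)
  show ?case unfolding C_on.simps
  proof (intro conjI ballI allI)
    show "f differentiable at x" if "x \<in> U" for x
      using Suc.prems[OF that] by auto
    show "C_on n (\<lambda>x. frechet_derivative f (at x) v) U" for v
      by (rule Suc.IH) (use Suc.prems in \<open>fastforce\<close>)
  qed
qed

lemma C_on_add:
  assumes "open U" "C_on n f U" "C_on n g U"
  shows "C_on n (\<lambda>x. f x + g x) U"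
  using assms(2,3)
proof (induction n arbitrary: f g)
  case (Suc n)
  note f = C_on_SucE[OF Suc.prems(1)] and g = C_on_SucE[OF Suc.prems(2)]
  show ?case
    by (rule C_on_SucI[OF assms(1) has_derivative_add[OF f(1) g(1)]])
      (use Suc.IH[OF f(2) g(2)] in auto)
qed (auto intro: continuous_intros)

lemma C_on_sum:
  assumes "open U" "\<And>i. i \<in> I \<Longrightarrow> C_on n (f i) U"
  shows "C_on n (\<lambda>x. \<Sum>i\<in>I. f i x) U"
  using assms(2)
  by (induction I rule: infinite_finite_induct) (auto intro!: C_on_const C_on_add[OF assms(1)])

lemma C_on_bilinear:
  assumes "bounded_bilinear b" "open U" "C_on n f U" "C_on n g U"
  shows "C_on n (\<lambda>x. b (f x) (g x)) U"
  using assms(3,4)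
proof (induction n arbitrary: f g)
  case 0
  then show ?case
    by (auto intro: bounded_bilinear.continuous_on[OF assms(1)])
next
  case (Suc n)
  note f = C_on_SucE[OF Suc.prems(1)] and g = C_on_SucE[OF Suc.prems(2)]
  show ?case
  proof (rule C_on_SucI[OF assms(2) bounded_bilinear.FDERIV[OF assms(1) f(1) g(1)]])
    fix v
    show "C_on n (\<lambda>x. b (f x) (frechet_derivative g (at x) v) + b (frechet_derivative f (at x) v) (g x)) U"
      by (intro C_on_add[OF assms(2)] Suc.IH f g Suc.prems[THEN C_on_SucD])
  qed
qed

lemma C_on_compose:
  fixes f :: "'b::euclidean_space \<Rightarrow> 'c::euclidean_space" and g :: "'a::euclidean_space \<Rightarrow> 'b"
  assumes "open U" "open V" "g ` U \<subseteq> V" "C_on n g U" "C_on n f V"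
  shows "C_on n (\<lambda>x. f (g x)) U"
  using assms(4,5)
proof (induction n arbitrary: f)
  case 0
  then show ?case using assms(3)
    by (auto intro: continuous_on_compose2)
next
  case (Suc n)
  note g = C_on_SucE[OF Suc.prems(1)] and f = C_on_SucE[OF Suc.prems(2)]
  \<comment> \<open>\<open>C_on\<close> differentiates in fixed directions only, while the chain
    rule applies the outer derivative to a moving vector. Expanding that vector in the basis leaves
    fixed directions with variable scalar coefficients.\<close>
  have D: "frechet_derivative f (at (g x)) (frechet_derivative g (at x) v) =
      (\<Sum>b\<in>Basis. (frechet_derivative g (at x) v \<bullet> b) *\<^sub>R frechet_derivative f (at (g x)) b)"
    if "x \<in> U" for x v
  proof -
    have "linear (frechet_derivative f (at (g x)))"
      using f(1)[of "g x"] that assms(3) by (auto dest: has_derivative_linear)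
    then show ?thesis
      by (subst (1) euclidean_representation[symmetric])
        (simp add: linear_sum linear_scale)
  qed
  show ?case
  proof (rule C_on_SucI[OF assms(1)])
    fix x assume x: "x \<in> U"
    then have "g x \<in> V" using assms(3) by auto
    show "((\<lambda>x. f (g x)) has_derivative
       (\<lambda>v. frechet_derivative f (at (g x)) (frechet_derivative g (at x) v))) (at x)"
      by (rule has_derivative_compose[OF g(1)[OF x] f(1)[OF \<open>g x \<in> V\<close>]])
  next
    fix v
    have "C_on n (\<lambda>x. \<Sum>b\<in>Basis. (frechet_derivative g (at x) v \<bullet> b) *\<^sub>R frechet_derivative f (at (g x)) b) U"
      by (intro C_on_sum[OF assms(1)] C_on_bilinear[OF bounded_bilinear_scaleR assms(1)]
          C_on_bilinear[OF bounded_bilinear_inner assms(1)] C_on_const g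
          Suc.IH[OF Suc.prems(1)[THEN C_on_SucD]] f)
    then show "C_on n (\<lambda>x. frechet_derivative f (at (g x)) (frechet_derivative g (at x) v)) U"
      by (rule C_on_cong[OF assms(1), rotated]) (simp add: D)
  qed
qed

section \<open>Smooth functions on open sets: closure properties and elementary functions\<close>

definition smooth_on :: "'a::euclidean_space set \<Rightarrow> ('a \<Rightarrow> 'b::euclidean_space) \<Rightarrow> bool" where
  "smooth_on U f \<longleftrightarrow> open U \<and> (\<forall>n. C_on n f U)"

lemma smooth_on_open: "smooth_on U f \<Longrightarrow> open U"
  and smooth_on_continuous: "smooth_on U f \<Longrightarrow> continuous_on U f"
  by (auto simp: smooth_on_def intro: C_on_imp_continuous)

lemma smooth_on_subset: "smooth_on U f \<Longrightarrow> open V \<Longrightarrow> V \<subseteq> U \<Longrightarrow> smooth_on V f"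
  by (auto simp: smooth_on_def intro: C_on_subset)

lemma smooth_on_cong: "smooth_on U f \<Longrightarrow> (\<And>x. x \<in> U \<Longrightarrow> f x = g x) \<Longrightarrow> smooth_on U g"
  by (auto simp: smooth_on_def intro: C_on_cong)

lemma smooth_on_local:
  assumes "\<And>x. x \<in> U \<Longrightarrow> \<exists>V. x \<in> V \<and> smooth_on V f" "open U"
  shows "smooth_on U f"
  unfolding smooth_on_def
proof (intro conjI allI)
  show "C_on n f U" for n
    by (rule C_on_local) (use assms(1) in \<open>auto simp: smooth_on_def\<close>)
qed (fact assms(2))

lemma smooth_on_compose:
  "smooth_on V f \<Longrightarrow> smooth_on U g \<Longrightarrow> g ` U \<subseteq> V \<Longrightarrow> smooth_on U (\<lambda>x. f (g x))"
  unfolding smooth_on_def using C_on_compose by metis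

lemma smooth_on_const: "open U \<Longrightarrow> smooth_on U (\<lambda>x. c)"
  by (auto simp: smooth_on_def intro: C_on_const)

lemma smooth_on_linear: "bounded_linear f \<Longrightarrow> open U \<Longrightarrow> smooth_on U f"
  by (auto simp: smooth_on_def intro: C_on_linear)

lemma smooth_on_add: "smooth_on U f \<Longrightarrow> smooth_on U g \<Longrightarrow> smooth_on U (\<lambda>x. f x + g x)"
  by (auto simp: smooth_on_def intro: C_on_add)

lemma smooth_on_bilinear:
  "bounded_bilinear b \<Longrightarrow> smooth_on U f \<Longrightarrow> smooth_on U g \<Longrightarrow> smooth_on U (\<lambda>x. b (f x) (g x))"
  by (auto simp: smooth_on_def intro: C_on_bilinear)

lemma smooth_on_linear_compose:
  "bounded_linear h \<Longrightarrow> smooth_on U f \<Longrightarrow> smooth_on U (\<lambda>x. h (f x))"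
  by (rule smooth_on_compose[of UNIV, OF smooth_on_linear]) simp_all

lemmas smooth_on_id = smooth_on_linear[OF bounded_linear_ident]

lemmas smooth_on_minus = smooth_on_linear_compose[OF bounded_linear_minus[OF bounded_linear_ident]]

lemma smooth_on_diff: "smooth_on U f \<Longrightarrow> smooth_on U g \<Longrightarrow> smooth_on U (\<lambda>x. f x - g x)"
  using smooth_on_add[of U f "\<lambda>x. - g x"] smooth_on_minus[of U g] by simp

lemma smooth_on_mult:
  fixes f g :: "'a::euclidean_space \<Rightarrow> 'b::{real_normed_algebra,euclidean_space}"
  shows "smooth_on U f \<Longrightarrow> smooth_on U g \<Longrightarrow> smooth_on U (\<lambda>x. f x * g x)"
  by (rule smooth_on_bilinear[OF bounded_bilinear_mult])

lemma smooth_on_power: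
  fixes f :: "'a::euclidean_space \<Rightarrow> 'b::{real_normed_algebra_1,euclidean_space}"
  assumes "smooth_on U f" shows "smooth_on U (\<lambda>x. f x ^ n)"
proof (induction n)
  case 0
  then show ?case using smooth_on_const[OF smooth_on_open[OF assms]] by simp
next
  case (Suc n)
  then show ?case using smooth_on_mult[OF assms Suc] by simp
qed

lemma C_on_real:
  fixes f :: "real \<Rightarrow> 'b::euclidean_space"
  assumes "open U" "\<And>x. x \<in> U \<Longrightarrow> (f has_vector_derivative f' x) (at x)" "C_on n f' U"
  shows "C_on (Suc n) f U"
proof (rule C_on_SucI[OF assms(1)])
  show "(f has_derivative (\<lambda>v. v *\<^sub>R f' x)) (at x)" if "x \<in> U" for x
    using assms(2)[OF that] by (simp add: has_vector_derivative_def)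
  show "C_on n (\<lambda>x. v *\<^sub>R f' x) U" for v
    by (rule C_on_bilinear[OF bounded_bilinear_scaleR assms(1) C_on_const assms(3)])
qed

text \<open>The derivative is a polynomial in the inverse itself, so each order of differentiability
  gives the next.\<close>

lemma smooth_on_field_inverse: "smooth_on {x. x \<noteq> (0::'b::{real_normed_field,euclidean_space})} inverse"
proof -
  have o: "open {x. x \<noteq> (0::'b)}"
    by (simp add: Collect_neg_eq open_Compl)
  have "C_on n inverse {x. x \<noteq> (0::'b)}" for n
  proof (induction n)
    case 0
    then show ?case by (auto intro!: continuous_intros)
  next
    case (Suc n)
    show ?case
    proof (rule C_on_SucI[OF o])
      show "(inverse has_derivative (\<lambda>v. - (inverse x * v * inverse x))) (at x)" if "x \<in> {x. x \<noteq> 0}" for x :: 'b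
        using that has_derivative_inverse'[of x UNIV] by simp
      show "C_on n (\<lambda>x. - (inverse x * v * inverse x)) {x. x \<noteq> 0}" for v :: 'b
      proof -
        have "C_on n (\<lambda>x. (inverse x * - v) * inverse x) {x. x \<noteq> 0}"
          by (intro C_on_bilinear[OF bounded_bilinear_mult o] C_on_const Suc.IH)
        then show ?thesis by simp
      qed
    qed
  qed
  then show ?thesis using o by (simp add: smooth_on_def)
qed

lemma smooth_on_inverse:
  fixes f :: "'a::euclidean_space \<Rightarrow> 'b::{real_normed_field,euclidean_space}"
  assumes "smooth_on U f" "\<And>x. x \<in> U \<Longrightarrow> f x \<noteq> 0"
  shows "smooth_on U (\<lambda>x. inverse (f x))"
  by (rule smooth_on_compose[OF smooth_on_field_inverse assms(1)]) (use assms(2) in auto)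

lemma smooth_on_divide:
  fixes f g :: "'a::euclidean_space \<Rightarrow> 'b::{real_normed_field,euclidean_space}"
  assumes "smooth_on U f" "smooth_on U g" "\<And>x. x \<in> U \<Longrightarrow> g x \<noteq> 0"
  shows "smooth_on U (\<lambda>x. f x / g x)"
  unfolding divide_inverse by (intro smooth_on_mult smooth_on_inverse assms)

lemma smooth_on_exp_real: "smooth_on UNIV (exp :: real \<Rightarrow> real)"
proof -
  have "C_on n exp (UNIV::real set)" for n
    by (induction n)
      (auto simp del: C_on.simps(2) intro!: continuous_intros C_on_real
        simp flip: has_real_derivative_iff_has_vector_derivative)
  then show ?thesis by (simp add: smooth_on_def)
qed

lemma smooth_on_sin_cos: "smooth_on UNIV (sin :: real \<Rightarrow> real)" "smooth_on UNIV (cos :: real \<Rightarrow> real)"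
proof -
  have "C_on n sin (UNIV::real set) \<and> C_on n cos (UNIV::real set)" for n
  proof (induction n)
    case (Suc n)
    have "C_on n (\<lambda>x::real. - sin x) UNIV"
      by (rule C_on_compose[of UNIV UNIV sin n uminus])
        (use Suc C_on_linear[OF bounded_linear_minus[OF bounded_linear_ident]] in auto)
    with Suc show ?case
      using C_on_real[OF open_UNIV DERIV_sin[THEN has_real_derivative_iff_has_vector_derivative[THEN iffD1]]]
        C_on_real[OF open_UNIV DERIV_cos[THEN has_real_derivative_iff_has_vector_derivative[THEN iffD1]]]
      by blast
  qed (auto intro!: continuous_intros)
  then show "smooth_on UNIV (sin :: real \<Rightarrow> real)" "smooth_on UNIV (cos :: real \<Rightarrow> real)"
    by (simp_all add: smooth_on_def)
qed

lemma smooth_on_arctan_real: "smooth_on UNIV (arctan :: real \<Rightarrow> real)"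
proof -
  have "smooth_on UNIV (\<lambda>x::real. inverse (1 + x\<^sup>2))"
    by (intro smooth_on_inverse smooth_on_add smooth_on_const smooth_on_power smooth_on_id open_UNIV)
      (metis add_pos_nonneg less_numeral_extra(3) zero_le_power2 zero_less_one)
  then have "C_on n arctan (UNIV::real set)" for n
    by (cases n) (auto simp del: C_on.simps(2) intro!: continuous_intros C_on_real simp: smooth_on_def
        DERIV_arctan[unfolded has_real_derivative_iff_has_vector_derivative])
  then show ?thesis by (simp add: smooth_on_def)
qed

lemma smooth_on_ln_real: "smooth_on {0<..} (ln :: real \<Rightarrow> real)"
proof -
  have "smooth_on {0<..} (\<lambda>x::real. inverse x)"
    by (intro smooth_on_inverse smooth_on_id) auto
  then have "C_on n ln {0::real<..}" for n
    by (cases n) (auto simp del: C_on.simps(2) intro!: continuous_intros C_on_real simp: smooth_on_def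
        DERIV_ln[unfolded has_real_derivative_iff_has_vector_derivative])
  then show ?thesis by (simp add: smooth_on_def)
qed

text \<open>The right half-plane is enough: roots will only be compared with their value at a nearby
  base point, where the quotient is close to 1.\<close>

lemma smooth_on_csqrt: "smooth_on {z. Re z > 0} csqrt"
proof -
  have o: "open {z. Re z > 0}"
    by (simp add: open_halfspace_Re_gt)
  have "C_on n csqrt {z. Re z > 0}" for n
  proof (induction n)
    case 0
    then show ?case
      by (auto intro!: continuous_at_imp_continuous_on continuous_at_csqrt simp: complex_nonpos_Reals_iff)
  next
    case (Suc n)
    show ?case
    proof (rule C_on_SucI[OF o])
      show "(csqrt has_derivative (*) (inverse (2 * csqrt x))) (at x)" if "x \<in> {z. Re z > 0}" for x
        using that has_field_derivative_csqrt[of x]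
        by (simp add: complex_nonpos_Reals_iff has_field_derivative_def)
      fix v
      have "C_on n (\<lambda>x. inverse (csqrt x)) {z. Re z > 0}"
        by (rule C_on_compose[of _ "{z. z \<noteq> 0}"])
          (use Suc.IH o smooth_on_field_inverse[where 'b = complex] in \<open>auto simp: smooth_on_def\<close>)
      then have "C_on n (\<lambda>x. inverse (csqrt x) * (v / 2)) {z. Re z > 0}"
        by (intro C_on_bilinear[OF bounded_bilinear_mult o] C_on_const)
      then show "C_on n (\<lambda>x. inverse (2 * csqrt x) * v) {z. Re z > 0}"
        by (rule C_on_cong[OF o, rotated]) (simp add: field_simps)
    qed
  qed
  then show ?thesis using o by (simp add: smooth_on_def)
qed

lemmas smooth_on_exp = smooth_on_compose[OF smooth_on_exp_real _ subset_UNIV]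
lemmas smooth_on_sin = smooth_on_compose[OF smooth_on_sin_cos(1) _ subset_UNIV]
lemmas smooth_on_cos = smooth_on_compose[OF smooth_on_sin_cos(2) _ subset_UNIV]
lemmas smooth_on_arctan = smooth_on_compose[OF smooth_on_arctan_real _ subset_UNIV]

lemma smooth_on_ln: "smooth_on U f \<Longrightarrow> (\<And>x. x \<in> U \<Longrightarrow> f x > 0) \<Longrightarrow> smooth_on U (\<lambda>x. ln (f x :: real))"
  by (rule smooth_on_compose[OF smooth_on_ln_real]) auto

lemma smooth_on_sqrt:
  assumes "smooth_on U f" "\<And>x. x \<in> U \<Longrightarrow> f x > 0"
  shows "smooth_on U (\<lambda>x. sqrt (f x))"
proof -
  have "smooth_on U (\<lambda>x. exp (ln (f x) * (1 / 2)))"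
    by (intro smooth_on_exp smooth_on_mult smooth_on_ln smooth_on_const assms smooth_on_open[OF assms(1)])
  then show ?thesis
    by (rule smooth_on_cong) (use assms(2) in \<open>simp add: powr_half_sqrt[symmetric] powr_def less_imp_le less_imp_neq[symmetric]\<close>)
qed

lemma smooth_on_csqrt_compose:
  "smooth_on U f \<Longrightarrow> (\<And>x. x \<in> U \<Longrightarrow> Re (f x) > 0) \<Longrightarrow> smooth_on U (\<lambda>x. csqrt (f x))"
  by (rule smooth_on_compose[OF smooth_on_csqrt]) auto

lemmas smooth_on_Re = smooth_on_linear_compose[OF bounded_linear_Re]
lemmas smooth_on_Im = smooth_on_linear_compose[OF bounded_linear_Im]
lemmas smooth_on_vec_nth = smooth_on_linear_compose[OF bounded_linear_vec_nth]
lemmas smooth_on_fst = smooth_on_linear_compose[OF bounded_linear_fst]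
lemmas smooth_on_snd = smooth_on_linear_compose[OF bounded_linear_snd]

lemma smooth_on_sum:
  "open U \<Longrightarrow> (\<And>i. i \<in> I \<Longrightarrow> smooth_on U (f i)) \<Longrightarrow> smooth_on U (\<lambda>x. \<Sum>i\<in>I. f i x)"
  by (auto simp: smooth_on_def intro: C_on_sum)

lemma smooth_on_vec:
  fixes f :: "'a::euclidean_space \<Rightarrow> 'b::euclidean_space ^ 'n"
  assumes "\<And>i. smooth_on U (\<lambda>x. f x $ i)"
  shows "smooth_on U f"
proof -
  have "bounded_linear (axis i :: 'b \<Rightarrow> 'b ^ 'n)" for i
    by (rule linear_conv_bounded_linear[THEN iffD1])
      (auto simp: axis_def vec_eq_iff intro!: linearI)
  then have "smooth_on U (\<lambda>x. \<Sum>i\<in>UNIV. axis i (f x $ i))"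
    by (intro smooth_on_sum smooth_on_open[OF assms] smooth_on_linear_compose[where h = "axis _"] assms)
  then show ?thesis
    by (rule smooth_on_cong) (simp add: vec_eq_iff axis_def)
qed

lemma smooth_on_Pair:
  assumes "smooth_on U f" "smooth_on U g"
  shows "smooth_on U (\<lambda>x. (f x, g x))"
proof -
  have "bounded_linear (\<lambda>x. (x, 0))" "bounded_linear (\<lambda>x. (0, x))"
    by (intro bounded_linear_Pair bounded_linear_ident bounded_linear_zero)+
  then have "smooth_on U (\<lambda>x. (f x, 0) + (0, g x))"
    by (intro smooth_on_add smooth_on_linear_compose[of "\<lambda>x. (x, 0)"]
        smooth_on_linear_compose[of "\<lambda>x. (0, x)"] assms)
  then show ?thesis by simp
qed

lemma smooth_on_complex:
  assumes "smooth_on U f" "smooth_on U g"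
  shows "smooth_on U (\<lambda>x. Complex (f x) (g x))"
proof -
  have "smooth_on U (\<lambda>x. f x *\<^sub>R 1 + g x *\<^sub>R \<i>)"
    by (intro smooth_on_add smooth_on_bilinear[OF bounded_bilinear_scaleR] assms
       smooth_on_const smooth_on_open[OF assms(1)])
  then show ?thesis
    by (rule smooth_on_cong) (simp add: complex_eq_iff)
qed

lemmas smooth_on_intros = smooth_on_add smooth_on_diff smooth_on_minus smooth_on_mult
  smooth_on_power smooth_on_const smooth_on_exp smooth_on_sin smooth_on_cos smooth_on_arctan
  smooth_on_ln smooth_on_divide smooth_on_sqrt smooth_on_Re smooth_on_Im smooth_on_complex
  smooth_on_Pair smooth_on_vec_nth

section \<open>Smooth maps on arbitrary subsets\<close>

lemma smooth_map_iff:
  "smooth_map S f \<longleftrightarrow> (\<forall>x\<in>S. \<exists>U g. x \<in> U \<and> smooth_on U g \<and> (\<forall>y\<in>S \<inter> U. g y = f y))"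
  unfolding smooth_map_def smooth_on_def
  by (intro ball_cong refl arg_cong[where f = Ex] ext) (simp only: conj_ac)

lemma smooth_mapI:
  assumes "\<And>x. x \<in> S \<Longrightarrow> \<exists>U g. x \<in> U \<and> smooth_on U g \<and> (\<forall>y\<in>S \<inter> U. g y = f y)"
  shows "smooth_map S f"
  using assms by (simp add: smooth_map_iff)

lemma smooth_on_imp_smooth_map: "smooth_on U f \<Longrightarrow> S \<subseteq> U \<Longrightarrow> smooth_map S f"
  by (rule smooth_mapI, rule exI[of _ U], rule exI[of _ f]) auto

lemma smooth_map_continuous_on:
  assumes "smooth_map S f" shows "continuous_on S f"
proof (rule continuous_on_eq_continuous_within[THEN iffD2], rule ballI)
  fix x assume "x \<in> S"
  with assms have "\<exists>U g. x \<in> U \<and> smooth_on U g \<and> (\<forall>y\<in>S \<inter> U. g y = f y)"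
    unfolding smooth_map_iff by (rule bspec)
  then obtain U g where U: "x \<in> U" "smooth_on U g" "\<And>y. y \<in> S \<inter> U \<Longrightarrow> g y = f y"
    by auto
  have "continuous (at x within S) g"
    by (rule continuous_at_imp_continuous_at_within)
      (use smooth_on_continuous[OF U(2)] smooth_on_open[OF U(2)] U(1) in \<open>simp add: continuous_on_eq_continuous_at\<close>)
  then have "(g \<longlongrightarrow> f x) (at x within S)"
    using U(1) U(3)[of x] \<open>x \<in> S\<close> by (simp add: continuous_within)
  then have "(f \<longlongrightarrow> f x) (at x within S)"
    by (rule Lim_transform_eventually)
      (unfold eventually_at_topological, rule exI[of _ U], use U(1,3) smooth_on_open[OF U(2)] in auto)
  then show "continuous (at x within S) f"
    by (simp add: continuous_within)
qed

text \<open>Near \<open>t0\<close> one has \<open>M t = M t0 * csqrt (G t / G t0)\<close>: on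
  \<open>V\<close> the quotient of the roots has positive real part, so it is the principal root,
  and the quotient of the squares lies where \<open>csqrt\<close> is smooth.\<close>

lemma smooth_square_root:
  fixes M G :: "real \<Rightarrow> complex"
  assumes "smooth_on UNIV G" "\<And>t. G t \<noteq> 0" "continuous_on UNIV M" "\<And>t. G t = (M t)\<^sup>2"
  shows "smooth_on UNIV M"
proof (rule smooth_on_local)
  fix t0 :: real
  have M0: "M t0 \<noteq> 0" using assms(2,4)[of t0] by auto
  define V where "V = {t. Re (M t / M t0) > 0} \<inter> {t. Re (G t / G t0) > 0}"
  have cG: "continuous_on UNIV G" by (rule smooth_on_continuous[OF assms(1)])
  have "continuous_on UNIV (\<lambda>t. Re (M t / M t0))" "continuous_on UNIV (\<lambda>t. Re (G t / G t0))"
    by (intro continuous_on_Re continuous_on_divide continuous_on_const assms(3) cG; use M0 assms(2) in simp)+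
  then have "open V" unfolding V_def
    by (intro open_Int open_Collect_less continuous_on_const)
  have "t0 \<in> V" using M0 assms(2) by (simp add: V_def)
  have "smooth_on V (\<lambda>t. M t0 * csqrt (G t / G t0))"
    by (intro smooth_on_mult smooth_on_const smooth_on_csqrt_compose smooth_on_divide
        smooth_on_subset[OF assms(1)] \<open>open V\<close> assms(2)) (auto simp: V_def)
  then have "smooth_on V M"
  proof (rule smooth_on_cong)
    fix t assume "t \<in> V"
    then have "csqrt ((M t / M t0)\<^sup>2) = M t / M t0"
      by (intro csqrt_square) (auto simp: V_def)
    then show "M t0 * csqrt (G t / G t0) = M t"
      using M0 by (simp add: assms(4) power_divide)
  qed
  then show "\<exists>V. t0 \<in> V \<and> smooth_on V M" using \<open>t0 \<in> V\<close> by blast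
qed simp

section \<open>Ordinary differential equations\<close>

definition locally_lipschitz :: "('a::euclidean_space \<Rightarrow> 'a) \<Rightarrow> bool" where
  "locally_lipschitz F \<longleftrightarrow> (\<forall>x. \<exists>r>0. \<exists>L\<ge>0. \<forall>y\<in>cball x r. \<forall>z\<in>cball x r. norm (F y - F z) \<le> L * norm (y - z))"

lemma locally_lipschitz_continuous:
  assumes "locally_lipschitz F" shows "continuous_on S F"
proof -
  have "isCont F x" for x
  proof -
    obtain r L where r: "r > 0" "L \<ge> 0"
      and L: "\<And>y z. y \<in> cball x r \<Longrightarrow> z \<in> cball x r \<Longrightarrow> norm (F y - F z) \<le> L * norm (y - z)"
      using assms unfolding locally_lipschitz_def by meson
    have "L-lipschitz_on (cball x r) F"
      by (rule lipschitz_onI) (use L r in \<open>auto simp: dist_norm\<close>)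
    then have "continuous_on (ball x r) F"
      by (rule continuous_on_subset[OF lipschitz_on_continuous_on]) auto
    then show "isCont F x"
      using r by (simp add: continuous_on_eq_continuous_at)
  qed
  then show ?thesis by (simp add: continuous_at_imp_continuous_on)
qed

text \<open>The Banach fixed point theorem is applied in the space of bounded continuous functions
  on the whole real line; clamping the time to the short interval by \<open>c\<close> makes the
  integral operator act there.\<close>

lemma picard_right:
  fixes F :: "'a::euclidean_space \<Rightarrow> 'a" and b :: real
  assumes "locally_lipschitz F"
  obtains e Y where "e > 0" "continuous_on {b..b+e} Y" "Y b = x0"
    "\<And>t. t \<in> {b..b+e} \<Longrightarrow> Y t = x0 + integral {b..t} (\<lambda>s. F (Y s))"
proof -
  obtain r L where r: "r > 0" "L \<ge> 0"
    and L: "\<And>y z. y \<in> cball x0 r \<Longrightarrow> z \<in> cball x0 r \<Longrightarrow> norm (F y - F z) \<le> L * norm (y - z)"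
    using assms unfolding locally_lipschitz_def by meson
  define M where "M = norm (F x0) + L * r"
  have M: "norm (F y) \<le> M" if "y \<in> cball x0 r" for y
  proof -
    have "norm (F y) \<le> norm (F x0) + norm (F y - F x0)"
      by (metis norm_triangle_sub)
    also have "norm (F y - F x0) \<le> L * norm (y - x0)" using L that r by auto
    also have "\<dots> \<le> L * r" using that r by (intro mult_left_mono) (auto simp: dist_norm norm_minus_commute)
    finally show ?thesis by (simp add: M_def)
  qed
  have "M \<ge> 0" using r by (simp add: M_def)
  \<comment> \<open>\<open>r / (M + 1)\<close> keeps the iterates in the ball of radius
    \<open>r\<close>, and \<open>1 / (2 * (L + 1))\<close> makes the iteration a contraction with
    factor 1/2. The added 1 avoids division by zero.\<close>
  define e where "e = min (r / (M + 1)) (1 / (2 * (L + 1)))"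
  have e: "e > 0" "M * e \<le> r" "L * e \<le> 1 / 2"
  proof -
    show "e > 0" using r \<open>M \<ge> 0\<close> by (simp add: e_def)
    have "M * e \<le> M * (r / (M + 1))" using \<open>M \<ge> 0\<close> by (intro mult_left_mono) (auto simp: e_def)
    also have "\<dots> \<le> r" using \<open>M \<ge> 0\<close> r by (simp add: field_simps)
    finally show "M * e \<le> r" .
    have "L * e \<le> L * (1 / (2 * (L + 1)))" using r by (intro mult_left_mono) (auto simp: e_def)
    also have "\<dots> \<le> 1 / 2" using r by (simp add: field_simps)
    finally show "L * e \<le> 1 / 2" .
  qed
  define c where "c t = max b (min t (b + e))" for t :: real
  have c: "c t \<in> {b..b+e}" for t using e by (auto simp: c_def)
  have contc: "continuous_on UNIV c" unfolding c_def by (intro continuous_intros)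
  have contF: "continuous_on S F" for S by (rule locally_lipschitz_continuous[OF assms])
  define S :: "(real \<Rightarrow>\<^sub>C 'a) set" where "S = {Y. \<forall>t. apply_bcontfun Y t \<in> cball x0 r}"
  define f where "f Y t = x0 + integral {b..c t} (\<lambda>s. F (apply_bcontfun Y s))" for Y t
  have contY: "continuous_on A (\<lambda>s. F (apply_bcontfun Y s))" for A Y
    by (rule continuous_on_compose2[OF contF[of UNIV]]) (auto intro: continuous_on_subset[OF continuous_on_apply_bcontfun])
  have int: "(\<lambda>s. F (apply_bcontfun Y s)) integrable_on {b..t}" for Y t
    by (intro integrable_continuous_real contY)
  have dist_f: "dist x0 (f Y t) \<le> r" if "Y \<in> S" for Y t
  proof -
    have "norm (integral {b..c t} (\<lambda>s. F (apply_bcontfun Y s))) \<le> M * (c t - b)"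
      by (rule integral_bound) (use c[of t] that M contY in \<open>auto simp: S_def\<close>)
    also have "\<dots> \<le> M * e" using c[of t] \<open>M \<ge> 0\<close> by (intro mult_left_mono) auto
    finally show ?thesis using e by (simp add: f_def dist_norm)
  qed
  have contf: "continuous_on UNIV (f Y)" for Y
  proof -
    have "continuous_on {b..b+e} (\<lambda>t. integral {b..t} (\<lambda>s. F (apply_bcontfun Y s)))"
      by (rule indefinite_integral_continuous_1[OF int])
    then have "continuous_on UNIV (\<lambda>t. integral {b..c t} (\<lambda>s. F (apply_bcontfun Y s)))"
      by (rule continuous_on_compose2[OF _ contc]) (use c in auto)
    then show ?thesis unfolding f_def by (intro continuous_intros)
  qed
  have bcf: "f Y \<in> bcontfun" if "Y \<in> S" for Y
  proof (rule bcontfun_normI[OF contf])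
    show "norm (f Y t) \<le> norm x0 + r" for t
      using dist_f[OF that, of t] norm_triangle_ineq2[of "f Y t" x0] by (simp add: dist_norm norm_minus_commute)
  qed
  define K where "K Y = Bcontfun (f Y)" for Y
  have K: "apply_bcontfun (K Y) = f Y" if "Y \<in> S" for Y
    using bcf[OF that] by (simp add: K_def Bcontfun_inverse)
  have "\<exists>!Y. Y \<in> S \<and> K Y = Y"
  proof (rule Banach_fix[of S "1/2" K])
    have "closed S"
    proof -
      have "S = (\<Inter>t. {Y. dist x0 (apply_bcontfun Y t) \<le> r})" by (auto simp: S_def)
      moreover have "closed {Y. dist x0 (apply_bcontfun Y t) \<le> r}" for t
      proof (rule closed_Collect_le)
        have "continuous_on UNIV (\<lambda>Y. apply_bcontfun Y t)"
          unfolding continuous_on_iff by (metis dist_bounded le_less_trans)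
        then show "continuous_on UNIV (\<lambda>Y. dist x0 (apply_bcontfun Y t))" by (intro continuous_intros)
      qed (rule continuous_on_const)
      ultimately show ?thesis by auto
    qed
    then show "complete S" by (simp add: complete_eq_closed)
    have "const_bcontfun x0 \<in> S" using r by (simp add: S_def)
    then show "S \<noteq> {}" by auto
    show "K ` S \<subseteq> S" using dist_f by (auto simp: S_def K[unfolded S_def])
    show "dist (K Y) (K Z) \<le> 1 / 2 * dist Y Z" if "Y \<in> S" "Z \<in> S" for Y Z
    proof (rule dist_bound)
      fix t
      have "dist (apply_bcontfun (K Y) t) (apply_bcontfun (K Z) t) =
          norm (integral {b..c t} (\<lambda>s. F (apply_bcontfun Y s)) - integral {b..c t} (\<lambda>s. F (apply_bcontfun Z s)))"
        using that by (simp add: K f_def dist_norm)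
      also have "\<dots> = norm (integral {b..c t} (\<lambda>s. F (apply_bcontfun Y s) - F (apply_bcontfun Z s)))"
        by (simp add: integral_diff int)
      also have "\<dots> \<le> (L * dist Y Z) * (c t - b)"
      proof (rule integral_bound)
        show "b \<le> c t" using c[of t] by simp
        show "continuous_on {b..c t} (\<lambda>s. F (apply_bcontfun Y s) - F (apply_bcontfun Z s))"
          by (intro continuous_intros contY)
        fix s
        have "norm (F (apply_bcontfun Y s) - F (apply_bcontfun Z s)) \<le> L * norm (apply_bcontfun Y s - apply_bcontfun Z s)"
          using that by (intro L) (auto simp: S_def)
        also have "\<dots> \<le> L * dist Y Z"
          using dist_bounded[of Y s Z] r by (intro mult_left_mono) (auto simp: dist_norm)
        finally show "norm (F (apply_bcontfun Y s) - F (apply_bcontfun Z s)) \<le> L * dist Y Z" .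
      qed
      also have "\<dots> \<le> (L * dist Y Z) * e" using c[of t] r by (intro mult_left_mono) auto
      also have "\<dots> = (L * e) * dist Y Z" by simp
      also have "\<dots> \<le> 1 / 2 * dist Y Z" using e by (intro mult_right_mono) auto
      finally show "dist (apply_bcontfun (K Y) t) (apply_bcontfun (K Z) t) \<le> 1 / 2 * dist Y Z" .
    qed
  qed auto
  then obtain Y where Y: "Y \<in> S" "K Y = Y" by auto
  have eq: "apply_bcontfun Y t = x0 + integral {b..c t} (\<lambda>s. F (apply_bcontfun Y s))" for t
    using K[OF Y(1)] Y(2) by (metis f_def)
  show ?thesis
  proof
    show "e > 0" by (fact e)
    show "continuous_on {b..b+e} (apply_bcontfun Y)"
      by (rule continuous_on_subset[OF continuous_on_apply_bcontfun subset_UNIV])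
    show "apply_bcontfun Y b = x0" using eq[of b] e by (simp add: c_def)
    show "apply_bcontfun Y t = x0 + integral {b..t} (\<lambda>s. F (apply_bcontfun Y s))" if "t \<in> {b..b+e}" for t
      using eq[of t] that by (simp add: c_def)
  qed
qed

text \<open>A bounded solution has bounded speed, so it is Lipschitz and has a limit at
  \<open>b\<close>; a Picard solution starting from that limit is attached on the right.\<close>

lemma bounded_solution_extends:
  fixes F :: "'a::euclidean_space \<Rightarrow> 'a" and a b :: real
  assumes F: "locally_lipschitz F" and "a < b"
    and X: "\<And>t. t \<in> {a<..<b} \<Longrightarrow> (X has_vector_derivative F (X t)) (at t)"
    and "bounded (X ` {a<..<b})"
  obtains e Z where "e > 0" "\<And>t. t \<in> {a<..<b} \<Longrightarrow> Z t = X t"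
    "\<And>t. t \<in> {a<..<b+e} \<Longrightarrow> (Z has_vector_derivative F (Z t)) (at t)"
proof -
  have contF: "continuous_on S F" for S by (rule locally_lipschitz_continuous[OF F])
  have "compact (F ` closure (X ` {a<..<b}))"
    by (intro compact_continuous_image contF) (use assms in simp)
  then obtain K where K: "\<And>y. y \<in> F ` closure (X ` {a<..<b}) \<Longrightarrow> norm y \<le> K"
    using compact_imp_bounded bounded_iff by metis
  have K': "norm (F (X t)) \<le> K" if "t \<in> {a<..<b}" for t
    by (rule K[OF imageI], rule subsetD[OF closure_subset], rule imageI[OF that])
  have lip: "norm (X t - X s) \<le> K * norm (t - s)" if "t \<in> {a<..<b}" "s \<in> {a<..<b}" for s t
  proof (rule differentiable_bound[of "{a<..<b}" X "\<lambda>t v. v *\<^sub>R F (X t)"])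
    show "onorm (\<lambda>v. v *\<^sub>R F (X t)) \<le> K" if "t \<in> {a<..<b}" for t
    proof -
      have "norm (F (X t)) \<le> K" using that by (rule K')
      then show ?thesis by (intro onorm_le) (simp, metis abs_ge_zero mult.commute mult_left_mono)
    qed
    show "(X has_derivative (\<lambda>v. v *\<^sub>R F (X t))) (at t within {a<..<b})" if "t \<in> {a<..<b}" for t
      using X[OF that] by (auto simp: has_vector_derivative_def intro: has_derivative_at_withinI)
  qed (use that in auto)
  have "K \<ge> 0"
  proof -
    have "(a+b)/2 \<in> {a<..<b}" using \<open>a < b\<close> by auto
    then have "norm (F (X ((a+b)/2))) \<le> K" by (rule K')
    then show ?thesis using norm_ge_zero order_trans by blast
  qed
  have "K-lipschitz_on {a<..<b} X"
    by (rule lipschitz_onI) (use lip \<open>K \<ge> 0\<close> in \<open>auto simp: dist_norm\<close>)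
  then have "uniformly_continuous_on {a<..<b} X"
    by (rule lipschitz_on_uniformly_continuous)
  then obtain g where g: "uniformly_continuous_on (closure {a<..<b}) g"
    "\<And>t. t \<in> {a<..<b} \<Longrightarrow> X t = g t"
    using uniformly_continuous_on_extension_on_closure by (metis (no_types))
  have contg: "continuous_on {a..b} g"
    using uniformly_continuous_imp_continuous[OF g(1)] \<open>a < b\<close> by simp
  obtain e Y where e: "e > 0" and Y: "continuous_on {b..b+e} Y" "Y b = g b"
    "\<And>t. t \<in> {b..b+e} \<Longrightarrow> Y t = g b + integral {b..t} (\<lambda>s. F (Y s))"
    using picard_right[OF F, of b "g b"] by blast
  have dY: "(Y has_vector_derivative F (Y t)) (at t)" if "t \<in> {b<..<b+e}" for t
  proof -
    have "((\<lambda>t. integral {b..t} (\<lambda>s. F (Y s))) has_vector_derivative F (Y t)) (at t within {b..b+e})"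
      by (rule integral_has_vector_derivative[OF continuous_on_compose2[OF contF[of UNIV] Y(1)]])
        (use that in auto)
    then have "((\<lambda>t. integral {b..t} (\<lambda>s. F (Y s))) has_vector_derivative F (Y t)) (at t)"
      using that by (simp add: at_within_Icc_at)
    then have "((\<lambda>t. g b + integral {b..t} (\<lambda>s. F (Y s))) has_vector_derivative 0 + F (Y t)) (at t)"
      by (rule has_vector_derivative_add[OF has_vector_derivative_const])
    then have "((\<lambda>t. g b + integral {b..t} (\<lambda>s. F (Y s))) has_vector_derivative F (Y t)) (at t)"
      by simp
    then show ?thesis
      by (rule has_vector_derivative_transform_within_open[of _ _ _ "{b<..<b+e}"])
        (use that Y(3) in auto)
  qed
  define Z where "Z t = (if t \<le> b then g t else Y t)" for t
  define c where "c = (a + b) / 2"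
  have c: "a < c" "c < b" using \<open>a < b\<close> by (auto simp: c_def)
  have contZ: "continuous_on {c..b+e} Z"
  proof -
    have "continuous_on ({c..b} \<union> {b..b+e}) Z" unfolding Z_def
      by (rule continuous_on_cases) (use Y contg c in \<open>auto intro: continuous_on_subset\<close>)
    moreover have "{c..b} \<union> {b..b+e} = {c..b+e}" using c e by auto
    ultimately show ?thesis by simp
  qed
  have dZ1: "(Z has_vector_derivative F (Z t)) (at t)" if "t \<in> {a<..<b}" for t
  proof (rule has_vector_derivative_transform_within_open[of X _ _ "{a<..<b}"])
    show "(X has_vector_derivative F (Z t)) (at t)"
      using X[OF that] that g(2) by (simp add: Z_def)
  qed (use that g(2) in \<open>auto simp: Z_def\<close>)
  have dZ2: "(Z has_vector_derivative F (Z t)) (at t)" if "t \<in> {b<..<b+e}" for t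
  proof (rule has_vector_derivative_transform_within_open[of Y _ _ "{b<..<b+e}"])
    show "(Y has_vector_derivative F (Z t)) (at t)"
      using dY[OF that] that by (simp add: Z_def)
  qed (use that in \<open>auto simp: Z_def\<close>)
  \<comment> \<open>At the seam each half gives only a one-sided derivative. A single exceptional
    point does not disturb the fundamental theorem of calculus, so \<open>Z\<close> satisfies one
    integral equation across \<open>b\<close>, which is then differentiated.\<close>
  have dZ: "(Z has_vector_derivative F (Z b)) (at b)"
  proof -
    have contFZ: "continuous_on {c..b+e} (\<lambda>s. F (Z s))"
      by (rule continuous_on_compose2[OF contF[of UNIV] contZ]) auto
    have "Z t = Z c + integral {c..t} (\<lambda>s. F (Z s))" if "t \<in> {c..b+e}" for t
    proof -
      have "((\<lambda>s. F (Z s)) has_integral Z t - Z c) {c..t}"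
      proof (rule fundamental_theorem_of_calculus_interior_strong[of "{b}"])
        show "(Z has_vector_derivative F (Z x)) (at x)" if "x \<in> {c<..<t} - {b}" for x
          using dZ1[of x] dZ2[of x] that \<open>t \<in> {c..b+e}\<close> c by (cases "x < b") auto
        show "continuous_on {c..t} Z"
          by (rule continuous_on_subset[OF contZ]) (use that in auto)
      qed (use that in auto)
      then show ?thesis by (simp add: integral_unique)
    qed
    note eq = this
    have "((\<lambda>t. integral {c..t} (\<lambda>s. F (Z s))) has_vector_derivative F (Z b)) (at b within {c..b+e})"
      by (rule integral_has_vector_derivative[OF contFZ]) (use c e in auto)
    then have "((\<lambda>t. integral {c..t} (\<lambda>s. F (Z s))) has_vector_derivative F (Z b)) (at b)"
      using c e by (simp add: at_within_Icc_at)
    then have "((\<lambda>t. Z c + integral {c..t} (\<lambda>s. F (Z s))) has_vector_derivative 0 + F (Z b)) (at b)"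
      by (rule has_vector_derivative_add[OF has_vector_derivative_const])
    then have "((\<lambda>t. Z c + integral {c..t} (\<lambda>s. F (Z s))) has_vector_derivative F (Z b)) (at b)"
      by simp
    then show ?thesis
      by (rule has_vector_derivative_transform_within_open[of _ _ _ "{c<..<b+e}"])
        (use eq c e in \<open>auto simp flip: eq\<close>)
  qed
  show ?thesis
  proof (rule that[OF e])
    show "Z t = X t" if "t \<in> {a<..<b}" for t using that g(2) by (simp add: Z_def)
    show "(Z has_vector_derivative F (Z t)) (at t)" if "t \<in> {a<..<b+e}" for t
      using dZ1[of t] dZ2[of t] dZ that by (cases "t < b"; cases "t = b") auto
  qed
qed

text \<open>This is \<open>solution\<close> for an arbitrary vector field, so that the time-reversed
  equation is covered as well.\<close>

definition ode_solution :: "('a::euclidean_space \<Rightarrow> 'a) \<Rightarrow> real set \<Rightarrow> (real \<Rightarrow> 'a) \<Rightarrow> bool" where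
  "ode_solution F J X \<longleftrightarrow> open J \<and> is_interval J \<and> J \<noteq> {} \<and>
      (\<forall>t\<in>J. (X has_vector_derivative F (X t)) (at t))"

definition maximal_ode_solution :: "('a::euclidean_space \<Rightarrow> 'a) \<Rightarrow> real set \<Rightarrow> (real \<Rightarrow> 'a) \<Rightarrow> bool" where
  "maximal_ode_solution F J X \<longleftrightarrow> ode_solution F J X \<and>
      (\<forall>J' Y. ode_solution F J' Y \<and> J \<subseteq> J' \<and> (\<forall>t\<in>J. Y t = X t) \<longrightarrow> J' = J)"

text \<open>A solution that stayed bounded near \<open>Sup J\<close> could be continued beyond
  \<open>Sup J\<close>, against maximality.\<close>

lemma maximal_solution_unbounded_right:
  assumes F: "locally_lipschitz F" and X: "maximal_ode_solution F J X"
    and t0: "t0 \<in> J" and bdd: "bdd_above J"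
  shows "\<not> bounded (X ` (J \<inter> {t0..}))"
proof
  assume bX: "bounded (X ` (J \<inter> {t0..}))"
  have J: "open J" "is_interval J" and dX: "\<And>t. t \<in> J \<Longrightarrow> (X has_vector_derivative F (X t)) (at t)"
    using X by (auto simp: maximal_ode_solution_def ode_solution_def)
  define b where "b = Sup J"
  have le: "t \<le> b" if "t \<in> J" for t unfolding b_def by (rule cSup_upper[OF that bdd])
  have "b \<notin> J"
  proof
    assume "b \<in> J"
    then obtain d where "d > 0" "ball b d \<subseteq> J" using J(1) openE by blast
    then have "b + d / 2 \<in> J" by (auto simp: dist_real_def subset_iff)
    then show False using le[of "b + d/2"] \<open>d > 0\<close> by simp
  qed
  have lt: "t < b" if "t \<in> J" for t using le[OF that] that \<open>b \<notin> J\<close> by (cases "t = b") auto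
  have sub: "{t0<..<b} \<subseteq> J"
  proof
    fix t assume "t \<in> {t0<..<b}"
    then obtain s where "s \<in> J" "t < s"
      using less_cSup_iff[of J t] t0 bdd by (auto simp: b_def)
    then show "t \<in> J" using mem_is_interval_1_I[OF J(2) t0, of s t] \<open>t \<in> {t0<..<b}\<close> by auto
  qed
  have "bounded (X ` {t0<..<b})"
    by (rule bounded_subset[OF bX]) (use sub in auto)
  then obtain e Z where e: "e > 0" and Z: "\<And>t. t \<in> {t0<..<b} \<Longrightarrow> Z t = X t"
    "\<And>t. t \<in> {t0<..<b+e} \<Longrightarrow> (Z has_vector_derivative F (Z t)) (at t)"
    using bounded_solution_extends[OF F lt[OF t0], of X] dX sub by blast
  \<comment> \<open>The extension \<open>Z\<close> is only controlled to the right of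
    \<open>t0\<close>; on the left the given solution is kept.\<close>
  define Y where "Y t = (if t \<le> t0 then X t else Z t)" for t
  define J' where "J' = J \<union> {t0<..<b+e}"
  have YX: "Y t = X t" if "t \<in> J" for t
    using Z(1)[of t] lt[OF that] by (auto simp: Y_def)
  have "ode_solution F J' Y"
    unfolding ode_solution_def
  proof (intro conjI ballI)
    show "open J'" using J by (simp add: J'_def open_Un)
    show "J' \<noteq> {}" using t0 by (auto simp: J'_def)
    have "connected J'"
      unfolding J'_def
    proof (rule connected_Un)
      show "connected J" using J(2) is_interval_connected_1 by blast
      show "J \<inter> {t0<..<b+e} \<noteq> {}"
      proof -
        have "(t0 + b) / 2 \<in> {t0<..<b}" using lt[OF t0] by auto
        then have "(t0 + b) / 2 \<in> J \<inter> {t0<..<b+e}" using sub e by auto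
        then show ?thesis by blast
      qed
    qed simp
    then show "is_interval J'" using is_interval_connected_1 by blast
    fix t assume t: "t \<in> J'"
    show "(Y has_vector_derivative F (Y t)) (at t)"
    proof (cases "t \<in> J")
      case True
      have "(X has_vector_derivative F (Y t)) (at t)" using dX[OF True] YX[OF True] by simp
      then show ?thesis
        by (rule has_vector_derivative_transform_within_open[OF _ J(1) True]) (simp add: YX)
    next
      case False
      then have t: "t \<in> {t0<..<b+e}" using t by (auto simp: J'_def)
      then have "(Z has_vector_derivative F (Y t)) (at t)" using Z(2)[OF t] by (simp add: Y_def)
      then show ?thesis
        by (rule has_vector_derivative_transform_within_open[OF _ _ t]) (auto simp: Y_def)
    qed
  qed
  then have "J' = J"
    using X YX unfolding maximal_ode_solution_def by (metis J'_def Un_upper1)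
  moreover have "b \<in> J'" using e lt[OF t0] by (auto simp: J'_def)
  ultimately show False using \<open>b \<notin> J\<close> by simp
qed

lemma ode_solution_reflect:
  assumes "ode_solution F J X"
  shows "ode_solution (\<lambda>x. - F x) (uminus ` J) (\<lambda>t. X (- t))"
  unfolding ode_solution_def
proof (intro conjI ballI)
  show "open (uminus ` J)" "is_interval (uminus ` J)" "uminus ` J \<noteq> {}"
    using assms by (auto simp: ode_solution_def open_negations is_interval_neg_translationI)
  fix t assume "t \<in> uminus ` J"
  then have "(X has_vector_derivative F (X (- t))) (at (- t))"
    using assms by (auto simp: ode_solution_def)
  then have "((X \<circ> uminus) has_vector_derivative (- 1) *\<^sub>R F (X (- t))) (at t)"
    by (intro vector_diff_chain_at) (auto intro!: derivative_eq_intros)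
  then show "((\<lambda>t. X (- t)) has_vector_derivative - F (X (- t))) (at t)"
    by (simp add: o_def)
qed

text \<open>Time reversal reduces statements about the left end of \<open>J\<close> to statements
  about a right end.\<close>

lemma maximal_ode_solution_reflect:
  assumes "maximal_ode_solution F J X"
  shows "maximal_ode_solution (\<lambda>x. - F x) (uminus ` J) (\<lambda>t. X (- t))"
  unfolding maximal_ode_solution_def
proof (intro conjI allI impI)
  show "ode_solution (\<lambda>x. - F x) (uminus ` J) (\<lambda>t. X (- t))"
    using assms by (auto simp: maximal_ode_solution_def intro: ode_solution_reflect)
  fix J' Y assume *: "ode_solution (\<lambda>x. - F x) J' Y \<and> uminus ` J \<subseteq> J' \<and> (\<forall>t\<in>uminus ` J. Y t = X (- t))"
  then have "ode_solution F (uminus ` J') (\<lambda>t. Y (- t))"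
    using ode_solution_reflect[of "\<lambda>x. - F x" J' Y] by simp
  moreover have "J \<subseteq> uminus ` J'" using * by force
  ultimately have "uminus ` J' = J"
    using assms * unfolding maximal_ode_solution_def by auto
  then show "J' = uminus ` J" by (auto simp: image_image)
qed

section \<open>Topology\<close>

text \<open>The complement of a piece is a union of pieces, so it is open in \<open>T\<close> too; a
  connected set that meets a piece therefore lies inside it.\<close>

lemma components_eqI:
  fixes T :: "'a::topological_space set"
  assumes cover: "\<Union>\<K> = T" and disj: "\<And>K K'. K \<in> \<K> \<Longrightarrow> K' \<in> \<K> \<Longrightarrow> K \<noteq> K' \<Longrightarrow> K \<inter> K' = {}"
    and conn: "\<And>K. K \<in> \<K> \<Longrightarrow> connected K \<and> K \<noteq> {}"
    and opn: "\<And>K. K \<in> \<K> \<Longrightarrow> openin (top_of_set T) K"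
  shows "components T = \<K>"
proof
  have opnU: "openin (top_of_set T) (T - K)" if "K \<in> \<K>" for K
  proof -
    have "T - K = \<Union>(\<K> - {K})" using cover disj that by auto
    then show ?thesis using opn by (auto intro!: openin_Union)
  qed
  have sub: "D \<subseteq> K" if "connected D" "D \<subseteq> T" "K \<in> \<K>" "D \<inter> K \<noteq> {}" for D K
  proof (rule ccontr)
    assume "\<not> D \<subseteq> K"
    obtain U V where UV: "open U" "K = T \<inter> U" "open V" "T - K = T \<inter> V"
      using opn[OF \<open>K \<in> \<K>\<close>] opnU[OF \<open>K \<in> \<K>\<close>] by (auto simp: openin_open)
    have "U \<inter> V \<inter> D = {} \<and> D \<subseteq> U \<union> V" using UV \<open>D \<subseteq> T\<close> by auto
    then have "U \<inter> D = {} \<or> V \<inter> D = {}"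
      using connectedD[OF \<open>connected D\<close> UV(1,3)] by auto
    then show False using UV that \<open>\<not> D \<subseteq> K\<close> by auto
  qed
  show incl: "\<K> \<subseteq> components T"
  proof
    fix K assume K: "K \<in> \<K>"
    show "K \<in> components T"
      unfolding in_components_maximal
    proof (intro conjI allI impI)
      fix D assume D: "D \<noteq> {} \<and> K \<subseteq> D \<and> D \<subseteq> T \<and> connected D"
      then have "D \<inter> K \<noteq> {}" using conn[OF K] by auto
      then show "D = K" using sub[of D K] D K by auto
    qed (use K conn cover in auto)
  qed
  show "components T \<subseteq> \<K>"
  proof
    fix D assume D: "D \<in> components T"
    then obtain x where "x \<in> D" "x \<in> T"
      using in_components_nonempty in_components_subset by blast
    then obtain K where "K \<in> \<K>" "x \<in> K" using cover by auto
    then show "D \<in> \<K>"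
      using components_eq[OF D, of K] incl \<open>x \<in> D\<close> by auto
  qed
qed

lemma components_eqI_closed:
  fixes T :: "'a::topological_space set"
  assumes cover: "\<Union>\<K> = T" and disj: "\<And>K K'. K \<in> \<K> \<Longrightarrow> K' \<in> \<K> \<Longrightarrow> K \<noteq> K' \<Longrightarrow> K \<inter> K' = {}"
    and conn: "\<And>K. K \<in> \<K> \<Longrightarrow> connected K \<and> K \<noteq> {}"
    and fin: "finite \<K>" and cl: "\<And>K. K \<in> \<K> \<Longrightarrow> closedin (top_of_set T) K"
  shows "components T = \<K>"
proof (rule components_eqI[OF cover disj conn])
  fix K assume K: "K \<in> \<K>"
  have "K = T - \<Union>(\<K> - {K})" using cover disj[OF K] K by auto
  moreover have "closedin (top_of_set T) (\<Union>(\<K> - {K}))"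
    using cl fin by (intro closedin_Union) auto
  ultimately show "openin (top_of_set T) K"
    by (metis openin_diff openin_subtopology_self topspace_euclidean_subtopology)
qed

text \<open>Properness is relative to \<open>T\<close>: parameters may run off to infinity as long
  as their images have no limit in \<open>T\<close>. If the images do converge there, a subsequence
  of the parameters converges and its limit is mapped to \<open>y\<close>.\<close>

lemma proper_image_closedin:
  fixes f :: "'a::euclidean_space \<Rightarrow> 'b::euclidean_space"
  assumes B: "closed B" and f: "continuous_on B f" and "f ` B \<subseteq> T"
    and proper: "\<And>xs y. (\<And>n::nat. xs n \<in> B) \<Longrightarrow> (\<lambda>n. f (xs n)) \<longlonglongrightarrow> y \<Longrightarrow> y \<in> T \<Longrightarrow> bounded (range xs)"
  shows "closedin (top_of_set T) (f ` B)"
  unfolding closedin_limpt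
proof (intro conjI allI impI)
  show "f ` B \<subseteq> T" by fact
  fix y assume "y islimpt f ` B \<and> y \<in> T"
  then obtain ys where ys: "\<And>n::nat. ys n \<in> f ` B" "ys \<longlonglongrightarrow> y" and "y \<in> T"
    by (auto simp: islimpt_sequential)
  then obtain xs where xs: "\<And>n. xs n \<in> B" "\<And>n. ys n = f (xs n)"
    unfolding image_iff by metis
  then have "bounded (range xs)"
    using proper[of xs y] ys(2) \<open>y \<in> T\<close> by (simp add: xs(2)[symmetric])
  then obtain l r where r: "strict_mono (r :: nat \<Rightarrow> nat)" "(xs \<circ> r) \<longlonglongrightarrow> l"
    using bounded_imp_convergent_subsequence by blast
  have "l \<in> B"
    using closed_sequentially[OF B _ r(2)] xs(1) by simp
  have "(\<lambda>n. f ((xs \<circ> r) n)) \<longlonglongrightarrow> f l"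
    using f \<open>l \<in> B\<close> xs(1) r(2) by (auto simp: continuous_on_sequentially o_def)
  moreover have "(\<lambda>n. f ((xs \<circ> r) n)) \<longlonglongrightarrow> y"
    using LIMSEQ_subseq_LIMSEQ[OF ys(2) r(1)] by (simp add: xs(2) o_def)
  ultimately have "y = f l" using LIMSEQ_unique by blast
  then show "y \<in> f ` B" using \<open>l \<in> B\<close> by blast
qed

text \<open>By properness the injection is a closed map onto its image, which gives a continuous
  inverse without a formula for it.\<close>

lemma proper_injection_homeomorphism:
  fixes f :: "'a::euclidean_space \<Rightarrow> 'b::euclidean_space"
  assumes B: "closed B" and f: "continuous_on B f" and "f ` B \<subseteq> T"
    and proper: "\<And>xs y. (\<And>n::nat. xs n \<in> B) \<Longrightarrow> (\<lambda>n. f (xs n)) \<longlonglongrightarrow> y \<Longrightarrow> y \<in> T \<Longrightarrow> bounded (range xs)"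
    and "inj_on f B"
  obtains g where "homeomorphism B (f ` B) f g"
proof (rule homeomorphism_injective_closed_map[OF f refl \<open>inj_on f B\<close>])
  fix U assume U: "closedin (top_of_set B) U"
  then have "closed U" "U \<subseteq> B"
    using B closedin_closed_trans closedin_imp_subset by blast+
  have "closedin (top_of_set T) (f ` U)"
    by (rule proper_image_closedin[OF \<open>closed U\<close> continuous_on_subset[OF f \<open>U \<subseteq> B\<close>]])
      (use \<open>U \<subseteq> B\<close> assms(3) proper in blast)+
  then show "closedin (top_of_set (f ` B)) (f ` U)"
    using \<open>U \<subseteq> B\<close> assms(3) by (meson closedin_subset_trans image_mono)
qed

text \<open>The cylinder retracts onto a circle, which is not contractible. This makes the two
  counts of components independent of each other.\<close>

lemma diffeo_R3_S1_R2_exclusive: "diffeo_R3 K \<Longrightarrow> \<not> diffeo_S1_R2 K"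
proof
  assume "diffeo_R3 K" "diffeo_S1_R2 K"
  then have "(UNIV :: (real^3) set) homeomorphic K"
    and "K homeomorphic sphere (0 :: real^2) 1 \<times> (UNIV :: (real^2) set)"
    unfolding diffeo_R3_def diffeo_S1_R2_def diffeomorphic_def homeomorphic_def
    using homeomorphic_sym[unfolded homeomorphic_def] by blast+
  then have "(UNIV :: (real^3) set) homeomorphic sphere (0 :: real^2) 1 \<times> (UNIV :: (real^2) set)"
    by (rule homeomorphic_trans)
  then have c: "contractible (sphere (0 :: real^2) 1 \<times> (UNIV :: (real^2) set))"
    using homeomorphic_contractible contractible_UNIV by blast
  have "(sphere (0 :: real^2) 1 \<times> {0::real^2}) retract_of (sphere (0 :: real^2) 1 \<times> (UNIV :: (real^2) set))"
    unfolding retract_of_def retraction_def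
    by (rule exI[of _ "\<lambda>x. (fst x, 0)"]) (auto intro!: continuous_intros)
  then have "contractible (sphere (0 :: real^2) 1 \<times> {0::real^2})"
    using retract_of_contractible[OF c] by blast
  moreover have "(sphere (0 :: real^2) 1 \<times> {0::real^2}) homeomorphic sphere (0 :: real^2) 1"
    unfolding homeomorphic_def homeomorphism_def
    by (rule exI[of _ fst], rule exI[of _ "\<lambda>x. (x, 0)"]) (auto intro!: continuous_intros)
  ultimately have "contractible (sphere (0 :: real^2) 1)"
    using homeomorphic_contractible by blast
  then show False by (simp add: contractible_sphere)
qed

section \<open>The projective plane\<close>

lemma hpoint_eq_iff:
  assumes "z \<noteq> 0" "w \<noteq> 0"
  shows "hpoint z = hpoint w \<longleftrightarrow> (\<exists>c. w = c *s z)"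
proof -
  have refl: "proj_rel x x" if "x \<noteq> 0" for x
    using that unfolding proj_rel_def by (metis vector_smult_lid)
  have "proj_rel z w \<longleftrightarrow> proj_rel z z \<and> proj_rel w w \<and> abs_cp2 z = abs_cp2 w"
    using Quotient3_rel[OF Quotient3_cp2, of z w] by blast
  then show ?thesis using assms refl by (auto simp: hpoint_def proj_rel_def)
qed

lemma hpoint_scale:
  assumes "z \<noteq> 0" "c \<noteq> 0" shows "hpoint (c *s z) = hpoint z"
proof -
  have "c *s z \<noteq> 0" using assms by (simp add: vector_mul_eq_0)
  then show ?thesis using hpoint_eq_iff[OF assms(1)] by metis
qed

lemma continuous_on_hpoint: "continuous_on (- {0}) hpoint"
proof -
  have "open (- {0::complex^3})" by (simp add: open_Compl)
  moreover have "hpoint -` U \<inter> - {0} = {z. z \<noteq> 0 \<and> hpoint z \<in> U}" for U by auto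
  ultimately show ?thesis
    by (simp add: continuous_on_open_vimage open_cp2_def)
qed

lemma norm_smult_vec: "norm (c *s (z :: complex^'n)) = norm c * norm z"
  by (simp add: norm_vec_def L2_set_def norm_mult power_mult_distrib real_sqrt_mult
      flip: sum_distrib_left)

text \<open>The norms on \<open>K\<close> are bounded below, so only a bounded set of scalars can
  move points of \<open>K\<close> close to a given \<open>z\<close>. The corresponding multiples of
  \<open>K\<close> form a compact set that misses \<open>z\<close>, hence a whole ball around
  \<open>z\<close>.\<close>

lemma closed_hpoint_compact:
  assumes "compact K" "0 \<notin> K"
  shows "closed (hpoint ` K)"
proof -
  let ?U = "{z. z \<noteq> 0 \<and> hpoint z \<in> - hpoint ` K}"
  have "open ?U"
    unfolding open_contains_ball
  proof
    fix z assume "z \<in> ?U"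
    then have z: "z \<noteq> 0" "hpoint z \<notin> hpoint ` K" by auto
    show "\<exists>e>0. ball z e \<subseteq> ?U"
    proof (cases "K = {}")
      case True
      have "open (- {0 :: complex^3})" by (simp add: open_Compl)
      then obtain e where "e > 0" "ball z e \<subseteq> - {0}" using z openE by blast
      then show ?thesis using True by (intro exI[of _ e]) auto
    next
      case False
      obtain k0 where k0: "k0 \<in> K" "\<And>k. k \<in> K \<Longrightarrow> norm k0 \<le> norm k"
        using continuous_attains_inf[OF assms(1) False continuous_on_norm_id] by blast
      have "norm k0 > 0" using k0 assms(2) by auto
      \<comment> \<open>Vectors within distance 1 of \<open>z\<close> have norm at most
        \<open>norm z + 1\<close>, so they are multiples \<open>c *s k\<close> only with
        \<open>norm c \<le> R\<close>.\<close>
      define R where "R = (norm z + 1) / norm k0"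
      define D where "D = (\<lambda>(c, k). c *s k) ` (cball (0::complex) R \<times> K)"
      have "compact D" unfolding D_def
      proof (rule compact_continuous_image)
        show "continuous_on (cball (0::complex) R \<times> K) (\<lambda>(c, k). c *s k)"
          unfolding vector_scalar_mult_def case_prod_unfold
          by (intro continuous_intros)
        show "compact (cball (0::complex) R \<times> K)" using assms(1) by (intro compact_Times compact_cball)
      qed
      then have "open (- D \<inter> - {0} \<inter> ball z 1)"
        by (intro open_Int) (auto simp: compact_imp_closed open_Compl)
      moreover have "z \<in> - D"
      proof
        assume "z \<in> D"
        then obtain c k where ck: "z = c *s k" "k \<in> K" by (auto simp: D_def)
        then have "c \<noteq> 0" using z(1) by auto
        then have "hpoint z = hpoint k" using hpoint_scale[of k c] ck assms(2) by metis
        then show False using z(2) ck by auto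
      qed
      ultimately obtain e where e: "e > 0" "ball z e \<subseteq> - D \<inter> - {0} \<inter> ball z 1"
        using z(1) openE by (metis ComplI Int_iff centre_in_ball singletonD zero_less_one)
      have "ball z e \<subseteq> ?U"
      proof
        fix w assume w: "w \<in> ball z e"
        then have w0: "w \<noteq> 0" "w \<notin> D" "dist z w < 1" using e(2) by auto
        have "hpoint w \<notin> hpoint ` K"
        proof
          assume "hpoint w \<in> hpoint ` K"
          then obtain k where k: "k \<in> K" "hpoint k = hpoint w" by auto
          then obtain c where c: "w = c *s k"
            using hpoint_eq_iff[of k w] w0(1) assms(2) by metis
          have "norm c * norm k0 \<le> norm c * norm k" using k0(2)[OF k(1)] by (intro mult_left_mono) auto
          also have "\<dots> = norm w" by (simp add: c norm_smult_vec)
          also have "\<dots> \<le> norm z + 1"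
            using w0(3) norm_triangle_ineq3[of z w] by (simp add: dist_norm)
          finally have "c \<in> cball 0 R" using \<open>norm k0 > 0\<close> by (simp add: R_def field_simps)
          then have "w \<in> D" unfolding D_def c using k(1) by (intro image_eqI[of _ _ "(c, k)"]) auto
          then show False using w0 by simp
        qed
        then show "w \<in> ?U" using w0 by simp
      qed
      then show ?thesis using e by blast
    qed
  qed
  then have "open (- hpoint ` K)" by (simp add: open_cp2_def)
  then show ?thesis by (simp add: closed_def)
qed

definition cvec :: "real^3 \<Rightarrow> complex^3" where
  "cvec x = (\<chi> i. of_real (x $ i))"

lemma cvec_nth [simp]: "cvec x $ i = of_real (x $ i)"
  by (simp add: cvec_def)

lemma cvec_eq_0_iff [simp]: "cvec x = 0 \<longleftrightarrow> x = 0"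
  by (simp add: vec_eq_iff)

lemma continuous_on_cvec: "continuous_on S cvec"
  unfolding cvec_def by (intro continuous_intros)

lemma RP2_cvec: "RP2 = (\<lambda>x. hpoint (cvec x)) ` (- {0})"
proof (intro equalityI subsetI)
  fix p assume "p \<in> RP2"
  then obtain z where z: "p = hpoint z" "z \<noteq> 0" "\<And>i. z $ i \<in> \<real>" by (auto simp: RP2_def)
  define x :: "real^3" where "x = (\<chi> i. Re (z $ i))"
  have "z = cvec x" using z(3) by (simp add: vec_eq_iff x_def complex_is_Real_iff complex_eq_iff)
  then show "p \<in> (\<lambda>x. hpoint (cvec x)) ` (- {0})" using z by auto
next
  fix p assume "p \<in> (\<lambda>x. hpoint (cvec x)) ` (- {0})"
  then obtain x where "p = hpoint (cvec x)" "x \<noteq> 0" by auto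
  then show "p \<in> RP2" by (auto simp: RP2_def intro!: exI[of _ "cvec x"])
qed

lemma hpoint_cvec_eq_iff:
  assumes "x \<noteq> 0" "y \<noteq> 0"
  shows "hpoint (cvec x) = hpoint (cvec y) \<longleftrightarrow> (\<exists>c. y = c *\<^sub>R x)"
proof
  assume "hpoint (cvec x) = hpoint (cvec y)"
  then obtain c where c: "cvec y = c *s cvec x" using assms by (auto simp: hpoint_eq_iff)
  obtain i where i: "x $ i \<noteq> 0" using assms(1) by (auto simp: vec_eq_iff)
  have eq: "of_real (y $ j) = c * of_real (x $ j)" for j
    using arg_cong[OF c, of "\<lambda>v. v $ j"] by simp
  define r where "r = y $ i / x $ i"
  have "c = of_real r" using eq[of i] i by (simp add: field_simps r_def)
  then have "complex_of_real (y $ j) = of_real (r * x $ j)" for j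
    using eq[of j] by simp
  then have "y $ j = r * x $ j" for j
    using of_real_eq_iff by blast
  then have "y = r *\<^sub>R x"
    by (simp add: vec_eq_iff)
  then show "\<exists>c. y = c *\<^sub>R x" by blast
next
  assume "\<exists>c. y = c *\<^sub>R x"
  then obtain c where "y = c *\<^sub>R x" by blast
  then have "cvec y = of_real c *s cvec x" by (simp add: vec_eq_iff)
  then show "hpoint (cvec x) = hpoint (cvec y)"
    using assms hpoint_eq_iff[of "cvec x" "cvec y"] cvec_eq_0_iff by metis
qed

section \<open>The reduced curve\<close>

lemma real_of_square_nonneg:
  assumes "z\<^sup>2 = of_real r" "r \<ge> 0" shows "Im z = 0"
proof (rule ccontr)
  assume "Im z \<noteq> 0"
  moreover have "Re z * Im z = 0" "Re z * Re z - Im z * Im z = r"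
    using assms(1) by (auto simp: complex_eq_iff power2_eq_square)
  ultimately have "- (Im z * Im z) = r" by simp
  with \<open>Im z \<noteq> 0\<close> show False
    using assms(2) by (metis neg_0_le_iff_le not_square_less_zero linorder_neqE_linordered_idom
      mult_eq_0_iff order_antisym zero_le_square)
qed

lemma cnj_mult_self: "cnj p * p = of_real ((cmod p)\<^sup>2)"
  by (metis complex_norm_square mult.commute)

text \<open>The condition on \<open>cnj p * q\<close> says that \<open>p\<close> and
  \<open>q\<close> lie on one real line through 0. A square root of
  \<open>p\<^sup>2 + q\<^sup>2\<close> lies on the same line, because the products of its conjugate
  with \<open>p\<close> and \<open>q\<close> have nonnegative real squares.\<close>

lemma square_root_parallel:
  assumes "z\<^sup>2 = p\<^sup>2 + q\<^sup>2" "Im (cnj p * q) = 0"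
  shows "Im (cnj z * p) = 0" "Im (cnj z * q) = 0"
proof -
  obtain r where r: "cnj p * q = of_real r"
    using assms(2) by (metis complex_is_Real_iff Reals_cases)
  then have r': "p * cnj q = of_real r"
    by (metis complex_cnj_cnj complex_cnj_complex_of_real complex_cnj_mult)
  have c: "(cnj z)\<^sup>2 = (cnj p)\<^sup>2 + (cnj q)\<^sup>2"
    using arg_cong[OF assms(1), of cnj] by simp
  have "(cnj z * p)\<^sup>2 = (cnj p * p)\<^sup>2 + (p * cnj q)\<^sup>2"
    unfolding power_mult_distrib c by (simp add: algebra_simps)
  also have "\<dots> = of_real ((cmod p)^4 + r\<^sup>2)"
    unfolding r' cnj_mult_self by (simp flip: power_mult)
  finally show "Im (cnj z * p) = 0" by (rule real_of_square_nonneg) simp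
  have "(cnj z * q)\<^sup>2 = (cnj p * q)\<^sup>2 + (cnj q * q)\<^sup>2"
    unfolding power_mult_distrib c by (simp add: algebra_simps)
  also have "\<dots> = of_real ((cmod q)^4 + r\<^sup>2)"
    unfolding r cnj_mult_self by (simp flip: power_mult)
  finally show "Im (cnj z * q) = 0" by (rule real_of_square_nonneg) simp
qed

text \<open>On a common real line squares cannot cancel: multiplication by the square of
  \<open>cnj p\<close> turns the sum into a sum of two real squares.\<close>

lemma square_sum_parallel_nonzero:
  assumes "Im (cnj p * q) = 0" "p \<noteq> 0 \<or> q \<noteq> 0"
  shows "p\<^sup>2 + q\<^sup>2 \<noteq> (0::complex)"
proof
  assume 0: "p\<^sup>2 + q\<^sup>2 = 0"
  obtain r where r: "cnj p * q = of_real r"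
    using assms(1) by (metis complex_is_Real_iff Reals_cases)
  have "(cnj p)\<^sup>2 * (p\<^sup>2 + q\<^sup>2) = (cnj p * p)\<^sup>2 + (cnj p * q)\<^sup>2"
    by (simp add: algebra_simps power_mult_distrib)
  also have "\<dots> = of_real ((cmod p)^4 + r\<^sup>2)"
    unfolding r cnj_mult_self by (simp flip: power_mult)
  finally have "(cmod p)^4 + r\<^sup>2 = 0" using 0 by (metis mult_zero_right of_real_eq_0_iff)
  moreover have "(cmod p)^4 \<ge> 0" by simp
  ultimately have "p = 0" by (metis add_nonneg_eq_0_iff norm_eq_zero power_eq_0_iff zero_le_power2)
  then show False using 0 assms(2) by simp
qed

lemma parallel_scale:
  fixes a b c d :: real
  assumes "a * d = b * c" "a \<noteq> 0 \<or> b \<noteq> 0"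
  obtains k where "c = k * a" "d = k * b"
proof (cases "a = 0")
  case True
  then show ?thesis using assms that[of "d / b"] by (auto simp: field_simps)
next
  case False
  then show ?thesis using assms that[of "c / a"] by (auto simp: field_simps)
qed

text \<open>With \<open>A + iB\<close> and \<open>C + iE\<close> in the roles of
  \<open>Z12 X\<close> and \<open>Z13 X\<close>, this is the identity \<open>X\<^sub>1\<^sub>3
  X\<^sub>3\<^sub>2 * X\<^sub>1\<^sub>2 X\<^sub>2\<^sub>3 = p1 * X\<^sub>1\<^sub>2
  X\<^sub>1\<^sub>3\<close>. It has to come from the parallelism relations alone, since the matrix
  is still to be constructed.\<close>

lemma off_diagonal_relation:
  fixes A B C E p1 p2 p3 u v :: real
  assumes "A \<noteq> 0 \<or> B \<noteq> 0" "C \<noteq> 0 \<or> E \<noteq> 0"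
    and r: "A * v = B * p3" "A * (p1 * p2) = B * u" "C * u = E * p2" "C * (p1 * p3) = E * v"
    and "u * v = p1 * p2 * p3"
    and n: "p3 \<noteq> 0 \<or> v \<noteq> 0 \<or> u \<noteq> 0 \<or> p1 * p2 \<noteq> 0" "p2 \<noteq> 0 \<or> u \<noteq> 0 \<or> v \<noteq> 0 \<or> p1 * p3 \<noteq> 0"
  shows "B * E = p1 * A * C"
proof -
  obtain k where k: "p3 = k * A" "v = k * B" using parallel_scale[OF r(1) assms(1)] by auto
  obtain m where m: "u = m * A" "p1 * p2 = m * B" using parallel_scale[OF r(2) assms(1)] by auto
  obtain k' where k': "p2 = k' * C" "u = k' * E" using parallel_scale[OF r(3) assms(2)] by auto
  obtain m' where m': "v = m' * C" "p1 * p3 = m' * E" using parallel_scale[OF r(4) assms(2)] by auto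
  \<comment> \<open>Each of the two directions has a nonzero proportionality factor. The four
    combinations below give the identity multiplied by a product of such factors, and at least one
    of these products is nonzero.\<close>
  have "k \<noteq> 0 \<or> m \<noteq> 0" "k' \<noteq> 0 \<or> m' \<noteq> 0" using n k m k' m' by auto
  moreover have "k * k' * (B * E) = k * k' * (p1 * A * C)"
    using k k' assms(7) by (algebra)
  moreover have "k * m' * (B * E) = k * m' * (p1 * A * C)"
    using k m' by algebra
  moreover have "m * k' * (B * E) = m * k' * (p1 * A * C)"
    using m k' by algebra
  moreover have "m * m' * (B * E) = m * m' * (p1 * A * C)"
    using m m' assms(7) by algebra
  ultimately show ?thesis by auto
qed

text \<open>\<open>A, B, C, E\<close> stand for \<open>X\<^sub>1\<^sub>2\<close>,
  \<open>X\<^sub>1\<^sub>3 X\<^sub>3\<^sub>2\<close>, \<open>X\<^sub>1\<^sub>3\<close>,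
  \<open>X\<^sub>1\<^sub>2 X\<^sub>2\<^sub>3\<close>. Every remaining entry is subject to two
  equations, for example \<open>A * X21 = p3\<close> and \<open>B * X21 = v\<close>. The quotient is
  their least-squares solution: it is exact because the equations are consistent, and it survives
  the vanishing of one of \<open>A\<close>, \<open>B\<close>.\<close>

lemma matrix_entries:
  fixes A B C E p1 p2 p3 u v :: real
  assumes nz: "A\<^sup>2 + B\<^sup>2 \<noteq> 0" "C\<^sup>2 + E\<^sup>2 \<noteq> 0"
    and r: "A * v = B * p3" "A * (p1 * p2) = B * u" "C * u = E * p2" "C * (p1 * p3) = E * v"
      "B * E = p1 * A * C"
  defines "X21 \<equiv> (p3 * A + v * B) / (A\<^sup>2 + B\<^sup>2)" and "X31 \<equiv> (p2 * C + u * E) / (C\<^sup>2 + E\<^sup>2)"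
    and "X32 \<equiv> (C * B + E * p1 * A) / (C\<^sup>2 + E\<^sup>2)" and "X23 \<equiv> (A * E + B * p1 * C) / (A\<^sup>2 + B\<^sup>2)"
  shows "A * X21 = p3" "C * X31 = p2" "X23 * X32 = p1" "C * X32 = B" "A * X23 = E"
    "A * X23 * X31 = u" "C * X32 * X21 = v"
proof -
  have e: "X21 * (A\<^sup>2 + B\<^sup>2) = p3 * A + v * B" "X31 * (C\<^sup>2 + E\<^sup>2) = p2 * C + u * E"
    "X32 * (C\<^sup>2 + E\<^sup>2) = C * B + E * p1 * A" "X23 * (A\<^sup>2 + B\<^sup>2) = A * E + B * p1 * C"
    using nz by (simp_all add: X21_def X31_def X32_def X23_def)
  have "A * X21 * (A\<^sup>2 + B\<^sup>2) = p3 * (A\<^sup>2 + B\<^sup>2)" using e r by algebra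
  then show "A * X21 = p3" using nz(1) mult_right_cancel by blast
  have "C * X31 * (C\<^sup>2 + E\<^sup>2) = p2 * (C\<^sup>2 + E\<^sup>2)" using e r by algebra
  then show "C * X31 = p2" using nz(2) mult_right_cancel by blast
  have "C * X32 * (C\<^sup>2 + E\<^sup>2) = B * (C\<^sup>2 + E\<^sup>2)" using e r by algebra
  then show 4: "C * X32 = B" using nz(2) mult_right_cancel by blast
  have "A * X23 * (A\<^sup>2 + B\<^sup>2) = E * (A\<^sup>2 + B\<^sup>2)" using e r by algebra
  then show 5: "A * X23 = E" using nz(1) mult_right_cancel by blast
  have "E * X31 * (C\<^sup>2 + E\<^sup>2) = u * (C\<^sup>2 + E\<^sup>2)" using e r by algebra
  then show "A * X23 * X31 = u" unfolding 5 using nz(2) mult_right_cancel by blast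
  have "B * X21 * (A\<^sup>2 + B\<^sup>2) = v * (A\<^sup>2 + B\<^sup>2)" using e r by algebra
  then show "C * X32 * X21 = v" unfolding 4 using nz(1) mult_right_cancel by blast
  have "(X23 * X32) * ((A\<^sup>2 + B\<^sup>2) * (C\<^sup>2 + E\<^sup>2)) = (A * E + B * p1 * C) * (C * B + E * p1 * A)"
    unfolding e[symmetric] by simp
  also have "\<dots> = p1 * ((A\<^sup>2 + B\<^sup>2) * (C\<^sup>2 + E\<^sup>2))" using r(5) by algebra
  finally show "X23 * X32 = p1" using nz mult_right_cancel no_zero_divisors by blast
qed

definition mat3 :: "real \<Rightarrow> real \<Rightarrow> real \<Rightarrow> real \<Rightarrow> real \<Rightarrow> real \<Rightarrow> real \<Rightarrow> real \<Rightarrow> real \<Rightarrow> real^3^3" where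
  "mat3 a b c d e f g h i = vector [vector [a, b, c], vector [d, e, f], vector [g, h, i]]"

lemma mat3_nth [simp]:
  "mat3 a b c d e f g h i $ 1 $ 1 = a" "mat3 a b c d e f g h i $ 1 $ 2 = b" "mat3 a b c d e f g h i $ 1 $ 3 = c"
  "mat3 a b c d e f g h i $ 2 $ 1 = d" "mat3 a b c d e f g h i $ 2 $ 2 = e" "mat3 a b c d e f g h i $ 2 $ 3 = f"
  "mat3 a b c d e f g h i $ 3 $ 1 = g" "mat3 a b c d e f g h i $ 3 $ 2 = h" "mat3 a b c d e f g h i $ 3 $ 3 = i"
  by (simp_all add: mat3_def)

lemma smooth_on_mat3:
  assumes "smooth_on U a" "smooth_on U b" "smooth_on U c" "smooth_on U d" "smooth_on U e"
    "smooth_on U f" "smooth_on U g" "smooth_on U h" "smooth_on U i"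
  shows "smooth_on U (\<lambda>x. mat3 (a x) (b x) (c x) (d x) (e x) (f x) (g x) (h x) (i x))"
proof (rule smooth_on_vec, rule smooth_on_vec)
  fix k l :: 3
  show "smooth_on U (\<lambda>x. mat3 (a x) (b x) (c x) (d x) (e x) (f x) (g x) (h x) (i x) $ k $ l)"
    using exhaust_3[of k] exhaust_3[of l] assms by (elim disjE) auto
qed

lemma mat3_eqI:
  assumes "(X :: real^3^3) $ 1 $ 1 = a" "X $ 1 $ 2 = b" "X $ 1 $ 3 = c" "X $ 2 $ 1 = d" "X $ 2 $ 2 = e"
    "X $ 2 $ 3 = f" "X $ 3 $ 1 = g" "X $ 3 $ 2 = h" "X $ 3 $ 3 = i"
  shows "X = mat3 a b c d e f g h i"
  using assms by (simp add: vec_eq_iff forall_3)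

text \<open>The negative product makes the leading coefficient of \<open>D\<close> positive, so the
  noncompact branch lies over large \<open>s\<close>. The last assumption says that \<open>D\<close>
  has no double root, with \<open>D\<close> and its derivative written out.\<close>

locale cubic_data =
  fixes w1 w2 w3 q1 q2 q3 g \<kappa> x1 x2 x3 :: real
  assumes w_sum: "w1 + w2 + w3 = 0" and w_prod: "w1 * w2 * w3 < 0"
    and nonsingular: "\<And>s. (g + \<kappa> * s)\<^sup>2 - 4 * ((q1 + s * w1) * (q2 + s * w2) * (q3 + s * w3)) = 0 \<Longrightarrow>
      2 * \<kappa> * (g + \<kappa> * s) - 4 * (w1 * (q2 + s * w2) * (q3 + s * w3) + w2 * (q1 + s * w1) * (q3 + s * w3)
        + w3 * (q1 + s * w1) * (q2 + s * w2)) \<noteq> 0"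
begin

definition "P1 s = q1 + s * w1"
definition "P2 s = q2 + s * w2"
definition "P3 s = q3 + s * w3"
definition "\<l> s = g + \<kappa> * s"
definition "D s = (\<l> s)\<^sup>2 - 4 * (P1 s * P2 s * P3 s)"
definition "D' s = 2 * \<kappa> * \<l> s - 4 * (w1 * P2 s * P3 s + w2 * P1 s * P3 s + w3 * P1 s * P2 s)"

lemma w_nonzero: "w1 \<noteq> 0" "w2 \<noteq> 0" "w3 \<noteq> 0"
  using w_prod by auto

lemma D_nonsingular: "D s = 0 \<Longrightarrow> D' s \<noteq> 0"
  using nonsingular[of s] by (simp add: D_def D'_def \<l>_def P1_def P2_def P3_def)

text \<open>The affine curve \<open>u\<^sup>2 - \<l>(s) u + P\<^sub>1 P\<^sub>2 P\<^sub>3(s) = 0\<close>, with \<open>v\<close> the second root.\<close>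

definition on_E :: "real \<Rightarrow> real \<Rightarrow> real \<Rightarrow> bool" where
  "on_E s u v \<longleftrightarrow> u + v = \<l> s \<and> u * v = P1 s * P2 s * P3 s"

lemma on_E_discriminant: "on_E s u v \<Longrightarrow> (u - v)\<^sup>2 = D s"
proof -
  have "(u - v)\<^sup>2 = (u + v)\<^sup>2 - 4 * (u * v)" by algebra
  then show "on_E s u v \<Longrightarrow> (u - v)\<^sup>2 = D s" by (simp add: on_E_def D_def)
qed

lemma on_E_iff: "on_E s u v \<longleftrightarrow> (\<exists>y. y\<^sup>2 = D s \<and> u = (\<l> s + y) / 2 \<and> v = (\<l> s - y) / 2)"
proof
  assume "on_E s u v"
  then show "\<exists>y. y\<^sup>2 = D s \<and> u = (\<l> s + y) / 2 \<and> v = (\<l> s - y) / 2"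
    using on_E_discriminant by (intro exI[of _ "u - v"]) (auto simp: on_E_def)
next
  assume "\<exists>y. y\<^sup>2 = D s \<and> u = (\<l> s + y) / 2 \<and> v = (\<l> s - y) / 2"
  then obtain y where "y\<^sup>2 = D s" "u = (\<l> s + y) / 2" "v = (\<l> s - y) / 2" by blast
  have "u * v = ((\<l> s)\<^sup>2 - D s) / 4"
    unfolding \<open>u = _\<close> \<open>v = _\<close> \<open>y\<^sup>2 = D s\<close>[symmetric] by (simp add: field_simps power2_eq_square)
  moreover have "u + v = \<l> s" using \<open>u = _\<close> \<open>v = _\<close> by simp
  ultimately show "on_E s u v" by (simp add: on_E_def D_def)
qed

text \<open>At such a point \<open>D\<close> vanishes, and if two of the \<open>P\<^sub>i\<close>
  vanished as well, every term of \<open>D'\<close> would vanish.\<close>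

lemma on_E_nonsingular:
  assumes "on_E s u v" "u = 0" "v = 0"
  shows "P1 s \<noteq> 0 \<or> P2 s \<noteq> 0" "P1 s \<noteq> 0 \<or> P3 s \<noteq> 0" "P2 s \<noteq> 0 \<or> P3 s \<noteq> 0"
  using D_nonsingular[of s] assms by (auto simp: on_E_def D_def D'_def)

text \<open>Chosen so that for \<open>X\<close> over \<open>(s, u, v)\<close> both
  \<open>p12\<close> and \<open>q12\<close> are real multiples of \<open>Z12 X\<close>, with factors
  \<open>X\<^sub>2\<^sub>1\<close> and \<open>X\<^sub>2\<^sub>3 X\<^sub>3\<^sub>1\<close>, while
  they depend on \<open>s, u, v\<close> only; likewise \<open>p13\<close> and \<open>q13\<close> for
  \<open>Z13 X\<close>. Each direction needs two of them because one may vanish.\<close>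

definition p12 :: "real \<Rightarrow> real \<Rightarrow> real \<Rightarrow> complex" where "p12 s u v = Complex (P3 s) v"
definition q12 :: "real \<Rightarrow> real \<Rightarrow> real \<Rightarrow> complex" where "q12 s u v = Complex u (P1 s * P2 s)"
definition p13 :: "real \<Rightarrow> real \<Rightarrow> real \<Rightarrow> complex" where "p13 s u v = Complex (P2 s) u"
definition q13 :: "real \<Rightarrow> real \<Rightarrow> real \<Rightarrow> complex" where "q13 s u v = Complex v (P1 s * P3 s)"
definition "G12 s u v = (p12 s u v)\<^sup>2 + (q12 s u v)\<^sup>2"
definition "G13 s u v = (p13 s u v)\<^sup>2 + (q13 s u v)\<^sup>2"

lemma pq_parallel:
  assumes "on_E s u v"
  shows "Im (cnj (p12 s u v) * q12 s u v) = 0" "Im (cnj (p13 s u v) * q13 s u v) = 0"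
  using assms by (simp_all add: p12_def q12_def p13_def q13_def on_E_def algebra_simps)

lemma pq_nonzero:
  assumes "on_E s u v"
  shows "p12 s u v \<noteq> 0 \<or> q12 s u v \<noteq> 0" "p13 s u v \<noteq> 0 \<or> q13 s u v \<noteq> 0"
  using on_E_nonsingular[OF assms]
  by (auto simp: p12_def q12_def p13_def q13_def complex_eq_iff)

lemma G_nonzero:
  assumes "on_E s u v" shows "G12 s u v \<noteq> 0" "G13 s u v \<noteq> 0"
  unfolding G12_def G13_def
  using square_sum_parallel_nonzero pq_parallel[OF assms] pq_nonzero[OF assms] by blast+

definition sX :: "real^3^3 \<Rightarrow> real" where "sX X = (X $ 2 $ 3 * X $ 3 $ 2 - q1) / w1"
definition uX :: "real^3^3 \<Rightarrow> real" where "uX X = X $ 1 $ 2 * X $ 2 $ 3 * X $ 3 $ 1"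
definition vX :: "real^3^3 \<Rightarrow> real" where "vX X = X $ 1 $ 3 * X $ 3 $ 2 * X $ 2 $ 1"
definition Z12 :: "real^3^3 \<Rightarrow> complex" where "Z12 X = Complex (X $ 1 $ 2) (X $ 1 $ 3 * X $ 3 $ 2)"
definition Z13 :: "real^3^3 \<Rightarrow> complex" where "Z13 X = Complex (X $ 1 $ 3) (X $ 1 $ 2 * X $ 2 $ 3)"

definition T :: "(real^3^3) set" where
  "T = {X. X $ 1 $ 1 = x1 \<and> X $ 2 $ 2 = x2 \<and> X $ 3 $ 3 = x3 \<and>
    (\<exists>s. X $ 2 $ 3 * X $ 3 $ 2 = P1 s \<and> X $ 1 $ 3 * X $ 3 $ 1 = P2 s \<and> X $ 1 $ 2 * X $ 2 $ 1 = P3 s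
      \<and> uX X + vX X = \<l> s)}"

lemma T_iff:
  "X \<in> T \<longleftrightarrow> X $ 1 $ 1 = x1 \<and> X $ 2 $ 2 = x2 \<and> X $ 3 $ 3 = x3 \<and> X $ 2 $ 3 * X $ 3 $ 2 = P1 (sX X) \<and>
    X $ 1 $ 3 * X $ 3 $ 1 = P2 (sX X) \<and> X $ 1 $ 2 * X $ 2 $ 1 = P3 (sX X) \<and> uX X + vX X = \<l> (sX X)"
proof -
  have "s = sX X" if "X $ 2 $ 3 * X $ 3 $ 2 = P1 s" for s
    using that w_nonzero by (simp add: sX_def P1_def)
  then show ?thesis unfolding T_def by auto
qed

lemma T_on_E: "X \<in> T \<Longrightarrow> on_E (sX X) (uX X) (vX X)"
proof -
  assume X: "X \<in> T"
  have "uX X * vX X = (X $ 2 $ 3 * X $ 3 $ 2) * (X $ 1 $ 3 * X $ 3 $ 1) * (X $ 1 $ 2 * X $ 2 $ 1)"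
    by (simp add: uX_def vX_def)
  then show ?thesis using X by (simp add: T_iff on_E_def)
qed

lemma T_Z:
  assumes "X \<in> T"
  shows "p12 (sX X) (uX X) (vX X) = of_real (X $ 2 $ 1) * Z12 X"
    "q12 (sX X) (uX X) (vX X) = of_real (X $ 2 $ 3 * X $ 3 $ 1) * Z12 X"
    "p13 (sX X) (uX X) (vX X) = of_real (X $ 3 $ 1) * Z13 X"
    "q13 (sX X) (uX X) (vX X) = of_real (X $ 3 $ 2 * X $ 2 $ 1) * Z13 X"
proof -
  have P: "P1 (sX X) = X $ 2 $ 3 * X $ 3 $ 2" "P2 (sX X) = X $ 1 $ 3 * X $ 3 $ 1"
    "P3 (sX X) = X $ 1 $ 2 * X $ 2 $ 1"
    using assms T_iff by metis+
  show "p12 (sX X) (uX X) (vX X) = of_real (X $ 2 $ 1) * Z12 X"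
    "q12 (sX X) (uX X) (vX X) = of_real (X $ 2 $ 3 * X $ 3 $ 1) * Z12 X"
    "p13 (sX X) (uX X) (vX X) = of_real (X $ 3 $ 1) * Z13 X"
    "q13 (sX X) (uX X) (vX X) = of_real (X $ 3 $ 2 * X $ 2 $ 1) * Z13 X"
    by (simp_all add: P p12_def q12_def p13_def q13_def Z12_def Z13_def complex_eq_iff uX_def vX_def)
qed

lemma T_G:
  assumes "X \<in> T"
  shows "G12 (sX X) (uX X) (vX X) = of_real ((X $ 2 $ 1)\<^sup>2 + (X $ 2 $ 3 * X $ 3 $ 1)\<^sup>2) * (Z12 X)\<^sup>2"
    "G13 (sX X) (uX X) (vX X) = of_real ((X $ 3 $ 1)\<^sup>2 + (X $ 3 $ 2 * X $ 2 $ 1)\<^sup>2) * (Z13 X)\<^sup>2"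
  unfolding G12_def G13_def T_Z[OF assms] by (simp_all add: power_mult_distrib algebra_simps)

lemma T_Z_nonzero:
  assumes "X \<in> T" shows "Z12 X \<noteq> 0" "Z13 X \<noteq> 0"
  using G_nonzero[OF T_on_E[OF assms]] T_G[OF assms] by auto

end

section \<open>Isospectral sets over a parametrized piece of the reduced curve\<close>

text \<open>Each branch of the reduced curve is parametrized by the whole real line, the compact one
  periodically. On this simply connected domain the square roots exist globally, and monodromy
  becomes a statement about translation by a period.\<close>

locale parametrized = cubic_data +
  fixes S U V :: "real \<Rightarrow> real"
  assumes smooth_S: "smooth_on UNIV S" and smooth_U: "smooth_on UNIV U" and smooth_V: "smooth_on UNIV V"
    and on_E: "\<And>t. on_E (S t) (U t) (V t)"
begin

lemma smooth_P:
  "smooth_on UNIV (\<lambda>t. P1 (S t))" "smooth_on UNIV (\<lambda>t. P2 (S t))" "smooth_on UNIV (\<lambda>t. P3 (S t))"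
  unfolding P1_def P2_def P3_def by (intro smooth_on_intros smooth_S open_UNIV)+

lemma smooth_G:
  "smooth_on UNIV (\<lambda>t. G12 (S t) (U t) (V t))" "smooth_on UNIV (\<lambda>t. G13 (S t) (U t) (V t))"
  unfolding G12_def G13_def p12_def q12_def p13_def q13_def
  by (intro smooth_on_intros smooth_P smooth_U smooth_V)+

definition "M12 = (SOME M. continuous_on UNIV M \<and> (\<forall>t. G12 (S t) (U t) (V t) = (M t)\<^sup>2))"
definition "M13 = (SOME M. continuous_on UNIV M \<and> (\<forall>t. G13 (S t) (U t) (V t) = (M t)\<^sup>2))"

lemma M12: "continuous_on UNIV M12" "G12 (S t) (U t) (V t) = (M12 t)\<^sup>2"
  and M13: "continuous_on UNIV M13" "G13 (S t) (U t) (V t) = (M13 t)\<^sup>2"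
proof -
  have "\<exists>M. continuous_on UNIV M \<and> (\<forall>t. G12 (S t) (U t) (V t) = (M t)\<^sup>2)"
    using continuous_sqrt_on_contractible[OF smooth_on_continuous[OF smooth_G(1)] contractible_UNIV G_nonzero(1)[OF on_E]]
    by (metis UNIV_I)
  then have ex: "continuous_on UNIV M12 \<and> (\<forall>t. G12 (S t) (U t) (V t) = (M12 t)\<^sup>2)"
    unfolding M12_def by (rule someI_ex)
  show "continuous_on UNIV M12" using ex by (rule conjunct1)
  show "G12 (S t) (U t) (V t) = (M12 t)\<^sup>2" using ex by (rule conjunct2[THEN spec])
  have "\<exists>M. continuous_on UNIV M \<and> (\<forall>t. G13 (S t) (U t) (V t) = (M t)\<^sup>2)"
    using continuous_sqrt_on_contractible[OF smooth_on_continuous[OF smooth_G(2)] contractible_UNIV G_nonzero(2)[OF on_E]]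
    by (metis UNIV_I)
  then have ex: "continuous_on UNIV M13 \<and> (\<forall>t. G13 (S t) (U t) (V t) = (M13 t)\<^sup>2)"
    unfolding M13_def by (rule someI_ex)
  show "continuous_on UNIV M13" using ex by (rule conjunct1)
  show "G13 (S t) (U t) (V t) = (M13 t)\<^sup>2" using ex by (rule conjunct2[THEN spec])
qed

lemma smooth_M: "smooth_on UNIV M12" "smooth_on UNIV M13"
  by (rule smooth_square_root[OF smooth_G(1) G_nonzero(1)[OF on_E] M12],
      rule smooth_square_root[OF smooth_G(2) G_nonzero(2)[OF on_E] M13])

lemma M_nonzero: "M12 t \<noteq> 0" "M13 t \<noteq> 0"
  using G_nonzero[OF on_E] M12(2) M13(2) by (metis zero_power2)+

lemma M_parallel:
  "Re (M12 t) * V t = Im (M12 t) * P3 (S t)" "Re (M12 t) * (P1 (S t) * P2 (S t)) = Im (M12 t) * U t"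
  "Re (M13 t) * U t = Im (M13 t) * P2 (S t)" "Re (M13 t) * (P1 (S t) * P3 (S t)) = Im (M13 t) * V t"
  using square_root_parallel[OF M12(2)[symmetric, unfolded G12_def] pq_parallel(1)[OF on_E]]
    square_root_parallel[OF M13(2)[symmetric, unfolded G13_def] pq_parallel(2)[OF on_E]]
  by (simp_all add: p12_def q12_def p13_def q13_def)

lemma M_relation: "Im (M12 t) * Im (M13 t) = P1 (S t) * Re (M12 t) * Re (M13 t)"
proof (rule off_diagonal_relation)
  show "U t * V t = P1 (S t) * P2 (S t) * P3 (S t)" using on_E[of t] by (simp add: on_E_def)
  show "P3 (S t) \<noteq> 0 \<or> V t \<noteq> 0 \<or> U t \<noteq> 0 \<or> P1 (S t) * P2 (S t) \<noteq> 0"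
    "P2 (S t) \<noteq> 0 \<or> U t \<noteq> 0 \<or> V t \<noteq> 0 \<or> P1 (S t) * P3 (S t) \<noteq> 0"
    using on_E_nonsingular[OF on_E[of t]] by auto
  show "Re (M12 t) \<noteq> 0 \<or> Im (M12 t) \<noteq> 0" "Re (M13 t) \<noteq> 0 \<or> Im (M13 t) \<noteq> 0"
    using M_nonzero by (metis complex_eq_0 add.right_neutral zero_power2)+
qed (fact M_parallel)+

text \<open>\<open>M12\<close> is vertical exactly if \<open>p12\<close> and \<open>q12\<close>,
  which span its real line and do not vanish together, both have vanishing real part.\<close>

lemma Re_M12_eq_0_iff: "Re (M12 t) = 0 \<longleftrightarrow> P3 (S t) = 0 \<and> U t = 0"
proof
  assume 0: "Re (M12 t) = 0"
  then have "Im (M12 t) \<noteq> 0" using M_nonzero(1)[of t] by (auto simp: complex_eq_iff)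
  then show "P3 (S t) = 0 \<and> U t = 0" using M_parallel(1,2)[of t] 0 by auto
next
  assume 0: "P3 (S t) = 0 \<and> U t = 0"
  then have "V t \<noteq> 0 \<or> P1 (S t) * P2 (S t) \<noteq> 0"
    using on_E_nonsingular[OF on_E[of t]] by auto
  then show "Re (M12 t) = 0" using M_parallel(1,2)[of t] 0 by auto
qed

lemma Re_M13_eq_0_iff: "Re (M13 t) = 0 \<longleftrightarrow> P2 (S t) = 0 \<and> V t = 0"
proof
  assume 0: "Re (M13 t) = 0"
  then have "Im (M13 t) \<noteq> 0" using M_nonzero(2)[of t] by (auto simp: complex_eq_iff)
  then show "P2 (S t) = 0 \<and> V t = 0" using M_parallel(3,4)[of t] 0 by auto
next
  assume 0: "P2 (S t) = 0 \<and> V t = 0"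
  then have "U t \<noteq> 0 \<or> P1 (S t) * P3 (S t) \<noteq> 0"
    using on_E_nonsingular[OF on_E[of t]] by auto
  then show "Re (M13 t) = 0" using M_parallel(3,4)[of t] 0 by auto
qed

text \<open>In the fibre over \<open>(s, u, v)\<close> the entries \<open>X\<^sub>1\<^sub>2\<close> and \<open>X\<^sub>1\<^sub>3 X\<^sub>3\<^sub>2\<close> transform in the same way
  under conjugation by diagonal matrices and do not vanish simultaneously; the direction of
  \<open>(X\<^sub>1\<^sub>2, X\<^sub>1\<^sub>3 X\<^sub>3\<^sub>2)\<close> is determined by \<open>(s, u, v)\<close> up to sign. The same holds for
  \<open>(X\<^sub>1\<^sub>3, X\<^sub>1\<^sub>2 X\<^sub>2\<^sub>3)\<close>. The lifts \<open>M12\<close>, \<open>M13\<close> fix these signs along the parametrization.\<close>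

definition Phi :: "real \<Rightarrow> real \<Rightarrow> real \<Rightarrow> real \<Rightarrow> real \<Rightarrow> real^3^3" where
  "Phi \<epsilon> \<delta> t f h =
    (let A = \<epsilon> * exp f * Re (M12 t); B = \<epsilon> * exp f * Im (M12 t);
         C = \<delta> * exp h * Re (M13 t); E = \<delta> * exp h * Im (M13 t) in
     mat3 x1 A C
       ((P3 (S t) * A + V t * B) / (A\<^sup>2 + B\<^sup>2)) x2 ((A * E + B * P1 (S t) * C) / (A\<^sup>2 + B\<^sup>2))
       ((P2 (S t) * C + U t * E) / (C\<^sup>2 + E\<^sup>2)) ((C * B + E * P1 (S t) * A) / (C\<^sup>2 + E\<^sup>2)) x3)"

lemma Phi:
  assumes "\<epsilon> \<noteq> 0" "\<delta> \<noteq> 0"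
  shows Phi_T: "Phi \<epsilon> \<delta> t f h \<in> T"
    and Phi_sX: "sX (Phi \<epsilon> \<delta> t f h) = S t" and Phi_uX: "uX (Phi \<epsilon> \<delta> t f h) = U t"
    and Phi_vX: "vX (Phi \<epsilon> \<delta> t f h) = V t"
    and Phi_Z12: "Z12 (Phi \<epsilon> \<delta> t f h) = of_real (\<epsilon> * exp f) * M12 t"
    and Phi_Z13: "Z13 (Phi \<epsilon> \<delta> t f h) = of_real (\<delta> * exp h) * M13 t"
proof -
  define A where "A = \<epsilon> * exp f * Re (M12 t)"
  define B where "B = \<epsilon> * exp f * Im (M12 t)"
  define C where "C = \<delta> * exp h * Re (M13 t)"
  define E where "E = \<delta> * exp h * Im (M13 t)"
  let ?X = "Phi \<epsilon> \<delta> t f h"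
  have X: "?X = mat3 x1 A C
       ((P3 (S t) * A + V t * B) / (A\<^sup>2 + B\<^sup>2)) x2 ((A * E + B * P1 (S t) * C) / (A\<^sup>2 + B\<^sup>2))
       ((P2 (S t) * C + U t * E) / (C\<^sup>2 + E\<^sup>2)) ((C * B + E * P1 (S t) * A) / (C\<^sup>2 + E\<^sup>2)) x3"
    by (simp add: Phi_def A_def B_def C_def E_def Let_def)
  have "A\<^sup>2 + B\<^sup>2 = (\<epsilon> * exp f)\<^sup>2 * ((Re (M12 t))\<^sup>2 + (Im (M12 t))\<^sup>2)"
    by (simp add: A_def B_def algebra_simps power_mult_distrib)
  then have 1: "A\<^sup>2 + B\<^sup>2 \<noteq> 0" using assms M_nonzero(1)[of t] by (simp add: complex_eq_0)
  have "C\<^sup>2 + E\<^sup>2 = (\<delta> * exp h)\<^sup>2 * ((Re (M13 t))\<^sup>2 + (Im (M13 t))\<^sup>2)"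
    by (simp add: C_def E_def algebra_simps power_mult_distrib)
  then have 2: "C\<^sup>2 + E\<^sup>2 \<noteq> 0" using assms M_nonzero(2)[of t] by (simp add: complex_eq_0)
  have r: "A * V t = B * P3 (S t)" "A * (P1 (S t) * P2 (S t)) = B * U t"
    "C * U t = E * P2 (S t)" "C * (P1 (S t) * P3 (S t)) = E * V t" "B * E = P1 (S t) * A * C"
    using M_parallel[of t] M_relation[of t] by (simp_all add: A_def B_def C_def E_def)
  note m = matrix_entries[OF 1 2 r]
  show "?X \<in> T"
    unfolding T_def mem_Collect_eq uX_def vX_def X mat3_nth
    using m on_E[of t] by (intro conjI refl exI[of _ "S t"]) (simp_all add: on_E_def)
  show "sX ?X = S t" unfolding sX_def X mat3_nth using m w_nonzero by (simp add: P1_def)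
  show "uX ?X = U t" "vX ?X = V t" unfolding uX_def vX_def X mat3_nth using m by simp_all
  have "Z12 ?X = Complex A B" "Z13 ?X = Complex C E"
    unfolding Z12_def Z13_def X mat3_nth using m by simp_all
  then show "Z12 ?X = of_real (\<epsilon> * exp f) * M12 t" "Z13 ?X = of_real (\<delta> * exp h) * M13 t"
    by (simp_all add: A_def B_def C_def E_def complex_eq_iff)
qed

lemma real_multiple_of_root:
  fixes z m :: complex
  assumes "m\<^sup>2 = of_real r * z\<^sup>2" "r \<ge> 0" "m \<noteq> 0" "z \<noteq> 0"
  obtains \<epsilon> f where "\<epsilon> \<in> {1, -1::real}" "z = of_real (\<epsilon> * exp f) * m"
proof -
  have "r \<noteq> 0" using assms by auto
  then have "r > 0" using assms by simp
  then have "z\<^sup>2 = (of_real (1 / sqrt r) * m)\<^sup>2"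
    unfolding power_mult_distrib assms(1) by (simp flip: of_real_power add: power_divide)
  then have "z = of_real (1 / sqrt r) * m \<or> z = - (of_real (1 / sqrt r) * m)"
    by (simp only: power2_eq_iff)
  moreover have "exp (ln (1 / sqrt r)) = 1 / sqrt r" using \<open>r > 0\<close> by simp
  ultimately show ?thesis
    using that[of 1 "ln (1 / sqrt r)"] that[of "-1" "ln (1 / sqrt r)"] by auto
qed

text \<open>The squares of \<open>M12 t\<close> and \<open>Z12 X\<close> differ by a positive
  factor, so the numbers themselves differ by a real one, whose sign is \<open>\<epsilon>\<close>
  and whose modulus is \<open>exp f\<close>; similarly for \<open>\<delta>\<close> and
  \<open>h\<close>. These two numbers determine all other entries.\<close>

lemma Phi_surj:
  assumes X: "X \<in> T" "sX X = S t" "uX X = U t" "vX X = V t"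
  obtains \<epsilon> \<delta> f h where "\<epsilon> \<in> {1, -1}" "\<delta> \<in> {1, -1}" "X = Phi \<epsilon> \<delta> t f h"
proof -
  obtain \<epsilon> f where 1: "\<epsilon> \<in> {1, -1::real}" "Z12 X = of_real (\<epsilon> * exp f) * M12 t"
  proof (rule real_multiple_of_root[of "M12 t" "(X $ 2 $ 1)\<^sup>2 + (X $ 2 $ 3 * X $ 3 $ 1)\<^sup>2" "Z12 X"])
    show "(M12 t)\<^sup>2 = of_real ((X $ 2 $ 1)\<^sup>2 + (X $ 2 $ 3 * X $ 3 $ 1)\<^sup>2) * (Z12 X)\<^sup>2"
      using T_G(1)[OF X(1)] M12(2)[of t] X by simp
  qed (use M_nonzero T_Z_nonzero[OF X(1)] in auto)
  obtain \<delta> h where 2: "\<delta> \<in> {1, -1::real}" "Z13 X = of_real (\<delta> * exp h) * M13 t"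
  proof (rule real_multiple_of_root[of "M13 t" "(X $ 3 $ 1)\<^sup>2 + (X $ 3 $ 2 * X $ 2 $ 1)\<^sup>2" "Z13 X"])
    show "(M13 t)\<^sup>2 = of_real ((X $ 3 $ 1)\<^sup>2 + (X $ 3 $ 2 * X $ 2 $ 1)\<^sup>2) * (Z13 X)\<^sup>2"
      using T_G(2)[OF X(1)] M13(2)[of t] X by simp
  qed (use M_nonzero T_Z_nonzero[OF X(1)] in auto)
  define A where "A = X $ 1 $ 2"
  define B where "B = X $ 1 $ 3 * X $ 3 $ 2"
  define C where "C = X $ 1 $ 3"
  define E where "E = X $ 1 $ 2 * X $ 2 $ 3"
  have AB: "\<epsilon> * exp f * Re (M12 t) = A" "\<epsilon> * exp f * Im (M12 t) = B"
    using 1(2) by (simp_all add: Z12_def A_def B_def complex_eq_iff)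
  have CE: "\<delta> * exp h * Re (M13 t) = C" "\<delta> * exp h * Im (M13 t) = E"
    using 2(2) by (simp_all add: Z13_def C_def E_def complex_eq_iff)
  have "A\<^sup>2 + B\<^sup>2 \<noteq> 0" "C\<^sup>2 + E\<^sup>2 \<noteq> 0"
    using T_Z_nonzero[OF X(1)] by (simp_all add: Z12_def Z13_def A_def B_def C_def E_def complex_eq_iff)
  note nz = this
  have P: "X $ 1 $ 1 = x1" "X $ 2 $ 2 = x2" "X $ 3 $ 3 = x3" "P1 (S t) = X $ 2 $ 3 * X $ 3 $ 2"
    "P2 (S t) = X $ 1 $ 3 * X $ 3 $ 1" "P3 (S t) = X $ 1 $ 2 * X $ 2 $ 1"
    using X T_iff[of X] by simp_all
  have uv: "U t = X $ 1 $ 2 * X $ 2 $ 3 * X $ 3 $ 1" "V t = X $ 1 $ 3 * X $ 3 $ 2 * X $ 2 $ 1"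
    using X by (simp_all add: uX_def vX_def)
  have "X = mat3 x1 A C
       ((P3 (S t) * A + V t * B) / (A\<^sup>2 + B\<^sup>2)) x2 ((A * E + B * P1 (S t) * C) / (A\<^sup>2 + B\<^sup>2))
       ((P2 (S t) * C + U t * E) / (C\<^sup>2 + E\<^sup>2)) ((C * B + E * P1 (S t) * A) / (C\<^sup>2 + E\<^sup>2)) x3"
    by (rule mat3_eqI; (simp only: nonzero_eq_divide_eq[OF nz(1)] nonzero_eq_divide_eq[OF nz(2)])?;
        simp add: P uv A_def B_def C_def E_def power2_eq_square algebra_simps)
  then have "X = Phi \<epsilon> \<delta> t f h"
    by (simp add: Phi_def AB CE Let_def)
  then show ?thesis using that 1(1) 2(1) by blast
qed

lemma Phi_eq_iff:
  assumes "\<epsilon> \<in> {1, -1}" "\<delta> \<in> {1, -1}" "\<epsilon>' \<in> {1, -1}" "\<delta>' \<in> {1, -1}"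
  shows "Phi \<epsilon> \<delta> t f h = Phi \<epsilon>' \<delta>' t f' h' \<longleftrightarrow> \<epsilon> = \<epsilon>' \<and> \<delta> = \<delta>' \<and> f = f' \<and> h = h'"
proof
  assume eq: "Phi \<epsilon> \<delta> t f h = Phi \<epsilon>' \<delta>' t f' h'"
  have nz: "\<epsilon> \<noteq> 0" "\<delta> \<noteq> 0" "\<epsilon>' \<noteq> 0" "\<delta>' \<noteq> 0" using assms by auto
  have "complex_of_real (\<epsilon> * exp f) = of_real (\<epsilon>' * exp f')"
    using Phi_Z12[OF nz(1,2), of t f h] Phi_Z12[OF nz(3,4), of t f' h'] eq M_nonzero(1)[of t]
    by (metis mult_right_cancel)
  then have 1: "\<epsilon> * exp f = \<epsilon>' * exp f'" using of_real_eq_iff by blast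
  have "complex_of_real (\<delta> * exp h) = of_real (\<delta>' * exp h')"
    using Phi_Z13[OF nz(1,2), of t f h] Phi_Z13[OF nz(3,4), of t f' h'] eq M_nonzero(2)[of t]
    by (metis mult_right_cancel)
  then have 2: "\<delta> * exp h = \<delta>' * exp h'" using of_real_eq_iff by blast
  have "a = b \<and> x = y" if "a * exp x = b * exp y" "a \<in> {1,-1}" "b \<in> {1,-1}" for a b x y :: real
    using that exp_gt_zero[of x] exp_gt_zero[of y] by (auto simp del: exp_gt_zero)
  from this[OF 1] this[OF 2] assms show "\<epsilon> = \<epsilon>' \<and> \<delta> = \<delta>' \<and> f = f' \<and> h = h'" by blast
qed auto

lemma smooth_Phi:
  assumes "\<epsilon> \<noteq> 0" "\<delta> \<noteq> 0" "smooth_on W t" "smooth_on W f" "smooth_on W h"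
  shows "smooth_on W (\<lambda>x. Phi \<epsilon> \<delta> (t x) (f x) (h x))"
proof -
  have c: "smooth_on W (\<lambda>x. F (t x))" if "smooth_on UNIV F" for F :: "real \<Rightarrow> 'c::euclidean_space"
    by (rule smooth_on_compose[OF that assms(3)]) simp
  have nz: "(\<epsilon> * exp a * Re (M12 b))\<^sup>2 + (\<epsilon> * exp a * Im (M12 b))\<^sup>2 \<noteq> 0"
     "(\<delta> * exp a * Re (M13 b))\<^sup>2 + (\<delta> * exp a * Im (M13 b))\<^sup>2 \<noteq> 0" for a b
    using assms(1,2) M_nonzero[of b] by (simp_all add: complex_eq_iff)
  note o = smooth_on_open[OF assms(3)]
  show ?thesis
    unfolding Phi_def Let_def
    by (intro smooth_on_mat3 smooth_on_add smooth_on_mult smooth_on_divide smooth_on_power smooth_on_exp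
        smooth_on_Re smooth_on_Im smooth_on_const[OF o] assms(4,5) nz c[OF smooth_M(1)] c[OF smooth_M(2)]
        c[OF smooth_P(1)] c[OF smooth_P(2)] c[OF smooth_P(3)] c[OF smooth_U] c[OF smooth_V])
qed

end

text \<open>Closedness is recorded because it is what the properness arguments yield; together with
  finiteness it makes the pieces the components.\<close>

definition decomposition :: "'a::topological_space set \<Rightarrow> 'a set set \<Rightarrow> nat \<Rightarrow> ('a set \<Rightarrow> bool) \<Rightarrow> bool" where
  "decomposition R \<K> n P \<longleftrightarrow> finite \<K> \<and> card \<K> = n \<and> \<Union>\<K> = R \<and>
    (\<forall>K\<in>\<K>. \<forall>K'\<in>\<K>. K \<noteq> K' \<longrightarrow> K \<inter> K' = {}) \<and>
    (\<forall>K\<in>\<K>. connected K \<and> K \<noteq> {} \<and> closedin (top_of_set R) K \<and> P K)"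

section \<open>Fibre coordinates as functions of the matrix\<close>

context cubic_data
begin

text \<open>On \<open>Phi\<close> the modulus of \<open>Z12\<close> is \<open>exp f\<close> times
  that of \<open>M12\<close>, whose square is \<open>G12\<close>. So \<open>f\<close> is the
  logarithm of the modulus of \<open>Z12\<close> minus half of that of \<open>G12\<close>; in terms
  of squared moduli, which are smooth, the factors become 1/2 and 1/4.\<close>

definition fX :: "real^3^3 \<Rightarrow> real" where
  "fX X = ln ((Re (Z12 X))\<^sup>2 + (Im (Z12 X))\<^sup>2) / 2 -
    ln ((Re (G12 (sX X) (uX X) (vX X)))\<^sup>2 + (Im (G12 (sX X) (uX X) (vX X)))\<^sup>2) / 4"
definition hX :: "real^3^3 \<Rightarrow> real" where
  "hX X = ln ((Re (Z13 X))\<^sup>2 + (Im (Z13 X))\<^sup>2) / 2 -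
    ln ((Re (G13 (sX X) (uX X) (vX X)))\<^sup>2 + (Im (G13 (sX X) (uX X) (vX X)))\<^sup>2) / 4"

text \<open>Smoothness on a subset asks for extensions to open sets; on this one the arguments of
  all the logarithms are positive.\<close>

definition T_nhd :: "(real^3^3) set" where
  "T_nhd = {X. Z12 X \<noteq> 0 \<and> Z13 X \<noteq> 0 \<and> G12 (sX X) (uX X) (vX X) \<noteq> 0 \<and> G13 (sX X) (uX X) (vX X) \<noteq> 0}"

lemma smooth_entry: "open W \<Longrightarrow> smooth_on W (\<lambda>X :: real^3^3. X $ i $ j)"
  by (intro smooth_on_vec_nth smooth_on_id)

lemma smooth_suv:
  assumes "open W" shows "smooth_on W sX" "smooth_on W uX" "smooth_on W vX"
  unfolding sX_def[abs_def] uX_def[abs_def] vX_def[abs_def]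
  by (intro smooth_on_divide smooth_on_diff smooth_on_mult smooth_on_const smooth_entry assms; simp add: w_nonzero)+

lemma smooth_ZG:
  assumes "open W" shows "smooth_on W Z12" "smooth_on W Z13"
    "smooth_on W (\<lambda>X. G12 (sX X) (uX X) (vX X))" "smooth_on W (\<lambda>X. G13 (sX X) (uX X) (vX X))"
  unfolding Z12_def[abs_def] Z13_def[abs_def] G12_def G13_def p12_def q12_def p13_def q13_def P1_def P2_def P3_def
  by (intro smooth_on_complex smooth_on_add smooth_on_power smooth_on_mult smooth_on_const smooth_entry assms smooth_suv)+

lemma T_nhd: "open T_nhd" "T \<subseteq> T_nhd"
proof -
  have c: "continuous_on UNIV Z12" "continuous_on UNIV Z13"
    "continuous_on UNIV (\<lambda>X. G12 (sX X) (uX X) (vX X))" "continuous_on UNIV (\<lambda>X. G13 (sX X) (uX X) (vX X))"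
    by (intro smooth_on_continuous smooth_ZG open_UNIV)+
  show "open T_nhd" unfolding T_nhd_def
    by (intro open_Collect_conj open_Collect_neq c continuous_on_const)
  show "T \<subseteq> T_nhd" using T_Z_nonzero G_nonzero[OF T_on_E] by (auto simp: T_nhd_def)
qed

lemma smooth_fX: "smooth_on T_nhd fX" "smooth_on T_nhd hX"
  unfolding fX_def[abs_def] hX_def[abs_def]
  by (intro smooth_on_diff smooth_on_divide smooth_on_ln smooth_on_add smooth_on_power smooth_on_Re smooth_on_Im
      smooth_ZG smooth_on_const T_nhd(1); (simp add: T_nhd_def flip: cmod_power2)?)+

end

context parametrized
begin

lemma fX_Phi:
  assumes "\<epsilon> \<in> {1, -1}" "\<delta> \<in> {1, -1}"
  shows "fX (Phi \<epsilon> \<delta> t f h) = f" "hX (Phi \<epsilon> \<delta> t f h) = h"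
proof -
  have nz: "\<epsilon> \<noteq> 0" "\<delta> \<noteq> 0" using assms by auto
  have *: "ln (cmod (of_real (e * exp r) * m) ^ 2) / 2 - ln (cmod (m\<^sup>2) ^ 2) / 4 = r"
    if "e \<in> {1, -1}" "m \<noteq> 0" for e r m
  proof -
    have "cmod (of_real (e * exp r) * m) = exp r * cmod m"
      using that by (auto simp: norm_mult)
    then show ?thesis
      using that by (simp add: norm_power ln_mult ln_realpow algebra_simps)
  qed
  show "fX (Phi \<epsilon> \<delta> t f h) = f" "hX (Phi \<epsilon> \<delta> t f h) = h"
    unfolding fX_def hX_def cmod_power2[symmetric] Phi_sX[OF nz] Phi_uX[OF nz] Phi_vX[OF nz] Phi_Z12[OF nz]
      Phi_Z13[OF nz] M12(2) M13(2)
    using *[OF assms(1) M_nonzero(1)] *[OF assms(2) M_nonzero(2)] by auto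
qed

definition TS :: "(real^3^3) set" where
  "TS = {X \<in> T. \<exists>t. sX X = S t \<and> uX X = U t \<and> vX X = V t}"

definition piece :: "real \<Rightarrow> real \<Rightarrow> (real^3^3) set" where
  "piece \<epsilon> \<delta> = range (\<lambda>(t, f, h). Phi \<epsilon> \<delta> t f h)"

lemma piece_memI: "Phi \<epsilon> \<delta> t f h \<in> piece \<epsilon> \<delta>"
  unfolding piece_def by (rule range_eqI[of _ _ "(t, f, h)"]) simp

definition "pieces = {piece 1 1, piece 1 (-1), piece (-1) 1, piece (-1) (-1)}"

lemma pieces_eq: "pieces = {piece \<epsilon> \<delta> | \<epsilon> \<delta>. \<epsilon> \<in> {1, -1} \<and> \<delta> \<in> {1, -1}}"
  by (auto simp: pieces_def)

lemma piece_subset: "\<epsilon> \<in> {1, -1} \<Longrightarrow> \<delta> \<in> {1, -1} \<Longrightarrow> piece \<epsilon> \<delta> \<subseteq> TS"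
proof -
  assume "\<epsilon> \<in> {1, -1}" "\<delta> \<in> {1, -1}"
  then have nz: "\<epsilon> \<noteq> 0" "\<delta> \<noteq> 0" by auto
  show ?thesis
    using Phi_T[OF nz] Phi_sX[OF nz] Phi_uX[OF nz] Phi_vX[OF nz] by (auto simp: piece_def TS_def)
qed

lemma Union_pieces: "\<Union>pieces = TS"
proof
  show "\<Union>pieces \<subseteq> TS" using piece_subset unfolding pieces_eq by blast
  show "TS \<subseteq> \<Union>pieces"
  proof
    fix X assume "X \<in> TS"
    then obtain t where "X \<in> T" "sX X = S t" "uX X = U t" "vX X = V t" by (auto simp: TS_def)
    from Phi_surj[OF this] obtain \<epsilon> \<delta> f h where "\<epsilon> \<in> {1, -1}" "\<delta> \<in> {1, -1}" "X = Phi \<epsilon> \<delta> t f h" .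
    then show "X \<in> \<Union>pieces" unfolding pieces_eq using piece_memI[of \<epsilon> \<delta> t f h] by blast
  qed
qed

lemma piece_nonempty: "piece \<epsilon> \<delta> \<noteq> {}"
  by (simp add: piece_def)

lemma connected_piece: "\<epsilon> \<noteq> 0 \<Longrightarrow> \<delta> \<noteq> 0 \<Longrightarrow> connected (piece \<epsilon> \<delta>)"
  unfolding piece_def case_prod_unfold
  by (intro connected_continuous_image smooth_on_continuous smooth_Phi smooth_on_fst smooth_on_snd smooth_on_id
      connected_UNIV open_UNIV)

lemma smooth_on_vec3:
  assumes "smooth_on W a" "smooth_on W b" "smooth_on W c"
  shows "smooth_on W (\<lambda>x. vector [a x, b x, c x] :: real^3)"
proof (rule smooth_on_vec)
  fix k :: 3
  show "smooth_on W (\<lambda>x. (vector [a x, b x, c x] :: real^3) $ k)"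
    using exhaust_3[of k] assms by auto
qed

section \<open>An injective parametrization: pieces diffeomorphic to three-space\<close>

context
  fixes \<tau> :: "real^3^3 \<Rightarrow> real" and W :: "(real^3^3) set"
  assumes \<tau>: "smooth_on W \<tau>" "TS \<subseteq> W"
    and \<tau>_eq: "\<And>X t. X \<in> T \<Longrightarrow> sX X = S t \<Longrightarrow> uX X = U t \<Longrightarrow> vX X = V t \<Longrightarrow> \<tau> X = t"
begin

lemma \<tau>_Phi: "\<epsilon> \<in> {1, -1} \<Longrightarrow> \<delta> \<in> {1, -1} \<Longrightarrow> \<tau> (Phi \<epsilon> \<delta> t f h) = t"
  by (rule \<tau>_eq; rule Phi_T Phi_sX Phi_uX Phi_vX; auto)

lemma line_chart_continuous:
  "continuous_on TS (\<lambda>X. vector [\<tau> X, fX X, hX X] :: real^3)"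
proof -
  have "smooth_on (W \<inter> T_nhd) (\<lambda>X. vector [\<tau> X, fX X, hX X] :: real^3)"
    by (intro smooth_on_vec3 smooth_on_subset[OF \<tau>(1)] smooth_on_subset[OF smooth_fX(1)]
        smooth_on_subset[OF smooth_fX(2)] open_Int T_nhd smooth_on_open[OF \<tau>(1)]) auto
  then show ?thesis
    by (rule continuous_on_subset[OF smooth_on_continuous]) (use \<tau>(2) T_nhd(2) in \<open>auto simp: TS_def\<close>)
qed

lemma smooth_line_param:
  assumes "\<epsilon> \<noteq> 0" "\<delta> \<noteq> 0"
  shows "smooth_on UNIV (\<lambda>v :: real^3. Phi \<epsilon> \<delta> (v $ 1) (v $ 2) (v $ 3))"
  by (intro smooth_Phi assms smooth_on_vec_nth smooth_on_id open_UNIV)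

lemma line_piece_diffeo:
  assumes e: "\<epsilon> \<in> {1, -1}" "\<delta> \<in> {1, -1}"
  shows "diffeo_R3 (piece \<epsilon> \<delta>)"
  unfolding diffeo_R3_def diffeomorphic_def
proof (intro exI conjI)
  have nz: "\<epsilon> \<noteq> 0" "\<delta> \<noteq> 0" using e by auto
  let ?f = "\<lambda>X. vector [\<tau> X, fX X, hX X] :: real^3"
  let ?g = "\<lambda>v :: real^3. Phi \<epsilon> \<delta> (v $ 1) (v $ 2) (v $ 3)"
  have "smooth_on (W \<inter> T_nhd) ?f"
    by (intro smooth_on_vec3 smooth_on_subset[OF \<tau>(1)] smooth_on_subset[OF smooth_fX(1)]
        smooth_on_subset[OF smooth_fX(2)] open_Int T_nhd smooth_on_open[OF \<tau>(1)]) auto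
  then show "smooth_map (piece \<epsilon> \<delta>) ?f"
    by (rule smooth_on_imp_smooth_map) (use \<tau>(2) T_nhd(2) piece_subset[OF e] in \<open>auto simp: TS_def\<close>)
  show "smooth_map UNIV ?g"
    by (rule smooth_on_imp_smooth_map[OF smooth_line_param[OF nz]]) simp
  show "homeomorphism (piece \<epsilon> \<delta>) UNIV ?f ?g"
  proof (rule homeomorphismI)
    show "continuous_on (piece \<epsilon> \<delta>) ?f"
      by (rule continuous_on_subset[OF line_chart_continuous piece_subset[OF e]])
    show "continuous_on UNIV ?g"
      by (rule smooth_on_continuous[OF smooth_line_param[OF nz]])
    show "?g ` UNIV \<subseteq> piece \<epsilon> \<delta>" using piece_memI by blast
    show "?g (?f X) = X" if "X \<in> piece \<epsilon> \<delta>" for X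
      using that by (auto simp: piece_def \<tau>_Phi[OF e] fX_Phi[OF e])
    show "?f (?g v) = v" for v
      by (simp add: vec_eq_iff forall_3 \<tau>_Phi[OF e] fX_Phi[OF e])
  qed auto
qed

text \<open>The left inverse of the parametrization is continuous on all of \<open>TS\<close>, not
  only on this piece, so the parameters converge whenever their images converge in
  \<open>TS\<close>.\<close>

lemma line_piece_closedin:
  assumes e: "\<epsilon> \<in> {1, -1}" "\<delta> \<in> {1, -1}"
  shows "closedin (top_of_set TS) (piece \<epsilon> \<delta>)"
proof -
  have nz: "\<epsilon> \<noteq> 0" "\<delta> \<noteq> 0" using e by auto
  let ?f = "\<lambda>X. vector [\<tau> X, fX X, hX X] :: real^3"
  let ?g = "\<lambda>v :: real^3. Phi \<epsilon> \<delta> (v $ 1) (v $ 2) (v $ 3)"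
  have eq: "?g ` UNIV = piece \<epsilon> \<delta>"
  proof (intro equalityI subsetI)
    fix X assume "X \<in> piece \<epsilon> \<delta>"
    then obtain t f h where "X = Phi \<epsilon> \<delta> t f h" by (auto simp: piece_def)
    then show "X \<in> range ?g" by (intro range_eqI[of _ _ "vector [t, f, h]"]) simp
  qed (use piece_memI in blast)
  have fg: "?f (?g v) = v" for v
    by (simp add: vec_eq_iff forall_3 \<tau>_Phi[OF e] fX_Phi[OF e])
  have "closedin (top_of_set TS) (?g ` UNIV)"
  proof (rule proper_image_closedin)
    show "continuous_on UNIV ?g"
      by (rule smooth_on_continuous[OF smooth_line_param[OF nz]])
    show "?g ` UNIV \<subseteq> TS" unfolding eq by (rule piece_subset[OF e])
    fix xs :: "nat \<Rightarrow> real^3" and y assume lim: "(\<lambda>n. ?g (xs n)) \<longlonglongrightarrow> y" "y \<in> TS"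
    have "\<forall>n. ?g (xs n) \<in> TS" using eq piece_subset[OF e] by blast
    then have "(\<lambda>n. ?f (?g (xs n))) \<longlonglongrightarrow> ?f y"
      using line_chart_continuous[unfolded continuous_on_sequentially, rule_format, of y "\<lambda>n. ?g (xs n)"] lim
      by (simp add: o_def)
    then have "xs \<longlonglongrightarrow> ?f y" unfolding fg by (simp add: eta_contract_eq)
    then show "bounded (range xs)" by (rule convergent_imp_bounded)
  qed simp
  then show ?thesis unfolding eq .
qed

lemma line_piece_disjoint:
  assumes e: "\<epsilon> \<in> {1, -1}" "\<delta> \<in> {1, -1}" "\<epsilon>' \<in> {1, -1}" "\<delta>' \<in> {1, -1}"
    and "piece \<epsilon> \<delta> \<inter> piece \<epsilon>' \<delta>' \<noteq> {}"
  shows "\<epsilon> = \<epsilon>' \<and> \<delta> = \<delta>'"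
proof -
  obtain t f h t' f' h' where eq: "Phi \<epsilon> \<delta> t f h = Phi \<epsilon>' \<delta>' t' f' h'"
    using assms(5) by (auto simp: piece_def)
  then have "t = t'" using \<tau>_Phi e by metis
  then show ?thesis using eq Phi_eq_iff[OF e] by simp
qed

theorem line_decomposition: "decomposition TS pieces 4 diffeo_R3"
  unfolding decomposition_def
proof (intro conjI ballI impI)
  show "card pieces = 4"
  proof -
    have "piece \<epsilon> \<delta> \<noteq> piece \<epsilon>' \<delta>'"
      if "\<epsilon> \<in> {1, -1}" "\<delta> \<in> {1, -1}" "\<epsilon>' \<in> {1, -1}" "\<delta>' \<in> {1, -1}" "\<epsilon> \<noteq> \<epsilon>' \<or> \<delta> \<noteq> \<delta>'" for \<epsilon> \<delta> \<epsilon>' \<delta>'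
      using line_piece_disjoint[OF that(1-4)] that(5) piece_nonempty by auto
    then show ?thesis by (simp add: pieces_def card_insert_if)
  qed
  fix K assume "K \<in> pieces"
  then obtain \<epsilon> \<delta> where K: "K = piece \<epsilon> \<delta>" "\<epsilon> \<in> {1, -1}" "\<delta> \<in> {1, -1}" by (auto simp: pieces_def)
  then show "connected K" using connected_piece[of \<epsilon> \<delta>] by auto
  show "K \<noteq> {}" using K piece_nonempty by simp
  show "closedin (top_of_set TS) K" using K line_piece_closedin by simp
  show "diffeo_R3 K" using K line_piece_diffeo by simp
  fix K' assume "K' \<in> pieces" "K \<noteq> K'"
  then obtain \<epsilon>' \<delta>' where K': "K' = piece \<epsilon>' \<delta>'" "\<epsilon>' \<in> {1, -1}" "\<delta>' \<in> {1, -1}" by (auto simp: pieces_def)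
  show "K \<inter> K' = {}" using line_piece_disjoint[OF K(2,3) K'(2,3)] K(1) K'(1) \<open>K \<noteq> K'\<close> by metis
qed (simp_all add: Union_pieces, simp add: pieces_def)

end

end

section \<open>A periodic parametrization: pieces diffeomorphic to the cylinder\<close>

lemma cis_eqE:
  assumes "cis a = cis b" obtains k :: int where "b = a + 2 * pi * of_int k"
proof -
  have "sin b = sin a \<and> cos b = cos a" using assms by (simp add: complex_eq_iff)
  then show ?thesis using that unfolding sin_cos_eq_iff by blast
qed

lemma unit_cis_arctan:
  assumes "cmod w = 1" "Re w > 0" shows "cis (arctan (Im w / Re w)) = w"
proof -
  have "(Re w)\<^sup>2 + (Im w)\<^sup>2 = 1" using assms(1) by (metis cmod_power2 one_power2)
  then have "1 + (Im w / Re w)\<^sup>2 = (1 / Re w)\<^sup>2"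
    using assms(2) by (simp add: field_simps)
  then have "sqrt (1 + (Im w / Re w)\<^sup>2) = 1 / Re w"
    using assms(2) by (simp add: real_sqrt_unique)
  then show ?thesis
    using assms(2) by (simp add: complex_eq_iff cos_arctan sin_arctan)
qed

definition cv :: "real^2 \<Rightarrow> complex" where "cv z = Complex (z $ 1) (z $ 2)"

lemma cmod_cv: "cmod (cv z) = norm z"
  by (simp add: cv_def cmod_def norm_vec_def L2_set_def sum_2)

lemma cv_eq_iff: "cv z = cv z' \<longleftrightarrow> z = z'"
  by (simp add: cv_def vec_eq_iff forall_2)

lemma cis_Arg_cv: "z \<in> sphere 0 1 \<Longrightarrow> cis (Arg (cv z)) = cv z"
  using cis_Arg[of "cv z"] by (metis cmod_cv div_by_1 mem_sphere_0 norm_zero of_real_1 sgn_eq zero_neq_one)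

lemma smooth_on_vec2:
  assumes "smooth_on W a" "smooth_on W b"
  shows "smooth_on W (\<lambda>x. vector [a x, b x] :: real^2)"
proof (rule smooth_on_vec)
  fix k :: 2
  show "smooth_on W (\<lambda>x. (vector [a x, b x] :: real^2) $ k)"
    using exhaust_2[of k] assms by auto
qed

lemma smooth_on_cv: "smooth_on W f \<Longrightarrow> smooth_on W (\<lambda>x. cv (f x))"
  unfolding cv_def by (intro smooth_on_complex smooth_on_vec_nth)

context parametrized
begin

context
  fixes c :: "real^3^3 \<Rightarrow> complex" and W :: "(real^3^3) set" and \<chi>12 \<chi>13 :: real and N :: nat
  assumes c: "smooth_on W c" "TS \<subseteq> W"
    and c_eq: "\<And>X t. X \<in> T \<Longrightarrow> sX X = S t \<Longrightarrow> uX X = U t \<Longrightarrow> vX X = V t \<Longrightarrow> c X = cis t"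
    and periodic: "\<And>t. S (t + 2 * pi) = S t" "\<And>t. U (t + 2 * pi) = U t" "\<And>t. V (t + 2 * pi) = V t"
    and \<chi>: "\<chi>12 \<in> {1, -1}" "\<chi>13 \<in> {1, -1}"
    and monodromy: "\<And>t. M12 (t + 2 * pi) = of_real \<chi>12 * M12 t" "\<And>t. M13 (t + 2 * pi) = of_real \<chi>13 * M13 t"
    and N: "N = (if \<chi>12 = 1 \<and> \<chi>13 = 1 then 1 else 2)"
begin

text \<open>One turn of the parameter acts on the signs by the monodromy, so a piece closes up after
  \<open>N\<close> turns.\<close>

lemma Phi_shift: "Phi \<epsilon> \<delta> (t + 2 * pi) f h = Phi (\<epsilon> * \<chi>12) (\<delta> * \<chi>13) t f h"
  by (simp add: Phi_def periodic monodromy mult.assoc mult.left_commute)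

text \<open>For a sign \<open>x\<close> this is the integer power \<open>x^k\<close>.\<close>

definition sg :: "real \<Rightarrow> int \<Rightarrow> real" where "sg x k = (if even k then 1 else x)"

lemma Phi_shift_int:
  "Phi \<epsilon> \<delta> (t + 2 * pi * of_int k) f h = Phi (\<epsilon> * sg \<chi>12 k) (\<delta> * sg \<chi>13 k) t f h"
proof (induction k arbitrary: \<epsilon> \<delta> rule: int_induct[where k = 0])
  case base
  then show ?case by (simp add: sg_def)
next
  case (step1 i)
  have "Phi \<epsilon> \<delta> (t + 2 * pi * of_int (i + 1)) f h = Phi \<epsilon> \<delta> ((t + 2 * pi * of_int i) + 2 * pi) f h"
    by (simp add: algebra_simps)
  also have "\<dots> = Phi (\<epsilon> * \<chi>12 * sg \<chi>12 i) (\<delta> * \<chi>13 * sg \<chi>13 i) t f h"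
    unfolding Phi_shift step1.IH ..
  also have "\<dots> = Phi (\<epsilon> * sg \<chi>12 (i + 1)) (\<delta> * sg \<chi>13 (i + 1)) t f h"
    using \<chi> by (auto simp: sg_def)
  finally show ?case .
next
  case (step2 i)
  have "Phi \<epsilon> \<delta> (t + 2 * pi * of_int (i - 1)) f h
      = Phi (\<epsilon> * \<chi>12 * \<chi>12) (\<delta> * \<chi>13 * \<chi>13) (t + 2 * pi * of_int (i - 1)) f h"
    using \<chi> by auto
  also have "\<dots> = Phi (\<epsilon> * \<chi>12) (\<delta> * \<chi>13) ((t + 2 * pi * of_int (i - 1)) + 2 * pi) f h"
    unfolding Phi_shift ..
  also have "(t + 2 * pi * of_int (i - 1)) + 2 * pi = t + 2 * pi * of_int i"
    by (simp add: algebra_simps)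
  also have "Phi (\<epsilon> * \<chi>12) (\<delta> * \<chi>13) (t + 2 * pi * of_int i) f h
      = Phi (\<epsilon> * \<chi>12 * sg \<chi>12 i) (\<delta> * \<chi>13 * sg \<chi>13 i) t f h"
    unfolding step2.IH ..
  also have "\<dots> = Phi (\<epsilon> * sg \<chi>12 (i - 1)) (\<delta> * sg \<chi>13 (i - 1)) t f h"
    using \<chi> by (auto simp: sg_def)
  finally show ?case .
qed

lemma c_Phi: "\<epsilon> \<in> {1, -1} \<Longrightarrow> \<delta> \<in> {1, -1} \<Longrightarrow> c (Phi \<epsilon> \<delta> t f h) = cis t"
  by (rule c_eq; rule Phi_T Phi_sX Phi_uX Phi_vX; auto)

lemma sg_cases: "sg \<chi>12 k \<in> {1, -1}" "sg \<chi>13 k \<in> {1, -1}"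
  using \<chi> by (auto simp: sg_def)

lemma circle_Phi_eqE:
  assumes e: "\<epsilon> \<in> {1, -1}" "\<delta> \<in> {1, -1}" "\<epsilon>' \<in> {1, -1}" "\<delta>' \<in> {1, -1}"
    and eq: "Phi \<epsilon> \<delta> a f h = Phi \<epsilon>' \<delta>' b f' h'"
  obtains k where "b = a + 2 * pi * of_int k" "\<epsilon> = \<epsilon>' * sg \<chi>12 k" "\<delta> = \<delta>' * sg \<chi>13 k" "f = f'" "h = h'"
proof -
  have "cis a = cis b" using c_Phi e eq by metis
  then obtain k :: int where k: "b = a + 2 * pi * of_int k" by (rule cis_eqE)
  have "Phi \<epsilon> \<delta> a f h = Phi (\<epsilon>' * sg \<chi>12 k) (\<delta>' * sg \<chi>13 k) a f' h'"
    using eq unfolding k Phi_shift_int .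
  moreover have "\<epsilon>' * sg \<chi>12 k \<in> {1, -1}" "\<delta>' * sg \<chi>13 k \<in> {1, -1}"
    using e sg_cases[of k] by auto
  ultimately show ?thesis using that k Phi_eq_iff e(1,2) by metis
qed

lemma sg_N: "sg \<chi>12 (int N * k) = 1" "sg \<chi>13 (int N * k) = 1"
  by (auto simp: sg_def N)

lemma Phi_N_periodic:
  assumes "cis a = cis b" shows "Phi \<epsilon> \<delta> (real N * a) f h = Phi \<epsilon> \<delta> (real N * b) f h"
proof -
  obtain k :: int where k: "b = a + 2 * pi * of_int k" using assms by (rule cis_eqE)
  have "real N * b = real N * a + 2 * pi * of_int (int N * k)"
    by (simp add: k algebra_simps)
  then show ?thesis using Phi_shift_int[of \<epsilon> \<delta> "real N * a" "int N * k" f h] sg_N by simp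
qed

lemma circle_Phi_N_inj:
  assumes e: "\<epsilon> \<in> {1, -1}" "\<delta> \<in> {1, -1}"
    and eq: "Phi \<epsilon> \<delta> (real N * a) f h = Phi \<epsilon> \<delta> (real N * b) f' h'"
  shows "cis a = cis b \<and> f = f' \<and> h = h'"
proof -
  obtain k where k: "real N * b = real N * a + 2 * pi * of_int k" "\<epsilon> = \<epsilon> * sg \<chi>12 k" "\<delta> = \<delta> * sg \<chi>13 k"
    and fh: "f = f'" "h = h'"
    using circle_Phi_eqE[OF e e eq] by blast
  have "\<exists>j. k = int N * j"
  proof (cases "N = 1")
    case False
    \<comment> \<open>If some monodromy sign is -1, only an even number of turns restores both
      signs.\<close>
    have "sg \<chi>12 k = 1" "sg \<chi>13 k = 1" using k(2,3)[symmetric] e by auto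
    then have "even k" using False N by (auto simp: sg_def split: if_splits)
    then show ?thesis using False N by (auto split: if_splits elim: evenE)
  qed simp
  then obtain j where "k = int N * j" by blast
  then have "real N * b = real N * (a + 2 * pi * of_int j)" using k(1) by (simp add: algebra_simps)
  then have "b = a + 2 * pi * of_int j" using N by (simp split: if_splits)
  then have "sin b = sin a \<and> cos b = cos a" unfolding sin_cos_eq_iff by blast
  then show ?thesis using fh by (simp add: complex_eq_iff)
qed

text \<open>One turn of the circle factor stands for \<open>N\<close> turns of the parameter, which
  makes the map injective. The jump of \<open>Arg\<close> does no harm, because by
  \<open>Phi_N_periodic\<close> the value depends on the angle only modulo a full turn.\<close>

definition Psi :: "real \<Rightarrow> real \<Rightarrow> (real^2) \<times> (real^2) \<Rightarrow> real^3^3" where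
  "Psi \<epsilon> \<delta> p = Phi \<epsilon> \<delta> (real N * Arg (cv (fst p))) (snd p $ 1) (snd p $ 2)"

abbreviation "cylinder \<equiv> sphere (0::real^2) 1 \<times> (UNIV :: (real^2) set)"

lemma Psi_image: "Psi \<epsilon> \<delta> ` cylinder = piece \<epsilon> \<delta>"
proof (intro equalityI subsetI)
  fix X assume "X \<in> piece \<epsilon> \<delta>"
  then obtain t f h where X: "X = Phi \<epsilon> \<delta> t f h" by (auto simp: piece_def)
  have N0: "real N \<noteq> 0" using N by simp
  define z :: "real^2" where "z = vector [cos (t / N), sin (t / N)]"
  have cz: "cv z = cis (t / N)" by (simp add: cv_def z_def complex_eq_iff)
  then have z: "z \<in> sphere 0 1" using cmod_cv[of z] by simp
  have "cis (Arg (cv z)) = cis (t / N)" using cis_Arg_cv[OF z] cz by simp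
  then have "Phi \<epsilon> \<delta> (real N * Arg (cv z)) f h = Phi \<epsilon> \<delta> (real N * (t / N)) f h"
    by (rule Phi_N_periodic)
  then have "X = Psi \<epsilon> \<delta> (z, vector [f, h])" using X N0 by (simp add: Psi_def)
  then show "X \<in> Psi \<epsilon> \<delta> ` cylinder" using z by blast
qed (auto simp: Psi_def piece_memI)

lemma Psi_inj: "\<epsilon> \<in> {1, -1} \<Longrightarrow> \<delta> \<in> {1, -1} \<Longrightarrow> inj_on (Psi \<epsilon> \<delta>) cylinder"
proof (rule inj_onI)
  fix p p' assume e: "\<epsilon> \<in> {1, -1}" "\<delta> \<in> {1, -1}" and p: "p \<in> cylinder" "p' \<in> cylinder"
    and eq: "Psi \<epsilon> \<delta> p = Psi \<epsilon> \<delta> p'"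
  note * = circle_Phi_N_inj[OF e eq[unfolded Psi_def]]
  have "cv (fst p) = cv (fst p')" using * p cis_Arg_cv by (metis mem_Times_iff)
  moreover have "snd p = snd p'" using * by (simp add: vec_eq_iff forall_2)
  ultimately show "p = p'" by (simp add: cv_eq_iff prod_eq_iff)
qed

lemma Psi_smooth:
  assumes "\<epsilon> \<noteq> 0" "\<delta> \<noteq> 0"
  shows "smooth_map cylinder (Psi \<epsilon> \<delta>)"
proof (rule smooth_mapI)
  fix p0 assume p0: "p0 \<in> cylinder"
  define z0 where "z0 = cv (fst p0)"
  have "fst p0 \<in> sphere 0 1" using p0 by (auto simp: mem_Times_iff)
  then have "cmod z0 = 1" "cis (Arg z0) = z0"
    using cis_Arg_cv cmod_cv by (auto simp: z0_def)
  then have z0: "cmod z0 = 1" "cis (Arg z0) = z0" "z0 \<noteq> 0" by auto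
  define w where "w p = cv (fst p) / z0" for p :: "(real^2) \<times> (real^2)"
  have w: "smooth_on UNIV w" unfolding w_def[abs_def]
    by (intro smooth_on_divide smooth_on_cv smooth_on_fst smooth_on_id smooth_on_const open_UNIV z0)
  define Y where "Y = {p. Re (w p) > 0}"
  have "open Y" unfolding Y_def
    by (intro open_Collect_less continuous_intros smooth_on_continuous[OF w])
  note wY = smooth_on_subset[OF w \<open>open Y\<close> subset_UNIV]
  \<comment> \<open>Near \<open>p0\<close> the function \<open>Arg\<close> is replaced by a branch
    without jump: \<open>Arg z0\<close> plus the angle of the quotient \<open>w\<close>, which stays
    in the right half-plane.\<close>
  have "smooth_on Y (\<lambda>p. Phi \<epsilon> \<delta> (real N * (Arg z0 + arctan (Im (w p) / Re (w p)))) (snd p $ 1) (snd p $ 2))"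
    by (intro smooth_Phi assms smooth_on_mult smooth_on_add smooth_on_const smooth_on_arctan smooth_on_divide
        smooth_on_Im smooth_on_Re wY smooth_on_vec_nth smooth_on_snd smooth_on_id \<open>open Y\<close>) (simp add: Y_def)
  moreover have "p0 \<in> Y" using z0 by (simp add: Y_def w_def z0_def[symmetric])
  moreover have "Phi \<epsilon> \<delta> (real N * (Arg z0 + arctan (Im (w p) / Re (w p)))) (snd p $ 1) (snd p $ 2) = Psi \<epsilon> \<delta> p"
    if "p \<in> cylinder \<inter> Y" for p
  proof -
    have z: "fst p \<in> sphere 0 1" "Re (w p) > 0" using that by (auto simp: mem_Times_iff Y_def)
    have "cmod (w p) = 1" using z z0 by (simp add: w_def norm_divide cmod_cv)
    then have "cis (arctan (Im (w p) / Re (w p))) = w p" using z by (intro unit_cis_arctan)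
    then have "cis (Arg z0 + arctan (Im (w p) / Re (w p))) = cis (Arg (cv (fst p)))"
      using cis_Arg_cv[OF z(1)] z0 by (simp add: w_def flip: cis_mult)
    then show ?thesis unfolding Psi_def by (rule Phi_N_periodic)
  qed
  ultimately show "\<exists>U g. p0 \<in> U \<and> smooth_on U g \<and> (\<forall>y\<in>cylinder \<inter> U. g y = Psi \<epsilon> \<delta> y)"
    by blast
qed

lemma fX_continuous: "continuous_on TS fX" "continuous_on TS hX"
  using smooth_on_continuous[OF smooth_fX(1)] smooth_on_continuous[OF smooth_fX(2)] T_nhd(2)
  by (auto simp: TS_def elim: continuous_on_subset)

lemma Psi_proper:
  assumes e: "\<epsilon> \<in> {1, -1}" "\<delta> \<in> {1, -1}"
    and xs: "\<And>n::nat. xs n \<in> cylinder" and lim: "(\<lambda>n. Psi \<epsilon> \<delta> (xs n)) \<longlonglongrightarrow> y" "y \<in> TS"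
  shows "bounded (range xs)"
proof -
  have "Psi \<epsilon> \<delta> (xs n) \<in> TS" for n
    using xs Psi_image[of \<epsilon> \<delta>] piece_subset[OF e] by blast
  then have "(\<lambda>n. fX (Psi \<epsilon> \<delta> (xs n))) \<longlonglongrightarrow> fX y" "(\<lambda>n. hX (Psi \<epsilon> \<delta> (xs n))) \<longlonglongrightarrow> hX y"
    using fX_continuous[unfolded continuous_on_sequentially] lim by (auto simp: o_def)
  then have l: "(\<lambda>n. snd (xs n) $ 1) \<longlonglongrightarrow> fX y" "(\<lambda>n. snd (xs n) $ 2) \<longlonglongrightarrow> hX y"
    unfolding Psi_def fX_Phi[OF e] by auto
  have "(\<lambda>n. snd (xs n)) \<longlonglongrightarrow> vector [fX y, hX y]"
  proof (rule vec_tendstoI)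
    fix k :: 2
    show "(\<lambda>n. snd (xs n) $ k) \<longlonglongrightarrow> vector [fX y, hX y] $ k"
      using exhaust_2[of k] l by auto
  qed
  then have "bounded (range (\<lambda>n. snd (xs n)))" by (rule convergent_imp_bounded)
  then have "bounded (sphere (0::real^2) 1 \<times> range (\<lambda>n. snd (xs n)))"
    by (intro bounded_Times bounded_sphere)
  moreover have "range xs \<subseteq> sphere (0::real^2) 1 \<times> range (\<lambda>n. snd (xs n))"
  proof
    fix p assume "p \<in> range xs"
    then obtain n where "p = xs n" by blast
    then show "p \<in> sphere (0::real^2) 1 \<times> range (\<lambda>n. snd (xs n))"
      using xs[of n] by (simp add: mem_Times_iff)
  qed
  ultimately show ?thesis by (rule bounded_subset)
qed

lemma circle_piece_closedin:
  assumes e: "\<epsilon> \<in> {1, -1}" "\<delta> \<in> {1, -1}"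
  shows "closedin (top_of_set TS) (piece \<epsilon> \<delta>)"
proof -
  have nz: "\<epsilon> \<noteq> 0" "\<delta> \<noteq> 0" using e by auto
  have "closedin (top_of_set TS) (Psi \<epsilon> \<delta> ` cylinder)"
  proof (rule proper_image_closedin)
    show "closed cylinder" by (intro closed_Times closed_sphere closed_UNIV)
    show "Psi \<epsilon> \<delta> ` cylinder \<subseteq> TS" using piece_subset[OF e] by (simp add: Psi_image)
    show "continuous_on cylinder (Psi \<epsilon> \<delta>)"
      by (rule smooth_map_continuous_on[OF Psi_smooth[OF nz]])
    show "bounded (range xs)" if "\<And>n. xs n \<in> cylinder" "(\<lambda>n. Psi \<epsilon> \<delta> (xs n)) \<longlonglongrightarrow> y" "y \<in> TS"
      for xs :: "nat \<Rightarrow> (real^2) \<times> (real^2)" and y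
      by (rule Psi_proper[OF e that])
  qed
  then show ?thesis by (simp add: Psi_image)
qed

text \<open>Properness gives a continuous inverse \<open>g\<close>; what remains is its smoothness.
  The smooth function \<open>c\<close> yields only the \<open>N\<close>-th power of the angular
  coordinate, and the continuity of \<open>g\<close> selects the right root.\<close>

lemma circle_piece_diffeo:
  assumes e: "\<epsilon> \<in> {1, -1}" "\<delta> \<in> {1, -1}"
  shows "diffeo_S1_R2 (piece \<epsilon> \<delta>)"
proof -
  let ?K = "piece \<epsilon> \<delta>"
  have nz: "\<epsilon> \<noteq> 0" "\<delta> \<noteq> 0" using e by auto
  have cl: "closed cylinder" by (intro closed_Times closed_sphere closed_UNIV)
  have sub: "Psi \<epsilon> \<delta> ` cylinder \<subseteq> TS" using piece_subset[OF e] by (simp add: Psi_image)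
  obtain g where "homeomorphism cylinder (Psi \<epsilon> \<delta> ` cylinder) (Psi \<epsilon> \<delta>) g"
  proof (rule proper_injection_homeomorphism[OF cl smooth_map_continuous_on[OF Psi_smooth[OF nz]] sub])
    show "bounded (range xs)" if "\<And>n. xs n \<in> cylinder" "(\<lambda>n. Psi \<epsilon> \<delta> (xs n)) \<longlonglongrightarrow> y" "y \<in> TS"
      for xs :: "nat \<Rightarrow> (real^2) \<times> (real^2)" and y
      by (rule Psi_proper[OF e that])
  qed (rule Psi_inj[OF e])
  then have hom: "homeomorphism ?K cylinder g (Psi \<epsilon> \<delta>)"
    by (simp add: Psi_image homeomorphism_symD)
  then have g: "continuous_on ?K g" "\<And>X. X \<in> ?K \<Longrightarrow> g X \<in> cylinder" "\<And>X. X \<in> ?K \<Longrightarrow> Psi \<epsilon> \<delta> (g X) = X"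
    unfolding homeomorphism_def by blast+
  have cz: "c X = cv (fst (g X)) ^ N" if "X \<in> ?K" for X
  proof -
    have "c X = cis (real N * Arg (cv (fst (g X))))"
      using g(3)[OF that] c_Phi[OF e] unfolding Psi_def by metis
    also have "\<dots> = cis (Arg (cv (fst (g X)))) ^ N" by (rule Complex.DeMoivre[symmetric])
    also have "cis (Arg (cv (fst (g X)))) = cv (fst (g X))"
      using cis_Arg_cv g(2)[OF that] by (auto simp: mem_Times_iff)
    finally show ?thesis .
  qed
  have "smooth_map ?K g"
  proof (rule smooth_mapI)
    fix X0 assume X0: "X0 \<in> ?K"
    define z0 where "z0 = cv (fst (g X0))"
    have "fst (g X0) \<in> sphere 0 1" using g(2)[OF X0] by (auto simp: mem_Times_iff)
    then have "cmod z0 = 1" using cmod_cv by (simp add: z0_def)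
    then have z0: "cmod z0 = 1" "z0 \<noteq> 0" by auto
    have c0: "c X0 = z0 ^ N" using cz[OF X0] by (simp add: z0_def)
    define w where "w X = c X / c X0" for X
    let ?W = "W \<inter> T_nhd"
    have oW: "open ?W" using smooth_on_open[OF c(1)] T_nhd(1) by blast
    have w: "smooth_on ?W w" unfolding w_def[abs_def]
      by (intro smooth_on_divide smooth_on_subset[OF c(1)] smooth_on_const oW) (use c0 z0 in auto)
    have "continuous_on ?W (\<lambda>X. Re (w X))"
      by (intro continuous_on_Re smooth_on_continuous[OF w])
    then have o1: "open (?W \<inter> (\<lambda>X. Re (w X)) -` {0<..})"
      by (rule continuous_open_preimage[OF _ oW open_greaterThan])
    have "continuous_on ?K (\<lambda>X. cv (fst (g X)))"
      unfolding cv_def complex_eq by (intro continuous_intros g)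
    then have "continuous_on ?K (\<lambda>X. Re (cv (fst (g X)) / z0))"
      using z0 by (intro continuous_intros) auto
    then have "openin (top_of_set ?K) (?K \<inter> (\<lambda>X. Re (cv (fst (g X)) / z0)) -` {0<..})"
      by (rule continuous_openin_preimage_gen) simp
    then obtain Y' where Y': "open Y'" "?K \<inter> (\<lambda>X. Re (cv (fst (g X)) / z0)) -` {0<..} = ?K \<inter> Y'"
      by (auto simp: openin_open)
    define Y where "Y = Y' \<inter> (?W \<inter> (\<lambda>X. Re (w X)) -` {0<..})"
    have oY: "open Y" unfolding Y_def using Y'(1) o1 by blast
    \<comment> \<open>The candidate for the angular coordinate: the base point \<open>z0\<close>,
      turned by the \<open>N\<close>-th part of the angle of \<open>c X\<close> relative to
      \<open>c X0\<close>.\<close>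
    define r where "r X = z0 * cis (arctan (Im (w X) / Re (w X)) / real N)" for X
    have wY: "smooth_on Y w" by (rule smooth_on_subset[OF w oY]) (auto simp: Y_def)
    have "smooth_on Y r" unfolding r_def[abs_def] cis.code
      by (intro smooth_on_mult smooth_on_const oY smooth_on_complex smooth_on_cos smooth_on_sin smooth_on_divide
          smooth_on_arctan smooth_on_Im smooth_on_Re wY) (use N in \<open>auto simp: Y_def\<close>)
    then have "smooth_on Y (\<lambda>X. (vector [Re (r X), Im (r X)] :: real^2, vector [fX X, hX X] :: real^2))"
      by (intro smooth_on_Pair smooth_on_vec2 smooth_on_Re smooth_on_Im
          smooth_on_subset[OF smooth_fX(1) oY] smooth_on_subset[OF smooth_fX(2) oY]) (auto simp: Y_def)
    moreover have "X0 \<in> Y"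
    proof -
      have "X0 \<in> ?K \<inter> Y'" unfolding Y'(2)[symmetric] using X0 z0 by (simp add: z0_def)
      moreover have "X0 \<in> ?W" using X0 piece_subset[OF e] c(2) T_nhd(2) by (auto simp: TS_def)
      ultimately show ?thesis using c0 z0 by (simp add: Y_def w_def)
    qed
    moreover have "(vector [Re (r X), Im (r X)], vector [fX X, hX X]) = g X" if "X \<in> ?K \<inter> Y" for X
    proof -
      have X: "X \<in> ?K" "Re (w X) > 0" using that by (auto simp: Y_def)
      have z1: "fst (g X) \<in> sphere 0 1" using g(2)[OF X(1)] by (auto simp: mem_Times_iff)
      define \<zeta> where "\<zeta> = cv (fst (g X)) / z0"
      have "X \<in> ?K \<inter> (\<lambda>X. Re (cv (fst (g X)) / z0)) -` {0<..}"
        unfolding Y'(2) using that by (auto simp: Y_def)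
      then have \<zeta>: "Re \<zeta> > 0" by (simp add: \<zeta>_def)
      have w\<zeta>: "w X = \<zeta> ^ N" by (simp add: w_def c0 cz[OF X(1)] \<zeta>_def power_divide)
      have "cmod \<zeta> = 1" using z1 z0 by (simp add: \<zeta>_def norm_divide cmod_cv)
      then have "cmod (w X) = 1" by (simp add: w\<zeta> norm_power)
      define \<theta> where "\<theta> = arctan (Im (w X) / Re (w X))"
      have "cis \<theta> = w X" unfolding \<theta>_def by (rule unit_cis_arctan) fact+
      have \<theta>: "- (pi / 2) < \<theta>" "\<theta> < pi / 2" unfolding \<theta>_def using arctan by auto
      have N1: "real N \<ge> 1" using N by auto
      \<comment> \<open>For \<open>N = 2\<close> the root is so far known up to sign only. Both
        \<open>\<zeta>\<close> and \<open>cis (\<theta> / real N)\<close> have positive real part,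
        which excludes the minus sign.\<close>
      have "\<bar>\<theta> / real N\<bar> \<le> \<bar>\<theta>\<bar>" unfolding N by (simp add: abs_mult)
      then have "cos (\<theta> / real N) > 0" using \<theta> by (intro cos_gt_zero_pi) linarith+
      have "cis (\<theta> / real N) ^ N = \<zeta> ^ N"
        using \<open>cis \<theta> = w X\<close> N1 by (simp add: Complex.DeMoivre w\<zeta>)
      then have "cis (\<theta> / real N) = \<zeta> \<or> cis (\<theta> / real N) = - \<zeta>"
        using N by (auto simp: power2_eq_iff split: if_splits)
      moreover have "cis (\<theta> / real N) \<noteq> - \<zeta>"
        using \<zeta> \<open>cos (\<theta> / real N) > 0\<close>
        by (metis cis.sel(1) less_asym neg_less_0_iff_less uminus_complex.sel(1))
      ultimately have "cis (\<theta> / real N) = \<zeta>" by blast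
      then have "r X = cv (fst (g X))" using z0 by (simp add: r_def \<zeta>_def \<theta>_def)
      then have "vector [Re (r X), Im (r X)] = fst (g X)"
        by (simp add: cv_def vec_eq_iff forall_2)
      moreover have "vector [fX X, hX X] = snd (g X)"
      proof -
        have "fX X = snd (g X) $ 1" "hX X = snd (g X) $ 2"
          using g(3)[OF X(1)] fX_Phi[OF e] unfolding Psi_def by metis+
        then show ?thesis by (simp add: vec_eq_iff forall_2)
      qed
      ultimately show ?thesis by (simp add: prod_eq_iff)
    qed
    ultimately show "\<exists>U f. X0 \<in> U \<and> smooth_on U f \<and> (\<forall>y\<in>?K \<inter> U. f y = g y)" by blast
  qed
  then show ?thesis
    unfolding diffeo_S1_R2_def diffeomorphic_def using hom Psi_smooth[OF nz] by blast
qed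

lemma circle_piece_shift: "piece (\<epsilon> * sg \<chi>12 k) (\<delta> * sg \<chi>13 k) = piece \<epsilon> \<delta>"
proof -
  have sub: "piece (\<epsilon> * sg \<chi>12 k) (\<delta> * sg \<chi>13 k) \<subseteq> piece \<epsilon> \<delta>" for \<epsilon> \<delta>
  proof
    fix X assume "X \<in> piece (\<epsilon> * sg \<chi>12 k) (\<delta> * sg \<chi>13 k)"
    then obtain t f h where "X = Phi (\<epsilon> * sg \<chi>12 k) (\<delta> * sg \<chi>13 k) t f h" by (auto simp: piece_def)
    then have "X = Phi \<epsilon> \<delta> (t + 2 * pi * of_int k) f h" by (simp only: Phi_shift_int)
    then show "X \<in> piece \<epsilon> \<delta>" using piece_memI by simp
  qed
  have "sg \<chi>12 k * sg \<chi>12 k = 1" "sg \<chi>13 k * sg \<chi>13 k = 1" using sg_cases[of k] by auto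
  then show ?thesis
    using sub[of \<epsilon> \<delta>] sub[of "\<epsilon> * sg \<chi>12 k" "\<delta> * sg \<chi>13 k"] by (simp add: mult.assoc)
qed

lemma circle_piece_inter:
  assumes e: "\<epsilon> \<in> {1, -1}" "\<delta> \<in> {1, -1}" "\<epsilon>' \<in> {1, -1}" "\<delta>' \<in> {1, -1}"
    and "piece \<epsilon> \<delta> \<inter> piece \<epsilon>' \<delta>' \<noteq> {}"
  shows "\<exists>k. \<epsilon> = \<epsilon>' * sg \<chi>12 k \<and> \<delta> = \<delta>' * sg \<chi>13 k"
proof -
  obtain t f h t' f' h' where "Phi \<epsilon> \<delta> t f h = Phi \<epsilon>' \<delta>' t' f' h'"
    using assms(5) by (auto simp: piece_def)
  from circle_Phi_eqE[OF e this] show ?thesis by blast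
qed

text \<open>The four pairs of signs form a group, and the pieces correspond to its cosets by the
  subgroup generated by \<open>(\<chi>12, \<chi>13)\<close>, which has order
  \<open>N\<close>.\<close>

lemma card_circle_pieces: "card pieces = 4 div N"
proof -
  have eq: "piece \<epsilon> \<delta> = piece \<epsilon>' \<delta>' \<longleftrightarrow> (\<epsilon> = \<epsilon>' \<and> \<delta> = \<delta>') \<or> (\<epsilon> = \<epsilon>' * \<chi>12 \<and> \<delta> = \<delta>' * \<chi>13)"
    if "\<epsilon> \<in> {1, -1}" "\<delta> \<in> {1, -1}" "\<epsilon>' \<in> {1, -1}" "\<delta>' \<in> {1, -1}" for \<epsilon> \<delta> \<epsilon>' \<delta>'
  proof
    assume "piece \<epsilon> \<delta> = piece \<epsilon>' \<delta>'"
    then have "piece \<epsilon> \<delta> \<inter> piece \<epsilon>' \<delta>' \<noteq> {}" using piece_nonempty by auto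
    from circle_piece_inter[OF that this]
    show "(\<epsilon> = \<epsilon>' \<and> \<delta> = \<delta>') \<or> (\<epsilon> = \<epsilon>' * \<chi>12 \<and> \<delta> = \<delta>' * \<chi>13)"
      unfolding sg_def by (metis mult.right_neutral)
  next
    assume "(\<epsilon> = \<epsilon>' \<and> \<delta> = \<delta>') \<or> (\<epsilon> = \<epsilon>' * \<chi>12 \<and> \<delta> = \<delta>' * \<chi>13)"
    then show "piece \<epsilon> \<delta> = piece \<epsilon>' \<delta>'"
      using circle_piece_shift[of \<epsilon>' 1 \<delta>'] by (auto simp: sg_def)
  qed
  show ?thesis
    using \<chi> unfolding pieces_def N
    by (auto simp: eq card_insert_if)
qed

theorem circle_decomposition: "decomposition TS pieces (4 div N) diffeo_S1_R2"
  unfolding decomposition_def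
proof (intro conjI ballI impI card_circle_pieces)
  fix K assume "K \<in> pieces"
  then obtain \<epsilon> \<delta> where K: "K = piece \<epsilon> \<delta>" "\<epsilon> \<in> {1, -1}" "\<delta> \<in> {1, -1}" by (auto simp: pieces_def)
  then show "connected K" using connected_piece[of \<epsilon> \<delta>] by auto
  show "K \<noteq> {}" using K piece_nonempty by simp
  show "closedin (top_of_set TS) K" using K circle_piece_closedin by simp
  show "diffeo_S1_R2 K" using K circle_piece_diffeo by simp
  fix K' assume "K' \<in> pieces" "K \<noteq> K'"
  then obtain \<epsilon>' \<delta>' where K': "K' = piece \<epsilon>' \<delta>'" "\<epsilon>' \<in> {1, -1}" "\<delta>' \<in> {1, -1}" by (auto simp: pieces_def)
  show "K \<inter> K' = {}"
    using circle_piece_inter[OF K(2,3) K'(2,3)] K(1) K'(1) \<open>K \<noteq> K'\<close> circle_piece_shift by metis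
qed (simp_all add: Union_pieces, simp add: pieces_def)

end

end

section \<open>Monodromy of the square roots\<close>

lemma sign_constant:
  fixes M N :: "real \<Rightarrow> complex"
  assumes "continuous_on UNIV M" "continuous_on UNIV N" "\<And>t. M t \<noteq> 0" "\<And>t. (N t)\<^sup>2 = (M t)\<^sup>2"
  obtains ch :: real where "ch \<in> {1, -1}" "\<And>t. N t = of_real ch * M t"
proof -
  have r: "N t / M t = 1 \<or> N t / M t = -1" for t
    using assms(3)[of t] assms(4)[of t] by (auto simp: power2_eq_iff)
  have "(\<lambda>t. N t / M t) constant_on UNIV"
  proof (rule continuous_finite_range_constant)
    show "continuous_on UNIV (\<lambda>t. N t / M t)" using assms by (intro continuous_intros) auto
    have "range (\<lambda>t. N t / M t) \<subseteq> {1, -1}" by (intro image_subsetI) (use r in blast)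
    then show "finite (range (\<lambda>t. N t / M t))" by (rule finite_subset) simp
  qed simp
  then obtain y where y: "\<And>t. N t / M t = y" by (auto simp: constant_on_def)
  then have N: "N t = y * M t" for t using assms(3)[of t] by (metis nonzero_divide_eq_eq)
  from r[of 0] y[of 0] have "y = 1 \<or> y = -1" by simp
  then show ?thesis using that[of 1] that[of "-1"] N by auto
qed

text \<open>With the same nonzero slope at both zeros, \<open>R\<close> has opposite signs just
  inside the two ends.\<close>

lemma zero_between:
  fixes R :: "real \<Rightarrow> real"
  assumes "a < b" "continuous_on {a..b} R" "R a = 0" "R b = 0" "d \<noteq> 0"
    and "(R has_real_derivative d) (at a)" "(R has_real_derivative d) (at b)"
  obtains t where "a < t" "t < b" "R t = 0"
proof -
  have *: "\<exists>t. a < t \<and> t < b \<and> R t = 0"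
    if d: "d > 0" and R: "continuous_on {a..b} R" "R a = 0" "R b = 0"
      "(R has_real_derivative d) (at a)" "(R has_real_derivative d) (at b)" for R :: "real \<Rightarrow> real" and d
  proof -
    obtain e where e: "e > 0" "\<And>h. 0 < h \<Longrightarrow> h < e \<Longrightarrow> R a < R (a + h)"
      using DERIV_pos_inc_right[OF R(4) d] by blast
    obtain e' where e': "e' > 0" "\<And>h. 0 < h \<Longrightarrow> h < e' \<Longrightarrow> R (b - h) < R b"
      using DERIV_pos_inc_left[OF R(5) d] by blast
    \<comment> \<open>A third of the length keeps \<open>a + h\<close> to the left of
      \<open>b - h\<close>.\<close>
    define h where "h = min (min e e') (b - a) / 3"
    have "h * 3 \<le> b - a" by (simp add: h_def)
    then have "a + h < b - h" using \<open>a < b\<close> by argo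
    then have h: "0 < h" "h < e" "h < e'" "a + h < b - h" using e(1) e'(1) \<open>a < b\<close> by (auto simp: h_def)
    have "R (a + h) > 0" "R (b - h) < 0" using e(2)[OF h(1,2)] e'(2)[OF h(1,3)] R by auto
    then obtain t where "a + h \<le> t" "t \<le> b - h" "R t = 0"
      using IVT2'[of R "b - h" 0 "a + h"] continuous_on_subset[OF R(1), of "{a+h..b-h}"] h by auto
    then show ?thesis using h by (intro exI[of _ t]) auto
  qed
  show ?thesis
  proof (cases "d > 0")
    case True
    then show ?thesis using *[OF True assms(2-4,6,7)] that by blast
  next
    case False
    then have "- d > 0" using assms(5) by simp
    then have "\<exists>t. a < t \<and> t < b \<and> - R t = 0"
      using assms by (intro *[of "-d"]) (auto intro!: continuous_intros derivative_eq_intros)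
    then show ?thesis using that by auto
  qed
qed

text \<open>If \<open>R'\<close> vanished, differentiating the two equations at \<open>t\<close>
  would make the vector \<open>(\<alpha>', \<gamma>')\<close> both orthogonal and parallel to the
  nonzero vector \<open>(\<beta> t, \<delta> t)\<close>, hence zero.\<close>

lemma nonvanishing_product_derivative:
  fixes R I \<alpha> \<beta> \<gamma> \<delta> :: "real \<Rightarrow> real"
  assumes d: "(R has_real_derivative R') (at t)" "(I has_real_derivative I') (at t)"
    "(\<alpha> has_real_derivative \<alpha>') (at t)" "(\<beta> has_real_derivative \<beta>') (at t)"
    "(\<gamma> has_real_derivative \<gamma>') (at t)" "(\<delta> has_real_derivative \<delta>') (at t)"
    and eq: "\<And>t. R t * I t = \<alpha> t * \<beta> t + \<gamma> t * \<delta> t" "\<And>t. \<alpha> t * \<delta> t = \<gamma> t * \<beta> t"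
    and z: "R t = 0" "\<alpha> t = 0" "\<gamma> t = 0" and nz: "\<beta> t \<noteq> 0 \<or> \<delta> t \<noteq> 0" "\<alpha>' \<noteq> 0 \<or> \<gamma>' \<noteq> 0"
  shows "R' \<noteq> 0"
proof
  assume "R' = 0"
  have "((\<lambda>t. R t * I t) has_real_derivative R' * I t + R t * I') (at t)"
    by (rule derivative_eq_intros d refl | simp)+
  moreover have "((\<lambda>t. \<alpha> t * \<beta> t + \<gamma> t * \<delta> t) has_real_derivative
      (\<alpha>' * \<beta> t + \<alpha> t * \<beta>') + (\<gamma>' * \<delta> t + \<gamma> t * \<delta>')) (at t)"
    by (rule derivative_eq_intros d refl | simp)+
  ultimately have 1: "\<alpha>' * \<beta> t + \<gamma>' * \<delta> t = 0"
    using DERIV_unique z \<open>R' = 0\<close> unfolding eq(1) by fastforce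
  have "((\<lambda>t. \<alpha> t * \<delta> t) has_real_derivative \<alpha>' * \<delta> t + \<alpha> t * \<delta>') (at t)"
    by (rule derivative_eq_intros d refl | simp)+
  moreover have "((\<lambda>t. \<gamma> t * \<beta> t) has_real_derivative \<gamma>' * \<beta> t + \<gamma> t * \<beta>') (at t)"
    by (rule derivative_eq_intros d refl | simp)+
  ultimately have 2: "\<alpha>' * \<delta> t = \<gamma>' * \<beta> t"
    using DERIV_unique z unfolding eq(2) by fastforce
  have "\<alpha>' * ((\<beta> t)\<^sup>2 + (\<delta> t)\<^sup>2) = 0" "\<gamma>' * ((\<beta> t)\<^sup>2 + (\<delta> t)\<^sup>2) = 0" using 1 2 by algebra+
  then show False using nz by (auto simp: sum_power2_eq_zero_iff)
qed

context parametrized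
begin

lemma smooth_real_derivative:
  assumes "smooth_on UNIV (F :: real \<Rightarrow> real)" obtains d where "(F has_real_derivative d) (at t)"
proof -
  have "F differentiable (at t)"
    using assms unfolding smooth_on_def by (auto dest: spec[of _ "Suc 0"])
  then show ?thesis using that real_differentiable_def by blast
qed

context
  fixes S' U' V' :: "real \<Rightarrow> real"
  assumes periodic: "\<And>t. S (t + 2 * pi) = S t" "\<And>t. U (t + 2 * pi) = U t" "\<And>t. V (t + 2 * pi) = V t"
    and inj: "\<And>t t'. S t = S t' \<Longrightarrow> U t = U t' \<Longrightarrow> V t = V t' \<Longrightarrow> cis t = cis t'"
    and deriv: "\<And>t. (S has_real_derivative S' t) (at t)" "\<And>t. (U has_real_derivative U' t) (at t)"
      "\<And>t. (V has_real_derivative V' t) (at t)"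
    and regular: "\<And>t. S' t = 0 \<Longrightarrow> U' t \<noteq> 0 \<and> V' t \<noteq> 0"
begin

text \<open>Zeros of \<open>Re M\<close> are simple and unique within a turn. If \<open>M\<close>
  were periodic, a zero would recur one turn later with the same slope and force another one in
  between; if \<open>M\<close> changes sign after a turn, continuity produces a zero.\<close>

lemma monodromy_sign:
  fixes M :: "real \<Rightarrow> complex" and \<alpha> \<beta> \<gamma> \<delta> :: "real \<Rightarrow> real" and ch :: real
  assumes M: "smooth_on UNIV M" and eq: "\<And>t. Re (M t) * Im (M t) = \<alpha> t * \<beta> t + \<gamma> t * \<delta> t"
      "\<And>t. \<alpha> t * \<delta> t = \<gamma> t * \<beta> t"
    and smooth: "smooth_on UNIV \<alpha>" "smooth_on UNIV \<beta>" "smooth_on UNIV \<gamma>" "smooth_on UNIV \<delta>"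
    and d: "\<And>t. (\<alpha> has_real_derivative \<alpha>' t) (at t)" "\<And>t. (\<gamma> has_real_derivative \<gamma>' t) (at t)"
    and nz: "\<And>t. \<alpha> t = 0 \<Longrightarrow> \<gamma> t = 0 \<Longrightarrow> \<beta> t \<noteq> 0 \<or> \<delta> t \<noteq> 0" "\<And>t. \<alpha>' t \<noteq> 0 \<or> \<gamma>' t \<noteq> 0"
    and zero: "\<And>t. Re (M t) = 0 \<longleftrightarrow> \<alpha> t = 0 \<and> \<gamma> t = 0"
    and unique: "\<And>t t'. \<alpha> t = 0 \<Longrightarrow> \<gamma> t = 0 \<Longrightarrow> \<alpha> t' = 0 \<Longrightarrow> \<gamma> t' = 0 \<Longrightarrow> cis t = cis t'"
    and ch: "ch \<in> {1, -1}" "\<And>t. M (t + 2 * pi) = of_real ch * M t"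
  shows "ch = 1 \<longleftrightarrow> (\<forall>t. Re (M t) \<noteq> 0)"
proof
  have contR: "continuous_on A (\<lambda>t. Re (M t))" for A
    using smooth_on_continuous[OF smooth_on_Re[OF M]] continuous_on_subset by blast
  show "\<forall>t. Re (M t) \<noteq> 0" if "ch = 1"
  proof (intro allI notI)
    fix t0 assume 0: "Re (M t0) = 0"
    have per: "Re (M (t + 2 * pi)) = Re (M t)" for t using ch(2)[of t] that by simp
    obtain R' where R': "((\<lambda>t. Re (M t)) has_real_derivative R') (at t0)"
      by (rule smooth_real_derivative[OF smooth_on_Re[OF M]])
    obtain I' where I': "((\<lambda>t. Im (M t)) has_real_derivative I') (at t0)"
      by (rule smooth_real_derivative[OF smooth_on_Im[OF M]])
    obtain \<beta>' where \<beta>': "(\<beta> has_real_derivative \<beta>') (at t0)" by (rule smooth_real_derivative[OF smooth(2)])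
    obtain \<delta>' where \<delta>': "(\<delta> has_real_derivative \<delta>') (at t0)" by (rule smooth_real_derivative[OF smooth(4)])
    have z: "\<alpha> t0 = 0" "\<gamma> t0 = 0" using 0 zero by auto
    have "R' \<noteq> 0"
      by (rule nonvanishing_product_derivative[OF R' I' d(1) \<beta>' d(2) \<delta>' eq 0 z nz(1)[OF z] nz(2)])
    moreover have "((\<lambda>t. Re (M t)) has_real_derivative R') (at (t0 + 2 * pi))"
    proof -
      have "((\<lambda>t. Re (M (t + - 2 * pi))) has_real_derivative R') (at (t0 + 2 * pi))"
        by (subst DERIV_shift) (use R' in simp)
      moreover have "Re (M (t + - 2 * pi)) = Re (M t)" for t using per[of "t + - 2 * pi"] by simp
      ultimately show ?thesis by simp
    qed
    moreover have "Re (M (t0 + 2 * pi)) = 0" using per 0 by simp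
    ultimately obtain t where t: "t0 < t" "t < t0 + 2 * pi" "Re (M t) = 0"
      using zero_between[of t0 "t0 + 2 * pi" "\<lambda>t. Re (M t)" R'] contR 0 R' pi_gt_zero by auto
    then have "cis t0 = cis t" using unique z zero by blast
    then obtain k :: int where k: "t = t0 + 2 * pi * of_int k" by (rule cis_eqE)
    then have "0 < 2 * pi * real_of_int k" "2 * pi * real_of_int k < 2 * pi * 1" using t by auto
    then have "0 < real_of_int k" "real_of_int k < 1"
      using pi_gt_zero by (simp_all add: zero_less_mult_iff)
    then have "0 < k" "k < 1" by simp_all
    then show False by simp
  qed
  show "ch = 1" if nz: "\<forall>t. Re (M t) \<noteq> 0"
  proof (rule ccontr)
    assume "ch \<noteq> 1"
    then have "Re (M (0 + 2 * pi)) = - Re (M 0)" using ch(1) ch(2)[of 0] by auto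
    then have "\<exists>t\<ge>0. t \<le> 2 * pi \<and> Re (M t) = 0"
      using IVT'[of "\<lambda>t. Re (M t)" 0 0 "2 * pi"] IVT2'[of "\<lambda>t. Re (M t)" "2 * pi" 0 0] contR
      by (cases "Re (M 0) \<le> 0") auto
    then show False using nz by auto
  qed
qed

lemma P_derivative:
  "((\<lambda>t. P1 (S t)) has_real_derivative w1 * S' t) (at t)"
  "((\<lambda>t. P2 (S t)) has_real_derivative w2 * S' t) (at t)"
  "((\<lambda>t. P3 (S t)) has_real_derivative w3 * S' t) (at t)"
  unfolding P1_def P2_def P3_def by (rule derivative_eq_intros deriv refl | simp)+

lemma monodromy_exists:
  obtains \<chi>12 \<chi>13 :: real where "\<chi>12 \<in> {1, -1}" "\<chi>13 \<in> {1, -1}"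
    "\<And>t. M12 (t + 2 * pi) = of_real \<chi>12 * M12 t" "\<And>t. M13 (t + 2 * pi) = of_real \<chi>13 * M13 t"
    "\<chi>12 = 1 \<longleftrightarrow> (\<forall>t. Re (M12 t) \<noteq> 0)" "\<chi>13 = 1 \<longleftrightarrow> (\<forall>t. Re (M13 t) \<noteq> 0)"
proof -
  have shift: "continuous_on UNIV (\<lambda>t. M (t + 2 * pi))" if "continuous_on UNIV M" for M :: "real \<Rightarrow> complex"
    by (rule continuous_on_compose2[OF that]) (auto intro!: continuous_intros)
  have "(M12 (t + 2 * pi))\<^sup>2 = (M12 t)\<^sup>2" "(M13 (t + 2 * pi))\<^sup>2 = (M13 t)\<^sup>2" for t
    using M12(2)[of t] M12(2)[of "t + 2 * pi"] M13(2)[of t] M13(2)[of "t + 2 * pi"] by (simp_all only: periodic)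
  note sq = this
  obtain \<chi>12 where 1: "\<chi>12 \<in> {1, -1::real}" "\<And>t. M12 (t + 2 * pi) = of_real \<chi>12 * M12 t"
    using sign_constant[OF M12(1) shift[OF M12(1)] M_nonzero(1) sq(1)] by blast
  obtain \<chi>13 where 2: "\<chi>13 \<in> {1, -1::real}" "\<And>t. M13 (t + 2 * pi) = of_real \<chi>13 * M13 t"
    using sign_constant[OF M13(1) shift[OF M13(1)] M_nonzero(2) sq(2)] by blast
  have E: "U t * V t = P1 (S t) * P2 (S t) * P3 (S t)" "U t + V t = \<l> (S t)" for t
    using on_E[of t] by (simp_all add: on_E_def)
  have "\<chi>12 = 1 \<longleftrightarrow> (\<forall>t. Re (M12 t) \<noteq> 0)"
  proof (rule monodromy_sign[OF smooth_M(1), where \<alpha> = "\<lambda>t. P3 (S t)" and \<beta> = V and \<gamma> = U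
        and \<delta> = "\<lambda>t. P1 (S t) * P2 (S t)" and \<alpha>' = "\<lambda>t. w3 * S' t" and \<gamma>' = U'])
    show "Re (M12 t) * Im (M12 t) = P3 (S t) * V t + U t * (P1 (S t) * P2 (S t))" for t
    proof -
      \<comment> \<open>Twice the product of real and imaginary part is the imaginary part of the
        square; it is read off here for \<open>M12\<close>, \<open>p12\<close> and
        \<open>q12\<close>.\<close>
      have "Im ((M12 t)\<^sup>2) = 2 * (P3 (S t) * V t + U t * (P1 (S t) * P2 (S t)))"
        unfolding M12(2)[symmetric] G12_def by (simp add: p12_def q12_def power2_eq_square algebra_simps)
      then show ?thesis by (simp add: power2_eq_square algebra_simps)
    qed
    show "P3 (S t) * (P1 (S t) * P2 (S t)) = U t * V t" for t using E by simp
    show "V t \<noteq> 0 \<or> P1 (S t) * P2 (S t) \<noteq> 0" if "P3 (S t) = 0" "U t = 0" for t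
      using on_E_nonsingular[OF on_E[of t]] that by auto
    show "w3 * S' t \<noteq> 0 \<or> U' t \<noteq> 0" for t using regular[of t] w_nonzero by auto
    show "(Re (M12 t) = 0) = (P3 (S t) = 0 \<and> U t = 0)" for t by (rule Re_M12_eq_0_iff)
    show "cis t = cis t'" if "P3 (S t) = 0" "U t = 0" "P3 (S t') = 0" "U t' = 0" for t t'
    proof (rule inj)
      \<comment> \<open>\<open>P3\<close> is affine with slope \<open>w3 \<noteq> 0\<close>, so its
        zero determines \<open>s\<close>; then \<open>v = \<l> s - u\<close> is determined
        too.\<close>
      show s: "S t = S t'" using that w_nonzero by (simp add: P3_def) (metis add_left_cancel mult_right_cancel)
      show "U t = U t'" using that by simp
      show "V t = V t'" using E(2)[of t] E(2)[of t'] that s by simp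
    qed
  qed (rule smooth_P smooth_V smooth_U smooth_on_mult P_derivative deriv 1)+
  moreover have "\<chi>13 = 1 \<longleftrightarrow> (\<forall>t. Re (M13 t) \<noteq> 0)"
  proof (rule monodromy_sign[OF smooth_M(2), where \<alpha> = "\<lambda>t. P2 (S t)" and \<beta> = U and \<gamma> = V
        and \<delta> = "\<lambda>t. P1 (S t) * P3 (S t)" and \<alpha>' = "\<lambda>t. w2 * S' t" and \<gamma>' = V'])
    show "Re (M13 t) * Im (M13 t) = P2 (S t) * U t + V t * (P1 (S t) * P3 (S t))" for t
    proof -
      have "Im ((M13 t)\<^sup>2) = 2 * (P2 (S t) * U t + V t * (P1 (S t) * P3 (S t)))"
        unfolding M13(2)[symmetric] G13_def by (simp add: p13_def q13_def power2_eq_square algebra_simps)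
      then show ?thesis by (simp add: power2_eq_square algebra_simps)
    qed
    show "P2 (S t) * (P1 (S t) * P3 (S t)) = V t * U t" for t using E[of t] by (simp add: mult.commute mult.left_commute)
    show "U t \<noteq> 0 \<or> P1 (S t) * P3 (S t) \<noteq> 0" if "P2 (S t) = 0" "V t = 0" for t
      using on_E_nonsingular[OF on_E[of t]] that by auto
    show "w2 * S' t \<noteq> 0 \<or> V' t \<noteq> 0" for t using regular[of t] w_nonzero by auto
    show "(Re (M13 t) = 0) = (P2 (S t) = 0 \<and> V t = 0)" for t by (rule Re_M13_eq_0_iff)
    show "cis t = cis t'" if "P2 (S t) = 0" "V t = 0" "P2 (S t') = 0" "V t' = 0" for t t'
    proof (rule inj)
      show s: "S t = S t'" using that w_nonzero by (simp add: P2_def) (metis add_left_cancel mult_right_cancel)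
      show "V t = V t'" using that by simp
      show "U t = U t'" using E(2)[of t] E(2)[of t'] that s by simp
    qed
  qed (rule smooth_P smooth_V smooth_U smooth_on_mult P_derivative deriv 2)+
  ultimately show ?thesis using that 1 2 by blast
qed

end

end

section \<open>Factorization of the discriminant\<close>

context cubic_data
begin

definition "W = - (w1 * w2 * w3)"

lemma W_pos: "W > 0" using w_prod by (simp add: W_def)

lemma D_expand:
  "D s = 4 * W * s^3 + (\<kappa>\<^sup>2 - 4 * (w1 * w2 * q3 + w1 * w3 * q2 + w2 * w3 * q1)) * s\<^sup>2
    + (2 * g * \<kappa> - 4 * (w1 * q2 * q3 + w2 * q1 * q3 + w3 * q1 * q2)) * s + (g\<^sup>2 - 4 * (q1 * q2 * q3))"
  by (simp add: D_def \<l>_def P1_def P2_def P3_def W_def algebra_simps power2_eq_square power3_eq_cube)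

lemma D_derivative: "(D has_real_derivative D' s) (at s)"
  unfolding D_def[abs_def] \<l>_def P1_def P2_def P3_def
  by (rule derivative_eq_intros refl | simp)+
    (simp add: D'_def \<l>_def P1_def P2_def P3_def algebra_simps power2_eq_square)

lemma D_no_double_root:
  assumes "\<And>s. D s = (s - p)\<^sup>2 * (k * (s - r))" shows False
proof -
  have "((\<lambda>s. (s - p)\<^sup>2 * (k * (s - r))) has_real_derivative 0) (at p)"
    by (rule derivative_eq_intros refl | simp)+
  then have "D' p = 0" using D_derivative[of p] DERIV_unique by (simp add: assms[abs_def])
  moreover have "D p = 0" using assms by simp
  ultimately show False using D_nonsingular by blast
qed

lemma D_root: "\<exists>r. D r = 0"
proof -
  obtain d0 d1 d2 where D: "\<And>s. D s = 4 * W * s^3 + d2 * s\<^sup>2 + d1 * s + d0"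
    using D_expand by blast
  \<comment> \<open>A Cauchy bound: at \<open>m\<close> and \<open>-m\<close> the leading term
    dominates the sum of the others, which gives the signs needed for the intermediate value
    theorem.\<close>
  define m where "m = 1 + (\<bar>d2\<bar> + \<bar>d1\<bar> + \<bar>d0\<bar>) / (4 * W)"
  have "m \<ge> 1" using W_pos by (simp add: m_def)
  have bound: "\<bar>d2 * s\<^sup>2 + d1 * s + d0\<bar> \<le> 4 * W * m^3" if "\<bar>s\<bar> = m" for s
  proof -
    have "m \<le> m\<^sup>2" "1 \<le> m\<^sup>2" using \<open>m \<ge> 1\<close> by (simp_all add: self_le_power one_le_power)
    have "\<bar>d2 * s\<^sup>2 + d1 * s + d0\<bar> \<le> \<bar>d2 * s\<^sup>2\<bar> + \<bar>d1 * s\<bar> + \<bar>d0\<bar>" by linarith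
    also have "\<dots> = \<bar>d2\<bar> * m\<^sup>2 + \<bar>d1\<bar> * m + \<bar>d0\<bar>"
      unfolding abs_mult that power_abs[symmetric] by (simp add: abs_mult power_abs that)
    also have "\<dots> \<le> \<bar>d2\<bar> * m\<^sup>2 + \<bar>d1\<bar> * m\<^sup>2 + \<bar>d0\<bar> * m\<^sup>2"
      using \<open>m \<le> m\<^sup>2\<close> mult_left_mono[OF \<open>1 \<le> m\<^sup>2\<close>, of "\<bar>d0\<bar>"] by (intro add_mono mult_left_mono) auto
    also have "\<dots> = (4 * W * (m - 1)) * m\<^sup>2" using W_pos by (simp add: m_def field_simps)
    also have "\<dots> \<le> (4 * W * m) * m\<^sup>2" using W_pos by (intro mult_right_mono) auto
    also have "\<dots> = 4 * W * m^3" by (simp add: power3_eq_cube power2_eq_square)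
    finally show ?thesis .
  qed
  have "D m \<ge> 0" using bound[of m] \<open>m \<ge> 1\<close> unfolding D by (auto simp: abs_le_iff)
  moreover have "D (- m) \<le> 0" using bound[of "-m"] \<open>m \<ge> 1\<close> unfolding D by (auto simp: abs_le_iff)
  moreover have "isCont D s" for s using D_derivative DERIV_isCont by blast
  ultimately show ?thesis using IVT[of D "-m" 0 m] \<open>m \<ge> 1\<close> by auto
qed

text \<open>Splitting off one real root leaves a quadratic factor without real roots or with two,
  which nonsingularity makes distinct from each other and from the first. In the second case the
  roots are sorted and \<open>s3\<close> is taken to be the largest, so that the quadratic factor is
  positive from there on.\<close>

lemma D_factor:
  obtains s3 b c where "\<And>s. D s = 4 * W * ((s - s3) * (s\<^sup>2 + b * s + c))" "\<And>s. s \<ge> s3 \<Longrightarrow> s\<^sup>2 + b * s + c > 0"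
    "(\<forall>s. s\<^sup>2 + b * s + c > 0) \<or> (\<exists>s1 s2. s1 < s2 \<and> s2 < s3 \<and> (\<forall>s. s\<^sup>2 + b * s + c = (s - s1) * (s - s2)))"
proof -
  note result = that
  obtain d0 d1 d2 where D: "\<And>s. D s = 4 * W * s^3 + d2 * s\<^sup>2 + d1 * s + d0"
    using D_expand by blast
  obtain r where r: "D r = 0" using D_root by blast
  define b where "b = r + d2 / (4 * W)"
  define c where "c = r * b + d1 / (4 * W)"
  have fac: "D s = 4 * W * ((s - r) * (s\<^sup>2 + b * s + c))" for s
  proof -
    have d12: "d2 = 4 * W * (b - r)" "d1 = 4 * W * (c - r * b)" using W_pos by (simp_all add: b_def c_def)
    have d0: "d0 = - (4 * W * r^3 + d2 * r\<^sup>2 + d1 * r)" using r unfolding D by simp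
    show ?thesis unfolding D d0 unfolding d12 by (simp add: algebra_simps power2_eq_square power3_eq_cube)
  qed
  show ?thesis
  proof (cases "b\<^sup>2 - 4 * c < 0")
    case True
    have "s\<^sup>2 + b * s + c > 0" for s
    proof -
      have "s\<^sup>2 + b * s + c = (s + b / 2)\<^sup>2 + (4 * c - b\<^sup>2) / 4" by (simp add: power2_eq_square field_simps)
      then show ?thesis using True by (simp add: add_nonneg_pos)
    qed
    then show ?thesis using that[OF fac] by blast
  next
    case False
    define e where "e = sqrt (b\<^sup>2 - 4 * c)"
    have e: "e\<^sup>2 = b\<^sup>2 - 4 * c" "e \<ge> 0" using False by (simp_all add: e_def)
    define \<rho>1 where "\<rho>1 = (- b - e) / 2"
    define \<rho>2 where "\<rho>2 = (- b + e) / 2"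
    have quad: "s\<^sup>2 + b * s + c = (s - \<rho>1) * (s - \<rho>2)" for s
      using e(1) by (simp add: \<rho>1_def \<rho>2_def field_simps power2_eq_square)
    have fac3: "D s = 4 * W * ((s - r) * ((s - \<rho>1) * (s - \<rho>2)))" for s unfolding fac quad ..
    have "\<rho>1 \<noteq> \<rho>2"
      using D_no_double_root[of \<rho>1 "4 * W" r] fac3 by (auto simp: power2_eq_square algebra_simps)
    then have "\<rho>1 < \<rho>2" using e(2) by (simp add: \<rho>1_def \<rho>2_def)
    have "r \<noteq> \<rho>1"
      using D_no_double_root[of \<rho>1 "4 * W" \<rho>2] fac3 by (auto simp: power2_eq_square algebra_simps)
    have "r \<noteq> \<rho>2"
      using D_no_double_root[of \<rho>2 "4 * W" \<rho>1] fac3 by (auto simp: power2_eq_square algebra_simps)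
    have fin: thesis if s: "s1 < s2" "s2 < s3" "\<And>s. D s = 4 * W * ((s - s3) * ((s - s1) * (s - s2)))" for s1 s2 s3
    proof (rule result[of s3 "- (s1 + s2)" "s1 * s2"])
      have q: "s\<^sup>2 + - (s1 + s2) * s + s1 * s2 = (s - s1) * (s - s2)" for s
        by (simp add: power2_eq_square algebra_simps)
      show "D s = 4 * W * ((s - s3) * (s\<^sup>2 + - (s1 + s2) * s + s1 * s2))" for s unfolding q by (rule s)
      show "s\<^sup>2 + - (s1 + s2) * s + s1 * s2 > 0" if "s \<ge> s3" for s unfolding q using that s by simp
      show "(\<forall>s. 0 < s\<^sup>2 + - (s1 + s2) * s + s1 * s2) \<or>
        (\<exists>s1' s2'. s1' < s2' \<and> s2' < s3 \<and> (\<forall>s. s\<^sup>2 + - (s1 + s2) * s + s1 * s2 = (s - s1') * (s - s2')))"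
        unfolding q using s by blast
    qed
    consider "r < \<rho>1" | "\<rho>1 < r" "r < \<rho>2" | "\<rho>2 < r" using \<open>r \<noteq> \<rho>1\<close> \<open>r \<noteq> \<rho>2\<close> by linarith
    then show ?thesis
    proof cases
      case 1
      show ?thesis by (rule fin[OF 1 \<open>\<rho>1 < \<rho>2\<close>]) (simp add: fac3 mult.left_commute mult.commute)
    next
      case 2
      show ?thesis by (rule fin[OF 2]) (simp add: fac3 mult.left_commute mult.commute)
    next
      case 3
      show ?thesis by (rule fin[OF \<open>\<rho>1 < \<rho>2\<close> 3]) (simp add: fac3)
    qed
  qed
qed

lemma T_D_nonneg: "X \<in> T \<Longrightarrow> D (sX X) \<ge> 0"
  using on_E_discriminant[OF T_on_E] zero_le_power2 by metis

end

section \<open>The unbounded branch of the reduced curve\<close>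

locale factored_cubic = cubic_data +
  fixes s3 b c :: real
  assumes D_factored: "\<And>s. D s = 4 * W * ((s - s3) * (s\<^sup>2 + b * s + c))"
    and h_pos: "\<And>s. s \<ge> s3 \<Longrightarrow> s\<^sup>2 + b * s + c > 0"
begin

definition "hq s = s\<^sup>2 + b * s + c"
text \<open>A signed square root of \<open>s - s3\<close> is the parameter. It removes the fold of
  the branch at \<open>s3\<close>, and what stays under the root in \<open>liney\<close> is
  positive.\<close>

definition "lineS t = s3 + t\<^sup>2"
definition "liney t = 2 * t * sqrt (W * hq (lineS t))"
definition "lineU t = (\<l> (lineS t) + liney t) / 2"
definition "lineV t = (\<l> (lineS t) - liney t) / 2"

lemma Wh_pos: "s \<ge> s3 \<Longrightarrow> W * hq s > 0"
  using h_pos W_pos by (simp add: hq_def)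

lemma line_on_E: "on_E (lineS t) (lineU t) (lineV t)"
  unfolding on_E_iff
proof (intro exI conjI)
  have "W * hq (lineS t) > 0" by (rule Wh_pos) (simp add: lineS_def)
  then show "(liney t)\<^sup>2 = D (lineS t)"
    unfolding D_factored hq_def[symmetric] by (simp add: liney_def power_mult_distrib lineS_def)
qed (simp_all add: lineU_def lineV_def)

lemma smooth_line: "smooth_on UNIV lineS" "smooth_on UNIV lineU" "smooth_on UNIV lineV"
proof -
  show S: "smooth_on UNIV lineS"
    unfolding lineS_def[abs_def] by (intro smooth_on_intros smooth_on_id open_UNIV)
  have "smooth_on UNIV (\<lambda>t. W * hq (lineS t))"
    unfolding hq_def by (intro smooth_on_add smooth_on_mult smooth_on_power smooth_on_const S open_UNIV)
  moreover have "W * hq (lineS t) > 0" for t by (rule Wh_pos) (simp add: lineS_def)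
  ultimately have "smooth_on UNIV (\<lambda>t. sqrt (W * hq (lineS t)))"
    by (rule smooth_on_sqrt)
  then have y: "smooth_on UNIV liney"
    unfolding liney_def[abs_def] by (intro smooth_on_mult smooth_on_id smooth_on_const open_UNIV)
  show "smooth_on UNIV lineU" "smooth_on UNIV lineV"
    unfolding lineU_def[abs_def] lineV_def[abs_def] \<l>_def
    by (intro smooth_on_divide smooth_on_diff smooth_on_add smooth_on_mult smooth_on_const S y open_UNIV; simp)+
qed

sublocale line: parametrized w1 w2 w3 q1 q2 q3 g \<kappa> x1 x2 x3 lineS lineU lineV
  by unfold_locales (simp_all add: smooth_line line_on_E)

lemma line_surj:
  assumes "on_E s u v" "s \<ge> s3"
  obtains t where "s = lineS t" "u = lineU t" "v = lineV t"
proof -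
  obtain y where y: "y\<^sup>2 = D s" "u = (\<l> s + y) / 2" "v = (\<l> s - y) / 2" using assms(1) on_E_iff by blast
  have pos: "W * hq s > 0" by (rule Wh_pos[OF assms(2)])
  define t where "t = y / (2 * sqrt (W * hq s))"
  have "t\<^sup>2 = D s / (4 * (W * hq s))"
    using pos by (simp add: t_def power_divide power_mult_distrib y(1))
  also have "D s = (4 * (W * hq s)) * (s - s3)" by (simp add: D_factored hq_def)
  also have "(4 * (W * hq s)) * (s - s3) / (4 * (W * hq s)) = s - s3"
    by (rule nonzero_mult_div_cancel_left) (use pos in linarith)
  finally have "t\<^sup>2 = s - s3" .
  then have S: "lineS t = s" by (simp add: lineS_def)
  moreover have "W \<noteq> 0" "hq s \<noteq> 0" using pos by auto
  then have "liney t = y" unfolding liney_def S by (simp add: t_def)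
  ultimately show ?thesis using that[of t] y by (simp add: lineU_def lineV_def)
qed

lemma line_TS: "line.TS = {X \<in> T. sX X \<ge> s3}"
proof (intro equalityI subsetI)
  fix X assume "X \<in> {X \<in> T. sX X \<ge> s3}"
  then show "X \<in> line.TS" unfolding line.TS_def using line_surj[OF T_on_E] by blast
qed (auto simp: line.TS_def lineS_def)

definition "\<tau> X = (uX X - vX X) / (2 * sqrt (W * hq (sX X)))"

lemma \<tau>_eq:
  assumes "sX X = lineS t" "uX X = lineU t" "vX X = lineV t"
  shows "\<tau> X = t"
proof -
  have "W * hq (lineS t) > 0" by (rule Wh_pos) (simp add: lineS_def)
  then have "W \<noteq> 0" "hq (lineS t) \<noteq> 0" by auto
  moreover have "lineU t - lineV t = liney t" by (simp add: lineU_def lineV_def field_simps)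
  ultimately show ?thesis unfolding \<tau>_def assms by (simp add: liney_def)
qed

lemma open_sX: "open {X. P (sX X)}" if "open {s. P s}"
proof -
  have "open (sX -` {s. P s})"
    by (rule open_vimage[OF that smooth_on_continuous[OF smooth_suv(1)[OF open_UNIV]]])
  then show ?thesis by (simp add: vimage_def)
qed

lemma line_pieces: "decomposition {X \<in> T. sX X \<ge> s3} line.pieces 4 diffeo_R3"
proof -
  define Y where "Y = {X. W * hq (sX X) > 0}"
  have "open {s. W * hq s > 0}"
    unfolding hq_def by (intro open_Collect_less continuous_intros)
  then have oY: "open Y" unfolding Y_def by (rule open_sX)
  have "smooth_on Y (\<lambda>X. W * hq (sX X))"
    unfolding hq_def by (intro smooth_on_add smooth_on_mult smooth_on_power smooth_on_const smooth_suv oY)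
  then have "smooth_on Y (\<lambda>X. sqrt (W * hq (sX X)))"
    by (rule smooth_on_sqrt) (simp add: Y_def)
  then have "smooth_on Y \<tau>" unfolding \<tau>_def[abs_def]
    by (intro smooth_on_divide smooth_on_diff smooth_on_mult smooth_on_const smooth_suv oY)
      (auto simp: Y_def)
  moreover have "line.TS \<subseteq> Y" unfolding line_TS Y_def using Wh_pos by auto
  ultimately show ?thesis unfolding line_TS[symmetric]
    by (rule line.line_decomposition) (rule \<tau>_eq)
qed

end

section \<open>The compact branch of the reduced curve\<close>

locale split_cubic = factored_cubic +
  fixes s1 s2 :: real
  assumes s12: "s1 < s2" and s23: "s2 < s3" and h_split: "\<And>s. s\<^sup>2 + b * s + c = (s - s1) * (s - s2)"
begin

definition "mid = (s1 + s2) / 2"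
definition "rad = (s2 - s1) / 2"
text \<open>\<open>(s - s1) * (s2 - s)\<close> becomes the square of \<open>rad * sin t\<close>, so
  the folds at \<open>s1\<close> and \<open>s2\<close> disappear and the remaining radicand is
  positive.\<close>

definition "circS t = mid + rad * cos t"
definition "circy t = 2 * rad * sin t * sqrt (W * (s3 - circS t))"
definition "circU t = (\<l> (circS t) + circy t) / 2"
definition "circV t = (\<l> (circS t) - circy t) / 2"

lemma rad_pos: "rad > 0" using s12 by (simp add: rad_def)

lemma D_split: "D s = 4 * W * (s3 - s) * ((s - s1) * (s2 - s))"
  unfolding D_factored h_split by (simp add: algebra_simps)

lemma circS_le: "circS t \<le> s2" "s1 \<le> circS t"
proof -
  have "rad * cos t \<le> rad * 1" "rad * (-1) \<le> rad * cos t" using rad_pos by (intro mult_left_mono; simp)+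
  then show "circS t \<le> s2" "s1 \<le> circS t" unfolding circS_def mid_def rad_def by argo+
qed

lemma circ_pos: "s \<le> s2 \<Longrightarrow> W * (s3 - s) > 0"
  using W_pos s23 by simp

lemma circ_on_E: "on_E (circS t) (circU t) (circV t)"
  unfolding on_E_iff
proof (intro exI conjI)
  have "W * (s3 - circS t) > 0" by (rule circ_pos[OF circS_le(1)])
  then have "(circy t)\<^sup>2 = 4 * W * (s3 - circS t) * (rad\<^sup>2 * (sin t)\<^sup>2)"
    by (simp add: circy_def power_mult_distrib)
  also have "rad\<^sup>2 * (sin t)\<^sup>2 = (circS t - s1) * (s2 - circS t)"
  proof -
    have e: "circS t - s1 = rad * (1 + cos t)" "s2 - circS t = rad * (1 - cos t)"
      by (simp_all add: circS_def mid_def rad_def field_simps)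
    show ?thesis unfolding e sin_squared_eq by (simp add: algebra_simps power2_eq_square)
  qed
  finally show "(circy t)\<^sup>2 = D (circS t)" by (simp add: D_split)
qed (simp_all add: circU_def circV_def)

lemma smooth_circ: "smooth_on UNIV circS" "smooth_on UNIV circy" "smooth_on UNIV circU" "smooth_on UNIV circV"
proof -
  show S: "smooth_on UNIV circS"
    unfolding circS_def[abs_def] by (intro smooth_on_intros smooth_on_id open_UNIV)
  have "W * (s3 - circS t) > 0" for t by (rule circ_pos[OF circS_le(1)])
  then show y: "smooth_on UNIV circy"
    unfolding circy_def[abs_def]
    by (intro smooth_on_mult smooth_on_sqrt smooth_on_diff smooth_on_sin smooth_on_id smooth_on_const S open_UNIV)
  show "smooth_on UNIV circU" "smooth_on UNIV circV"
    unfolding circU_def[abs_def] circV_def[abs_def] \<l>_def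
    by (intro smooth_on_divide smooth_on_diff smooth_on_add smooth_on_mult smooth_on_const S y open_UNIV; simp)+
qed

sublocale circle: parametrized w1 w2 w3 q1 q2 q3 g \<kappa> x1 x2 x3 circS circU circV
  by unfold_locales (simp_all add: smooth_circ circ_on_E)

lemma circ_surj:
  assumes "on_E s u v" "s \<le> s2"
  obtains t where "t \<in> {0..2*pi}" "s = circS t" "u = circU t" "v = circV t"
proof -
  obtain y where y: "y\<^sup>2 = D s" "u = (\<l> s + y) / 2" "v = (\<l> s - y) / 2" using assms(1) on_E_iff by blast
  have pos: "W * (s3 - s) > 0" by (rule circ_pos[OF assms(2)])
  define r where "r = sqrt (W * (s3 - s))"
  have r: "r > 0" "r\<^sup>2 = W * (s3 - s)" using pos by (simp_all add: r_def)
  have "((s - mid) / rad)\<^sup>2 + (y / (2 * rad * r))\<^sup>2 = 1"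
  proof -
    have "y\<^sup>2 = 4 * r\<^sup>2 * ((s - s1) * (s2 - s))" by (simp add: y(1) D_split r(2))
    then have "(y / (2 * rad * r))\<^sup>2 = (s - s1) * (s2 - s) / rad\<^sup>2"
      using rad_pos r(1) by (simp add: power_divide power_mult_distrib)
    moreover have "(s - mid)\<^sup>2 + (s - s1) * (s2 - s) = rad\<^sup>2"
      by (simp add: mid_def rad_def power2_eq_square field_simps)
    ultimately show ?thesis using rad_pos by (simp add: power_divide flip: add_divide_distrib)
  qed
  then obtain t where t: "(s - mid) / rad = cos t" "y / (2 * rad * r) = sin t" "t \<in> {0..2*pi}"
    by (rule sincos_total_2pi) auto
  have S: "circS t = s" using t(1)[symmetric] rad_pos by (simp add: circS_def)
  moreover have "circy t = y" unfolding circy_def S r_def[symmetric] using t(2)[symmetric] rad_pos r(1) by simp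
  ultimately show ?thesis using that[of t] y t(3) by (simp add: circU_def circV_def)
qed

lemma circle_TS: "circle.TS = {X \<in> T. sX X \<le> s2}"
proof (intro equalityI subsetI)
  fix X assume "X \<in> {X \<in> T. sX X \<le> s2}"
  then show "X \<in> circle.TS" unfolding circle.TS_def using circ_surj[OF T_on_E, of X] by blast
qed (auto simp: circle.TS_def circS_le)

lemma circ_diff: "circU t - circV t = circy t" by (simp add: circU_def circV_def field_simps)

lemma circ_cis:
  assumes "s = circS t" "u = circU t" "v = circV t"
  shows "Complex ((s - mid) / rad) ((u - v) / (2 * rad * sqrt (W * (s3 - s)))) = cis t"
proof -
  have "W * (s3 - circS t) > 0" by (rule circ_pos[OF circS_le(1)])
  then have "2 * rad * sqrt (W * (s3 - circS t)) > 0"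
    using rad_pos W_pos s23 circS_le(1)[of t] by (intro mult_pos_pos real_sqrt_gt_zero) auto
  moreover have "circy t = (2 * rad * sqrt (W * (s3 - circS t))) * sin t"
    by (simp add: circy_def)
  ultimately have "circy t / (2 * rad * sqrt (W * (s3 - circS t))) = sin t"
    by (metis less_irrefl nonzero_mult_div_cancel_left)
  moreover have "(circS t - mid) / rad = cos t" using rad_pos by (simp add: circS_def)
  ultimately show ?thesis unfolding assms circ_diff by (simp add: complex_eq_iff)
qed

lemma circ_periodic: "circS (t + 2 * pi) = circS t" "circU (t + 2 * pi) = circU t" "circV (t + 2 * pi) = circV t"
  by (simp_all add: circS_def circU_def circV_def circy_def)

lemma circ_monodromy:
  obtains \<chi>12 \<chi>13 :: real where "\<chi>12 \<in> {1, -1}" "\<chi>13 \<in> {1, -1}"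
    "\<And>t. circle.M12 (t + 2 * pi) = of_real \<chi>12 * circle.M12 t"
    "\<And>t. circle.M13 (t + 2 * pi) = of_real \<chi>13 * circle.M13 t"
    "\<chi>12 = 1 \<longleftrightarrow> (\<forall>t. Re (circle.M12 t) \<noteq> 0)" "\<chi>13 = 1 \<longleftrightarrow> (\<forall>t. Re (circle.M13 t) \<noteq> 0)"
proof -
  define r where "r t = sqrt (W * (s3 - circS t))" for t
  have r: "r t > 0" for t using circ_pos[OF circS_le(1)] by (simp add: r_def)
  have inj: "cis t = cis t'" if "circS t = circS t'" "circU t = circU t'" "circV t = circV t'" for t t'
    using circ_cis[OF that] circ_cis[OF refl refl refl, of t] by simp
  have dS: "(circS has_real_derivative - rad * sin t) (at t)" for t
    unfolding circS_def[abs_def] by (rule derivative_eq_intros refl | simp)+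
  \<comment> \<open>The slope of \<open>circy\<close> matters only where \<open>sin t = 0\<close>:
    there \<open>circS\<close> is stationary, and the term with the derivative of the root drops
    out.\<close>
  have "\<exists>d. (circy has_real_derivative d) (at t) \<and> (sin t = 0 \<longrightarrow> d = 2 * rad * cos t * r t)" for t
  proof -
    obtain r' where r': "(r has_real_derivative r') (at t)"
    proof (rule circle.smooth_real_derivative[of r])
      show "smooth_on UNIV r" unfolding r_def[abs_def]
        by (intro smooth_on_sqrt smooth_on_mult smooth_on_diff smooth_on_const smooth_circ open_UNIV
            circ_pos[OF circS_le(1)])
    qed
    have "((\<lambda>t. 2 * rad * sin t * r t) has_real_derivative 2 * rad * cos t * r t + 2 * rad * sin t * r') (at t)"
      by (rule derivative_eq_intros r' refl | simp)+
    then show ?thesis unfolding circy_def[abs_def] r_def[symmetric] by (intro exI conjI) auto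
  qed
  then obtain y' where y': "\<And>t. (circy has_real_derivative y' t) (at t)"
    "\<And>t. sin t = 0 \<Longrightarrow> y' t = 2 * rad * cos t * r t" by metis
  have dU: "(circU has_real_derivative (\<kappa> * (- rad * sin t) + y' t) / 2) (at t)" for t
    unfolding circU_def[abs_def] \<l>_def by (rule derivative_eq_intros dS y' refl | simp)+
  have dV: "(circV has_real_derivative (\<kappa> * (- rad * sin t) - y' t) / 2) (at t)" for t
    unfolding circV_def[abs_def] \<l>_def by (rule derivative_eq_intros dS y' refl | simp)+
  have regular: "(\<kappa> * (- rad * sin t) + y' t) / 2 \<noteq> 0 \<and> (\<kappa> * (- rad * sin t) - y' t) / 2 \<noteq> 0"
    if "- rad * sin t = 0" for t
  proof -
    have s: "sin t = 0" using that rad_pos by simp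
    then have "cos t \<noteq> 0" using sin_cos_squared_add[of t] by auto
    then show ?thesis using s y'(2)[OF s] rad_pos r[of t] by simp
  qed
  show ?thesis
    by (rule circle.monodromy_exists[OF circ_periodic inj dS dU dV regular]) (assumption | rule that)+
qed

lemma circle_pieces:
  "decomposition {X \<in> T. sX X \<le> s2} circle.pieces
    (if (\<forall>t. Re (circle.M12 t) \<noteq> 0) \<and> (\<forall>t. Re (circle.M13 t) \<noteq> 0) then 4 else 2) diffeo_S1_R2"
proof -
  obtain \<chi>12 \<chi>13 :: real where \<chi>: "\<chi>12 \<in> {1, -1}" "\<chi>13 \<in> {1, -1}"
    "\<And>t. circle.M12 (t + 2 * pi) = of_real \<chi>12 * circle.M12 t"
    "\<And>t. circle.M13 (t + 2 * pi) = of_real \<chi>13 * circle.M13 t"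
    "\<chi>12 = 1 \<longleftrightarrow> (\<forall>t. Re (circle.M12 t) \<noteq> 0)" "\<chi>13 = 1 \<longleftrightarrow> (\<forall>t. Re (circle.M13 t) \<noteq> 0)"
    by (rule circ_monodromy) (rule that; assumption)
  define Y where "Y = {X. W * (s3 - sX X) > 0}"
  have "open {s. W * (s3 - s) > 0}" by (intro open_Collect_less continuous_intros)
  then have oY: "open Y" unfolding Y_def by (rule open_sX)
  define k where "k X = Complex ((sX X - mid) / rad) ((uX X - vX X) / (2 * rad * sqrt (W * (s3 - sX X))))" for X
  have "smooth_on Y k" unfolding k_def[abs_def]
    by (intro smooth_on_complex smooth_on_divide smooth_on_diff smooth_on_mult smooth_on_sqrt smooth_on_const smooth_suv oY)
      (use rad_pos in \<open>auto simp: Y_def\<close>)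
  moreover have "circle.TS \<subseteq> Y" unfolding circle_TS Y_def using circ_pos by auto
  moreover have "k X = cis t" if "X \<in> T" "sX X = circS t" "uX X = circU t" "vX X = circV t" for X t
    unfolding k_def by (rule circ_cis[OF that(2-4)])
  ultimately have *: "decomposition circle.TS circle.pieces (4 div (if \<chi>12 = 1 \<and> \<chi>13 = 1 then 1 else 2)) diffeo_S1_R2"
    by (rule circle.circle_decomposition[OF _ _ _ circ_periodic \<chi>(1-4) refl])
  show ?thesis
  proof (cases "\<chi>12 = 1 \<and> \<chi>13 = 1")
    case True
    show ?thesis using * unfolding circle_TS \<chi>(5,6)[symmetric] if_P[OF True] by simp
  next
    case False
    show ?thesis using * unfolding circle_TS \<chi>(5,6)[symmetric] if_not_P[OF False] by simp
  qed
qed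

end

section \<open>Ovals of the spectral curve\<close>

locale spectral_cubic = cubic_data +
  fixes a1 a2 a3 \<sigma> :: real
  assumes \<sigma>: "\<sigma> \<in> {1, -1}"
    and w_def: "w1 = \<sigma> * (a2 - a3)" "w2 = \<sigma> * (a3 - a1)" "w3 = \<sigma> * (a1 - a2)"
    and \<kappa>_def: "\<kappa> = w1 * x1 + w2 * x2 + w3 * x3"
begin

definition "L1 (z :: real^3) = x1 * z $ 3 + a1 * z $ 1 - z $ 2"
definition "L2 (z :: real^3) = x2 * z $ 3 + a2 * z $ 1 - z $ 2"
definition "L3 (z :: real^3) = x3 * z $ 3 + a3 * z $ 1 - z $ 2"
definition "F z = L1 z * L2 z * L3 z - (z $ 3)\<^sup>2 * (q1 * L1 z + q2 * L2 z + q3 * L3 z) + (z $ 3)^3 * g"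
definition "CR = {hpoint (cvec z) | z. z \<noteq> 0 \<and> F z = 0}"

text \<open>\<open>L2\<close>, \<open>L3\<close> and the third coordinate are linear coordinates
  because \<open>a2 \<noteq> a3\<close>; this is the inverse change of coordinates.\<close>

definition zpt :: "real \<Rightarrow> real \<Rightarrow> real \<Rightarrow> real^3" where
  "zpt l2 l3 m = (let z1 = (l2 - l3 - (x2 - x3) * m) / (a2 - a3) in vector [z1, x2 * m + a2 * z1 - l2, m])"

lemma a_distinct: "a1 \<noteq> a2" "a1 \<noteq> a3" "a2 \<noteq> a3"
  using w_nonzero w_def by auto

lemma L_relation: "w1 * L1 z + w2 * L2 z + w3 * L3 z = \<kappa> * z $ 3"
  by (simp add: L1_def L2_def L3_def \<kappa>_def w_def algebra_simps)

lemma zpt_coords: "L2 (zpt l2 l3 m) = l2" "L3 (zpt l2 l3 m) = l3" "zpt l2 l3 m $ 3 = m"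
proof -
  show "L2 (zpt l2 l3 m) = l2" "zpt l2 l3 m $ 3 = m" by (simp_all add: zpt_def Let_def L2_def)
  define z1 where "z1 = (l2 - l3 - (x2 - x3) * m) / (a2 - a3)"
  have "(a2 - a3) * z1 = l2 - l3 - (x2 - x3) * m" using a_distinct by (simp add: z1_def)
  moreover have "zpt l2 l3 m = vector [z1, x2 * m + a2 * z1 - l2, m]"
    by (simp add: zpt_def Let_def z1_def)
  ultimately show "L3 (zpt l2 l3 m) = l3"
    by (simp add: L3_def algebra_simps)
qed

lemma z_eqI:
  assumes "L2 z = L2 z'" "L3 z = L3 z'" "z $ 3 = z' $ 3" shows "z = z'"
proof -
  have "(a2 - a3) * z $ 1 = (a2 - a3) * z' $ 1" using assms by (simp add: L2_def L3_def algebra_simps)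
  then have "z $ 1 = z' $ 1" using a_distinct by simp
  moreover have "z $ 2 = z' $ 2" using assms \<open>z $ 1 = z' $ 1\<close> by (simp add: L2_def)
  ultimately show ?thesis using assms by (simp add: vec_eq_iff forall_3)
qed

lemma L_scale: "L1 (k *\<^sub>R z) = k * L1 z" "L2 (k *\<^sub>R z) = k * L2 z" "L3 (k *\<^sub>R z) = k * L3 z"
  by (simp_all add: L1_def L2_def L3_def algebra_simps)

lemma L_zero: "L2 0 = 0" "L3 0 = 0"
  by (simp_all add: L2_def L3_def)

lemma F_scale: "F (k *\<^sub>R z) = k^3 * F z"
  unfolding F_def L_scale by (simp add: algebra_simps power2_eq_square power3_eq_cube)

lemma continuous_zpt:
  assumes "continuous_on A f" "continuous_on A h" "continuous_on A k"
  shows "continuous_on A (\<lambda>t. zpt (f t) (h t) (k t))"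
proof -
  have "continuous_on A (\<lambda>t. zpt (f t) (h t) (k t) $ i)" for i
    unfolding zpt_def Let_def using exhaust_3[of i] a_distinct
    by (elim disjE; simp; intro continuous_intros assms; simp)
  then have "continuous_on A (\<lambda>t. \<chi> i. zpt (f t) (h t) (k t) $ i)"
    by (rule continuous_on_vec_lambda)
  then show ?thesis by simp
qed

text \<open>The only real point of the spectral curve that lies over no point of the reduced curve:
  \<open>s\<close> has its pole there.\<close>

definition inf1 :: "real^3" where "inf1 = vector [1, a1, 0]"

lemma inf1: "L1 inf1 = 0" "L2 inf1 = a2 - a1" "L3 inf1 = a3 - a1" "inf1 $ 3 = 0" "inf1 \<noteq> 0"
  by (simp_all add: inf1_def L1_def L2_def L3_def vec_eq_iff forall_3)

lemma inf1_CR: "hpoint (cvec inf1) \<in> CR"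
  using inf1 by (auto simp: CR_def F_def intro!: exI[of _ inf1])

lemma CR_cases_infinity:
  assumes z: "z \<noteq> 0" "F z = 0" "z $ 3 = 0"
  shows "(\<exists>k. z = k *\<^sub>R inf1) \<or> (L2 z = 0 \<and> L3 z \<noteq> 0) \<or> (L3 z = 0 \<and> L2 z \<noteq> 0)"
proof -
  have L23: "L2 z \<noteq> 0 \<or> L3 z \<noteq> 0"
    using z z_eqI[of z 0] L_zero by auto
  have "L1 z * L2 z * L3 z = 0" using z by (simp add: F_def)
  then consider "L1 z = 0" | "L2 z = 0" | "L3 z = 0" by auto
  then show ?thesis
  proof cases
    case 1
    then have "z = (z $ 1) *\<^sub>R inf1"
      using z(3) by (simp add: inf1_def L1_def vec_eq_iff forall_3 mult.commute)
    then show ?thesis by blast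
  qed (use L23 in auto)
qed

text \<open>\<open>low m z\<close> separates the ovals: at the point over \<open>(s, u, v)\<close> it means \<open>s < m\<close>.\<close>

definition low :: "real \<Rightarrow> real^3 \<Rightarrow> bool" where
  "low m z \<longleftrightarrow> (z $ 3 \<noteq> 0 \<and> (L2 z * L3 z - q1 * (z $ 3)\<^sup>2) / w1 < m * (z $ 3)\<^sup>2) \<or>
    (L1 z \<noteq> 0 \<and> (q2 * L2 z + q3 * L3 z - g * z $ 3) / w1 * L1 z < m * (L1 z)\<^sup>2)"

lemma low_scale: "k \<noteq> 0 \<Longrightarrow> low m (k *\<^sub>R z) = low m z"
proof -
  assume "k \<noteq> 0"
  then have k: "k\<^sup>2 > 0" by simp
  have "(L2 (k *\<^sub>R z) * L3 (k *\<^sub>R z) - q1 * ((k *\<^sub>R z) $ 3)\<^sup>2) / w1 = k\<^sup>2 * ((L2 z * L3 z - q1 * (z $ 3)\<^sup>2) / w1)"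
    "m * ((k *\<^sub>R z) $ 3)\<^sup>2 = k\<^sup>2 * (m * (z $ 3)\<^sup>2)"
    "(q2 * L2 (k *\<^sub>R z) + q3 * L3 (k *\<^sub>R z) - g * (k *\<^sub>R z) $ 3) / w1 * L1 (k *\<^sub>R z) =
      k\<^sup>2 * ((q2 * L2 z + q3 * L3 z - g * z $ 3) / w1 * L1 z)"
    "m * (L1 (k *\<^sub>R z))\<^sup>2 = k\<^sup>2 * (m * (L1 z)\<^sup>2)"
    by (simp_all add: L_scale power2_eq_square algebra_simps diff_divide_distrib add_divide_distrib)
  note e = this
  show ?thesis unfolding low_def e mult_less_cancel_left_pos[OF k] using \<open>k \<noteq> 0\<close> by (simp add: L_scale)
qed

lemma continuous_L: "continuous_on A L1" "continuous_on A L2" "continuous_on A L3"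
  unfolding L1_def[abs_def] L2_def[abs_def] L3_def[abs_def] by (intro continuous_intros)+

lemma open_low: "open {z. low m z}"
  unfolding low_def
  by (intro open_Collect_disj open_Collect_conj open_Collect_neq open_Collect_less continuous_intros
      continuous_L continuous_on_component) (simp_all add: w_nonzero)

lemma not_low_inf1: "\<not> low m inf1"
  by (simp add: low_def inf1)

end

section \<open>The spectral curve over a parametrized branch\<close>

locale param_spectral = parametrized + spectral_cubic
begin

text \<open>Away from infinity the point is given by \<open>L3 / z\<^sub>3 = Im M12 / Re M12\<close>
  and \<open>L2 / z\<^sub>3 = Im M13 / Re M13\<close>. Cleared of denominators, this also makes
  sense where one of the real parts vanishes; the signs of the roots cancel projectively.\<close>

definition "\<gamma> t = zpt (Im (M13 t) * Re (M12 t)) (Im (M12 t) * Re (M13 t)) (Re (M12 t) * Re (M13 t))"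

lemma \<gamma>_coords: "L2 (\<gamma> t) = Im (M13 t) * Re (M12 t)" "L3 (\<gamma> t) = Im (M12 t) * Re (M13 t)"
  "\<gamma> t $ 3 = Re (M12 t) * Re (M13 t)"
  by (simp_all add: \<gamma>_def zpt_coords)

lemma not_both_zero: "\<not> (Re (M12 t) = 0 \<and> Re (M13 t) = 0)"
  using on_E_nonsingular[OF on_E[of t]] Re_M12_eq_0_iff[of t] Re_M13_eq_0_iff[of t] by auto

lemma Im_nonzero: "Re (M12 t) = 0 \<Longrightarrow> Im (M12 t) \<noteq> 0" "Re (M13 t) = 0 \<Longrightarrow> Im (M13 t) \<noteq> 0"
  using M_nonzero[of t] by (auto simp: complex_eq_iff)

lemma \<gamma>_infinity:
  "\<gamma> t $ 3 = 0 \<Longrightarrow> (Re (M12 t) = 0 \<and> L2 (\<gamma> t) = 0 \<and> L3 (\<gamma> t) \<noteq> 0) \<or> (Re (M13 t) = 0 \<and> L3 (\<gamma> t) = 0 \<and> L2 (\<gamma> t) \<noteq> 0)"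
  using not_both_zero[of t] Im_nonzero[of t] by (auto simp: \<gamma>_coords)

lemma \<gamma>_nonzero: "\<gamma> t \<noteq> 0"
  using \<gamma>_infinity[of t] L_zero by (cases "\<gamma> t $ 3 = 0") auto

lemma \<gamma>_L23: "L2 (\<gamma> t) * L3 (\<gamma> t) = P1 (S t) * (\<gamma> t $ 3)\<^sup>2"
  using M_relation[of t] unfolding \<gamma>_coords by algebra

text \<open>The parallelism relations give \<open>P2 * L2 + P3 * L3 = \<l> * z\<^sub>3\<close>, and
  \<open>L_relation\<close> trades the terms with \<open>w2\<close> and \<open>w3\<close> for one
  with \<open>L1\<close>.\<close>

lemma \<gamma>_linear: "q2 * L2 (\<gamma> t) + q3 * L3 (\<gamma> t) - g * \<gamma> t $ 3 = w1 * S t * L1 (\<gamma> t)"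
proof -
  have "P2 (S t) * L2 (\<gamma> t) = U t * \<gamma> t $ 3" "P3 (S t) * L3 (\<gamma> t) = V t * \<gamma> t $ 3"
    using M_parallel(1,3)[of t] unfolding \<gamma>_coords by algebra+
  then have "P2 (S t) * L2 (\<gamma> t) + P3 (S t) * L3 (\<gamma> t) = \<l> (S t) * \<gamma> t $ 3"
    using on_E[of t] by (simp add: on_E_def flip: distrib_right)
  then show ?thesis using L_relation[of "\<gamma> t"] unfolding P2_def P3_def \<l>_def by algebra
qed

lemma F_\<gamma>: "F (\<gamma> t) = 0"
proof -
  have "F (\<gamma> t) = L1 (\<gamma> t) * (L2 (\<gamma> t) * L3 (\<gamma> t)) - (\<gamma> t $ 3)\<^sup>2 * (q1 * L1 (\<gamma> t) + (q2 * L2 (\<gamma> t) + q3 * L3 (\<gamma> t) - g * \<gamma> t $ 3))"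
    by (simp add: F_def algebra_simps power2_eq_square power3_eq_cube)
  also have "\<dots> = 0" unfolding \<gamma>_L23 \<gamma>_linear by (simp add: P1_def algebra_simps)
  finally show ?thesis .
qed

text \<open>The two quotients in \<open>low\<close> are two expressions for \<open>s\<close>, one
  from \<open>\<gamma>_L23\<close> and one from \<open>\<gamma>_linear\<close>. Along
  \<open>\<gamma>\<close> the third coordinate and \<open>L1\<close> do not vanish together, so at
  least one expression applies.\<close>

lemma low_\<gamma>: "low m (\<gamma> t) \<longleftrightarrow> S t < m"
proof -
  have "(L2 (\<gamma> t) * L3 (\<gamma> t) - q1 * (\<gamma> t $ 3)\<^sup>2) / w1 = S t * (\<gamma> t $ 3)\<^sup>2"
    unfolding \<gamma>_L23 using w_nonzero by (simp add: P1_def field_simps)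
  moreover have "(q2 * L2 (\<gamma> t) + q3 * L3 (\<gamma> t) - g * \<gamma> t $ 3) / w1 * L1 (\<gamma> t) = S t * (L1 (\<gamma> t))\<^sup>2"
    unfolding \<gamma>_linear using w_nonzero by (simp add: power2_eq_square)
  moreover have "\<gamma> t $ 3 \<noteq> 0 \<or> L1 (\<gamma> t) \<noteq> 0"
    using \<gamma>_infinity[of t] L_relation[of "\<gamma> t"] w_nonzero by auto
  ultimately show ?thesis unfolding low_def by (auto simp: mult_less_cancel_right)
qed

definition "p t = hpoint (cvec (\<gamma> t))"

lemma continuous_p: "continuous_on UNIV p"
proof -
  have "continuous_on UNIV \<gamma>"
    unfolding \<gamma>_def[abs_def] by (intro continuous_zpt continuous_intros M12(1) M13(1))
  then have "continuous_on UNIV (\<lambda>t. cvec (\<gamma> t))"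
    by (rule continuous_on_compose2[OF continuous_on_cvec[of UNIV]]) auto
  then show ?thesis unfolding p_def[abs_def]
    by (rule continuous_on_compose2[OF continuous_on_hpoint]) (use \<gamma>_nonzero in auto)
qed

lemma p_CR: "p t \<in> CR"
  using F_\<gamma> \<gamma>_nonzero by (auto simp: p_def CR_def)

lemma p_unique:
  assumes "S t = S t'" "U t = U t'" "V t = V t'" shows "p t = p t'"
proof -
  have "(M12 t)\<^sup>2 = (M12 t')\<^sup>2" "(M13 t)\<^sup>2 = (M13 t')\<^sup>2" using M12(2) M13(2) assms by metis+
  then have "M12 t' = M12 t \<or> M12 t' = - M12 t" "M13 t' = M13 t \<or> M13 t' = - M13 t"
    by (metis power2_eq_iff)+
  moreover have "\<exists>e::real. z' = of_real e * z" if "z' = z \<or> z' = - z" for z z' :: complex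
    using that exI[of "\<lambda>e::real. z' = of_real e * z" 1] exI[of "\<lambda>e::real. z' = of_real e * z" "-1"] by auto
  ultimately obtain e e' :: real where e: "M12 t' = of_real e * M12 t" "M13 t' = of_real e' * M13 t"
    by meson
  have "\<gamma> t' = (e * e') *\<^sub>R \<gamma> t"
    by (rule z_eqI) (simp_all add: \<gamma>_coords L_scale e)
  then show ?thesis unfolding p_def using hpoint_cvec_eq_iff[OF \<gamma>_nonzero \<gamma>_nonzero] by blast
qed

lemma p_eqI:
  assumes "z \<noteq> 0" "\<gamma> t = k *\<^sub>R z" shows "hpoint (cvec z) = p t"
  unfolding p_def using hpoint_cvec_eq_iff[OF assms(1) \<gamma>_nonzero[of t]] assms(2) by blast

text \<open>The slopes \<open>l\<close> and \<open>l'\<close> of a finite point must be those of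
  \<open>M12\<close> and \<open>M13\<close>. Each root satisfies two parallelism relations, and the
  second one decides where the first degenerates.\<close>

lemma finite_point:
  assumes z: "z $ 3 \<noteq> 0" "F z = 0"
  defines "l \<equiv> L3 z / z $ 3" and "l' \<equiv> L2 z / z $ 3"
  assumes t: "P1 (S t) = l * l'" "U t = l' * P2 (S t)" "V t = l * P3 (S t)"
  shows "hpoint (cvec z) = p t"
proof -
  have i: "Im (M12 t) = l * Re (M12 t)"
  proof (cases "P3 (S t) = 0")
    case False
    then show ?thesis using M_parallel(1)[of t] t(3) by (simp add: mult.commute)
  next
    case True
    then have "U t \<noteq> 0 \<or> P1 (S t) * P2 (S t) \<noteq> 0"
      using on_E_nonsingular[OF on_E[of t]] t by auto
    then have "l' * P2 (S t) \<noteq> 0" using t by auto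
    moreover have "Re (M12 t) * (l * (l' * P2 (S t))) = Im (M12 t) * (l' * P2 (S t))"
      using M_parallel(2)[of t] t(1,2) by simp
    then have "(Im (M12 t) - l * Re (M12 t)) * (l' * P2 (S t)) = 0" by algebra
    ultimately show ?thesis by simp
  qed
  have i': "Im (M13 t) = l' * Re (M13 t)"
  proof (cases "P2 (S t) = 0")
    case False
    then show ?thesis using M_parallel(3)[of t] t(2) by (simp add: mult.commute)
  next
    case True
    then have "V t \<noteq> 0 \<or> P1 (S t) * P3 (S t) \<noteq> 0"
      using on_E_nonsingular[OF on_E[of t]] t by auto
    then have "l * P3 (S t) \<noteq> 0" using t by auto
    moreover have "Re (M13 t) * (l * l' * P3 (S t)) = Im (M13 t) * (l * P3 (S t))"
      using M_parallel(4)[of t] t(1,3) by simp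
    then have "(Im (M13 t) - l' * Re (M13 t)) * (l * P3 (S t)) = 0" by algebra
    ultimately show ?thesis by simp
  qed
  have "\<gamma> t = (Re (M12 t) * Re (M13 t) / z $ 3) *\<^sub>R z"
    by (rule z_eqI) (use z(1) in \<open>simp_all add: L_scale \<gamma>_coords i i' l_def l'_def\<close>)
  moreover have "z \<noteq> 0" using z by auto
  ultimately show ?thesis using p_eqI by blast
qed

text \<open>The points \<open>\<infinity>\<^sub>2\<close> and \<open>\<infinity>\<^sub>3\<close>
  come from the zeros of \<open>Re M12\<close> and of \<open>Re M13\<close> respectively.\<close>

lemma infinite_point:
  assumes z: "z $ 3 = 0" "z \<noteq> 0"
  shows "L2 z = 0 \<Longrightarrow> P3 (S t) = 0 \<Longrightarrow> U t = 0 \<Longrightarrow> hpoint (cvec z) = p t"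
    "L3 z = 0 \<Longrightarrow> P2 (S t) = 0 \<Longrightarrow> V t = 0 \<Longrightarrow> hpoint (cvec z) = p t"
proof -
  assume 0: "L2 z = 0" "P3 (S t) = 0" "U t = 0"
  then have "Re (M12 t) = 0" using Re_M12_eq_0_iff by simp
  moreover have "L3 z \<noteq> 0" using z z_eqI[of z 0] L_zero 0 by auto
  ultimately have "\<gamma> t = (L3 (\<gamma> t) / L3 z) *\<^sub>R z"
    by (intro z_eqI) (use z 0 in \<open>simp_all add: L_scale \<gamma>_coords\<close>)
  then show "hpoint (cvec z) = p t" using z(2) p_eqI by blast
next
  assume 0: "L3 z = 0" "P2 (S t) = 0" "V t = 0"
  then have "Re (M13 t) = 0" using Re_M13_eq_0_iff by simp
  moreover have "L2 z \<noteq> 0" using z z_eqI[of z 0] L_zero 0 by auto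
  ultimately have "\<gamma> t = (L2 (\<gamma> t) / L2 z) *\<^sub>R z"
    by (intro z_eqI) (use z 0 in \<open>simp_all add: L_scale \<gamma>_coords\<close>)
  then show "hpoint (cvec z) = p t" using z(2) p_eqI by blast
qed

lemma p_at_infinity: "p t \<in> line_at_infinity \<longleftrightarrow> Re (M12 t) = 0 \<or> Re (M13 t) = 0"
proof
  assume "p t \<in> line_at_infinity"
  then obtain z where z: "z \<noteq> 0" "z $ 3 = 0" "hpoint z = hpoint (cvec (\<gamma> t))"
    by (auto simp: p_def line_at_infinity_def)
  then obtain c where "cvec (\<gamma> t) = c *s z" using hpoint_eq_iff[of z "cvec (\<gamma> t)"] \<gamma>_nonzero by auto
  then have "cvec (\<gamma> t) $ 3 = 0" using z by simp
  then show "Re (M12 t) = 0 \<or> Re (M13 t) = 0" by (simp add: \<gamma>_coords)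
next
  assume "Re (M12 t) = 0 \<or> Re (M13 t) = 0"
  then have "cvec (\<gamma> t) $ 3 = 0" by (auto simp: \<gamma>_coords)
  then show "p t \<in> line_at_infinity"
    unfolding p_def line_at_infinity_def using \<gamma>_nonzero by (auto intro!: exI[of _ "cvec (\<gamma> t)"])
qed

end

lemma tendsto_eventually_eq:
  assumes "(f \<longlongrightarrow> a') F" "eventually P F" "\<And>x. P x \<Longrightarrow> f x = g x" "a' = a"
  shows "(g \<longlongrightarrow> a) F"
  using Lim_transform_eventually[OF assms(1) eventually_mono[OF assms(2,3)]] assms(4) by blast

context spectral_cubic
begin

text \<open>At a finite point \<open>s\<close> is defined by \<open>P1 s = l * l'\<close>. The
  equation of the cubic, divided by the square of the third coordinate and combined with
  \<open>L_relation\<close>, then says that \<open>u = l' * P2 s\<close> and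
  \<open>v = l * P3 s\<close> add up to \<open>\<l> s\<close>.\<close>

lemma CR_point_cases:
  assumes z: "z \<noteq> 0" "F z = 0"
  shows "(\<exists>k. z = k *\<^sub>R inf1) \<or>
    (z $ 3 \<noteq> 0 \<and> (\<exists>s. on_E s (L2 z / z $ 3 * P2 s) (L3 z / z $ 3 * P3 s) \<and> P1 s = L3 z / z $ 3 * (L2 z / z $ 3))) \<or>
    (z $ 3 = 0 \<and> L2 z = 0 \<and> (\<exists>s. P3 s = 0 \<and> on_E s 0 (\<l> s))) \<or>
    (z $ 3 = 0 \<and> L3 z = 0 \<and> (\<exists>s. P2 s = 0 \<and> on_E s (\<l> s) 0))"
proof (cases "z $ 3 = 0")
  case True
  have "P3 (- q3 / w3) = 0" "P2 (- q2 / w2) = 0" using w_nonzero by (simp_all add: P2_def P3_def)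
  then have "\<exists>s. P3 s = 0 \<and> on_E s 0 (\<l> s)" "\<exists>s. P2 s = 0 \<and> on_E s (\<l> s) 0"
    by (auto simp: on_E_def)
  then show ?thesis using CR_cases_infinity[OF z True] True by blast
next
  case False
  define m where "m = z $ 3"
  define l where "l = L3 z / m"
  define l' where "l' = L2 z / m"
  define s where "s = (l * l' - q1) / w1"
  have m: "m \<noteq> 0" "L3 z = l * m" "L2 z = l' * m" using False by (simp_all add: m_def l_def l'_def)
  have P1: "P1 s = l * l'" using w_nonzero by (simp add: P1_def s_def)
  have "m\<^sup>2 * (L1 z * (l * l' - q1) - m * (q2 * l' + q3 * l - g)) = F z"
    unfolding F_def m(2,3) m_def[symmetric] by (simp add: algebra_simps power2_eq_square power3_eq_cube)
  then have "L1 z * (l * l' - q1) = m * (q2 * l' + q3 * l - g)" using z m by simp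
  moreover have "w1 * s = l * l' - q1" using w_nonzero by (simp add: s_def)
  ultimately have "L1 z * (w1 * s) = m * (q2 * l' + q3 * l - g)" by simp
  moreover have "w1 * L1 z + w2 * (l' * m) + w3 * (l * m) = \<kappa> * m"
    using L_relation[of z] m by (simp add: m_def)
  ultimately have "m * (l' * P2 s + l * P3 s - \<l> s) = 0"
    unfolding P2_def P3_def \<l>_def by algebra
  then have "l' * P2 s + l * P3 s = \<l> s" using m by simp
  then have "on_E s (l' * P2 s) (l * P3 s)" using P1 by (simp add: on_E_def)
  then show ?thesis using P1 False unfolding l_def l'_def m_def by blast
qed

end

section \<open>The oval over the unbounded branch\<close>

locale factored_spectral = factored_cubic + spectral_cubic
begin

sublocale line: param_spectral w1 w2 w3 q1 q2 q3 g \<kappa> x1 x2 x3 lineS lineU lineV a1 a2 a3 \<sigma> ..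

text \<open>The parametrization by the line omits \<open>inf1\<close> and approaches it as the
  parameter tends to infinity.\<close>

definition "Qinf = insert (hpoint (cvec inf1)) (range line.p)"

text \<open>For large \<open>t\<close>, \<open>lineU\<close> and \<open>lineV\<close> behave like
  plus and minus \<open>sqrt W * t^3\<close>, and \<open>P2\<close>, \<open>P3\<close> like
  \<open>w2 * t^2\<close>, \<open>w3 * t^2\<close>. The two quotients are the coordinates of the
  curve after \<open>L2\<close> has been scaled to 1.\<close>

lemma line_limits:
  "((\<lambda>t. P2 (lineS t) / lineU t) \<longlongrightarrow> 0) at_top"
  "((\<lambda>t. (lineV t * P2 (lineS t)) / (lineU t * P3 (lineS t))) \<longlongrightarrow> - (w2 / w3)) at_top"
  "eventually (\<lambda>t. lineU t \<noteq> 0 \<and> P2 (lineS t) \<noteq> 0 \<and> P3 (lineS t) \<noteq> 0) at_top"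
proof -
  have i: "((\<lambda>t::real. 1 / t) \<longlongrightarrow> 0) at_top" "((\<lambda>t::real. 1 / t^2) \<longlongrightarrow> 0) at_top"
     "((\<lambda>t::real. 1 / t^3) \<longlongrightarrow> 0) at_top" "((\<lambda>t::real. 1 / t^4) \<longlongrightarrow> 0) at_top"
    by real_asymp+
  have pos: "eventually (\<lambda>t::real. t > 0) at_top" by (rule eventually_gt_at_top)
  have lin: "((\<lambda>t. (\<alpha> + lineS t * \<beta>) / t^3) \<longlongrightarrow> 0) at_top" "((\<lambda>t. (\<alpha> + lineS t * \<beta>) / t^2) \<longlongrightarrow> \<beta>) at_top" for \<alpha> \<beta>
  proof -
    have "((\<lambda>t. \<alpha> * (1 / t^3) + s3 * \<beta> * (1 / t^3) + \<beta> * (1 / t)) \<longlongrightarrow> \<alpha> * 0 + s3 * \<beta> * 0 + \<beta> * 0) at_top"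
      by (intro tendsto_intros i)
    then show "((\<lambda>t. (\<alpha> + lineS t * \<beta>) / t^3) \<longlongrightarrow> 0) at_top"
      by (rule tendsto_eventually_eq[OF _ pos])
        (auto simp: lineS_def field_simps power2_eq_square power3_eq_cube)
    have "((\<lambda>t. \<alpha> * (1 / t^2) + s3 * \<beta> * (1 / t^2) + \<beta>) \<longlongrightarrow> \<alpha> * 0 + s3 * \<beta> * 0 + \<beta>) at_top"
      by (intro tendsto_intros i)
    then show "((\<lambda>t. (\<alpha> + lineS t * \<beta>) / t^2) \<longlongrightarrow> \<beta>) at_top"
      by (rule tendsto_eventually_eq[OF _ pos])
        (auto simp: lineS_def field_simps power2_eq_square)
  qed
  have "((\<lambda>t. (s3 * (1 / t^2) + 1)\<^sup>2 + b * (s3 * (1 / t^4) + 1 / t^2) + c * (1 / t^4)) \<longlongrightarrow>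
      (s3 * 0 + 1)\<^sup>2 + b * (s3 * 0 + 0) + c * 0) at_top"
    by (intro tendsto_intros i)
  then have h: "((\<lambda>t. hq (lineS t) / t^4) \<longlongrightarrow> 1) at_top"
    by (rule tendsto_eventually_eq[OF _ pos])
      (auto simp: lineS_def hq_def field_simps power2_eq_square power4_eq_xxxx)
  have "((\<lambda>t. 2 * sqrt (W * (hq (lineS t) / t^4))) \<longlongrightarrow> 2 * sqrt (W * 1)) at_top"
    by (intro tendsto_intros h)
  then have y: "((\<lambda>t. liney t / t^3) \<longlongrightarrow> 2 * sqrt W) at_top"
  proof (rule tendsto_eventually_eq[OF _ pos])
    fix t :: real assume "t > 0"
    have "sqrt (t^4) = t\<^sup>2" by (rule real_sqrt_unique) (simp_all flip: power_mult)
    then have "sqrt (W * (hq (lineS t) / t^4)) = sqrt (W * hq (lineS t)) / t\<^sup>2"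
      by (simp only: times_divide_eq_right real_sqrt_divide)
    then show "2 * sqrt (W * (hq (lineS t) / t^4)) = liney t / t^3"
      using \<open>t > 0\<close> by (simp add: liney_def field_simps power2_eq_square power3_eq_cube)
  qed simp
  have l: "((\<lambda>t. \<l> (lineS t) / t^3) \<longlongrightarrow> 0) at_top"
    using lin(1)[of g \<kappa>] by (simp add: \<l>_def mult.commute)
  have "((\<lambda>t. (\<l> (lineS t) / t^3 + liney t / t^3) / 2) \<longlongrightarrow> (0 + 2 * sqrt W) / 2) at_top"
    by (intro tendsto_intros l y) simp
  then have U: "((\<lambda>t. lineU t / t^3) \<longlongrightarrow> sqrt W) at_top"
    by (simp add: lineU_def add_divide_distrib mult.commute)
  have "((\<lambda>t. (\<l> (lineS t) / t^3 - liney t / t^3) / 2) \<longlongrightarrow> (0 - 2 * sqrt W) / 2) at_top"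
    by (intro tendsto_intros l y) simp
  then have V: "((\<lambda>t. lineV t / t^3) \<longlongrightarrow> - sqrt W) at_top"
    by (simp add: lineV_def diff_divide_distrib mult.commute)
  have P2: "((\<lambda>t. P2 (lineS t) / t^3) \<longlongrightarrow> 0) at_top" "((\<lambda>t. P2 (lineS t) / t^2) \<longlongrightarrow> w2) at_top"
    and P3: "((\<lambda>t. P3 (lineS t) / t^2) \<longlongrightarrow> w3) at_top"
    using lin by (simp_all add: P2_def P3_def)
  have sW: "sqrt W \<noteq> 0" using W_pos by simp
  have "((\<lambda>t. (P2 (lineS t) / t^3) / (lineU t / t^3)) \<longlongrightarrow> 0 / sqrt W) at_top"
    by (intro tendsto_divide P2 U sW)
  then show "((\<lambda>t. P2 (lineS t) / lineU t) \<longlongrightarrow> 0) at_top"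
    by (rule tendsto_eventually_eq[OF _ pos]) auto
  have "((\<lambda>t. ((lineV t / t^3) * (P2 (lineS t) / t^2)) / ((lineU t / t^3) * (P3 (lineS t) / t^2)))
      \<longlongrightarrow> (- sqrt W * w2) / (sqrt W * w3)) at_top"
    by (intro tendsto_divide tendsto_mult P2 P3 U V) (use W_pos w_nonzero in simp)
  then show "((\<lambda>t. (lineV t * P2 (lineS t)) / (lineU t * P3 (lineS t))) \<longlongrightarrow> - (w2 / w3)) at_top"
    by (rule tendsto_eventually_eq[OF _ pos])
      (use W_pos in auto)
  have "eventually (\<lambda>t. lineU t / t^3 \<noteq> 0 \<and> P2 (lineS t) / t^2 \<noteq> 0 \<and> P3 (lineS t) / t^2 \<noteq> 0) at_top"
    by (intro eventually_conj tendsto_imp_eventually_ne[OF U sW] tendsto_imp_eventually_ne[OF P2(2) w_nonzero(2)]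
        tendsto_imp_eventually_ne[OF P3 w_nonzero(3)])
  then show "eventually (\<lambda>t. lineU t \<noteq> 0 \<and> P2 (lineS t) \<noteq> 0 \<and> P3 (lineS t) \<noteq> 0) at_top"
    by (rule eventually_mono) auto
qed

lemma inf1_closure: "hpoint (cvec inf1) \<in> closure (range line.p)"
proof -
  \<comment> \<open>The representative of \<open>line.p t\<close> with \<open>L2 = 1\<close>; this
    normalization keeps the limit away from the zero vector.\<close>
  define \<zeta> where "\<zeta> t = zpt 1 ((lineV t * P2 (lineS t)) / (lineU t * P3 (lineS t))) (P2 (lineS t) / lineU t)" for t
  define \<zeta>\<^sub>0 where "\<zeta>\<^sub>0 = zpt 1 (- (w2 / w3)) 0"
  have "\<zeta>\<^sub>0 \<noteq> 0" using zpt_coords(1)[of 1 "- (w2 / w3)" 0] L_zero unfolding \<zeta>\<^sub>0_def by fastforce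
  have coords: "((\<lambda>t. zpt 1 (f t) (h t) $ i) \<longlongrightarrow> zpt 1 l 0 $ i) at_top"
    if f: "(f \<longlongrightarrow> l) at_top" and h: "(h \<longlongrightarrow> 0) at_top" for f h :: "real \<Rightarrow> real" and l i
  proof -
    have 1: "((\<lambda>t. (1 - f t - (x2 - x3) * h t) / (a2 - a3)) \<longlongrightarrow> (1 - l - (x2 - x3) * 0) / (a2 - a3)) at_top"
      by (intro tendsto_divide tendsto_diff tendsto_mult tendsto_const f h) (use a_distinct in simp)
    have 2: "((\<lambda>t. x2 * h t + a2 * ((1 - f t - (x2 - x3) * h t) / (a2 - a3)) - 1) \<longlongrightarrow>
        x2 * 0 + a2 * ((1 - l - (x2 - x3) * 0) / (a2 - a3)) - 1) at_top"
      by (intro tendsto_diff tendsto_add tendsto_mult tendsto_const 1 h)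
    show ?thesis using exhaust_3[of i] 1 2 h by (auto simp: zpt_def Let_def)
  qed
  have "((\<lambda>t. \<zeta> t $ i) \<longlongrightarrow> \<zeta>\<^sub>0 $ i) at_top" for i
    unfolding \<zeta>_def \<zeta>\<^sub>0_def by (rule coords[OF line_limits(2,1)])
  then have "((\<lambda>t. cvec (\<zeta> t)) \<longlongrightarrow> cvec \<zeta>\<^sub>0) at_top"
    unfolding cvec_def by (intro tendsto_vec_lambda tendsto_of_real)
  moreover have "isCont hpoint (cvec \<zeta>\<^sub>0)"
    using continuous_on_hpoint \<open>\<zeta>\<^sub>0 \<noteq> 0\<close> continuous_on_eq_continuous_at[of "- {0}" hpoint] by (simp add: open_Compl)
  ultimately have "((\<lambda>t. hpoint (cvec (\<zeta> t))) \<longlongrightarrow> hpoint (cvec \<zeta>\<^sub>0)) at_top"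
    by (rule isCont_tendsto_compose[rotated])
  moreover have "hpoint (cvec \<zeta>\<^sub>0) = hpoint (cvec inf1)"
  proof -
    have "inf1 = (a2 - a1) *\<^sub>R \<zeta>\<^sub>0"
      unfolding \<zeta>\<^sub>0_def
    proof (rule z_eqI)
      have "w2 / w3 = (a3 - a1) / (a1 - a2)" using \<sigma> by (auto simp: w_def)
      moreover have "a3 - a1 = (a2 - a1) * - ((a3 - a1) / (a1 - a2))" using a_distinct by (simp add: field_simps)
      ultimately show "L3 inf1 = L3 ((a2 - a1) *\<^sub>R zpt 1 (- (w2 / w3)) 0)"
        unfolding L_scale zpt_coords inf1 by simp
    qed (simp_all only: L_scale zpt_coords inf1 vector_scaleR_component mult_1_right mult_zero_right real_scaleR_def)
    then show ?thesis using hpoint_cvec_eq_iff[OF \<open>\<zeta>\<^sub>0 \<noteq> 0\<close> inf1(5)] by blast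
  qed
  ultimately have lim: "((\<lambda>t. hpoint (cvec (\<zeta> t))) \<longlongrightarrow> hpoint (cvec inf1)) at_top" by simp
  have "eventually (\<lambda>t. hpoint (cvec (\<zeta> t)) \<in> closure (range line.p)) at_top"
    using line_limits(3)
  proof (rule eventually_mono)
    fix t assume nz: "lineU t \<noteq> 0 \<and> P2 (lineS t) \<noteq> 0 \<and> P3 (lineS t) \<noteq> 0"
    define r where "r = Re (line.M12 t)"
    define r' where "r' = Re (line.M13 t)"
    have i: "Im (line.M12 t) = r * lineV t / P3 (lineS t)" "Im (line.M13 t) = r' * lineU t / P2 (lineS t)"
      using line.M_parallel(1,3)[of t] nz by (simp_all add: field_simps r_def r'_def)
    have "line.\<gamma> t = (r * r' * lineU t / P2 (lineS t)) *\<^sub>R \<zeta> t"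
      unfolding \<zeta>_def
      by (rule z_eqI) (use nz in \<open>simp_all add: line.\<gamma>_coords L_scale zpt_coords i r_def[symmetric] r'_def[symmetric]\<close>)
    moreover have "\<zeta> t \<noteq> 0"
      using zpt_coords(1)[of 1] L_zero unfolding \<zeta>_def by (metis zero_neq_one)
    ultimately have "hpoint (cvec (\<zeta> t)) = line.p t" using line.p_eqI by blast
    then show "hpoint (cvec (\<zeta> t)) \<in> closure (range line.p)" using closure_subset by fastforce
  qed
  then show ?thesis
    using Lim_in_closed_set[OF closed_closure _ _ lim] by simp
qed

lemma connected_Qinf: "connected Qinf"
proof (rule connected_intermediate_closure)
  show "connected (range line.p)" using connected_continuous_image[OF line.continuous_p] by simp
  show "Qinf \<subseteq> closure (range line.p)"
    using inf1_closure closure_subset[of "range line.p"] by (auto simp: Qinf_def)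
qed (auto simp: Qinf_def)

lemma Qinf_CR: "Qinf \<subseteq> CR"
  using inf1_CR line.p_CR by (auto simp: Qinf_def)

lemma Qinf_unbounded: "\<not> bounded_oval Qinf"
proof -
  have "hpoint (cvec inf1) \<in> line_at_infinity"
    unfolding line_at_infinity_def using inf1 by (auto intro!: exI[of _ "cvec inf1"])
  then show ?thesis by (auto simp: bounded_oval_def Qinf_def)
qed

lemma inf1_multiple: "z \<noteq> 0 \<Longrightarrow> z = k *\<^sub>R inf1 \<Longrightarrow> hpoint (cvec z) = hpoint (cvec inf1)"
  using hpoint_cvec_eq_iff[OF inf1(5)] by metis

lemma ovals_one:
  assumes "\<And>s. hq s > 0" shows "components CR = {CR}"
proof -
  have "CR \<subseteq> Qinf"
  proof
    fix x assume "x \<in> CR"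
    then obtain z where z: "x = hpoint (cvec z)" "z \<noteq> 0" "F z = 0" by (auto simp: CR_def)
    have surj: "\<exists>t. s = lineS t \<and> u = lineU t \<and> v = lineV t" if "on_E s u v" for s u v
    proof -
      have "D s \<ge> 0" using on_E_discriminant[OF that] zero_le_power2 by metis
      then have "s \<ge> s3" unfolding D_factored hq_def[symmetric]
        using assms[of s] W_pos by (simp add: zero_le_mult_iff)
      then show ?thesis using line_surj[OF that] by blast
    qed
    show "x \<in> Qinf"
      using CR_point_cases[OF z(2,3)]
    proof (elim disjE exE conjE)
      show "x \<in> Qinf" if "z = k *\<^sub>R inf1" for k using inf1_multiple[OF z(2) that] z(1) by (simp add: Qinf_def)
      show "x \<in> Qinf" if "z $ 3 \<noteq> 0" "on_E s (L2 z / z $ 3 * P2 s) (L3 z / z $ 3 * P3 s)"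
        "P1 s = L3 z / z $ 3 * (L2 z / z $ 3)" for s
        using surj[OF that(2)] line.finite_point[OF that(1) z(3)] that z(1) unfolding Qinf_def by (metis insertCI rangeI)
      show "x \<in> Qinf" if "z $ 3 = 0" "L2 z = 0" "P3 s = 0" "on_E s 0 (\<l> s)" for s
        using surj[OF that(4)] line.infinite_point(1)[OF that(1) z(2) that(2)] that z(1) unfolding Qinf_def by (metis insertCI rangeI)
      show "x \<in> Qinf" if "z $ 3 = 0" "L3 z = 0" "P2 s = 0" "on_E s (\<l> s) 0" for s
        using surj[OF that(4)] line.infinite_point(2)[OF that(1) z(2) that(2)] that z(1) unfolding Qinf_def by (metis insertCI rangeI)
    qed
  qed
  then have "CR = Qinf" using Qinf_CR by blast
  then have "connected CR" "CR \<noteq> {}" using connected_Qinf by (auto simp: Qinf_def)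
  then show ?thesis by (metis connected_eq_connected_components_eq connected_iff_eq_connected_component_set connected_imp_connected_closure components_eq_sing_iff)
qed

end

section \<open>The case of two ovals\<close>

locale split_spectral = split_cubic + spectral_cubic
begin

sublocale factored_spectral w1 w2 w3 q1 q2 q3 g \<kappa> x1 x2 x3 s3 b c a1 a2 a3 \<sigma> ..

sublocale circle: param_spectral w1 w2 w3 q1 q2 q3 g \<kappa> x1 x2 x3 circS circU circV a1 a2 a3 \<sigma> ..

definition "Qc = range circle.p"

lemma CR_split: "CR = Qc \<union> Qinf"
proof
  show "Qc \<union> Qinf \<subseteq> CR" using Qinf_CR circle.p_CR by (auto simp: Qc_def)
  show "CR \<subseteq> Qc \<union> Qinf"
  proof
    fix x assume "x \<in> CR"
    then obtain z where z: "x = hpoint (cvec z)" "z \<noteq> 0" "F z = 0" by (auto simp: CR_def)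
    have surj: "(\<exists>t. s = lineS t \<and> u = lineU t \<and> v = lineV t) \<or> (\<exists>t. s = circS t \<and> u = circU t \<and> v = circV t)"
      if "on_E s u v" for s u v
    proof -
      have "D s \<ge> 0" using on_E_discriminant[OF that] zero_le_power2 by metis
      have "s \<ge> s3 \<or> s \<le> s2"
      proof (rule ccontr)
        assume "\<not> (s \<ge> s3 \<or> s \<le> s2)"
        then have "4 * W * (s3 - s) > 0" "(s - s1) * (s2 - s) < 0"
          using s12 W_pos by (auto intro: mult_pos_neg)
        then have "D s < 0" unfolding D_split by (rule mult_pos_neg)
        then show False using \<open>D s \<ge> 0\<close> by simp
      qed
      then show ?thesis using line_surj[OF that] circ_surj[OF that] by metis
    qed
    have l: "x \<in> Qc \<union> Qinf" if "x = line.p t \<or> x = circle.p t" for t using that by (auto simp: Qinf_def Qc_def)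
    show "x \<in> Qc \<union> Qinf"
      using CR_point_cases[OF z(2,3)]
    proof (elim disjE exE conjE)
      show "x \<in> Qc \<union> Qinf" if "z = k *\<^sub>R inf1" for k using inf1_multiple[OF z(2) that] z(1) by (simp add: Qinf_def)
      show "x \<in> Qc \<union> Qinf" if "z $ 3 \<noteq> 0" "on_E s (L2 z / z $ 3 * P2 s) (L3 z / z $ 3 * P3 s)"
        "P1 s = L3 z / z $ 3 * (L2 z / z $ 3)" for s
        using surj[OF that(2)] line.finite_point[OF that(1) z(3)] circle.finite_point[OF that(1) z(3)] that z(1) l by metis
      show "x \<in> Qc \<union> Qinf" if "z $ 3 = 0" "L2 z = 0" "P3 s = 0" "on_E s 0 (\<l> s)" for s
        using surj[OF that(4)] line.infinite_point(1)[OF that(1) z(2) that(2)]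
          circle.infinite_point(1)[OF that(1) z(2) that(2)] that z(1) l by metis
      show "x \<in> Qc \<union> Qinf" if "z $ 3 = 0" "L3 z = 0" "P2 s = 0" "on_E s (\<l> s) 0" for s
        using surj[OF that(4)] line.infinite_point(2)[OF that(1) z(2) that(2)]
          circle.infinite_point(2)[OF that(1) z(2) that(2)] that z(1) l by metis
    qed
  qed
qed

lemma closed_Qc: "closed Qc"
proof -
  have "Qc = hpoint ` ((\<lambda>t. cvec (circle.\<gamma> t)) ` {0..2*pi})"
  proof (intro equalityI subsetI)
    fix x assume "x \<in> Qc"
    then obtain t where "x = circle.p t" by (auto simp: Qc_def)
    moreover obtain t' where "t' \<in> {0..2*pi}" "circS t = circS t'" "circU t = circU t'" "circV t = circV t'"
      using circ_surj[OF circ_on_E circS_le(1), of t] by metis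
    ultimately show "x \<in> hpoint ` ((\<lambda>t. cvec (circle.\<gamma> t)) ` {0..2*pi})"
      using circle.p_unique[of t t'] by (auto simp: circle.p_def)
  qed (auto simp: Qc_def circle.p_def)
  moreover have "closed (hpoint ` ((\<lambda>t. cvec (circle.\<gamma> t)) ` {0..2*pi}))"
  proof (rule closed_hpoint_compact)
    have "continuous_on {0..2*pi} circle.\<gamma>"
      unfolding circle.\<gamma>_def[abs_def]
      by (intro continuous_zpt continuous_intros continuous_on_subset[OF circle.M12(1)] continuous_on_subset[OF circle.M13(1)] subset_UNIV)
    then have "continuous_on {0..2*pi} (\<lambda>t. cvec (circle.\<gamma> t))"
      by (rule continuous_on_compose2[OF continuous_on_cvec[of UNIV]]) auto
    then show "compact ((\<lambda>t. cvec (circle.\<gamma> t)) ` {0..2*pi})" by (rule compact_continuous_image) simp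
    show "0 \<notin> (\<lambda>t. cvec (circle.\<gamma> t)) ` {0..2*pi}" using circle.\<gamma>_nonzero by (metis cvec_eq_0_iff imageE)
  qed
  ultimately show ?thesis by simp
qed

text \<open>The threshold is the midpoint of the gap between \<open>s2\<close> and
  \<open>s3\<close>, which neither branch enters.\<close>

lemma low_iff:
  assumes "z \<noteq> 0" "hpoint (cvec z) \<in> CR"
  shows "low ((s2 + s3) / 2) z \<Longrightarrow> hpoint (cvec z) \<notin> Qinf"
    "\<not> low ((s2 + s3) / 2) z \<Longrightarrow> hpoint (cvec z) \<notin> Qc"
proof -
  have eq: "low m z = low m z'" if "hpoint (cvec z) = hpoint (cvec z')" "z' \<noteq> 0" for m z'
  proof -
    have "\<exists>k. z' = k *\<^sub>R z" using that(1) hpoint_cvec_eq_iff[OF assms(1) that(2)] by blast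
    then obtain k where k: "z' = k *\<^sub>R z" by blast
    then have "k \<noteq> 0" using that(2) by auto
    then show ?thesis using low_scale k by simp
  qed
  show "hpoint (cvec z) \<notin> Qinf" if "low ((s2 + s3) / 2) z"
  proof
    assume "hpoint (cvec z) \<in> Qinf"
    then consider "hpoint (cvec z) = hpoint (cvec inf1)" | t where "hpoint (cvec z) = hpoint (cvec (line.\<gamma> t))"
      by (auto simp: Qinf_def line.p_def)
    then show False
    proof cases
      case 1
      then show False using eq[OF 1 inf1(5)] that not_low_inf1 by blast
    next
      case 2
      have "s3 \<le> lineS t" by (simp add: lineS_def)
      then show False using eq[OF 2 line.\<gamma>_nonzero] that line.low_\<gamma>[of "(s2 + s3) / 2" t] s23 by simp
    qed
  qed
  show "hpoint (cvec z) \<notin> Qc" if "\<not> low ((s2 + s3) / 2) z"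
  proof
    assume "hpoint (cvec z) \<in> Qc"
    then obtain t where t: "hpoint (cvec z) = hpoint (cvec (circle.\<gamma> t))" by (auto simp: Qc_def circle.p_def)
    show False using eq[OF t circle.\<gamma>_nonzero] that circle.low_\<gamma>[of "(s2 + s3) / 2" t] circS_le(1)[of t] s23 by simp
  qed
qed

lemma Qc_Qinf_disjoint: "Qc \<inter> Qinf = {}"
proof (rule ccontr)
  assume "Qc \<inter> Qinf \<noteq> {}"
  then obtain x where x: "x \<in> Qc" "x \<in> Qinf" by blast
  then have "x \<in> CR" using Qinf_CR by blast
  then obtain z where "x = hpoint (cvec z)" "z \<noteq> 0" by (auto simp: CR_def)
  then show False using low_iff[of z] x \<open>x \<in> CR\<close> by auto
qed

text \<open>The parameter line is not compact, so the oval is realized as the image of the unit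
  vectors on the cubic that are not \<open>low\<close>. They form a compact set because
  \<open>low\<close> is an open condition.\<close>

lemma closed_Qinf: "closed Qinf"
proof -
  let ?K = "{z \<in> sphere 0 1. F z = 0} - {z. low ((s2 + s3) / 2) z}"
  have "continuous_on UNIV F"
    unfolding F_def[abs_def] by (intro continuous_intros continuous_L)
  then have "closed {z. F z = 0}" by (intro closed_Collect_eq continuous_on_const)
  then have "compact (sphere 0 1 \<inter> {z. F z = 0} - {z. low ((s2 + s3) / 2) z})"
    by (intro compact_diff compact_Int_closed compact_sphere open_low)
  then have "compact ?K" by (simp add: Int_def)
  then have "compact (cvec ` ?K)" by (intro compact_continuous_image continuous_on_cvec)
  moreover have "0 \<notin> cvec ` ?K" by (auto simp: image_iff)
  ultimately have "closed (hpoint ` (cvec ` ?K))" by (rule closed_hpoint_compact)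
  moreover have "hpoint ` (cvec ` ?K) = Qinf"
  proof (intro equalityI subsetI)
    fix x assume "x \<in> hpoint ` (cvec ` ?K)"
    then obtain z where z: "x = hpoint (cvec z)" "norm z = 1" "F z = 0" "\<not> low ((s2 + s3) / 2) z" by auto
    then have "z \<noteq> 0" by auto
    then have "x \<in> CR" using z by (auto simp: CR_def)
    then show "x \<in> Qinf" using low_iff(2)[OF \<open>z \<noteq> 0\<close>] z CR_split by auto
  next
    fix x assume x: "x \<in> Qinf"
    then obtain z where z: "x = hpoint (cvec z)" "z \<noteq> 0" "F z = 0" using Qinf_CR by (auto simp: CR_def)
    let ?z = "(1 / norm z) *\<^sub>R z"
    have eq: "hpoint (cvec ?z) = x"
      using hpoint_cvec_eq_iff[of z ?z] z by auto
    have "?z \<noteq> 0" using z by simp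
    moreover have "\<not> low ((s2 + s3) / 2) ?z"
      using low_iff(1)[OF \<open>?z \<noteq> 0\<close>] eq x Qinf_CR by auto
    moreover have "F ?z = 0" using z by (simp only: F_scale)
    moreover have "norm ?z = 1" using z by simp
    ultimately have "?z \<in> ?K" by simp
    then show "x \<in> hpoint ` (cvec ` ?K)" using eq by blast
  qed
  ultimately show ?thesis by simp
qed

lemma ovals_two:
  "components CR = {Qc, Qinf}" "Qc \<noteq> Qinf" "\<not> bounded_oval Qinf"
  "bounded_oval Qc \<longleftrightarrow> (\<forall>t. Re (circle.M12 t) \<noteq> 0) \<and> (\<forall>t. Re (circle.M13 t) \<noteq> 0)"
proof -
  have ne: "Qc \<noteq> {}" "Qinf \<noteq> {}" by (auto simp: Qc_def Qinf_def)
  show "Qc \<noteq> Qinf" using Qc_Qinf_disjoint ne by auto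
  have "connected Qc" unfolding Qc_def by (rule connected_continuous_image[OF circle.continuous_p]) simp
  show "components CR = {Qc, Qinf}"
  proof (rule components_eqI_closed)
    show "\<Union>{Qc, Qinf} = CR" using CR_split by simp
    show "connected K \<and> K \<noteq> {}" if "K \<in> {Qc, Qinf}" for K
      using that \<open>connected Qc\<close> connected_Qinf ne by auto
    show "closedin (top_of_set CR) K" if "K \<in> {Qc, Qinf}" for K
      using that closed_Qc closed_Qinf CR_split by (intro closed_subset) auto
  qed (use Qc_Qinf_disjoint in auto)
  show "\<not> bounded_oval Qinf" by (rule Qinf_unbounded)
  show "bounded_oval Qc \<longleftrightarrow> (\<forall>t. Re (circle.M12 t) \<noteq> 0) \<and> (\<forall>t. Re (circle.M13 t) \<noteq> 0)"
    unfolding bounded_oval_def Qc_def disjoint_iff using circle.p_at_infinity by blast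
qed

end

section \<open>Dynamics\<close>

definition vfield :: "real^3 \<Rightarrow> real^3^3 \<Rightarrow> real^3^3" where
  "vfield a X = commutator (X ** X) (diag a)"

lemma vfield_nth: "vfield a X $ i $ j = (X ** X) $ i $ j * (a $ j - a $ i)"
proof -
  have 1: "(Y ** diag a) $ i $ j = Y $ i $ j * a $ j" for Y :: "real^3^3"
    by (simp add: matrix_matrix_mult_def diag_def if_distrib cong: if_cong)
  have 2: "(diag a ** Y) $ i $ j = a $ i * Y $ i $ j" for Y :: "real^3^3"
    by (simp add: matrix_matrix_mult_def diag_def if_distrib if_distribR cong: if_cong)
  show ?thesis by (simp add: vfield_def commutator_def 1 2 algebra_simps)
qed

text \<open>The field is \<open>B X X\<close> for a bilinear \<open>B\<close>, so a difference of
  values is linear in the increment. The factor \<open>e\<close> will be 1 or -1, for the two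
  directions of time.\<close>

lemma locally_lipschitz_vfield: "locally_lipschitz (\<lambda>X. e *\<^sub>R vfield a X)"
proof -
  define B :: "real^3^3 \<Rightarrow> real^3^3 \<Rightarrow> real^3^3"
    where "B X Y = (\<chi> i j. e * ((X ** Y) $ i $ j * (a $ j - a $ i)))" for X Y
  have vB: "e *\<^sub>R vfield a X = B X X" for X
    by (simp add: vec_eq_iff vfield_nth B_def)
  have "bilinear B"
    unfolding bilinear_def
    by (intro conjI allI linearI)
      (simp_all add: B_def vec_eq_iff matrix_matrix_mult_def sum_3 algebra_simps)
  then have B: "bounded_bilinear B" by (rule bilinear_conv_bounded_bilinear[THEN iffD1])
  then obtain K where K: "K > 0" "\<And>X Y. norm (B X Y) \<le> norm X * norm Y * K"
    using bounded_bilinear.pos_bounded by blast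
  show ?thesis unfolding locally_lipschitz_def
  proof (intro allI exI conjI ballI)
    fix X Y Z :: "real^3^3" assume Y: "Y \<in> cball X 1" and Z: "Z \<in> cball X 1"
    have n: "norm Y \<le> norm X + 1" "norm Z \<le> norm X + 1"
      using Y Z norm_triangle_ineq2[of Y X] norm_triangle_ineq2[of Z X]
      by (auto simp: dist_norm norm_minus_commute)
    have "e *\<^sub>R vfield a Y - e *\<^sub>R vfield a Z = B (Y - Z) Y + B Z (Y - Z)"
      using bounded_bilinear.diff_left[OF B] bounded_bilinear.diff_right[OF B]
      by (simp add: vB)
    also have "norm \<dots> \<le> norm (Y - Z) * norm Y * K + norm Z * norm (Y - Z) * K"
      by (rule norm_triangle_le) (intro add_mono K)
    also have "\<dots> = ((norm Y + norm Z) * K) * norm (Y - Z)" by (simp add: algebra_simps)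
    also have "\<dots> \<le> (2 * (norm X + 1) * K) * norm (Y - Z)"
      using n K(1) by (intro mult_right_mono) auto
    finally show "norm (e *\<^sub>R vfield a Y - e *\<^sub>R vfield a Z) \<le> (2 * (norm X + 1) * K) * norm (Y - Z)" .
  qed (use K in auto)
qed

text \<open>A Gronwall estimate: the derivative of \<open>A\<^sup>2 + B\<^sup>2\<close> is at most
  \<open>4 * C\<close> times the sum itself, so multiplying by the matching exponential makes it
  nonincreasing.\<close>

lemma linear_system_growth:
  fixes A B :: "real \<Rightarrow> real"
  assumes d: "\<And>t. t \<in> {t0..t1} \<Longrightarrow> (A has_real_derivative m11 t * A t + m12 t * B t) (at t)"
     "\<And>t. t \<in> {t0..t1} \<Longrightarrow> (B has_real_derivative m21 t * A t + m22 t * B t) (at t)"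
    and m: "\<And>t. t \<in> {t0..t1} \<Longrightarrow> \<bar>m11 t\<bar> \<le> C \<and> \<bar>m12 t\<bar> \<le> C \<and> \<bar>m21 t\<bar> \<le> C \<and> \<bar>m22 t\<bar> \<le> C"
    and "t0 \<le> t1"
  shows "(A t1)\<^sup>2 + (B t1)\<^sup>2 \<le> ((A t0)\<^sup>2 + (B t0)\<^sup>2) * exp (4 * C * (t1 - t0))"
proof -
  define N where "N t = ((A t)\<^sup>2 + (B t)\<^sup>2) * exp (- 4 * C * (t - t0))" for t
  have "N t1 \<le> N t0"
  proof (rule DERIV_nonpos_imp_nonincreasing[OF \<open>t0 \<le> t1\<close>])
    fix t assume "t0 \<le> t" "t \<le> t1"
    then have t: "t \<in> {t0..t1}" by simp
    let ?A' = "m11 t * A t + m12 t * B t" and ?B' = "m21 t * A t + m22 t * B t"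
    let ?D = "(2 * (A t * ?A' + B t * ?B') - 4 * C * ((A t)\<^sup>2 + (B t)\<^sup>2)) * exp (- 4 * C * (t - t0))"
    have "(N has_real_derivative ?D) (at t)"
      unfolding N_def[abs_def]
      by (rule derivative_eq_intros d[OF t] refl | simp)+ (simp add: algebra_simps power2_eq_square)
    moreover have "?D \<le> 0"
    proof -
      have ab: "\<bar>A t * B t\<bar> \<le> ((A t)\<^sup>2 + (B t)\<^sup>2) / 2"
        using sum_squares_bound[of "\<bar>A t\<bar>" "\<bar>B t\<bar>"] by (simp add: abs_mult)
      have le: "x * y \<le> C * z" if "\<bar>x\<bar> \<le> C" "\<bar>y\<bar> \<le> z" for x y z
        using mult_mono[OF that] that by (metis abs_ge_self abs_ge_zero abs_mult order_trans)
      have "m11 t * (A t)\<^sup>2 \<le> C * (A t)\<^sup>2" "m22 t * (B t)\<^sup>2 \<le> C * (B t)\<^sup>2"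
        "m12 t * (A t * B t) \<le> C * (((A t)\<^sup>2 + (B t)\<^sup>2) / 2)" "m21 t * (A t * B t) \<le> C * (((A t)\<^sup>2 + (B t)\<^sup>2) / 2)"
        by (rule le; use m[OF t] ab in simp)+
      then have "A t * ?A' + B t * ?B' \<le> 2 * C * ((A t)\<^sup>2 + (B t)\<^sup>2)"
        by (simp add: algebra_simps power2_eq_square)
      then show ?thesis by (simp add: mult_nonpos_nonneg)
    qed
    ultimately show "\<exists>y. (N has_real_derivative y) (at t) \<and> y \<le> 0" by blast
  qed
  then have "((A t1)\<^sup>2 + (B t1)\<^sup>2) * exp (- 4 * C * (t1 - t0)) \<le> (A t0)\<^sup>2 + (B t0)\<^sup>2"
    by (simp add: N_def)
  then have "((A t1)\<^sup>2 + (B t1)\<^sup>2) * exp (- 4 * C * (t1 - t0)) * exp (4 * C * (t1 - t0))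
      \<le> ((A t0)\<^sup>2 + (B t0)\<^sup>2) * exp (4 * C * (t1 - t0))"
    by (rule mult_right_mono) simp
  then show ?thesis by (simp add: mult.assoc flip: exp_add)
qed

lemma norm_matrix_le: "norm (X :: real^3^3) \<le> (\<Sum>i\<in>UNIV. \<Sum>j\<in>UNIV. \<bar>X $ i $ j\<bar>)"
proof -
  have "norm X \<le> (\<Sum>i\<in>UNIV. norm (X $ i))"
    unfolding norm_vec_def[of X] by (rule L2_set_le_sum) simp
  also have "\<dots> \<le> (\<Sum>i\<in>UNIV. \<Sum>j\<in>UNIV. \<bar>X $ i $ j\<bar>)"
    by (intro sum_mono norm_le_l1_cart)
  finally show ?thesis .
qed

lemma bounded_matrices:
  fixes X :: "real \<Rightarrow> real^3^3"
  assumes "\<And>i j. \<exists>K. \<forall>t\<in>I. \<bar>X t $ i $ j\<bar> \<le> K"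
  shows "bounded (X ` I)"
proof -
  obtain K where K: "\<And>i j t. t \<in> I \<Longrightarrow> \<bar>X t $ i $ j\<bar> \<le> K i j" using assms by metis
  have "norm (X t) \<le> (\<Sum>i\<in>UNIV. \<Sum>j\<in>UNIV. K i j)" if "t \<in> I" for t
    using norm_matrix_le[of "X t"] sum_mono[of UNIV "\<lambda>i. \<Sum>j\<in>UNIV. \<bar>X t $ i $ j\<bar>" "\<lambda>i. \<Sum>j\<in>UNIV. K i j"]
      sum_mono[of UNIV "\<lambda>j. \<bar>X t $ _ $ j\<bar>" "K _"] K[OF that] order_trans by (meson sum_mono)
  then show ?thesis by (auto simp: bounded_iff)
qed

lemma entry_derivative:
  assumes "(X has_vector_derivative e *\<^sub>R vfield a (X t)) (at t)"
  shows "((\<lambda>t. X t $ i $ j) has_real_derivative e * (X t ** X t) $ i $ j * (a $ j - a $ i)) (at t)"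
proof -
  have "((\<lambda>t. X t $ i $ j) has_vector_derivative (e *\<^sub>R vfield a (X t)) $ i $ j) (at t)"
    using bounded_linear.has_vector_derivative[OF bounded_linear_vec_nth
        bounded_linear.has_vector_derivative[OF bounded_linear_vec_nth assms]] .
  then show ?thesis
    by (simp add: has_real_derivative_iff_has_vector_derivative vfield_nth mult.assoc)
qed

lemma square_entry:
  fixes X :: "real^3^3"
  assumes "i \<noteq> j" "i \<noteq> k" "j \<noteq> k"
  shows "(X ** X) $ i $ j = (X $ i $ i + X $ j $ j) * X $ i $ j + X $ i $ k * X $ k $ j"
proof -
  have "{i, j, k} \<subseteq> (UNIV :: 3 set)" "card {i, j, k} = card (UNIV :: 3 set)" using assms by simp_all
  then have U: "(UNIV :: 3 set) = {i, j, k}" by (metis card_subset_eq finite)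
  have "(X ** X) $ i $ j = (\<Sum>m\<in>{i, j, k}. X $ i $ m * X $ m $ j)"
    unfolding matrix_matrix_mult_def U[symmetric] by simp
  then show ?thesis using assms by (simp add: algebra_simps)
qed

text \<open>For distinct \<open>i, j, k\<close> the pair \<open>(X\<^sub>i\<^sub>j, X\<^sub>i\<^sub>k X\<^sub>k\<^sub>j)\<close> solves a linear system whose coefficients
  involve only the diagonal and the products \<open>X\<^sub>j\<^sub>k X\<^sub>k\<^sub>j\<close>.\<close>

lemma bounded_products_imp_bounded:
  fixes X :: "real \<Rightarrow> real^3^3"
  assumes X: "\<And>t. t \<in> I \<Longrightarrow> (X has_vector_derivative e *\<^sub>R vfield a (X t)) (at t)"
    and I: "is_interval I" "bdd_above I" "t0 \<in> I" "\<And>t. t \<in> I \<Longrightarrow> t0 \<le> t"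
    and bd: "\<And>t i j. t \<in> I \<Longrightarrow> \<bar>X t $ i $ j * X t $ j $ i\<bar> \<le> C"
  shows "bounded (X ` I)"
proof (rule bounded_matrices)
  fix i j :: 3
  have C: "C \<ge> 0" using bd[OF I(3)] abs_ge_zero order_trans by blast
  have dg: "\<bar>X t $ i $ i\<bar> \<le> 1 + C" if "t \<in> I" for t i
  proof -
    have "X t $ i $ i * X t $ i $ i \<le> C" using bd[OF that, of i i] by (simp add: abs_le_iff)
    moreover have "2 * \<bar>x\<bar> \<le> 1 + x * x" for x :: real
      using sum_squares_bound[of 1 "\<bar>x\<bar>"] by (simp add: power2_eq_square)
    from this[of "X t $ i $ i"] have "2 * \<bar>X t $ i $ i\<bar> \<le> 1 + X t $ i $ i * X t $ i $ i" .
    ultimately show ?thesis using C by linarith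
  qed
  obtain u where u: "\<And>t. t \<in> I \<Longrightarrow> t \<le> u" using I(2) by (auto simp: bdd_above_def)
  show "\<exists>K. \<forall>t\<in>I. \<bar>X t $ i $ j\<bar> \<le> K"
  proof (cases "i = j")
    case True
    then show ?thesis using dg by blast
  next
    case False
    have "\<exists>k::3. i \<noteq> k \<and> j \<noteq> k"
    proof (rule ccontr)
      assume "\<nexists>k::3. i \<noteq> k \<and> j \<noteq> k"
      then have "(UNIV :: 3 set) \<subseteq> {i, j}" by auto
      then have "card (UNIV :: 3 set) \<le> card {i, j}" by (intro card_mono) auto
      then show False using False by simp
    qed
    then obtain k where k: "i \<noteq> k" "j \<noteq> k" by blast
    define A where "A t = X t $ i $ j" for t
    define B where "B t = X t $ i $ k * X t $ k $ j" for t
    define m11 where "m11 t = e * (a $ j - a $ i) * (X t $ i $ i + X t $ j $ j)" for t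
    define m12 where "m12 t = e * (a $ j - a $ i)" for t :: real
    define m21 where "m21 t = e * (a $ k - a $ i) * (X t $ j $ k * X t $ k $ j) + e * (a $ j - a $ k) * (X t $ i $ k * X t $ k $ i)" for t
    define m22 where "m22 t = e * (a $ k - a $ i) * (X t $ i $ i + X t $ k $ k) + e * (a $ j - a $ k) * (X t $ k $ k + X t $ j $ j)" for t
    note der = entry_derivative[OF X]
    have dA: "(A has_real_derivative m11 t * A t + m12 t * B t) (at t)" if "t \<in> I" for t
      unfolding A_def[abs_def]
      by (rule DERIV_cong[OF der[OF that]])
        (simp add: square_entry[OF False k] A_def B_def m11_def m12_def algebra_simps)
    have dB: "(B has_real_derivative m21 t * A t + m22 t * B t) (at t)" if "t \<in> I" for t
      unfolding B_def[abs_def]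
      by (rule DERIV_cong[OF DERIV_mult[OF der[OF that] der[OF that]]])
        (simp add: square_entry[OF k(1) False k(2)[symmetric]] square_entry[OF k(2)[symmetric] k(1)[symmetric] False[symmetric]]
            A_def B_def m21_def m22_def algebra_simps)
    define M where "M = \<bar>e\<bar> * (\<bar>a $ j - a $ i\<bar> + \<bar>a $ k - a $ i\<bar> + \<bar>a $ j - a $ k\<bar>)"
    have M: "\<bar>e * (a $ j - a $ i)\<bar> \<le> M" "\<bar>e * (a $ k - a $ i)\<bar> \<le> M" "\<bar>e * (a $ j - a $ k)\<bar> \<le> M" "M \<ge> 0"
      by (auto simp: M_def abs_mult intro!: mult_left_mono)
    \<comment> \<open>One crude bound for all four coefficients; it is dictated by
      \<open>m22\<close>, which has two terms bounded by \<open>M * (2 * (1 + C))\<close>.\<close>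
    define Q where "Q = M * (4 * (1 + C))"
    have m: "\<bar>m11 t\<bar> \<le> Q \<and> \<bar>m12 t\<bar> \<le> Q \<and> \<bar>m21 t\<bar> \<le> Q \<and> \<bar>m22 t\<bar> \<le> Q" if t: "t \<in> I" for t
    proof -
      have pr: "\<bar>x * y\<bar> \<le> M * z" if "\<bar>x\<bar> \<le> M" "\<bar>y\<bar> \<le> z" for x y z
        unfolding abs_mult using that M(4) by (intro mult_mono) auto
      have s: "\<bar>X t $ i' $ i' + X t $ j' $ j'\<bar> \<le> 2 * (1 + C)" for i' j'
        using order_trans[OF abs_triangle_ineq add_mono[OF dg[OF t, of i'] dg[OF t, of j']]] by simp

      have "\<bar>m11 t\<bar> \<le> M * (2 * (1 + C))" unfolding m11_def by (rule pr[OF M(1) s])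
      moreover have "\<bar>m12 t\<bar> \<le> M * 1" unfolding m12_def using M by simp
      moreover have "\<bar>m21 t\<bar> \<le> M * C + M * C" unfolding m21_def
        by (rule order_trans[OF abs_triangle_ineq add_mono[OF pr[OF M(2) bd[OF t]] pr[OF M(3) bd[OF t]]]])
      moreover have "\<bar>m22 t\<bar> \<le> M * (2 * (1 + C)) + M * (2 * (1 + C))" unfolding m22_def
        by (rule order_trans[OF abs_triangle_ineq add_mono[OF pr[OF M(2) s] pr[OF M(3) s]]])
      moreover have "M * (2 * (1 + C)) \<le> Q" "M * 1 \<le> Q"
        unfolding Q_def by (intro mult_left_mono M(4); use C in simp)+
      moreover have "M * C + M * C \<le> Q"
      proof -
        have "M * C + M * C = M * (2 * C)" by simp
        also have "\<dots> \<le> Q" unfolding Q_def by (intro mult_left_mono M(4)) (use C in simp)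
        finally show ?thesis .
      qed
      moreover have "M * (2 * (1 + C)) + M * (2 * (1 + C)) = Q" by (simp add: Q_def algebra_simps)
      ultimately show ?thesis by (metis order_trans)
    qed
    have Q0: "Q \<ge> 0" using M C by (simp add: Q_def)
    define N0 where "N0 = (A t0)\<^sup>2 + (B t0)\<^sup>2"
    have "\<bar>X t $ i $ j\<bar> \<le> 1 + N0 * exp (4 * Q * (u - t0))" if t: "t \<in> I" for t
    proof -
      have sub: "{t0..t} \<subseteq> I" using mem_is_interval_1_I[OF I(1,3) t] by auto
      have "(A t)\<^sup>2 + (B t)\<^sup>2 \<le> N0 * exp (4 * Q * (t - t0))"
        unfolding N0_def by (rule linear_system_growth[OF dA dB m I(4)[OF t]]) (use sub in auto)
      also have "\<dots> \<le> N0 * exp (4 * Q * (u - t0))"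
        using u[OF t] Q0 by (intro mult_left_mono) (auto simp: N0_def intro!: mult_left_mono)
      finally have "(A t)\<^sup>2 \<le> N0 * exp (4 * Q * (u - t0))"
        using zero_le_power2[of "B t"] by linarith
      moreover have "2 * \<bar>x\<bar> \<le> 1 + x\<^sup>2" for x :: real
        using sum_squares_bound[of 1 "\<bar>x\<bar>"] by (simp add: power2_eq_square)
      from this[of "A t"] have "2 * \<bar>A t\<bar> \<le> 1 + (A t)\<^sup>2" .
      ultimately show ?thesis using zero_le_power2[of "A t"] unfolding A_def by linarith
    qed
    then show ?thesis by blast
  qed
qed

section \<open>The flow in the coordinates s, u, v\<close>

context spectral_cubic
begin

definition "av = (vector [a1, a2, a3] :: real^3)"

lemma av_nth [simp]: "av $ 1 = a1" "av $ 2 = a2" "av $ 3 = a3"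
  by (simp_all add: av_def)

context
  fixes X :: "real \<Rightarrow> real^3^3" and e :: real and t :: real
  assumes X: "(X has_vector_derivative e *\<^sub>R vfield av (X t)) (at t)" and T: "X t \<in> T"
begin

lemma T_entries: "X t $ 1 $ 1 = x1" "X t $ 2 $ 2 = x2" "X t $ 3 $ 3 = x3"
  "X t $ 2 $ 3 * X t $ 3 $ 2 = P1 (sX (X t))" "X t $ 1 $ 3 * X t $ 3 $ 1 = P2 (sX (X t))"
  "X t $ 1 $ 2 * X t $ 2 $ 1 = P3 (sX (X t))" "uX (X t) + vX (X t) = \<l> (sX (X t))"
  using T T_iff by metis+

lemma d_entries:
  "((\<lambda>t. X t $ 1 $ 2) has_real_derivative e * ((x1 + x2) * X t $ 1 $ 2 + X t $ 1 $ 3 * X t $ 3 $ 2) * (a2 - a1)) (at t)"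
  "((\<lambda>t. X t $ 2 $ 1) has_real_derivative e * ((x1 + x2) * X t $ 2 $ 1 + X t $ 2 $ 3 * X t $ 3 $ 1) * (a1 - a2)) (at t)"
  "((\<lambda>t. X t $ 1 $ 3) has_real_derivative e * ((x1 + x3) * X t $ 1 $ 3 + X t $ 1 $ 2 * X t $ 2 $ 3) * (a3 - a1)) (at t)"
  "((\<lambda>t. X t $ 3 $ 1) has_real_derivative e * ((x1 + x3) * X t $ 3 $ 1 + X t $ 3 $ 2 * X t $ 2 $ 1) * (a1 - a3)) (at t)"
  "((\<lambda>t. X t $ 2 $ 3) has_real_derivative e * ((x2 + x3) * X t $ 2 $ 3 + X t $ 2 $ 1 * X t $ 1 $ 3) * (a3 - a2)) (at t)"
  "((\<lambda>t. X t $ 3 $ 2) has_real_derivative e * ((x2 + x3) * X t $ 3 $ 2 + X t $ 3 $ 1 * X t $ 1 $ 2) * (a2 - a3)) (at t)"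
  using entry_derivative[OF X, of 1 2] entry_derivative[OF X, of 2 1] entry_derivative[OF X, of 1 3]
    entry_derivative[OF X, of 3 1] entry_derivative[OF X, of 2 3] entry_derivative[OF X, of 3 2]
  by (simp_all add: square_entry[of 1 2 3] square_entry[of 2 1 3] square_entry[of 1 3 2]
      square_entry[of 3 1 2] square_entry[of 2 3 1] square_entry[of 3 2 1] T_entries(1-3) add.commute)

lemma sX_derivative: "((\<lambda>t. sX (X t)) has_real_derivative e * \<sigma> * (uX (X t) - vX (X t))) (at t)"
proof -
  have "((\<lambda>t. sX (X t)) has_real_derivative
     ((e * ((x2 + x3) * X t $ 2 $ 3 + X t $ 2 $ 1 * X t $ 1 $ 3) * (a3 - a2)) * X t $ 3 $ 2 +
     (e * ((x2 + x3) * X t $ 3 $ 2 + X t $ 3 $ 1 * X t $ 1 $ 2) * (a2 - a3)) * X t $ 2 $ 3) / w1) (at t)"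
    unfolding sX_def by (rule derivative_eq_intros d_entries refl | simp add: w_nonzero)+
  then show ?thesis
  proof (rule DERIV_cong)
    show "((e * ((x2 + x3) * X t $ 2 $ 3 + X t $ 2 $ 1 * X t $ 1 $ 3) * (a3 - a2)) * X t $ 3 $ 2 +
     (e * ((x2 + x3) * X t $ 3 $ 2 + X t $ 3 $ 1 * X t $ 1 $ 2) * (a2 - a3)) * X t $ 2 $ 3) / w1
      = e * \<sigma> * (uX (X t) - vX (X t))"
      unfolding nonzero_divide_eq_eq[OF w_nonzero(1)] uX_def vX_def
      unfolding w_def(1) using \<sigma> by (auto simp: algebra_simps)
  qed
qed

text \<open>Differentiating \<open>y\<^sup>2 = D s\<close> would give this only where
  \<open>y = u - v\<close> is nonzero; the computation from the matrix entries covers the turning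
  points as well.\<close>

lemma y_derivative: "((\<lambda>t. uX (X t) - vX (X t)) has_real_derivative e * \<sigma> * (D' (sX (X t)) / 2)) (at t)"
proof -
  let ?s = "sX (X t)"
  define Q where "Q = w1 * P2 ?s * P3 ?s + w2 * P1 ?s * P3 ?s + w3 * P1 ?s * P2 ?s"
  have s2: "\<sigma> * \<sigma> = 1" using \<sigma> by auto
  have u: "((\<lambda>t. uX (X t)) has_real_derivative e * \<sigma> * (\<kappa> * uX (X t) - Q)) (at t)"
  proof -
    have "((\<lambda>t. uX (X t)) has_real_derivative
       ((e * ((x1 + x2) * X t $ 1 $ 2 + X t $ 1 $ 3 * X t $ 3 $ 2) * (a2 - a1)) * X t $ 2 $ 3 +
        X t $ 1 $ 2 * (e * ((x2 + x3) * X t $ 2 $ 3 + X t $ 2 $ 1 * X t $ 1 $ 3) * (a3 - a2))) * X t $ 3 $ 1 +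
        X t $ 1 $ 2 * X t $ 2 $ 3 * (e * ((x1 + x3) * X t $ 3 $ 1 + X t $ 3 $ 2 * X t $ 2 $ 1) * (a1 - a3))) (at t)"
      (is "(_ has_real_derivative ?E) _")
      unfolding uX_def by (intro DERIV_cong[OF DERIV_mult[OF DERIV_mult[OF d_entries(1) d_entries(5)] d_entries(4)]])
        (simp add: algebra_simps)
    \<comment> \<open>The factor \<open>\<sigma> * \<sigma>\<close>, which is 1, is inserted so that
      one \<open>\<sigma>\<close> can turn the differences of the \<open>a\<^sub>i\<close> into the
      \<open>w\<^sub>i\<close>.\<close>
    moreover have "?E = e * (\<sigma> * \<sigma>) * (((a2 - a3) * x1 + (a3 - a1) * x2 + (a1 - a2) * x3) * uX (X t) -
       ((a2 - a3) * P2 ?s * P3 ?s + (a3 - a1) * P1 ?s * P3 ?s + (a1 - a2) * P1 ?s * P2 ?s))"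
      unfolding T_entries(4-6)[symmetric] uX_def s2 by (simp add: algebra_simps)
    moreover have "\<dots> = e * \<sigma> * (\<kappa> * uX (X t) - Q)"
      unfolding \<kappa>_def w_def Q_def by (simp add: algebra_simps)
    ultimately show ?thesis by (simp only:)
  qed
  have v: "((\<lambda>t. vX (X t)) has_real_derivative - (e * \<sigma> * (\<kappa> * vX (X t) - Q))) (at t)"
  proof -
    have "((\<lambda>t. vX (X t)) has_real_derivative
       ((e * ((x1 + x3) * X t $ 1 $ 3 + X t $ 1 $ 2 * X t $ 2 $ 3) * (a3 - a1)) * X t $ 3 $ 2 +
        X t $ 1 $ 3 * (e * ((x2 + x3) * X t $ 3 $ 2 + X t $ 3 $ 1 * X t $ 1 $ 2) * (a2 - a3))) * X t $ 2 $ 1 +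
        X t $ 1 $ 3 * X t $ 3 $ 2 * (e * ((x1 + x2) * X t $ 2 $ 1 + X t $ 2 $ 3 * X t $ 3 $ 1) * (a1 - a2))) (at t)"
      (is "(_ has_real_derivative ?E) _")
      unfolding vX_def by (intro DERIV_cong[OF DERIV_mult[OF DERIV_mult[OF d_entries(3) d_entries(6)] d_entries(2)]])
        (simp add: algebra_simps)
    moreover have "?E = - (e * (\<sigma> * \<sigma>) * (((a2 - a3) * x1 + (a3 - a1) * x2 + (a1 - a2) * x3) * vX (X t) -
       ((a2 - a3) * P2 ?s * P3 ?s + (a3 - a1) * P1 ?s * P3 ?s + (a1 - a2) * P1 ?s * P2 ?s)))"
      unfolding T_entries(4-6)[symmetric] vX_def s2 by (simp add: algebra_simps)
    moreover have "\<dots> = - (e * \<sigma> * (\<kappa> * vX (X t) - Q))"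
      unfolding \<kappa>_def w_def Q_def by (simp add: algebra_simps)
    ultimately show ?thesis by (simp only:)
  qed
  have "e * \<sigma> * (\<kappa> * uX (X t) - Q) - - (e * \<sigma> * (\<kappa> * vX (X t) - Q)) = e * \<sigma> * (\<kappa> * (uX (X t) + vX (X t)) - 2 * Q)"
    by (simp add: algebra_simps)
  also have "\<dots> = e * \<sigma> * (D' ?s / 2)" unfolding T_entries(7) D'_def Q_def by (simp add: field_simps)
  finally show ?thesis by (rule DERIV_cong[OF DERIV_diff[OF u v]])
qed

end

lemma products_bounded:
  fixes X :: "real \<Rightarrow> real^3^3"
  assumes T: "\<And>t. t \<in> I \<Longrightarrow> X t \<in> T" and s: "\<And>t. t \<in> I \<Longrightarrow> \<bar>sX (X t)\<bar> \<le> M"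
  shows "\<exists>C. \<forall>t\<in>I. \<forall>i j. \<bar>X t $ i $ j * X t $ j $ i\<bar> \<le> C"
proof (intro exI ballI allI)
  fix t i j assume t: "t \<in> I"
  let ?C = "x1\<^sup>2 + x2\<^sup>2 + x3\<^sup>2 + (\<bar>q1\<bar> + M * \<bar>w1\<bar>) + (\<bar>q2\<bar> + M * \<bar>w2\<bar>) + (\<bar>q3\<bar> + M * \<bar>w3\<bar>)"
  have M: "M \<ge> 0" using s[OF t] by simp
  have b: "\<bar>q + sX (X t) * w\<bar> \<le> \<bar>q\<bar> + M * \<bar>w\<bar>" for q w
    using abs_triangle_ineq[of q "sX (X t) * w"] mult_right_mono[OF s[OF t], of "\<bar>w\<bar>"] by (simp add: abs_mult)
  have n: "x1\<^sup>2 \<ge> 0" "x2\<^sup>2 \<ge> 0" "x3\<^sup>2 \<ge> 0" "\<bar>q1\<bar> + M * \<bar>w1\<bar> \<ge> 0" "\<bar>q2\<bar> + M * \<bar>w2\<bar> \<ge> 0" "\<bar>q3\<bar> + M * \<bar>w3\<bar> \<ge> 0"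
    using M by simp_all
  have X: "X t $ 1 $ 1 = x1" "X t $ 2 $ 2 = x2" "X t $ 3 $ 3 = x3"
    "X t $ 2 $ 3 * X t $ 3 $ 2 = q1 + sX (X t) * w1" "X t $ 1 $ 3 * X t $ 3 $ 1 = q2 + sX (X t) * w2"
    "X t $ 1 $ 2 * X t $ 2 $ 1 = q3 + sX (X t) * w3"
    using T[OF t] T_iff unfolding P1_def P2_def P3_def by metis+
  have X': "X t $ 3 $ 2 * X t $ 2 $ 3 = q1 + sX (X t) * w1" "X t $ 3 $ 1 * X t $ 1 $ 3 = q2 + sX (X t) * w2"
    "X t $ 2 $ 1 * X t $ 1 $ 2 = q3 + sX (X t) * w3"
    using X(4-6) by (simp_all add: mult.commute)
  have d: "\<bar>X t $ 1 $ 1 * X t $ 1 $ 1\<bar> = x1\<^sup>2" "\<bar>X t $ 2 $ 2 * X t $ 2 $ 2\<bar> = x2\<^sup>2" "\<bar>X t $ 3 $ 3 * X t $ 3 $ 3\<bar> = x3\<^sup>2"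
    using X(1-3) by (simp_all add: power2_eq_square)
  show "\<bar>X t $ i $ j * X t $ j $ i\<bar> \<le> ?C"
    using exhaust_3[of i] exhaust_3[of j]
    by (elim disjE; simp only: X(4-6) X' d; use n b[of q1 w1] b[of q2 w2] b[of q3 w3] in linarith)
qed

text \<open>At a finite end the solution is unbounded. If \<open>s\<close> stayed bounded, so would
  the products of opposite entries, and these control all entries over a bounded time.\<close>

lemma unbounded_sX:
  assumes X: "maximal_ode_solution (\<lambda>X. e *\<^sub>R vfield av X) J X" and T: "X ` J \<subseteq> T"
    and t0: "t0 \<in> J" and bdd: "bdd_above J"
  shows "\<not> (\<exists>M. \<forall>t\<in>J \<inter> {t0..}. \<bar>sX (X t)\<bar> \<le> M)"
proof
  assume "\<exists>M. \<forall>t\<in>J \<inter> {t0..}. \<bar>sX (X t)\<bar> \<le> M"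
  then obtain M where "\<And>t. t \<in> J \<inter> {t0..} \<Longrightarrow> \<bar>sX (X t)\<bar> \<le> M" by blast
  then obtain C where C: "\<forall>t\<in>J \<inter> {t0..}. \<forall>i j. \<bar>X t $ i $ j * X t $ j $ i\<bar> \<le> C"
    using products_bounded[of "J \<inter> {t0..}" X M] T by auto
  have J: "is_interval J" "\<And>t. t \<in> J \<Longrightarrow> (X has_vector_derivative e *\<^sub>R vfield av (X t)) (at t)"
    using X by (auto simp: maximal_ode_solution_def ode_solution_def)
  have "bounded (X ` (J \<inter> {t0..}))"
  proof (rule bounded_products_imp_bounded[of _ X e av t0 C])
    show "is_interval (J \<inter> {t0..})" using J(1) by (intro is_interval_Int is_interval_ci)
    show "bdd_above (J \<inter> {t0..})" using bdd by (rule bdd_above_mono) auto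
  qed (use J t0 C in auto)
  then show False
    using maximal_solution_unbounded_right[OF locally_lipschitz_vfield X t0 bdd] by simp
qed

lemma global_if_bounded_sX:
  assumes X: "maximal_ode_solution (\<lambda>X. e *\<^sub>R vfield av X) J X" and T: "X ` J \<subseteq> T"
    and s: "\<And>t. t \<in> J \<Longrightarrow> \<bar>sX (X t)\<bar> \<le> M"
  shows "J = UNIV"
proof -
  have J: "is_interval J" "J \<noteq> {}" using X by (auto simp: maximal_ode_solution_def ode_solution_def)
  then obtain t0 where t0: "t0 \<in> J" by blast
  have above: "\<not> bdd_above J" using unbounded_sX[OF X T t0] s by blast
  have X': "maximal_ode_solution (\<lambda>X. (- e) *\<^sub>R vfield av X) (uminus ` J) (\<lambda>t. X (- t))"
    using maximal_ode_solution_reflect[OF X] by simp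
  have "(\<lambda>t. X (- t)) ` (uminus ` J) \<subseteq> T" using T by (auto simp: image_image)
  moreover have "\<forall>t\<in>uminus ` J \<inter> {- t0..}. \<bar>sX (X (- t))\<bar> \<le> M" using s by auto
  moreover have "- t0 \<in> uminus ` J" using t0 by simp
  ultimately have "\<not> bdd_above (uminus ` J)"
    using unbounded_sX[OF X', of "- t0"] by blast
  then have below: "\<not> bdd_below J" by (simp add: bdd_above_uminus)
  show ?thesis
  proof (intro equalityI subsetI)
    fix t :: real
    obtain u where "u \<in> J" "t \<le> u" using above unfolding bdd_above_def by (meson linear)
    moreover obtain l where "l \<in> J" "l \<le> t" using below unfolding bdd_below_def by (meson linear)
    ultimately show "t \<in> J" using mem_is_interval_1_I[OF J(1)] by blast
  qed simp
qed

end

section \<open>Blow-up on the unbounded branch\<close>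

context factored_spectral
begin

text \<open>This bound gives the branch parameter a speed of at least a constant times one plus its
  square, which forces it to reach infinity in finite time.\<close>

lemma hq_growth: "\<exists>k>0. \<forall>r\<ge>0. k * (1 + r)\<^sup>2 \<le> hq (s3 + r)"
proof -
  define b' where "b' = 2 * s3 + b"
  define c' where "c' = hq s3"
  have hq: "hq (s3 + r) = r\<^sup>2 + b' * r + c'" for r
    by (simp add: hq_def b'_def c'_def algebra_simps power2_eq_square)
  have "c' > 0" using h_pos[of s3] by (simp add: c'_def hq_def)
  \<comment> \<open>Beyond \<open>R\<close> the linear term of the quadratic is at most half of its
    leading term.\<close>
  define R where "R = 1 + 2 * \<bar>b'\<bar>"
  have "R > 0" by (simp add: R_def)
  have "continuous_on {0..R} (\<lambda>r. hq (s3 + r))" unfolding hq by (intro continuous_intros)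
  then obtain r0 where r0: "r0 \<in> {0..R}" "\<And>r. r \<in> {0..R} \<Longrightarrow> hq (s3 + r0) \<le> hq (s3 + r)"
    using continuous_attains_inf[of "{0..R}" "\<lambda>r. hq (s3 + r)"] \<open>R > 0\<close> by auto
  define m where "m = hq (s3 + r0)"
  have "m > 0" using h_pos[of "s3 + r0"] r0(1) by (simp add: m_def hq_def)
  \<comment> \<open>Beyond \<open>R\<close> the value is at least \<open>r\<^sup>2 / 2\<close> and
    \<open>(1 + r)\<^sup>2 \<le> 4 * r\<^sup>2\<close>, whence 1/8; up to \<open>R\<close> the
    minimum \<open>m\<close> is compared with the largest value of
    \<open>(1 + r)\<^sup>2\<close>.\<close>
  define k where "k = min (1 / 8) (m / (1 + R)\<^sup>2)"
  have "k > 0" using \<open>m > 0\<close> \<open>R > 0\<close> by (simp add: k_def)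
  moreover have "k * (1 + r)\<^sup>2 \<le> hq (s3 + r)" if r: "r \<ge> 0" for r
  proof (cases "r \<le> R")
    case True
    have "(1 + r)\<^sup>2 \<le> (1 + R)\<^sup>2" using True r by (intro power_mono) auto
    then have "k * (1 + r)\<^sup>2 \<le> (m / (1 + R)\<^sup>2) * (1 + R)\<^sup>2"
      using \<open>m > 0\<close> \<open>R > 0\<close> by (intro mult_mono) (auto simp: k_def)
    also have "\<dots> = m" using \<open>R > 0\<close> by simp
    also have "\<dots> \<le> hq (s3 + r)" unfolding m_def using r0(2) True r by simp
    finally show ?thesis .
  next
    case False
    then have r1: "r \<ge> 1" "2 * \<bar>b'\<bar> \<le> r" by (simp_all add: R_def)
    have "- b' * r \<le> (r / 2) * r" using r1 by (intro mult_right_mono) auto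
    then have "r\<^sup>2 / 2 \<le> hq (s3 + r)" using \<open>c' > 0\<close> unfolding hq by (simp add: power2_eq_square)
    moreover have "(1 + r)\<^sup>2 \<le> (2 * r)\<^sup>2" using r1 by (intro power_mono) auto
    then have "(1 / 8) * (1 + r)\<^sup>2 \<le> r\<^sup>2 / 2" by (simp add: power_mult_distrib)
    moreover have "k \<le> 1 / 8" unfolding k_def by (rule min.cobounded1)
    then have "k * (1 + r)\<^sup>2 \<le> (1 / 8) * (1 + r)\<^sup>2" by (rule mult_right_mono) simp
    ultimately show ?thesis by linarith
  qed
  ultimately show ?thesis by blast
qed

lemma D'_factored: "D' s = 4 * W * (hq s + (s - s3) * (2 * s + b))"
proof -
  have "(D has_real_derivative 4 * W * (hq s + (s - s3) * (2 * s + b))) (at s)"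
    unfolding D_factored[abs_def] hq_def
    by (rule derivative_eq_intros refl | simp add: algebra_simps)+
  then show ?thesis using D_derivative DERIV_unique by blast
qed

lemma sX_\<tau>: "X \<in> T \<Longrightarrow> sX X \<ge> s3 \<Longrightarrow> sX X = s3 + (\<tau> X)\<^sup>2"
proof -
  assume "X \<in> T" "sX X \<ge> s3"
  then obtain t where "sX X = lineS t" "uX X = lineU t" "vX X = lineV t"
    using line_surj[OF T_on_E] by blast
  then show ?thesis using \<tau>_eq by (simp add: lineS_def)
qed

text \<open>The derivative of \<open>s\<close> vanishes at \<open>s3\<close>, but in the parameter
  \<open>\<tau>\<close> there is no turning point: it passes 0 with nonzero speed when
  \<open>e\<close> is 1 or -1. The relation \<open>s = s3 + \<tau>\<^sup>2\<close> says nothing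
  about that moment, so the quotient defining \<open>\<tau>\<close> is differentiated
  directly.\<close>

lemma \<tau>_derivative:
  assumes X: "(X has_vector_derivative e *\<^sub>R vfield av (X t)) (at t)" and T: "X t \<in> T" "sX (X t) \<ge> s3"
  shows "((\<lambda>t. \<tau> (X t)) has_real_derivative e * \<sigma> * sqrt (W * hq (sX (X t)))) (at t)"
proof -
  define s where "s = sX (X t)"
  define y where "y = uX (X t) - vX (X t)"
  define r where "r = sqrt (W * hq s)"
  have pos: "W * hq s > 0" using Wh_pos T(2) by (simp add: s_def)
  then have r: "r > 0" "r\<^sup>2 = W * hq s" by (simp_all add: r_def)
  have y2: "y\<^sup>2 = 4 * (s - s3) * r\<^sup>2"
    using on_E_discriminant[OF T_on_E[OF T(1)]] unfolding r(2) y_def s_def D_factored hq_def by simp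
  have dh: "((\<lambda>t. W * hq (sX (X t))) has_real_derivative W * ((2 * s + b) * (e * \<sigma> * y))) (at t)"
    unfolding hq_def s_def y_def
    by (rule derivative_eq_intros sX_derivative[OF X T(1)] refl | simp)+ (simp add: algebra_simps)
  have dr: "((\<lambda>t. sqrt (W * hq (sX (X t)))) has_real_derivative W * ((2 * s + b) * (e * \<sigma> * y)) * (inverse r / 2)) (at t)"
  proof -
    have "(sqrt has_real_derivative inverse r / 2) (at (W * hq (sX (X t))))"
      using DERIV_real_sqrt[OF pos] by (simp only: r_def s_def)
    from DERIV_chain2[OF this dh] show ?thesis by (simp only: mult.commute)
  qed
  have "((\<lambda>t. \<tau> (X t)) has_real_derivative
      (e * \<sigma> * (D' s / 2) * (2 * r) - y * (2 * (W * ((2 * s + b) * (e * \<sigma> * y)) * (inverse r / 2)))) / ((2 * r) * (2 * r))) (at t)"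
  proof -
    have "2 * sqrt (W * hq (sX (X t))) \<noteq> 0" using r(1) unfolding r_def s_def by linarith
    from DERIV_divide[OF y_derivative[OF X T(1)] DERIV_cmult[OF dr] this] show ?thesis
      unfolding \<tau>_def r_def s_def y_def .
  qed
  moreover have "(e * \<sigma> * (D' s / 2) * (2 * r) - y * (2 * (W * ((2 * s + b) * (e * \<sigma> * y)) * (inverse r / 2)))) / ((2 * r) * (2 * r))
      = e * \<sigma> * r"
  proof -
    have "y * (2 * (W * (q * (e * \<sigma> * y)) * (inverse r / 2))) = e * \<sigma> * W * q * (y\<^sup>2) / r" for q
      using r(1) by (simp add: power2_eq_square field_simps)
    then have "y * (2 * (W * ((2 * s + b) * (e * \<sigma> * y)) * (inverse r / 2))) = e * \<sigma> * W * (2 * s + b) * (y\<^sup>2) / r" .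
    also have "\<dots> = e * \<sigma> * (4 * W * (s - s3) * (2 * s + b)) * r"
      unfolding y2 using r(1) by (simp add: power2_eq_square)
    finally have 1: "y * (2 * (W * ((2 * s + b) * (e * \<sigma> * y)) * (inverse r / 2))) = e * \<sigma> * (4 * W * (s - s3) * (2 * s + b)) * r" .
    have D': "D' s = 4 * r\<^sup>2 + 4 * W * (s - s3) * (2 * s + b)"
      unfolding D'_factored r(2) by (simp add: algebra_simps)
    have "e * \<sigma> * ((x + z) / 2) * (2 * r) = e * \<sigma> * x * r + e * \<sigma> * z * r" for x z
      by (simp add: algebra_simps)
    then have "e * \<sigma> * (D' s / 2) * (2 * r) = e * \<sigma> * (4 * r\<^sup>2) * r + e * \<sigma> * (4 * W * (s - s3) * (2 * s + b)) * r"
      unfolding D' .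
    then show ?thesis unfolding 1 using r(1) by (simp add: power2_eq_square)
  qed
  ultimately show ?thesis by (simp add: r_def s_def)
qed

lemma line_solution_right:
  assumes X: "maximal_ode_solution (\<lambda>X. e *\<^sub>R vfield av X) J X" and T: "X ` J \<subseteq> {X \<in> T. sX X \<ge> s3}"
    and e: "e \<in> {1, -1}"
  shows "bdd_above J \<and> filterlim (\<lambda>t. norm (X t)) at_top (at_left (Sup J))"
proof -
  have J: "is_interval J" "J \<noteq> {}" "\<And>t. t \<in> J \<Longrightarrow> (X has_vector_derivative e *\<^sub>R vfield av (X t)) (at t)"
    using X by (auto simp: maximal_ode_solution_def ode_solution_def)
  then obtain t0 where t0: "t0 \<in> J" by blast
  have XT: "X t \<in> T" "sX (X t) \<ge> s3" if "t \<in> J" for t using T that by auto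
  define \<epsilon> where "\<epsilon> = e * \<sigma>"
  have \<epsilon>: "\<epsilon> \<in> {1, -1}" using e \<sigma> by (auto simp: \<epsilon>_def)
  have \<epsilon>2: "\<epsilon> * \<epsilon> = 1" using \<epsilon> by auto
  \<comment> \<open>The sign makes the branch parameter increasing in time.\<close>
  define \<phi> where "\<phi> t = \<epsilon> * \<tau> (X t)" for t
  have s\<phi>: "sX (X t) = s3 + (\<phi> t)\<^sup>2" if "t \<in> J" for t
    using sX_\<tau>[OF XT[OF that]] \<epsilon> by (auto simp: \<phi>_def)
  have d\<phi>: "(\<phi> has_real_derivative sqrt (W * hq (s3 + (\<phi> t)\<^sup>2))) (at t)" if "t \<in> J" for t
  proof -
    have "(\<phi> has_real_derivative \<epsilon> * (e * \<sigma> * sqrt (W * hq (sX (X t))))) (at t)"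
      unfolding \<phi>_def[abs_def] by (rule DERIV_cmult[OF \<tau>_derivative[OF J(3) XT]]; fact)
    moreover have "\<epsilon> * (e * \<sigma> * sqrt (W * hq (sX (X t)))) = (\<epsilon> * \<epsilon>) * sqrt (W * hq (s3 + (\<phi> t)\<^sup>2))"
      unfolding s\<phi>[OF that] by (simp add: \<epsilon>_def mult.assoc)
    ultimately show ?thesis by (simp add: \<epsilon>2)
  qed
  obtain k where k: "k > 0" "\<And>r. r \<ge> 0 \<Longrightarrow> k * (1 + r)\<^sup>2 \<le> hq (s3 + r)" using hq_growth by blast
  define k' where "k' = sqrt (W * k)"
  have k': "k' > 0" using W_pos k(1) by (simp add: k'_def)
  have speed: "k' * (1 + x\<^sup>2) \<le> sqrt (W * hq (s3 + x\<^sup>2))" for x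
  proof -
    have "(k' * (1 + x\<^sup>2))\<^sup>2 = W * (k * (1 + x\<^sup>2)\<^sup>2)"
      using W_pos k(1) by (simp add: k'_def power_mult_distrib)
    also have "\<dots> \<le> W * hq (s3 + x\<^sup>2)" using W_pos k(2)[of "x\<^sup>2"] by simp
    finally show ?thesis by (rule real_le_rsqrt)
  qed
  \<comment> \<open>\<open>arctan (\<phi> t)\<close> increases at least at the rate
    \<open>k'\<close> but stays bounded, so the remaining lifetime is finite.\<close>
  have grow: "k' * (t2 - t1) \<le> arctan (\<phi> t2) - arctan (\<phi> t1)" if t: "t1 \<in> J" "t2 \<in> J" "t1 \<le> t2" for t1 t2
  proof -
    have "arctan (\<phi> t1) - k' * t1 \<le> arctan (\<phi> t2) - k' * t2"
    proof (rule DERIV_nonneg_imp_nondecreasing[OF t(3)])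
      fix t assume "t1 \<le> t" "t \<le> t2"
      then have tJ: "t \<in> J" using mem_is_interval_1_I[OF J(1) t(1,2)] by blast
      have "((\<lambda>t. arctan (\<phi> t) - k' * t) has_real_derivative
          inverse (1 + (\<phi> t)\<^sup>2) * sqrt (W * hq (s3 + (\<phi> t)\<^sup>2)) - k') (at t)"
        by (rule derivative_eq_intros DERIV_chain2[OF DERIV_arctan d\<phi>[OF tJ]] refl | simp)+
      moreover have "k' \<le> inverse (1 + (\<phi> t)\<^sup>2) * sqrt (W * hq (s3 + (\<phi> t)\<^sup>2))"
      proof -
        have p: "1 + (\<phi> t)\<^sup>2 > 0" by (simp add: add_pos_nonneg)
        then show ?thesis using speed[of "\<phi> t"] by (simp add: field_simps)
      qed
      ultimately show "\<exists>y. ((\<lambda>t. arctan (\<phi> t) - k' * t) has_real_derivative y) (at t) \<and> 0 \<le> y" by auto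
    qed
    then show ?thesis by (simp add: algebra_simps)
  qed
  have bdd: "bdd_above J"
  proof (rule bdd_aboveI)
    fix t assume t: "t \<in> J"
    show "t \<le> \<bar>t0\<bar> + pi / k'"
    proof (cases "t0 \<le> t")
      case True
      have "k' * (t - t0) \<le> pi"
        using grow[OF t0 t True] arctan_ubound[of "\<phi> t"] arctan_lbound[of "\<phi> t0"] by simp
      then have "t - t0 \<le> pi / k'" using k' by (simp add: field_simps)
      then show ?thesis by simp
    next
      case False
      have "0 \<le> pi / k'" using k' by simp
      then show ?thesis using False by simp
    qed
  qed
  have mono: "\<phi> t1 \<le> \<phi> t2" if t: "t1 \<in> J" "t2 \<in> J" "t1 \<le> t2" for t1 t2
  proof -
    have "k' * (t2 - t1) \<ge> 0" using k' t by simp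
    then show ?thesis using grow[OF t] arctan_le_iff[of "\<phi> t1" "\<phi> t2"] by linarith
  qed
  \<comment> \<open>If \<open>\<phi>\<close> stayed below \<open>M\<close>, monotonicity would bound
    it on both sides after \<open>t0\<close>, hence also \<open>s = s3 + \<phi>\<^sup>2\<close>,
    which \<open>unbounded_sX\<close> forbids.\<close>
  have unb: "\<exists>t1\<in>J. M \<le> \<phi> t1" for M
  proof (rule ccontr)
    assume neg: "\<not> (\<exists>t1\<in>J. M \<le> \<phi> t1)"
    have "\<bar>sX (X t)\<bar> \<le> \<bar>s3\<bar> + (\<bar>M\<bar> + \<bar>\<phi> t0\<bar>)\<^sup>2" if "t \<in> J \<inter> {t0..}" for t
    proof -
      have t: "t \<in> J" "t0 \<le> t" using that by auto
      have "\<bar>\<phi> t\<bar> \<le> \<bar>M\<bar> + \<bar>\<phi> t0\<bar>" using neg t(1) mono[OF t0 t] by fastforce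
      then have "(\<phi> t)\<^sup>2 \<le> (\<bar>M\<bar> + \<bar>\<phi> t0\<bar>)\<^sup>2" by (simp add: abs_le_square_iff[symmetric])
      then show ?thesis unfolding s\<phi>[OF t(1)]
        using abs_triangle_ineq[of s3 "(\<phi> t)\<^sup>2"] by simp
    qed
    then show False using unbounded_sX[OF X _ t0 bdd] T by blast
  qed
  have "filterlim (\<lambda>t. norm (X t)) at_top (at_left (Sup J))"
    unfolding filterlim_at_top
  proof
    fix Z :: real
    \<comment> \<open>As soon as \<open>\<phi>\<^sup>2 \<ge> M\<close>, the product
      \<open>X\<^sub>2\<^sub>3 X\<^sub>3\<^sub>2 = P1 s\<close> has modulus at least
      \<open>Z\<^sup>2\<close>. The summand 1 gives \<open>M \<ge> 1\<close>, so that
      \<open>\<phi> \<ge> M\<close> implies \<open>\<phi>\<^sup>2 \<ge> M\<close>.\<close>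
    define M where "M = 1 + (\<bar>q1\<bar> + \<bar>w1\<bar> * \<bar>s3\<bar> + Z\<^sup>2) / \<bar>w1\<bar>"
    have w: "\<bar>w1\<bar> > 0" using w_nonzero by simp
    have M1: "M \<ge> 1" using w by (simp add: M_def)
    obtain t1 where t1: "t1 \<in> J" "M \<le> \<phi> t1" using unb by blast
    have "t1 < Sup J"
    proof -
      obtain t2 where t2: "t2 \<in> J" "\<phi> t1 + 1 \<le> \<phi> t2" using unb by blast
      then have "t1 < t2" using mono[OF t2(1) t1(1)] by fastforce
      then show ?thesis using cSup_upper[OF t2(1) bdd] by linarith
    qed
    moreover have "Z \<le> norm (X t)" if t: "t1 < t" "t < Sup J" for t
    proof -
      obtain u where "u \<in> J" "t < u" using less_cSup_iff[OF J(2) bdd] t(2) by blast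
      then have tJ: "t \<in> J" using mem_is_interval_1_I[OF J(1) t1(1), of u t] t(1) by simp
      have "M \<le> \<phi> t" using t1 mono[OF t1(1) tJ] t(1) by simp
      moreover from this have "\<phi> t \<le> (\<phi> t)\<^sup>2" using M1 by (intro self_le_power) auto
      ultimately have "M \<le> (\<phi> t)\<^sup>2" by simp
      then have "\<bar>w1\<bar> * M \<le> \<bar>w1\<bar> * (\<phi> t)\<^sup>2" by (intro mult_left_mono) auto
      moreover have "\<bar>w1\<bar> * M = \<bar>w1\<bar> + (\<bar>q1\<bar> + \<bar>w1\<bar> * \<bar>s3\<bar> + Z\<^sup>2)"
        using w by (simp add: M_def field_simps)
      ultimately have big: "\<bar>q1\<bar> + \<bar>w1\<bar> * \<bar>s3\<bar> + Z\<^sup>2 \<le> \<bar>w1\<bar> * (\<phi> t)\<^sup>2" using w by linarith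
      have "X t $ 2 $ 3 * X t $ 3 $ 2 = q1 + (s3 + (\<phi> t)\<^sup>2) * w1"
        using XT(1)[OF tJ] T_iff[of "X t"] s\<phi>[OF tJ] by (simp add: P1_def)
      then have "(\<phi> t)\<^sup>2 * w1 = X t $ 2 $ 3 * X t $ 3 $ 2 - q1 - s3 * w1" by (simp add: algebra_simps)
      moreover have "\<bar>w1\<bar> * (\<phi> t)\<^sup>2 = \<bar>(\<phi> t)\<^sup>2 * w1\<bar>" "\<bar>w1\<bar> * \<bar>s3\<bar> = \<bar>s3 * w1\<bar>"
        by (simp_all add: abs_mult)
      moreover have "\<bar>x - y - z\<bar> \<le> \<bar>x\<bar> + \<bar>y\<bar> + \<bar>z\<bar>" for x y z :: real by linarith
      ultimately have "\<bar>w1\<bar> * (\<phi> t)\<^sup>2 \<le> \<bar>X t $ 2 $ 3 * X t $ 3 $ 2\<bar> + \<bar>q1\<bar> + \<bar>w1\<bar> * \<bar>s3\<bar>"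
        by metis
      then have "Z\<^sup>2 \<le> \<bar>X t $ 2 $ 3 * X t $ 3 $ 2\<bar>" using big by linarith
      also have "\<dots> \<le> norm (X t) * norm (X t)"
      proof -
        have "\<bar>X t $ i $ j\<bar> \<le> norm (X t)" for i j
          using component_le_norm_cart[of "X t $ i" j] Finite_Cartesian_Product.norm_nth_le[of "X t" i] by simp
        then show ?thesis unfolding abs_mult by (intro mult_mono) auto
      qed
      finally have "Z\<^sup>2 \<le> (norm (X t))\<^sup>2" by (simp add: power2_eq_square)
      then show ?thesis by (rule power2_le_imp_le) simp
    qed
    ultimately show "eventually (\<lambda>t. Z \<le> norm (X t)) (at_left (Sup J))"
      unfolding eventually_at_left_field by blast
  qed
  then show ?thesis using bdd by blast
qed

theorem line_blows_up:
  assumes X: "maximal_ode_solution (vfield av) J X" and T: "X ` J \<subseteq> {X \<in> T. sX X \<ge> s3}"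
  shows "blows_up J X"
proof -
  have X1: "maximal_ode_solution (\<lambda>X. 1 *\<^sub>R vfield av X) J X" using X by (simp add: eta_contract_eq)
  have X2: "maximal_ode_solution (\<lambda>X. (-1) *\<^sub>R vfield av X) (uminus ` J) (\<lambda>t. X (- t))"
    using maximal_ode_solution_reflect[OF X] by simp
  have T2: "(\<lambda>t. X (- t)) ` (uminus ` J) \<subseteq> {X \<in> T. sX X \<ge> s3}" using T by (auto simp: image_image)
  have r: "bdd_above J" "filterlim (\<lambda>t. norm (X t)) at_top (at_left (Sup J))"
    using line_solution_right[OF X1 T] by simp_all
  have l: "bdd_above (uminus ` J)" "filterlim (\<lambda>t. norm (X (- t))) at_top (at_left (Sup (uminus ` J)))"
    using line_solution_right[OF X2 T2] by simp_all
  have J: "open J" "is_interval J" "J \<noteq> {}" using X by (auto simp: maximal_ode_solution_def ode_solution_def)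
  have below: "bdd_below J" using l(1) by (simp add: bdd_above_uminus)
  have "Sup (uminus ` J) = - Inf J" by (simp add: Inf_real_def image_image)
  then have l2: "filterlim (\<lambda>t. norm (X t)) at_top (at_right (Inf J))"
    using l(2) by (simp add: filterlim_at_left_to_right)
  have "J = {Inf J<..<Sup J}"
  proof (intro equalityI subsetI)
    fix t assume t: "t \<in> J"
    obtain d where d: "d > 0" "ball t d \<subseteq> J" using J(1) t openE by blast
    then have "t + d / 2 \<in> J" "t - d / 2 \<in> J" by (auto simp: dist_real_def subset_iff)
    then show "t \<in> {Inf J<..<Sup J}"
      using cSup_upper[OF _ r(1), of "t + d / 2"] cInf_lower[OF _ below, of "t - d / 2"] d(1) by simp
  next
    fix t assume t: "t \<in> {Inf J<..<Sup J}"
    then obtain u l where "u \<in> J" "t < u" "l \<in> J" "l < t"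
      using less_cSup_iff[OF J(3) r(1)] cInf_less_iff[OF J(3) below] by (metis greaterThanLessThan_iff)
    then show "t \<in> J" using mem_is_interval_1_I[OF J(2), of l u t] by simp
  qed
  moreover have "Inf J < Sup J" using calculation J(3) by (metis greaterThanLessThan_empty_iff linorder_not_less)
  ultimately show ?thesis unfolding blows_up_def using r(2) l2 by blast
qed

end

lemma (in split_spectral) circle_global:
  assumes X: "maximal_ode_solution (vfield av) J X" and T: "X ` J \<subseteq> {X \<in> T. sX X \<le> s2}"
  shows "J = UNIV"
proof (rule global_if_bounded_sX)
  show "maximal_ode_solution (\<lambda>X. 1 *\<^sub>R vfield av X) J X" using X by (simp add: eta_contract_eq)
  show "X ` J \<subseteq> T" using T by auto
  show "\<bar>sX (X t)\<bar> \<le> \<bar>s1\<bar> + \<bar>s2\<bar>" if "t \<in> J" for t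
  proof -
    have XT: "X t \<in> T" "sX (X t) \<le> s2" using T that by auto
    then obtain r where "sX (X t) = circS r" using circ_surj[OF T_on_E] by blast
    then have "s1 \<le> sX (X t)" using circS_le(2)[of r] by simp
    then show ?thesis using XT(2) by linarith
  qed
qed

section \<open>Plane cubics\<close>

definition cubf :: "complex \<Rightarrow> complex \<Rightarrow> complex \<Rightarrow> complex \<Rightarrow> complex \<Rightarrow> complex \<Rightarrow> complex \<Rightarrow> complex \<Rightarrow> complex \<Rightarrow> complex
    \<Rightarrow> complex^3 \<Rightarrow> complex" where
  "cubf c300 c210 c120 c030 c201 c111 c021 c102 c012 c003 z =
    c300 * (z $ 1)^3 + c210 * (z $ 1)^2 * z $ 2 + c120 * z $ 1 * (z $ 2)^2 + c030 * (z $ 2)^3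
    + (c201 * (z $ 1)^2 + c111 * z $ 1 * z $ 2 + c021 * (z $ 2)^2) * z $ 3
    + (c102 * z $ 1 + c012 * z $ 2) * (z $ 3)^2 + c003 * (z $ 3)^3"

lemma hpoly_3:
  "hpoly 3 c = cubf (c 3 0 0) (c 2 1 0) (c 1 2 0) (c 0 3 0) (c 2 0 1) (c 1 1 1) (c 0 2 1) (c 1 0 2) (c 0 1 2) (c 0 0 3)"
proof
  fix z
  have "{(i, j, k). i + j + k = 3} = {(3,0,0),(2,1,0),(1,2,0),(0,3,0),(2,0,1),(1,1,1),(0,2,1),(1,0,2),(0,1,2),(0,0,3::nat)}"
    (is "?A = ?B")
  proof (intro equalityI subsetI)
    fix t :: "nat \<times> nat \<times> nat" assume "t \<in> ?A"
    then obtain i j k where t: "t = (i, j, k)" "i + j + k = 3" by auto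
    have "i = 0 \<or> i = 1 \<or> i = 2 \<or> i = 3" "j = 0 \<or> j = 1 \<or> j = 2 \<or> j = 3" using t(2) by arith+
    then show "t \<in> ?B" using t by (elim disjE) simp_all
  qed auto
  then show "hpoly 3 c z = cubf (c 3 0 0) (c 2 1 0) (c 1 2 0) (c 0 3 0) (c 2 0 1) (c 1 1 1) (c 0 2 1) (c 1 0 2) (c 0 1 2) (c 0 0 3) z"
    by (simp add: hpoly_def cubf_def algebra_simps)
qed

lemma hpoly_scale: "hpoly d c (k *s z) = k ^ d * hpoly d c z"
proof -
  have "c i j l * ((k *s z) $ 1) ^ i * ((k *s z) $ 2) ^ j * ((k *s z) $ 3) ^ l =
      k ^ d * (c i j l * (z $ 1) ^ i * (z $ 2) ^ j * (z $ 3) ^ l)" if "i + j + l = d" for i j l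
    unfolding that[symmetric] by (simp add: power_mult_distrib power_add mult_ac)
  then show ?thesis
    unfolding hpoly_def sum_distrib_left by (intro sum.cong) auto
qed

lemma zero_locus_iff:
  assumes "\<And>k z. F (k *s z) = k ^ d * F z" "z \<noteq> 0"
  shows "hpoint z \<in> zero_locus F \<longleftrightarrow> F z = 0"
proof
  assume "hpoint z \<in> zero_locus F"
  then obtain w where w: "hpoint z = hpoint w" "w \<noteq> 0" "F w = 0" by (auto simp: zero_locus_def)
  then obtain k where "z = k *s w" using hpoint_eq_iff[of w z] assms(2) by metis
  then show "F z = 0" using assms(1) w by simp
qed (use assms(2) in \<open>auto simp: zero_locus_def\<close>)

lemma cubf_scale:
  "cubf c300 c210 c120 c030 c201 c111 c021 c102 c012 c003 (k *s z) =
    k ^ 3 * cubf c300 c210 c120 c030 c201 c111 c021 c102 c012 c003 z"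
  by (simp add: cubf_def algebra_simps power2_eq_square power3_eq_cube)

lemma zero_locus_eqI:
  assumes "\<And>z. z \<noteq> 0 \<Longrightarrow> F z = 0 \<longleftrightarrow> G z = 0" shows "zero_locus F = zero_locus G"
  using assms by (auto simp: zero_locus_def)

lemma monic_cubic_root:
  fixes A B C :: complex
  shows "\<exists>r1 r2 r3. \<forall>y. y^3 + A * y^2 + B * y + C = (y - r1) * (y - r2) * (y - r3)"
proof -
  have "\<not> constant (poly [:C, B, A, 1:])" by (simp add: constant_degree)
  then obtain r where r: "poly [:C, B, A, 1:] r = 0" using fundamental_theorem_of_algebra by blast
  then have "r^3 + A * r^2 + B * r + C = 0"
    by (simp add: algebra_simps power2_eq_square power3_eq_cube)
  then have C: "C = - (r^3 + A * r^2 + B * r)" by algebra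
  define p where "p = A + r"
  define q where "q = B + r * p"
  have 1: "y^3 + A * y^2 + B * y + C = (y - r) * (y\<^sup>2 + p * y + q)" for y
    by (simp add: C p_def q_def algebra_simps power2_eq_square power3_eq_cube)
  define e where "e = csqrt (p\<^sup>2 - 4 * q)"
  have e: "e\<^sup>2 = p\<^sup>2 - 4 * q" by (simp add: e_def)
  have "y\<^sup>2 + p * y + q = (y - (- p + e) / 2) * (y - (- p - e) / 2)" for y
  proof -
    have "(y - (- p + e) / 2) * (y - (- p - e) / 2) = y\<^sup>2 + p * y + (p\<^sup>2 - e\<^sup>2) / 4"
      by (simp add: field_simps power2_eq_square)
    then show ?thesis by (simp add: e)
  qed
  then show ?thesis using 1 by (metis mult.assoc)
qed

text \<open>The value is the product of the differences to the three roots; if all of these had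
  modulus at least \<open>\<delta>\<close>, the value would have modulus at least
  \<open>\<delta>^3\<close>.\<close>

lemma root_near:
  fixes A B C \<alpha> :: complex
  assumes "\<delta> > 0" "cmod (\<alpha>^3 + A * \<alpha>^2 + B * \<alpha> + C) < \<delta>^3"
  shows "\<exists>y. y^3 + A * y^2 + B * y + C = 0 \<and> cmod (\<alpha> - y) < \<delta>"
proof -
  obtain r1 r2 r3 where r: "\<And>y. y^3 + A * y^2 + B * y + C = (y - r1) * (y - r2) * (y - r3)"
    using monic_cubic_root by blast
  show ?thesis
  proof (rule ccontr)
    assume "\<not> ?thesis"
    then have "cmod (\<alpha> - r1) \<ge> \<delta>" "cmod (\<alpha> - r2) \<ge> \<delta>" "cmod (\<alpha> - r3) \<ge> \<delta>"
      using r by (auto simp: not_less)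
    then have "\<delta> * \<delta> * \<delta> \<le> cmod (\<alpha> - r1) * cmod (\<alpha> - r2) * cmod (\<alpha> - r3)"
      using assms(1) by (intro mult_mono mult_nonneg_nonneg) auto
    then show False using assms(2) unfolding r by (simp add: norm_mult power3_eq_cube)
  qed
qed

lemma quadratic_three_roots:
  fixes e0 e1 e2 :: complex
  assumes "y1 \<noteq> y2" "y1 \<noteq> y3" "y2 \<noteq> y3" "\<And>y. y \<in> {y1, y2, y3} \<Longrightarrow> e2 * y\<^sup>2 + e1 * y + e0 = 0"
  shows "e2 = 0 \<and> e1 = 0 \<and> e0 = 0"
proof -
  have e: "e2 * y1\<^sup>2 + e1 * y1 + e0 = 0" "e2 * y2\<^sup>2 + e1 * y2 + e0 = 0" "e2 * y3\<^sup>2 + e1 * y3 + e0 = 0"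
    using assms(4) by auto
  have "(y1 - y2) * (e2 * (y1 + y2) + e1) = 0" "(y1 - y3) * (e2 * (y1 + y3) + e1) = 0"
    using e by algebra+
  then have e': "e2 * (y1 + y2) + e1 = 0" "e2 * (y1 + y3) + e1 = 0" using assms by auto
  then have "e2 * (y2 - y3) = 0" by algebra
  then have "e2 = 0" using assms by simp
  then show ?thesis using e e' by simp
qed

lemma cubic_vanishing_near_0:
  fixes p0 p1 p2 p3 :: complex
  assumes "\<eta> > 0" "\<And>\<epsilon>::real. 0 < \<epsilon> \<Longrightarrow> \<epsilon> < \<eta> \<Longrightarrow> p0 + p1 * of_real \<epsilon> + p2 * of_real \<epsilon> ^ 2 + p3 * of_real \<epsilon> ^ 3 = 0"
  shows "p0 = 0 \<and> p1 = 0 \<and> p2 = 0 \<and> p3 = 0"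
proof (rule ccontr)
  assume "\<not> ?thesis"
  then have "[:p0, p1, p2, p3:] \<noteq> 0" by auto
  then have "finite {x. poly [:p0, p1, p2, p3:] x = 0}" by (rule poly_roots_finite)
  moreover have "complex_of_real ` {0<..<\<eta>} \<subseteq> {x. poly [:p0, p1, p2, p3:] x = 0}"
    using assms(2) by (auto simp: algebra_simps power2_eq_square power3_eq_cube)
  ultimately have "finite (complex_of_real ` {0<..<\<eta>})" by (rule rev_finite_subset)
  then have "finite {0<..<\<eta>}" by (rule finite_imageD) (simp add: inj_on_def)
  then show False using infinite_Ioo[OF assms(1)] by contradiction
qed

text \<open>On the lines \<open>z\<^sub>1 = 1, z\<^sub>3 = \<epsilon>\<close> close to the line at infinity the first cubic has three distinct
  zeros, so the inclusion of zero sets forces the two cubics to agree there.\<close>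

lemma cubic_determined_by_zeros:
  assumes \<alpha>: "\<alpha>1 \<noteq> \<alpha>2" "\<alpha>1 \<noteq> \<alpha>3" "\<alpha>2 \<noteq> \<alpha>3"
    and root: "\<And>\<alpha>. \<alpha> \<in> {\<alpha>1, \<alpha>2, \<alpha>3} \<Longrightarrow> c300 + c210 * \<alpha> + c120 * \<alpha>\<^sup>2 - \<alpha>^3 = 0"
    and incl: "\<And>z. z \<noteq> 0 \<Longrightarrow> cubf c300 c210 c120 (-1) c201 c111 c021 c102 c012 c003 z = 0 \<Longrightarrow>
      cubf d300 d210 d120 (-1) d201 d111 d021 d102 d012 d003 z = 0"
  shows "d300 = c300 \<and> d210 = c210 \<and> d120 = c120 \<and> d201 = c201 \<and> d111 = c111 \<and> d021 = c021 \<and>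
    d102 = c102 \<and> d012 = c012 \<and> d003 = c003"
proof -
  \<comment> \<open>Half of the smallest distance, so that roots within \<open>\<delta>\<close> of
    different \<open>\<alpha>\<^sub>i\<close> are different.\<close>
  define \<delta> where "\<delta> = min (cmod (\<alpha>1 - \<alpha>2)) (min (cmod (\<alpha>1 - \<alpha>3)) (cmod (\<alpha>2 - \<alpha>3))) / 2"
  have \<delta>: "\<delta> > 0" "2 * \<delta> \<le> cmod (\<alpha>1 - \<alpha>2)" "2 * \<delta> \<le> cmod (\<alpha>1 - \<alpha>3)" "2 * \<delta> \<le> cmod (\<alpha>2 - \<alpha>3)"
    using \<alpha> by (simp_all add: \<delta>_def)
  define A where "A \<epsilon> = - (c120 + c021 * \<epsilon>)" for \<epsilon> :: complex
  define B where "B \<epsilon> = - (c210 + c111 * \<epsilon> + c012 * \<epsilon>^2)" for \<epsilon> :: complex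
  define C where "C \<epsilon> = - (c300 + c201 * \<epsilon> + c102 * \<epsilon>^2 + c003 * \<epsilon>^3)" for \<epsilon> :: complex
  have "\<exists>\<eta>::real. (0::real) < \<eta> \<and> (\<forall>\<epsilon>::real. (0::real) < \<epsilon> \<and> \<epsilon> < \<eta> \<longrightarrow> cmod (\<alpha>^3 + A (of_real \<epsilon>) * \<alpha>^2 + B (of_real \<epsilon>) * \<alpha> + C (of_real \<epsilon>)) < \<delta>^3)"
    if "\<alpha> \<in> {\<alpha>1, \<alpha>2, \<alpha>3}" for \<alpha>
  proof -
    let ?f = "\<lambda>\<epsilon>::real. cmod (\<alpha>^3 + A (of_real \<epsilon>) * \<alpha>^2 + B (of_real \<epsilon>) * \<alpha> + C (of_real \<epsilon>))"
    have "isCont ?f 0" unfolding A_def B_def C_def by (intro continuous_intros)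
    moreover have "?f 0 = cmod (- (c300 + c210 * \<alpha> + c120 * \<alpha>\<^sup>2 - \<alpha>^3))"
      by (simp add: A_def B_def C_def algebra_simps)
    then have "?f 0 = 0" unfolding root[OF that] by simp
    ultimately have "(?f \<longlongrightarrow> 0) (at 0)" by (simp add: isCont_def)
    then have "eventually (\<lambda>\<epsilon>. ?f \<epsilon> < \<delta>^3) (at 0)" using \<delta>(1) by (intro order_tendstoD) auto
    then obtain \<eta> where \<eta>: "\<eta> > 0" "\<And>\<epsilon>. \<epsilon> \<noteq> 0 \<Longrightarrow> dist \<epsilon> 0 < \<eta> \<Longrightarrow> ?f \<epsilon> < \<delta>^3"
      unfolding eventually_at by blast
    show ?thesis
    proof (rule exI, intro conjI allI impI)
      show "\<eta> > 0" by (rule \<eta>(1))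
      show "?f \<epsilon> < \<delta>^3" if "(0::real) < \<epsilon> \<and> \<epsilon> < \<eta>" for \<epsilon> using \<eta>(2)[of \<epsilon>] that by (simp add: dist_real_def)
    qed
  qed
  then have "\<forall>\<alpha>\<in>{\<alpha>1, \<alpha>2, \<alpha>3}. \<exists>\<eta>::real. (0::real) < \<eta> \<and>
      (\<forall>\<epsilon>::real. (0::real) < \<epsilon> \<and> \<epsilon> < \<eta> \<longrightarrow> cmod (\<alpha>^3 + A (of_real \<epsilon>) * \<alpha>^2 + B (of_real \<epsilon>) * \<alpha> + C (of_real \<epsilon>)) < \<delta>^3)"
    by (rule ballI)
  from bchoice[OF this] obtain \<eta> :: "complex \<Rightarrow> real" where \<eta>': "\<forall>\<alpha>\<in>{\<alpha>1, \<alpha>2, \<alpha>3}. (0::real) < \<eta> \<alpha> \<and>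
      (\<forall>\<epsilon>::real. (0::real) < \<epsilon> \<and> \<epsilon> < \<eta> \<alpha> \<longrightarrow> cmod (\<alpha>^3 + A (of_real \<epsilon>) * \<alpha>^2 + B (of_real \<epsilon>) * \<alpha> + C (of_real \<epsilon>)) < \<delta>^3)" ..
  have \<eta>: "\<And>\<alpha>. \<alpha> \<in> {\<alpha>1, \<alpha>2, \<alpha>3} \<Longrightarrow> \<eta> \<alpha> > 0"
    "\<And>\<alpha> \<epsilon>::real. \<alpha> \<in> {\<alpha>1, \<alpha>2, \<alpha>3} \<Longrightarrow> 0 < \<epsilon> \<Longrightarrow> \<epsilon> < \<eta> \<alpha> \<Longrightarrow> cmod (\<alpha>^3 + A (of_real \<epsilon>) * \<alpha>^2 + B (of_real \<epsilon>) * \<alpha> + C (of_real \<epsilon>)) < \<delta>^3"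
    using bspec[OF \<eta>'] by blast+
  define \<eta>0 where "\<eta>0 = min (\<eta> \<alpha>1) (min (\<eta> \<alpha>2) (\<eta> \<alpha>3))"
  have \<eta>0: "\<eta>0 > 0" "\<eta>0 \<le> \<eta> \<alpha>1" "\<eta>0 \<le> \<eta> \<alpha>2" "\<eta>0 \<le> \<eta> \<alpha>3" using \<eta>(1) by (simp_all add: \<eta>0_def)
  \<comment> \<open>Both cubics have coefficient -1 at the cube of the second coordinate, so on such
    a line their difference is only quadratic and three zeros annihilate it.\<close>
  have key: "(d120 - c120) + (d021 - c021) * of_real \<epsilon> = 0 \<and>
      (d210 - c210) + (d111 - c111) * of_real \<epsilon> + (d012 - c012) * of_real \<epsilon> ^ 2 = 0 \<and>
      (d300 - c300) + (d201 - c201) * of_real \<epsilon> + (d102 - c102) * of_real \<epsilon> ^ 2 + (d003 - c003) * of_real \<epsilon> ^ 3 = 0"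
    if \<epsilon>: "0 < \<epsilon>" "\<epsilon> < \<eta>0" for \<epsilon> :: real
  proof -
    have ex: "\<exists>y. y^3 + A \<epsilon> * y^2 + B \<epsilon> * y + C \<epsilon> = 0 \<and> cmod (\<alpha> - y) < \<delta>" if "\<alpha> \<in> {\<alpha>1, \<alpha>2, \<alpha>3}" for \<alpha>
      by (rule root_near[OF \<delta>(1) \<eta>(2)[OF that \<epsilon>(1)]]) (use that \<epsilon>(2) \<eta>0 in auto)
    obtain y1 where y1: "y1^3 + A \<epsilon> * y1^2 + B \<epsilon> * y1 + C \<epsilon> = 0" "cmod (\<alpha>1 - y1) < \<delta>" using ex[of \<alpha>1] by auto
    obtain y2 where y2: "y2^3 + A \<epsilon> * y2^2 + B \<epsilon> * y2 + C \<epsilon> = 0" "cmod (\<alpha>2 - y2) < \<delta>" using ex[of \<alpha>2] by auto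
    obtain y3 where y3: "y3^3 + A \<epsilon> * y3^2 + B \<epsilon> * y3 + C \<epsilon> = 0" "cmod (\<alpha>3 - y3) < \<delta>" using ex[of \<alpha>3] by auto
    have ne: "y \<noteq> y'" if "cmod (\<alpha> - y) < \<delta>" "cmod (\<alpha>' - y') < \<delta>" "2 * \<delta> \<le> cmod (\<alpha> - \<alpha>')" for y y' \<alpha> \<alpha>'
      using norm_triangle_ineq4[of "\<alpha> - y" "\<alpha>' - y"] that by auto
    have "y1 \<noteq> y2" "y1 \<noteq> y3" "y2 \<noteq> y3"
      by (rule ne[OF y1(2) y2(2) \<delta>(2)], rule ne[OF y1(2) y3(2) \<delta>(3)], rule ne[OF y2(2) y3(2) \<delta>(4)])
    moreover have "((d120 - c120) + (d021 - c021) * of_real \<epsilon>) * y\<^sup>2 +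
        ((d210 - c210) + (d111 - c111) * of_real \<epsilon> + (d012 - c012) * of_real \<epsilon> ^ 2) * y +
        ((d300 - c300) + (d201 - c201) * of_real \<epsilon> + (d102 - c102) * of_real \<epsilon> ^ 2 + (d003 - c003) * of_real \<epsilon> ^ 3) = 0"
      if "y \<in> {y1, y2, y3}" for y
    proof -
      let ?z = "vector [1, y, of_real \<epsilon>] :: complex^3"
      have "?z $ 1 \<noteq> 0" by simp
      then have nz: "?z \<noteq> 0" by (metis zero_index)
      have "y^3 + A \<epsilon> * y^2 + B \<epsilon> * y + C \<epsilon> = 0" using that y1 y2 y3 by auto
      moreover have "cubf c300 c210 c120 (-1) c201 c111 c021 c102 c012 c003 ?z =
          - (y^3 + A \<epsilon> * y^2 + B \<epsilon> * y + C \<epsilon>)"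
        by (simp add: cubf_def A_def B_def C_def algebra_simps)
      ultimately have c0: "cubf c300 c210 c120 (-1) c201 c111 c021 c102 c012 c003 ?z = 0" by simp
      have "cubf d300 d210 d120 (-1) d201 d111 d021 d102 d012 d003 ?z = 0" by (rule incl[OF nz c0])
      with c0 have "cubf d300 d210 d120 (-1) d201 d111 d021 d102 d012 d003 ?z -
          cubf c300 c210 c120 (-1) c201 c111 c021 c102 c012 c003 ?z = 0" by simp
      then show ?thesis by (simp add: cubf_def algebra_simps)
    qed
    ultimately show ?thesis by (rule quadratic_three_roots)
  qed
  have 1: "d120 - c120 = 0 \<and> d021 - c021 = 0 \<and> 0 = (0::complex) \<and> 0 = (0::complex)"
    by (rule cubic_vanishing_near_0[OF \<eta>0(1)]) (use key in simp)
  have 2: "d210 - c210 = 0 \<and> d111 - c111 = 0 \<and> d012 - c012 = 0 \<and> 0 = (0::complex)"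
    by (rule cubic_vanishing_near_0[OF \<eta>0(1)]) (use key in simp)
  have 3: "d300 - c300 = 0 \<and> d201 - c201 = 0 \<and> d102 - c102 = 0 \<and> d003 - c003 = 0"
    by (rule cubic_vanishing_near_0[OF \<eta>0(1)]) (use key in simp)
  show ?thesis using 1 2 3 by auto
qed

lemma binary_quadratic_zero:
  fixes A B C :: complex
  obtains s t where "s \<noteq> 0 \<or> t \<noteq> 0" "A * s\<^sup>2 + B * s * t + C * t\<^sup>2 = 0"
proof (cases "A = 0")
  case True
  then show ?thesis using that[of 1 0] by simp
next
  case False
  define e where "e = csqrt (B\<^sup>2 - 4 * A * C)"
  have e: "e\<^sup>2 = B\<^sup>2 - 4 * A * C" by (simp add: e_def)
  define s where "s = (- B + e) / (2 * A)"
  have s: "2 * A * s = - B + e" using False by (simp add: s_def)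
  have "4 * A * (A * s\<^sup>2 + B * s * 1 + C * 1\<^sup>2) = (2 * A * s)\<^sup>2 + 2 * B * (2 * A * s) + 4 * A * C"
    by (simp add: power2_eq_square algebra_simps)
  also have "\<dots> = 0" unfolding s using e by (simp add: power2_eq_square algebra_simps)
  finally show ?thesis using that[of s 1] False by simp
qed

lemma line_times_conic_singular:
  fixes M Q :: "complex^3 \<Rightarrow> complex"
  assumes M: "(M has_derivative M') (at z)" and Q: "(Q has_derivative Q') (at z)" and "M z = 0" "Q z = 0"
  shows "((\<lambda>z. M z * Q z) has_derivative (\<lambda>_. 0)) (at z)"
proof -
  have "((\<lambda>z. M z * Q z) has_derivative (\<lambda>h. M z * Q' h + M' h * Q z)) (at z)"
    by (rule has_derivative_mult[OF M Q])
  then show ?thesis using assms by simp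
qed

lemma has_derivative_nth: "((\<lambda>z :: complex^3. z $ i) has_derivative (\<lambda>h. h $ i)) (at z)"
  by (rule bounded_linear_imp_has_derivative[OF bounded_linear_vec_nth])

definition Lc :: "real \<Rightarrow> real \<Rightarrow> complex^3 \<Rightarrow> complex" where
  "Lc x a z = of_real x * z $ 3 + of_real a * z $ 1 - z $ 2"

lemma Lc_derivative: "(Lc x a has_derivative Lc x a) (at z)"
  unfolding Lc_def[abs_def] by (intro derivative_intros has_derivative_nth)

text \<open>\<open>det (z\<^sub>3 X + z\<^sub>1 A - z\<^sub>2)\<close> for a matrix \<open>X\<close> with diagonal \<open>x\<^sub>i\<close>, products \<open>p\<^sub>i = X\<^sub>j\<^sub>k X\<^sub>k\<^sub>j\<close> and
  \<open>e = X\<^sub>1\<^sub>2 X\<^sub>2\<^sub>3 X\<^sub>3\<^sub>1 + X\<^sub>1\<^sub>3 X\<^sub>3\<^sub>2 X\<^sub>2\<^sub>1\<close>.\<close>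

definition Fc :: "real \<Rightarrow> real \<Rightarrow> real \<Rightarrow> real \<Rightarrow> real \<Rightarrow> real \<Rightarrow> real \<Rightarrow> real \<Rightarrow> real \<Rightarrow> real \<Rightarrow> complex^3 \<Rightarrow> complex" where
  "Fc a1 a2 a3 x1 x2 x3 p1 p2 p3 e z = Lc x1 a1 z * Lc x2 a2 z * Lc x3 a3 z
    - (z $ 3)\<^sup>2 * (of_real p1 * Lc x1 a1 z + of_real p2 * Lc x2 a2 z + of_real p3 * Lc x3 a3 z)
    + (z $ 3)^3 * of_real e"

lemma Fc_cubf:
  "Fc a1 a2 a3 x1 x2 x3 p1 p2 p3 e z = cubf (of_real (a1 * a2 * a3)) (of_real (- (a1 * a2 + a1 * a3 + a2 * a3)))
    (of_real (a1 + a2 + a3)) (-1)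
    (of_real (x1 * a2 * a3 + x2 * a1 * a3 + x3 * a1 * a2))
    (of_real (- (x1 * (a2 + a3) + x2 * (a1 + a3) + x3 * (a1 + a2)))) (of_real (x1 + x2 + x3))
    (of_real (x1 * x2 * a3 + x1 * x3 * a2 + x2 * x3 * a1 - (p1 * a1 + p2 * a2 + p3 * a3)))
    (of_real (p1 + p2 + p3 - (x1 * x2 + x1 * x3 + x2 * x3)))
    (of_real (x1 * x2 * x3 - (p1 * x1 + p2 * x2 + p3 * x3) + e)) z"
  by (simp add: Fc_def Lc_def cubf_def algebra_simps power2_eq_square power3_eq_cube)

lemma det_Fc:
  "det (\<chi> i j. z $ 3 * of_real (X $ i $ j) + z $ 1 * of_real (diag a $ i $ j) - z $ 2 * mat 1 $ i $ j) =
    Fc (a $ 1) (a $ 2) (a $ 3) (X $ 1 $ 1) (X $ 2 $ 2) (X $ 3 $ 3) (X $ 2 $ 3 * X $ 3 $ 2) (X $ 1 $ 3 * X $ 3 $ 1)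
      (X $ 1 $ 2 * X $ 2 $ 1) (X $ 1 $ 2 * X $ 2 $ 3 * X $ 3 $ 1 + X $ 1 $ 3 * X $ 3 $ 2 * X $ 2 $ 1) z"
  by (simp add: det_3 diag_def mat_def Fc_def Lc_def algebra_simps power2_eq_square power3_eq_cube)

lemma Fc_real: "Fc a1 a2 a3 x1 x2 x3 p1 p2 p3 e (cvec z) =
  of_real ((x1 * z $ 3 + a1 * z $ 1 - z $ 2) * (x2 * z $ 3 + a2 * z $ 1 - z $ 2) * (x3 * z $ 3 + a3 * z $ 1 - z $ 2)
    - (z $ 3)\<^sup>2 * (p1 * (x1 * z $ 3 + a1 * z $ 1 - z $ 2) + p2 * (x2 * z $ 3 + a2 * z $ 1 - z $ 2) + p3 * (x3 * z $ 3 + a3 * z $ 1 - z $ 2))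
    + (z $ 3)^3 * e)"
  by (simp add: Fc_def Lc_def)

lemma Fc_scale: "Fc a1 a2 a3 x1 x2 x3 p1 p2 p3 e (k *s z) = k^3 * Fc a1 a2 a3 x1 x2 x3 p1 p2 p3 e z"
  unfolding Fc_cubf by (rule cubf_scale)

text \<open>The three sums are, up to sign, the coefficients of the polynomial \<open>y\<^sub>1 (t -
  a\<^sub>2) (t - a\<^sub>3) + y\<^sub>2 (t - a\<^sub>1) (t - a\<^sub>3) + y\<^sub>3 (t - a\<^sub>1)
  (t - a\<^sub>2)\<close>; evaluation at the \<open>a\<^sub>i\<close> isolates each
  \<open>y\<^sub>i\<close>.\<close>

lemma three_linear_unique:
  fixes a1 a2 a3 y1 y2 y3 :: real
  assumes "a1 \<noteq> a2" "a1 \<noteq> a3" "a2 \<noteq> a3" "y1 + y2 + y3 = 0" "y1 * (a2 + a3) + y2 * (a1 + a3) + y3 * (a1 + a2) = 0"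
    "y1 * a2 * a3 + y2 * a1 * a3 + y3 * a1 * a2 = 0"
  shows "y1 = 0 \<and> y2 = 0 \<and> y3 = 0"
proof -
  have "y1 * ((a2 - a1) * (a3 - a1)) = 0" "y2 * ((a1 - a2) * (a3 - a2)) = 0" "y3 * ((a1 - a3) * (a2 - a3)) = 0"
    using assms(4-6) by algebra+
  then show ?thesis using assms(1-3) by simp
qed

lemma Fc_eqD:
  assumes a: "a1 \<noteq> a2" "a1 \<noteq> a3" "a2 \<noteq> (a3::real)"
    and incl: "\<And>z. z \<noteq> 0 \<Longrightarrow> Fc a1 a2 a3 x1 x2 x3 p1 p2 p3 e z = 0 \<Longrightarrow> Fc a1 a2 a3 x1' x2' x3' p1' p2' p3' e' z = 0"
  shows "x1' = x1 \<and> x2' = x2 \<and> x3' = x3 \<and> p1' + p2' + p3' = p1 + p2 + p3 \<and>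
    p1' * a1 + p2' * a2 + p3' * a3 = p1 * a1 + p2 * a2 + p3 * a3 \<and>
    e' - (p1' * x1 + p2' * x2 + p3' * x3) = e - (p1 * x1 + p2 * x2 + p3 * x3)"
proof -
  have root: "of_real (a1 * a2 * a3) + of_real (- (a1 * a2 + a1 * a3 + a2 * a3)) * \<alpha> + of_real (a1 + a2 + a3) * \<alpha>\<^sup>2 - \<alpha>^3 = 0"
    if "\<alpha> \<in> {complex_of_real a1, of_real a2, of_real a3}" for \<alpha>
    using that by (elim insertE emptyE; simp add: algebra_simps power2_eq_square power3_eq_cube)
  have d: "complex_of_real a1 \<noteq> of_real a2" "complex_of_real a1 \<noteq> of_real a3" "complex_of_real a2 \<noteq> of_real a3"
    using a by simp_all
  have eqs: "complex_of_real (a1 * a2 * a3) = of_real (a1 * a2 * a3) \<and>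
      complex_of_real (- (a1 * a2 + a1 * a3 + a2 * a3)) = of_real (- (a1 * a2 + a1 * a3 + a2 * a3)) \<and>
      complex_of_real (a1 + a2 + a3) = of_real (a1 + a2 + a3) \<and>
      complex_of_real (x1' * a2 * a3 + x2' * a1 * a3 + x3' * a1 * a2) = of_real (x1 * a2 * a3 + x2 * a1 * a3 + x3 * a1 * a2) \<and>
      complex_of_real (- (x1' * (a2 + a3) + x2' * (a1 + a3) + x3' * (a1 + a2))) = of_real (- (x1 * (a2 + a3) + x2 * (a1 + a3) + x3 * (a1 + a2))) \<and>
      complex_of_real (x1' + x2' + x3') = of_real (x1 + x2 + x3) \<and>
      complex_of_real (x1' * x2' * a3 + x1' * x3' * a2 + x2' * x3' * a1 - (p1' * a1 + p2' * a2 + p3' * a3)) =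
        of_real (x1 * x2 * a3 + x1 * x3 * a2 + x2 * x3 * a1 - (p1 * a1 + p2 * a2 + p3 * a3)) \<and>
      complex_of_real (p1' + p2' + p3' - (x1' * x2' + x1' * x3' + x2' * x3')) = of_real (p1 + p2 + p3 - (x1 * x2 + x1 * x3 + x2 * x3)) \<and>
      complex_of_real (x1' * x2' * x3' - (p1' * x1' + p2' * x2' + p3' * x3') + e') = of_real (x1 * x2 * x3 - (p1 * x1 + p2 * x2 + p3 * x3) + e)"
    by (rule cubic_determined_by_zeros[OF d]) (fact root, fact incl[unfolded Fc_cubf])
  have e1: "x1' * a2 * a3 + x2' * a1 * a3 + x3' * a1 * a2 = x1 * a2 * a3 + x2 * a1 * a3 + x3 * a1 * a2"
    "- (x1' * (a2 + a3) + x2' * (a1 + a3) + x3' * (a1 + a2)) = - (x1 * (a2 + a3) + x2 * (a1 + a3) + x3 * (a1 + a2))"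
    "x1' + x2' + x3' = x1 + x2 + x3"
    "x1' * x2' * a3 + x1' * x3' * a2 + x2' * x3' * a1 - (p1' * a1 + p2' * a2 + p3' * a3) =
     x1 * x2 * a3 + x1 * x3 * a2 + x2 * x3 * a1 - (p1 * a1 + p2 * a2 + p3 * a3)"
    "p1' + p2' + p3' - (x1' * x2' + x1' * x3' + x2' * x3') = p1 + p2 + p3 - (x1 * x2 + x1 * x3 + x2 * x3)"
    "x1' * x2' * x3' - (p1' * x1' + p2' * x2' + p3' * x3') + e' = x1 * x2 * x3 - (p1 * x1 + p2 * x2 + p3 * x3) + e"
    using eqs unfolding of_real_eq_iff by blast+
  have "x1' - x1 = 0 \<and> x2' - x2 = 0 \<and> x3' - x3 = 0"
    by (rule three_linear_unique[OF a]) (use e1(1-3) in \<open>simp_all add: algebra_simps\<close>)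
  then have x: "x1' = x1" "x2' = x2" "x3' = x3" by auto
  show ?thesis using e1(4-6) unfolding x by auto
qed

lemma Fc_exists:
  fixes a1 a2 a3 :: real
  assumes a: "a1 \<noteq> a2" "a1 \<noteq> a3" "a2 \<noteq> a3"
  obtains x1 x2 x3 q1 q2 g where "\<And>z. cubf (of_real (a1 * a2 * a3)) (of_real (- (a1 * a2 + a1 * a3 + a2 * a3)))
    (of_real (a1 + a2 + a3)) (-1) (of_real r201) (of_real r111) (of_real r021) (of_real r102) (of_real r012) (of_real r003) z
      = Fc a1 a2 a3 x1 x2 x3 q1 q2 0 g z"
proof -
  \<comment> \<open>Lagrange interpolation: in the part linear in \<open>z\<^sub>3\<close>, the
    substitution \<open>z\<^sub>2 = a\<^sub>i z\<^sub>1\<close> leaves only the term with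
    \<open>x\<^sub>i\<close>.\<close>
  define x1 where "x1 = (r201 + r111 * a1 + r021 * a1\<^sup>2) / ((a2 - a1) * (a3 - a1))"
  define x2 where "x2 = (r201 + r111 * a2 + r021 * a2\<^sup>2) / ((a1 - a2) * (a3 - a2))"
  define x3 where "x3 = (r201 + r111 * a3 + r021 * a3\<^sup>2) / ((a1 - a3) * (a2 - a3))"
  define y1 where "y1 = x1 * a2 * a3 + x2 * a1 * a3 + x3 * a1 * a2"
  define y2 where "y2 = - (x1 * (a2 + a3) + x2 * (a1 + a3) + x3 * (a1 + a2))"
  define y3 where "y3 = x1 + x2 + x3"
  have x: "x1 * ((a2 - a1) * (a3 - a1)) = r201 + r111 * a1 + r021 * a1\<^sup>2"
    "x2 * ((a1 - a2) * (a3 - a2)) = r201 + r111 * a2 + r021 * a2\<^sup>2"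
    "x3 * ((a1 - a3) * (a2 - a3)) = r201 + r111 * a3 + r021 * a3\<^sup>2"
    using a by (simp_all add: x1_def x2_def x3_def)
  have "complex_of_real (y3 - r021) = 0 \<and> complex_of_real (y2 - r111) = 0 \<and> complex_of_real (y1 - r201) = 0"
  proof (rule quadratic_three_roots[of "complex_of_real a1" "of_real a2" "of_real a3"])
    fix y assume "y \<in> {complex_of_real a1, of_real a2, of_real a3}"
    moreover have "(y3 - r021) * a1\<^sup>2 + (y2 - r111) * a1 + (y1 - r201) = 0"
      "(y3 - r021) * a2\<^sup>2 + (y2 - r111) * a2 + (y1 - r201) = 0"
      "(y3 - r021) * a3\<^sup>2 + (y2 - r111) * a3 + (y1 - r201) = 0"
      using x unfolding y1_def y2_def y3_def by algebra+
    ultimately show "complex_of_real (y3 - r021) * y\<^sup>2 + complex_of_real (y2 - r111) * y + complex_of_real (y1 - r201) = 0"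
      by (auto simp flip: of_real_power of_real_mult of_real_add simp del: of_real_diff)
  qed (use a in auto)
  then have y: "y3 = r021" "y2 = r111" "y1 = r201" by (simp_all flip: of_real_diff)
  define m where "m = r012 + (x1 * x2 + x1 * x3 + x2 * x3)"
  define n where "n = x1 * x2 * a3 + x1 * x3 * a2 + x2 * x3 * a1 - r102"
  \<comment> \<open>With the third product set to 0, the equations \<open>q1 + q2 = m\<close> and
    \<open>q1 * a1 + q2 * a2 = n\<close> fix the other two. This normalization is harmless: shifting
    the products along \<open>w\<close>, with \<open>g\<close> adjusted, does not change the
    cubic.\<close>
  define q1 where "q1 = (n - a2 * m) / (a1 - a2)"
  define q2 where "q2 = m - q1"
  have "q1 * (a1 - a2) = n - a2 * m" using a by (simp add: q1_def)
  then have n: "q1 * a1 + q2 * a2 + 0 * a3 = n" by (simp add: q2_def algebra_simps)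
  have m: "q1 + q2 + 0 = m" by (simp add: q2_def)
  define g where "g = r003 - x1 * x2 * x3 + (q1 * x1 + q2 * x2 + 0 * x3)"
  show ?thesis
  proof (rule that[of x1 x2 x3 q1 q2 g])
    fix z
    have e: "x1 * a2 * a3 + x2 * a1 * a3 + x3 * a1 * a2 = r201"
      "- (x1 * (a2 + a3) + x2 * (a1 + a3) + x3 * (a1 + a2)) = r111" "x1 + x2 + x3 = r021"
      "x1 * x2 * a3 + x1 * x3 * a2 + x2 * x3 * a1 - (q1 * a1 + q2 * a2 + 0 * a3) = r102"
      "q1 + q2 + 0 - (x1 * x2 + x1 * x3 + x2 * x3) = r012"
      "x1 * x2 * x3 - (q1 * x1 + q2 * x2 + 0 * x3) + g = r003"
      using y unfolding n m by (simp_all add: y1_def y2_def y3_def n_def m_def g_def)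
    show "cubf (of_real (a1 * a2 * a3)) (of_real (- (a1 * a2 + a1 * a3 + a2 * a3)))
      (of_real (a1 + a2 + a3)) (-1) (of_real r201) (of_real r111) (of_real r021) (of_real r102) (of_real r012) (of_real r003) z
      = Fc a1 a2 a3 x1 x2 x3 q1 q2 0 g z"
      unfolding Fc_cubf e ..
  qed
qed

section \<open>The normal form of a smooth cubic\<close>

lemma zero_locus_hpoly_iff: "z \<noteq> 0 \<Longrightarrow> hpoint z \<in> zero_locus (hpoly d c) \<longleftrightarrow> hpoly d c z = 0"
  by (rule zero_locus_iff[where F = "hpoly d c", OF hpoly_scale])

lemma zero_locus_Fc_iff:
  "z \<noteq> 0 \<Longrightarrow> hpoint z \<in> zero_locus (Fc a1 a2 a3 x1 x2 x3 p1 p2 p3 e) \<longleftrightarrow> Fc a1 a2 a3 x1 x2 x3 p1 p2 p3 e z = 0"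
  by (rule zero_locus_iff[where F = "Fc a1 a2 a3 x1 x2 x3 p1 p2 p3 e", OF Fc_scale])

lemma has_derivative_nth_differentiable: "(\<lambda>z :: complex^3. z $ i) differentiable (at z)"
  using has_derivative_nth differentiableI by blast

text \<open>The real polynomial defining \<open>C\<close> may have any degree, so its coefficients
  cannot be compared with those of the cubic. It serves to show that the zero set is stable under
  conjugation; the zeros of the cubic are then zeros of its conjugate, which forces the coefficients
  to be real.\<close>

lemma smooth_cubic_normal_form:
  assumes a: "inj (($) (a :: real^3))" and C: "smooth_cubic C" "real_curve C" "\<forall>i. infinity_pt a i \<in> C"
  obtains x1 x2 x3 q1 q2 g where "C = zero_locus (Fc (a $ 1) (a $ 2) (a $ 3) x1 x2 x3 q1 q2 0 g)"
    "\<And>z. z \<noteq> 0 \<Longrightarrow> Fc (a $ 1) (a $ 2) (a $ 3) x1 x2 x3 q1 q2 0 g z = 0 \<Longrightarrow>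
      \<not> (Fc (a $ 1) (a $ 2) (a $ 3) x1 x2 x3 q1 q2 0 g has_derivative (\<lambda>_. 0)) (at z)"
proof -
  note result = that
  obtain c where Cc: "C = zero_locus (hpoly 3 c)"
    and ns: "\<And>z. z \<noteq> 0 \<Longrightarrow> hpoly 3 c z = 0 \<Longrightarrow> \<not> (hpoly 3 c has_derivative (\<lambda>_. 0)) (at z)"
    using C(1) by (auto simp: smooth_cubic_def)
  obtain d r where Cr: "C = zero_locus (hpoly d (\<lambda>i j k. complex_of_real (r i j k)))"
    using C(2) by (auto simp: real_curve_def)
  have a': "a $ 1 \<noteq> a $ 2" "a $ 1 \<noteq> a $ 3" "a $ 2 \<noteq> a $ 3" using a by (auto simp: inj_eq)
  then have ac: "complex_of_real (a $ 1) \<noteq> of_real (a $ 2)" "complex_of_real (a $ 1) \<noteq> of_real (a $ 3)"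
    "complex_of_real (a $ 2) \<noteq> of_real (a $ 3)" by simp_all
  have inf: "c 3 0 0 + c 2 1 0 * y + c 1 2 0 * y\<^sup>2 + c 0 3 0 * y^3 = 0"
    if y: "y \<in> {complex_of_real (a $ 1), of_real (a $ 2), of_real (a $ 3)}" for y
  proof -
    obtain i where i: "y = of_real (a $ i)" using y by auto
    let ?z = "vector [1, y, 0] :: complex^3"
    have "?z $ 1 \<noteq> 0" by simp
    then have nz: "?z \<noteq> 0" by (metis zero_index)
    have "hpoint ?z \<in> zero_locus (hpoly 3 c)"
      using C(3) unfolding Cc[symmetric] infinity_pt_def i by blast
    then have "hpoly 3 c ?z = 0" using zero_locus_hpoly_iff[OF nz] by blast
    then show ?thesis by (simp add: hpoly_3 cubf_def)
  qed
  \<comment> \<open>Otherwise the restriction to the line at infinity is at most quadratic in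
    \<open>y\<close> and has three zeros. The line then splits off, and the cubic is singular where
    it meets the residual conic.\<close>
  have c0: "c 0 3 0 \<noteq> 0"
  proof
    assume 0: "c 0 3 0 = 0"
    have "c 1 2 0 = 0 \<and> c 2 1 0 = 0 \<and> c 3 0 0 = 0"
    proof (rule quadratic_three_roots[OF ac])
      fix y assume "y \<in> {complex_of_real (a $ 1), of_real (a $ 2), of_real (a $ 3)}"
      from inf[OF this] 0 show "c 1 2 0 * y\<^sup>2 + c 2 1 0 * y + c 3 0 0 = 0" by (simp add: algebra_simps)
    qed
    define Q where "Q z = c 2 0 1 * (z $ 1)^2 + c 1 1 1 * z $ 1 * z $ 2 + c 0 2 1 * (z $ 2)^2
      + (c 1 0 2 * z $ 1 + c 0 1 2 * z $ 2) * z $ 3 + c 0 0 3 * (z $ 3)^2" for z :: "complex^3"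
    have F: "hpoly 3 c = (\<lambda>z. z $ 3 * Q z)"
      using 0 \<open>c 1 2 0 = 0 \<and> _\<close>
      by (auto simp: hpoly_3 cubf_def Q_def fun_eq_iff algebra_simps power2_eq_square power3_eq_cube)
    obtain s t where st: "s \<noteq> 0 \<or> t \<noteq> 0" "c 2 0 1 * s\<^sup>2 + c 1 1 1 * s * t + c 0 2 1 * t\<^sup>2 = 0"
      by (rule binary_quadratic_zero)
    define z where "z = (vector [s, t, 0] :: complex^3)"
    have z: "z $ 1 = s" "z $ 2 = t" "z $ 3 = 0" by (simp_all add: z_def)
    have nz: "z \<noteq> 0" using st(1) z by (metis zero_index)
    have Q0: "Q z = 0" using st(2) by (simp add: Q_def z)
    have "Q differentiable (at z)"
      unfolding Q_def[abs_def] by (intro derivative_intros has_derivative_nth_differentiable)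
    then obtain Q' where Q': "(Q has_derivative Q') (at z)" by (auto simp: differentiable_def)
    have "(hpoly 3 c has_derivative (\<lambda>_. 0)) (at z)"
      unfolding F by (rule line_times_conic_singular[OF has_derivative_nth Q' z(3) Q0])
    moreover have "hpoly 3 c z = 0" by (simp add: F z)
    ultimately show False using ns nz by blast
  qed
  define e where "e i j k = - c i j k / c 0 3 0" for i j k
  have eF: "cubf (e 3 0 0) (e 2 1 0) (e 1 2 0) (-1) (e 2 0 1) (e 1 1 1) (e 0 2 1) (e 1 0 2) (e 0 1 2) (e 0 0 3) z
      = (- 1 / c 0 3 0) * hpoly 3 c z" for z
    using c0 by (simp add: hpoly_3 cubf_def e_def field_simps)
  have inf': "e 3 0 0 + e 2 1 0 * y + e 1 2 0 * y\<^sup>2 - y^3 = 0"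
    if "y \<in> {complex_of_real (a $ 1), of_real (a $ 2), of_real (a $ 3)}" for y
  proof -
    have "e 3 0 0 + e 2 1 0 * y + e 1 2 0 * y\<^sup>2 - y^3
        = - (c 3 0 0 + c 2 1 0 * y + c 1 2 0 * y\<^sup>2 + c 0 3 0 * y^3) / c 0 3 0"
      using c0 by (simp add: e_def field_simps)
    then show ?thesis unfolding inf[OF that] by simp
  qed
  let ?A = "a $ 1 * a $ 2 * a $ 3" and ?B = "- (a $ 1 * a $ 2 + a $ 1 * a $ 3 + a $ 2 * a $ 3)" and ?E = "a $ 1 + a $ 2 + a $ 3"
  have "e 1 2 0 - of_real ?E = 0 \<and> e 2 1 0 - of_real ?B = 0 \<and> e 3 0 0 - of_real ?A = 0"
  proof (rule quadratic_three_roots[OF ac])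
    fix y assume y: "y \<in> {complex_of_real (a $ 1), of_real (a $ 2), of_real (a $ 3)}"
    then have "of_real ?A + of_real ?B * y + of_real ?E * y\<^sup>2 - y^3 = 0"
      by (elim insertE emptyE; simp add: algebra_simps power2_eq_square power3_eq_cube)
    with inf'[OF y] show "(e 1 2 0 - of_real ?E) * y\<^sup>2 + (e 2 1 0 - of_real ?B) * y + (e 3 0 0 - of_real ?A) = 0"
      by algebra
  qed
  then have top: "e 1 2 0 = of_real ?E" "e 2 1 0 = of_real ?B" "e 3 0 0 = of_real ?A" by simp_all
  have zC: "hpoint z \<in> C \<longleftrightarrow>
      cubf (e 3 0 0) (e 2 1 0) (e 1 2 0) (-1) (e 2 0 1) (e 1 1 1) (e 0 2 1) (e 1 0 2) (e 0 1 2) (e 0 0 3) z = 0"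
    if "z \<noteq> 0" for z
    using c0 unfolding Cc zero_locus_hpoly_iff[OF that] eF by simp
  have conj: "cnj (e 3 0 0) = e 3 0 0 \<and> cnj (e 2 1 0) = e 2 1 0 \<and> cnj (e 1 2 0) = e 1 2 0 \<and>
      cnj (e 2 0 1) = e 2 0 1 \<and> cnj (e 1 1 1) = e 1 1 1 \<and> cnj (e 0 2 1) = e 0 2 1 \<and>
      cnj (e 1 0 2) = e 1 0 2 \<and> cnj (e 0 1 2) = e 0 1 2 \<and> cnj (e 0 0 3) = e 0 0 3"
  proof (rule cubic_determined_by_zeros[OF ac])
    fix z :: "complex^3" assume z: "z \<noteq> 0"
      "cubf (e 3 0 0) (e 2 1 0) (e 1 2 0) (-1) (e 2 0 1) (e 1 1 1) (e 0 2 1) (e 1 0 2) (e 0 1 2) (e 0 0 3) z = 0"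
    define z' where "z' = (\<chi> i. cnj (z $ i))"
    have z': "z' $ i = cnj (z $ i)" for i by (simp add: z'_def)
    have nz: "z' \<noteq> 0" using z(1) by (simp add: vec_eq_iff z')
    have "hpoint z \<in> C" using z zC by blast
    then have "hpoly d (\<lambda>i j k. complex_of_real (r i j k)) z = 0"
      unfolding Cr using zero_locus_hpoly_iff[OF z(1)] by blast
    moreover have "hpoly d (\<lambda>i j k. complex_of_real (r i j k)) z' = cnj (hpoly d (\<lambda>i j k. complex_of_real (r i j k)) z)"
      unfolding hpoly_def z' by (simp add: case_prod_unfold)
    ultimately have "hpoint z' \<in> C"
      unfolding Cr using zero_locus_hpoly_iff[OF nz] by simp
    then have "cnj (cubf (e 3 0 0) (e 2 1 0) (e 1 2 0) (-1) (e 2 0 1) (e 1 1 1) (e 0 2 1) (e 1 0 2) (e 0 1 2) (e 0 0 3) z') = 0"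
      using zC[OF nz] by simp
    then show "cubf (cnj (e 3 0 0)) (cnj (e 2 1 0)) (cnj (e 1 2 0)) (-1) (cnj (e 2 0 1)) (cnj (e 1 1 1))
        (cnj (e 0 2 1)) (cnj (e 1 0 2)) (cnj (e 0 1 2)) (cnj (e 0 0 3)) z = 0"
      by (simp add: cubf_def z')
  qed (fact inf')
  have re: "w = of_real (Re w)" if "cnj w = w" for w
    using that by (simp add: complex_eq_iff)
  obtain x1 x2 x3 q1 q2 g where F: "\<And>z. cubf (of_real ?A) (of_real ?B) (of_real ?E) (-1)
      (of_real (Re (e 2 0 1))) (of_real (Re (e 1 1 1))) (of_real (Re (e 0 2 1)))
      (of_real (Re (e 1 0 2))) (of_real (Re (e 0 1 2))) (of_real (Re (e 0 0 3))) z
      = Fc (a $ 1) (a $ 2) (a $ 3) x1 x2 x3 q1 q2 0 g z"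
    by (rule Fc_exists[OF a', where ?r201.0 = "Re (e 2 0 1)" and ?r111.0 = "Re (e 1 1 1)" and ?r021.0 = "Re (e 0 2 1)"
      and ?r102.0 = "Re (e 1 0 2)" and ?r012.0 = "Re (e 0 1 2)" and ?r003.0 = "Re (e 0 0 3)"]) (rule that, assumption)
  have re6: "of_real (Re (e 2 0 1)) = e 2 0 1" "of_real (Re (e 1 1 1)) = e 1 1 1" "of_real (Re (e 0 2 1)) = e 0 2 1"
    "of_real (Re (e 1 0 2)) = e 1 0 2" "of_real (Re (e 0 1 2)) = e 0 1 2" "of_real (Re (e 0 0 3)) = e 0 0 3"
    using conj re by metis+
  have FF: "Fc (a $ 1) (a $ 2) (a $ 3) x1 x2 x3 q1 q2 0 g z = (- 1 / c 0 3 0) * hpoly 3 c z" for z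
    unfolding F[symmetric] eF[symmetric] re6 top ..
  show ?thesis
  proof (rule result[of x1 x2 x3 q1 q2 g])
    show "C = zero_locus (Fc (a $ 1) (a $ 2) (a $ 3) x1 x2 x3 q1 q2 0 g)"
      unfolding Cc by (rule zero_locus_eqI) (use c0 in \<open>simp add: FF\<close>)
    fix z :: "complex^3" assume z: "z \<noteq> 0" "Fc (a $ 1) (a $ 2) (a $ 3) x1 x2 x3 q1 q2 0 g z = 0"
    show "\<not> (Fc (a $ 1) (a $ 2) (a $ 3) x1 x2 x3 q1 q2 0 g has_derivative (\<lambda>_. 0)) (at z)"
    proof
      assume "(Fc (a $ 1) (a $ 2) (a $ 3) x1 x2 x3 q1 q2 0 g has_derivative (\<lambda>_. 0)) (at z)"
      then have "((\<lambda>z. (- c 0 3 0) * Fc (a $ 1) (a $ 2) (a $ 3) x1 x2 x3 q1 q2 0 g z) has_derivative (\<lambda>h. (- c 0 3 0) * 0)) (at z)"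
        by (rule has_derivative_mult_right)
      then have "(hpoly 3 c has_derivative (\<lambda>_. 0)) (at z)" using c0 by (simp add: FF)
      moreover have "hpoly 3 c z = 0" using z(2) c0 by (simp add: FF)
      ultimately show False using ns z(1) by blast
    qed
  qed
qed

lemma Fc_derivative:
  "(Fc a1 a2 a3 x1 x2 x3 p1 p2 p3 e has_derivative (\<lambda>h.
    (Lc x2 a2 z * Lc x3 a3 z - (z $ 3)\<^sup>2 * of_real p1) * Lc x1 a1 h
    + (Lc x1 a1 z * Lc x3 a3 z - (z $ 3)\<^sup>2 * of_real p2) * Lc x2 a2 h
    + (Lc x1 a1 z * Lc x2 a2 z - (z $ 3)\<^sup>2 * of_real p3) * Lc x3 a3 h
    + (3 * (z $ 3)\<^sup>2 * of_real e
       - 2 * z $ 3 * (of_real p1 * Lc x1 a1 z + of_real p2 * Lc x2 a2 z + of_real p3 * Lc x3 a3 z)) * h $ 3)) (at z)"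
  unfolding Fc_def[abs_def]
  by (rule derivative_eq_intros Lc_derivative has_derivative_nth refl)+
    (simp add: fun_eq_iff algebra_simps power2_eq_square power3_eq_cube)

lemma Fc_swap:
  "Fc a1 a2 a3 x1 x2 x3 p1 p2 p3 e = Fc a2 a1 a3 x2 x1 x3 p2 p1 p3 e"
  "Fc a1 a2 a3 x1 x2 x3 p1 p2 p3 e = Fc a3 a2 a1 x3 x2 x1 p3 p2 p1 e"
  by (simp_all add: fun_eq_iff Fc_def algebra_simps)

text \<open>With a single product left, the factor \<open>Lc x1 a1\<close> splits off; any common
  zero of it and the residual conic is singular.\<close>

lemma Fc_line_conic_singular:
  "\<exists>z. z \<noteq> 0 \<and> Fc a1 a2 a3 x1 x2 x3 p 0 0 0 z = 0 \<and> (Fc a1 a2 a3 x1 x2 x3 p 0 0 0 has_derivative (\<lambda>_. 0)) (at z)"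
proof -
  obtain s t :: complex where st: "s \<noteq> 0 \<or> t \<noteq> 0"
    "of_real ((a2 - a1) * (a3 - a1)) * s\<^sup>2 + of_real ((a2 - a1) * (x3 - x1) + (a3 - a1) * (x2 - x1)) * s * t
      + of_real ((x2 - x1) * (x3 - x1) - p) * t\<^sup>2 = 0"
    by (rule binary_quadratic_zero)
  define z where "z = (vector [s, of_real x1 * t + of_real a1 * s, t] :: complex^3)"
  have z: "z $ 1 = s" "z $ 2 = of_real x1 * t + of_real a1 * s" "z $ 3 = t" by (simp_all add: z_def)
  define Q where "Q z = Lc x2 a2 z * Lc x3 a3 z - (z $ 3)\<^sup>2 * of_real p" for z
  have nz: "z \<noteq> 0" using st(1) z by (metis zero_index)
  have L0: "Lc x1 a1 z = 0" by (simp add: Lc_def z)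
  have Q0: "Q z = 0" using st(2) by (simp add: Q_def Lc_def z algebra_simps power2_eq_square)
  have F: "Fc a1 a2 a3 x1 x2 x3 p 0 0 0 = (\<lambda>z. Lc x1 a1 z * Q z)"
    by (simp add: fun_eq_iff Fc_def Q_def algebra_simps)
  have "Lc x a differentiable (at z)" for x a using Lc_derivative differentiableI by blast
  then have "Q differentiable (at z)"
    unfolding Q_def[abs_def] by (intro derivative_intros has_derivative_nth_differentiable)
  then obtain Q' where Q': "(Q has_derivative Q') (at z)" by (auto simp: differentiable_def)
  have "(Fc a1 a2 a3 x1 x2 x3 p 0 0 0 has_derivative (\<lambda>_. 0)) (at z)"
    unfolding F by (rule line_times_conic_singular[OF Lc_derivative Q' L0 Q0])
  then show ?thesis using nz L0 F by (metis mult_zero_left)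
qed

context
  fixes a1 a2 a3 x1 x2 x3 \<sigma> w1 w2 w3 \<kappa> :: real
  assumes a: "a1 \<noteq> a2" "a1 \<noteq> a3" "a2 \<noteq> a3" and \<sigma>: "\<sigma> \<noteq> 0"
    and w: "w1 = \<sigma> * (a2 - a3)" "w2 = \<sigma> * (a3 - a1)" "w3 = \<sigma> * (a1 - a2)"
    and \<kappa>: "\<kappa> = w1 * x1 + w2 * x2 + w3 * x3"
begin

lemma Lc_relation: "of_real w1 * Lc x1 a1 z + of_real w2 * Lc x2 a2 z + of_real w3 * Lc x3 a3 z = of_real \<kappa> * z $ 3"
  by (simp add: Lc_def \<kappa> w algebra_simps)

lemma Fc_shift:
  "Fc a1 a2 a3 x1 x2 x3 (q1 + s * w1) (q2 + s * w2) (q3 + s * w3) (g + \<kappa> * s) = Fc a1 a2 a3 x1 x2 x3 q1 q2 q3 g"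
proof
  fix z
  have "Fc a1 a2 a3 x1 x2 x3 (q1 + s * w1) (q2 + s * w2) (q3 + s * w3) (g + \<kappa> * s) z =
    Fc a1 a2 a3 x1 x2 x3 q1 q2 q3 g z - of_real s * (z $ 3)\<^sup>2 *
      ((of_real w1 * Lc x1 a1 z + of_real w2 * Lc x2 a2 z + of_real w3 * Lc x3 a3 z) - of_real \<kappa> * z $ 3)"
    unfolding Fc_def by (simp add: algebra_simps power2_eq_square power3_eq_cube)
  then show "Fc a1 a2 a3 x1 x2 x3 (q1 + s * w1) (q2 + s * w2) (q3 + s * w3) (g + \<kappa> * s) z =
    Fc a1 a2 a3 x1 x2 x3 q1 q2 q3 g z" by (simp add: Lc_relation)
qed

text \<open>Equal zero sets force equal coefficients. The differences of the products then have
  vanishing sum and vanishing sum weighted by the \<open>a\<^sub>i\<close>, which makes them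
  multiples of \<open>w\<close>.\<close>

lemma zero_locus_Fc_eq_iff:
  "zero_locus (Fc a1 a2 a3 y1 y2 y3 p1 p2 p3 e) = zero_locus (Fc a1 a2 a3 x1 x2 x3 q1 q2 q3 g) \<longleftrightarrow>
    y1 = x1 \<and> y2 = x2 \<and> y3 = x3 \<and> (\<exists>s. p1 = q1 + s * w1 \<and> p2 = q2 + s * w2 \<and> p3 = q3 + s * w3 \<and> e = g + \<kappa> * s)"
proof
  assume eq: "zero_locus (Fc a1 a2 a3 y1 y2 y3 p1 p2 p3 e) = zero_locus (Fc a1 a2 a3 x1 x2 x3 q1 q2 q3 g)"
  have y: "y1 = x1 \<and> y2 = x2 \<and> y3 = x3 \<and> p1 + p2 + p3 = q1 + q2 + q3 \<and>
    p1 * a1 + p2 * a2 + p3 * a3 = q1 * a1 + q2 * a2 + q3 * a3 \<and>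
    e - (p1 * x1 + p2 * x2 + p3 * x3) = g - (q1 * x1 + q2 * x2 + q3 * x3)"
  proof (rule Fc_eqD[OF a])
    fix z :: "complex^3" assume z: "z \<noteq> 0" "Fc a1 a2 a3 x1 x2 x3 q1 q2 q3 g z = 0"
    then have "hpoint z \<in> zero_locus (Fc a1 a2 a3 y1 y2 y3 p1 p2 p3 e)"
      unfolding eq using z zero_locus_Fc_iff[OF z(1)] by blast
    then show "Fc a1 a2 a3 y1 y2 y3 p1 p2 p3 e z = 0" using zero_locus_Fc_iff[OF z(1)] by blast
  qed
  define s where "s = (p1 - q1) / w1"
  have w1: "w1 \<noteq> 0" using a \<sigma> by (simp add: w)
  have 1: "p1 = q1 + s * w1" using w1 by (simp add: s_def)
  have y': "p1 + p2 + p3 = q1 + q2 + q3" "p1 * a1 + p2 * a2 + p3 * a3 = q1 * a1 + q2 * a2 + q3 * a3"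
    "e - (p1 * x1 + p2 * x2 + p3 * x3) = g - (q1 * x1 + q2 * x2 + q3 * x3)" using y by blast+
  have "(p2 - q2 - s * w2) * (a2 - a3) = 0"
    using y'(1,2) 1 unfolding w by algebra
  then have 2: "p2 = q2 + s * w2" using a by simp
  have 3: "p3 = q3 + s * w3" using y'(1) 1 2 unfolding w by algebra
  have "e = g + \<kappa> * s" using y'(3) 1 2 3 unfolding \<kappa> by algebra
  then show "y1 = x1 \<and> y2 = x2 \<and> y3 = x3 \<and> (\<exists>s. p1 = q1 + s * w1 \<and> p2 = q2 + s * w2 \<and> p3 = q3 + s * w3 \<and> e = g + \<kappa> * s)"
    using y 1 2 3 by blast
qed (auto simp: Fc_shift)

text \<open>A double root of the discriminant gives a singular point: \<open>L\<^sub>i = \<l> / (2 P\<^sub>i)\<close> if \<open>\<l> \<noteq> 0\<close>; otherwise two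
  of the \<open>P\<^sub>i\<close> vanish and the cubic contains a line.\<close>

lemma discriminant_nonsingular:
  assumes ns: "\<And>z. z \<noteq> 0 \<Longrightarrow> Fc a1 a2 a3 x1 x2 x3 q1 q2 q3 g z = 0 \<Longrightarrow>
      \<not> (Fc a1 a2 a3 x1 x2 x3 q1 q2 q3 g has_derivative (\<lambda>_. 0)) (at z)"
    and D: "(g + \<kappa> * s)\<^sup>2 - 4 * ((q1 + s * w1) * (q2 + s * w2) * (q3 + s * w3)) = 0"
  shows "2 * \<kappa> * (g + \<kappa> * s) - 4 * (w1 * (q2 + s * w2) * (q3 + s * w3) + w2 * (q1 + s * w1) * (q3 + s * w3)
        + w3 * (q1 + s * w1) * (q2 + s * w2)) \<noteq> 0"
proof
  define p1 where "p1 = q1 + s * w1"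
  define p2 where "p2 = q2 + s * w2"
  define p3 where "p3 = q3 + s * w3"
  define u where "u = (g + \<kappa> * s) / 2"
  assume D': "2 * \<kappa> * (g + \<kappa> * s) - 4 * (w1 * (q2 + s * w2) * (q3 + s * w3) + w2 * (q1 + s * w1) * (q3 + s * w3)
        + w3 * (q1 + s * w1) * (q2 + s * w2)) = 0"
  have g: "g + \<kappa> * s = 2 * u" by (simp add: u_def)
  have F: "Fc a1 a2 a3 x1 x2 x3 q1 q2 q3 g = Fc a1 a2 a3 x1 x2 x3 p1 p2 p3 (2 * u)"
    unfolding p1_def p2_def p3_def g[symmetric] by (rule Fc_shift[symmetric])
  have u2: "u\<^sup>2 = p1 * p2 * p3" using D unfolding g p1_def[symmetric] p2_def[symmetric] p3_def[symmetric]
    by (simp add: power2_eq_square)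
  have ku: "\<kappa> * u = w1 * p2 * p3 + w2 * p1 * p3 + w3 * p1 * p2"
    using D' unfolding g p1_def[symmetric] p2_def[symmetric] p3_def[symmetric] by simp
  have w0: "w1 \<noteq> 0" "w2 \<noteq> 0" "w3 \<noteq> 0" using a \<sigma> by (simp_all add: w)
  show False
  proof (cases "u = 0")
    case True
    \<comment> \<open>One factor of \<open>p1 * p2 * p3\<close> vanishes, and then
      \<open>\<kappa> * u = 0\<close> leaves a nonzero multiple of the product of the other
      two.\<close>
    have two: "(p1 = 0 \<and> p2 = 0) \<or> (p1 = 0 \<and> p3 = 0) \<or> (p2 = 0 \<and> p3 = 0)"
      using u2 ku w0 True by auto
    have "\<exists>z. z \<noteq> 0 \<and> Fc a1 a2 a3 x1 x2 x3 q1 q2 q3 g z = 0 \<and>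
        (Fc a1 a2 a3 x1 x2 x3 q1 q2 q3 g has_derivative (\<lambda>_. 0)) (at z)"
      using two
    proof (elim disjE conjE)
      assume "p1 = 0" "p2 = 0"
      then show ?thesis unfolding F True using Fc_line_conic_singular[of a3 a2 a1 x3 x2 x1 p3]
        by (simp add: Fc_swap(2)[of a1])
    next
      assume "p1 = 0" "p3 = 0"
      then show ?thesis unfolding F True using Fc_line_conic_singular[of a2 a1 a3 x2 x1 x3 p2]
        by (simp add: Fc_swap(1)[of a1])
    next
      assume "p2 = 0" "p3 = 0"
      then show ?thesis unfolding F True using Fc_line_conic_singular[of a1 a2 a3 x1 x2 x3 p1] by simp
    qed
    then show False using ns by blast
  next
    case False
    then have p: "p1 \<noteq> 0" "p2 \<noteq> 0" "p3 \<noteq> 0" using u2 by auto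
    define m1 where "m1 = u / p1"
    define m2 where "m2 = u / p2"
    define m3 where "m3 = u / p3"
    have m: "m1 * p1 = u" "m2 * p2 = u" "m3 * p3 = u" using p by (simp_all add: m1_def m2_def m3_def)
    have "(p2 * p3) * (m2 * m3 - p1) = (m2 * p2) * (m3 * p3) - p1 * p2 * p3"
      "(p1 * p3) * (m1 * m3 - p2) = (m1 * p1) * (m3 * p3) - p1 * p2 * p3"
      "(p1 * p2) * (m1 * m2 - p3) = (m1 * p1) * (m2 * p2) - p1 * p2 * p3"
      by algebra+
    then have "(p2 * p3) * (m2 * m3 - p1) = 0" "(p1 * p3) * (m1 * m3 - p2) = 0" "(p1 * p2) * (m1 * m2 - p3) = 0"
      unfolding m u2[symmetric] by (simp_all add: power2_eq_square)
    then have mm: "m2 * m3 = p1" "m1 * m3 = p2" "m1 * m2 = p3" using p by simp_all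
    \<comment> \<open>Three values are taken by the \<open>L\<^sub>i\<close> at a point with third
      coordinate 1 exactly if they satisfy the linear relation; the vanishing derivative of the
      discriminant provides it.\<close>
    have "u * (\<kappa> - (w1 * m1 + w2 * m2 + w3 * m3)) = 0"
      using ku m mm by algebra
    then have km: "\<kappa> = w1 * m1 + w2 * m2 + w3 * m3" using False by simp
    define z1 where "z1 = (m2 - m3 - (x2 - x3)) / (a2 - a3)"
    define y where "y = x2 + a2 * z1 - m2"
    define z where "z = (vector [of_real z1, of_real y, 1] :: complex^3)"
    have z1: "z1 * (a2 - a3) = m2 - m3 - (x2 - x3)" using a by (simp add: z1_def)
    have l2: "x2 + a2 * z1 - y = m2" by (simp add: y_def)
    have l3: "x3 + a3 * z1 - y = m3" using z1 by (simp add: y_def algebra_simps)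
    have "w1 * (x1 + a1 * z1 - y) + w2 * (x2 + a2 * z1 - y) + w3 * (x3 + a3 * z1 - y) = \<kappa>"
      by (simp add: \<kappa> w algebra_simps)
    then have "w1 * (x1 + a1 * z1 - y) = w1 * m1" unfolding l2 l3 km by simp
    then have l1: "x1 + a1 * z1 - y = m1" using w0 by simp
    have L: "Lc x1 a1 z = of_real m1" "Lc x2 a2 z = of_real m2" "Lc x3 a3 z = of_real m3"
      unfolding l1[symmetric] l2[symmetric] l3[symmetric] by (simp_all add: Lc_def z_def)
    have z3: "z $ 3 = 1" by (simp add: z_def)
    have "m1 * m2 * m3 = u" using m(1) mm(1) by (simp add: mult.assoc)
    then have "m1 * m2 * m3 - (p1 * m1 + p2 * m2 + p3 * m3) + 2 * u = 0"
      using m by (simp add: mult.commute)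
    then have "complex_of_real (m1 * m2 * m3 - (p1 * m1 + p2 * m2 + p3 * m3) + 2 * u) = 0" by simp
    then have "Fc a1 a2 a3 x1 x2 x3 q1 q2 q3 g z = 0"
      unfolding F Fc_def L z3 by simp
    moreover have "(Fc a1 a2 a3 x1 x2 x3 q1 q2 q3 g has_derivative (\<lambda>_. 0)) (at z)"
    proof -
      have "3 * (2 * u) - 2 * (p1 * m1 + p2 * m2 + p3 * m3) = 0" using m by (simp add: mult.commute)
      then have e: "complex_of_real (3 * (2 * u) - 2 * (p1 * m1 + p2 * m2 + p3 * m3)) = 0" by simp
      have e': "complex_of_real (m2 * m3) = of_real p1" "complex_of_real (m1 * m3) = of_real p2"
        "complex_of_real (m1 * m2) = of_real p3" using mm by simp_all
      show ?thesis
        using Fc_derivative[of a1 a2 a3 x1 x2 x3 p1 p2 p3 "2 * u" z] e e'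
        unfolding F L z3 by simp
    qed
    moreover have "z \<noteq> 0" using z3 by (metis zero_index zero_neq_one)
    ultimately show False using ns by blast
  qed
qed

end

section \<open>Components of the isospectral set\<close>

lemma decomposition_components:
  assumes "decomposition T \<K> n P"
  shows "components T = \<K>" "card (components T) = n" "\<And>K. K \<in> components T \<Longrightarrow> P K"
proof -
  show "components T = \<K>"
    using assms unfolding decomposition_def by (intro components_eqI_closed) auto
  then show "card (components T) = n" "\<And>K. K \<in> components T \<Longrightarrow> P K"
    using assms by (auto simp: decomposition_def)
qed

lemma decompositionD:
  assumes "decomposition R \<K> n P"
  shows "finite \<K>" "card \<K> = n" "\<Union>\<K> = R" "\<And>K K'. K \<in> \<K> \<Longrightarrow> K' \<in> \<K> \<Longrightarrow> K \<noteq> K' \<Longrightarrow> K \<inter> K' = {}"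
    "\<And>K. K \<in> \<K> \<Longrightarrow> connected K \<and> K \<noteq> {} \<and> closedin (top_of_set R) K \<and> P K"
  using assms by (simp_all add: decomposition_def)

lemma decomposition_Un_components:
  assumes 1: "decomposition R1 \<K>1 n1 P1" and 2: "decomposition R2 \<K>2 n2 P2"
    and disj: "R1 \<inter> R2 = {}" and cl: "closedin (top_of_set (R1 \<union> R2)) R1" "closedin (top_of_set (R1 \<union> R2)) R2"
    and P: "\<And>K. P1 K \<Longrightarrow> \<not> P2 K"
  shows "components (R1 \<union> R2) = \<K>1 \<union> \<K>2" "card {K \<in> components (R1 \<union> R2). P1 K} = n1"
    "card {K \<in> components (R1 \<union> R2). P2 K} = n2"
proof -
  note d1 = decompositionD[OF 1] and d2 = decompositionD[OF 2]
  show c: "components (R1 \<union> R2) = \<K>1 \<union> \<K>2"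
  proof (rule components_eqI_closed)
    show "\<Union> (\<K>1 \<union> \<K>2) = R1 \<union> R2" using d1(3) d2(3) by auto
    fix K assume K: "K \<in> \<K>1 \<union> \<K>2"
    show "connected K \<and> K \<noteq> {}" using K d1(5) d2(5) by blast
    show "closedin (top_of_set (R1 \<union> R2)) K"
      using K
    proof
      assume "K \<in> \<K>1"
      then show ?thesis using closedin_trans[OF _ cl(1)] d1(5) by blast
    next
      assume "K \<in> \<K>2"
      then show ?thesis using closedin_trans[OF _ cl(2)] d2(5) by blast
    qed
    fix K' assume K': "K' \<in> \<K>1 \<union> \<K>2" "K \<noteq> K'"
    have cross: "A \<inter> B = {}" if "A \<in> \<K>1" "B \<in> \<K>2" for A B
      using that d1(3) d2(3) disj by blast
    show "K \<inter> K' = {}"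
      using K K' d1(4) d2(4) cross[of K K'] cross[of K' K] by blast
  qed (use d1(1) d2(1) in auto)
  have "{K \<in> components (R1 \<union> R2). P1 K} = \<K>1" "{K \<in> components (R1 \<union> R2). P2 K} = \<K>2"
    unfolding c using d1(5) d2(5) P by blast+
  then show "card {K \<in> components (R1 \<union> R2). P1 K} = n1" "card {K \<in> components (R1 \<union> R2). P2 K} = n2"
    using d1(2) d2(2) by simp_all
qed

text \<open>The conclusion of the theorem for a real part \<open>R\<close> and an isospectral set
  \<open>T\<close>, so that it can be proved separately for each shape of the reduced curve.\<close>

definition component_structure :: "real^3 \<Rightarrow> cp2 set \<Rightarrow> (real^3^3) set \<Rightarrow> bool" where
  "component_structure a R T \<longleftrightarrow>
     (card (components R) = 1 \<longrightarrow>
        card (components T) = 4 \<and> (\<forall>K\<in>components T. diffeo_R3 K)) \<and>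
     (card (components R) = 2 \<and> (\<exists>Q\<in>components R. bounded_oval Q) \<longrightarrow>
        card {K \<in> components T. diffeo_R3 K} = 4 \<and>
        card {K \<in> components T. diffeo_S1_R2 K} = 4 \<and>
        (\<forall>K\<in>components T. diffeo_R3 K \<or> diffeo_S1_R2 K)) \<and>
     (card (components R) = 2 \<and> (\<forall>Q\<in>components R. \<not> bounded_oval Q) \<longrightarrow>
        card {K \<in> components T. diffeo_R3 K} = 4 \<and>
        card {K \<in> components T. diffeo_S1_R2 K} = 2 \<and>
        (\<forall>K\<in>components T. diffeo_R3 K \<or> diffeo_S1_R2 K)) \<and>
     (\<forall>K\<in>components T. \<forall>J X. maximal_ode_solution (vfield a) J X \<and> X ` J \<subseteq> K \<longrightarrow>
        (diffeo_R3 K \<longrightarrow> blows_up J X) \<and> (diffeo_S1_R2 K \<longrightarrow> J = UNIV))"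

lemma (in factored_spectral) component_structure_one:
  assumes pos: "\<And>s. hq s > 0"
  shows "component_structure av CR T"
proof -
  have T: "T = {X \<in> T. sX X \<ge> s3}"
  proof (intro equalityI subsetI)
    fix X assume X: "X \<in> T"
    have "4 * W * ((sX X - s3) * hq (sX X)) \<ge> 0" using T_D_nonneg[OF X] by (simp add: D_factored hq_def)
    then have "sX X \<ge> s3" using W_pos pos[of "sX X"] by (simp add: zero_le_mult_iff)
    then show "X \<in> {X \<in> T. sX X \<ge> s3}" using X by simp
  qed auto
  have "decomposition T line.pieces 4 diffeo_R3" using line_pieces unfolding T[symmetric] .
  note d = decomposition_components[OF this]
  have blow: "blows_up J X" if "K \<in> components T" "maximal_ode_solution (vfield av) J X" "X ` J \<subseteq> K" for K J X
    by (rule line_blows_up[OF that(2)]) (use that(3) in_components_subset[OF that(1)] T in blast)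
  have "card (components CR) = 1" using ovals_one[OF pos] by simp
  then show ?thesis
    unfolding component_structure_def using d(2,3) blow diffeo_R3_S1_R2_exclusive[OF d(3)] by auto
qed

lemma (in split_spectral) component_structure_two: "component_structure av CR T"
proof -
  let ?R1 = "{X \<in> T. sX X \<ge> s3}" and ?R2 = "{X \<in> T. sX X \<le> s2}"
  let ?n = "if (\<forall>t. Re (circle.M12 t) \<noteq> 0) \<and> (\<forall>t. Re (circle.M13 t) \<noteq> 0) then 4 else 2 :: nat"
  have T: "T = ?R1 \<union> ?R2"
  proof (intro equalityI subsetI)
    fix X assume X: "X \<in> T"
    have "sX X \<ge> s3 \<or> sX X \<le> s2"
    proof (rule ccontr)
      assume c: "\<not> ?thesis"
      then have "(s3 - sX X) * ((sX X - s1) * (s2 - sX X)) < 0"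
        using s12 by (intro mult_pos_neg mult_pos_neg) auto
      then have "D (sX X) < 0" unfolding D_split using W_pos by (simp add: mult.assoc mult_less_0_iff)
      then show False using T_D_nonneg[OF X] by simp
    qed
    then show "X \<in> ?R1 \<union> ?R2" using X by auto
  qed auto
  have disj: "?R1 \<inter> ?R2 = {}" using s23 by auto
  have "open {s::real. s < s3}" "open {s. s > s2}" by (intro open_Collect_less continuous_intros)+
  then have "closed (- {X. sX X < s3})" "closed (- {X. sX X > s2})"
    by (simp_all only: closed_Compl open_sX[of "\<lambda>s. s < s3"] open_sX[of "\<lambda>s. s > s2"])
  moreover have "?R1 = T \<inter> - {X. sX X < s3}" "?R2 = T \<inter> - {X. sX X > s2}" by auto
  ultimately have cl: "closedin (top_of_set (?R1 \<union> ?R2)) ?R1" "closedin (top_of_set (?R1 \<union> ?R2)) ?R2"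
    unfolding T[symmetric] by (auto intro: closedin_closed_Int)
  note d = decomposition_Un_components[OF line_pieces circle_pieces disj cl diffeo_R3_S1_R2_exclusive, folded T]
  have l: "K \<subseteq> ?R1 \<and> diffeo_R3 K" if "K \<in> line.pieces" for K
    using decompositionD(3,5)[OF line_pieces] that by blast
  have c: "K \<subseteq> ?R2 \<and> diffeo_S1_R2 K" if "K \<in> circle.pieces" for K
    using decompositionD(3,5)[OF circle_pieces] that by blast
  have all: "\<forall>K\<in>components T. diffeo_R3 K \<or> diffeo_S1_R2 K" using d(1) l c by auto
  have blow: "blows_up J X"
    if "K \<in> components T" "maximal_ode_solution (vfield av) J X" "X ` J \<subseteq> K" "diffeo_R3 K" for K J X
  proof -
    have "K \<in> line.pieces" using that(1,4) d(1) c diffeo_R3_S1_R2_exclusive by auto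
    then have "X ` J \<subseteq> ?R1" using that(3) l by blast
    then show ?thesis by (rule line_blows_up[OF that(2)])
  qed
  have glob: "J = UNIV"
    if "K \<in> components T" "maximal_ode_solution (vfield av) J X" "X ` J \<subseteq> K" "diffeo_S1_R2 K" for K J X
  proof -
    have "K \<in> circle.pieces" using that(1,4) d(1) l diffeo_R3_S1_R2_exclusive by auto
    then have "X ` J \<subseteq> ?R2" using that(3) c by blast
    then show ?thesis by (rule circle_global[OF that(2)])
  qed
  have card: "card (components CR) = 2" using ovals_two(1,2) by simp
  have b: "(\<exists>Q\<in>components CR. bounded_oval Q) \<longleftrightarrow> ?n = 4" "?n = 4 \<or> ?n = 2"
    using ovals_two by auto
  have ode: "\<forall>K\<in>components T. \<forall>J X. maximal_ode_solution (vfield av) J X \<and> X ` J \<subseteq> K \<longrightarrow>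
      (diffeo_R3 K \<longrightarrow> blows_up J X) \<and> (diffeo_S1_R2 K \<longrightarrow> J = UNIV)"
  proof (intro ballI allI impI conjI; elim conjE)
    fix K J X assume K: "K \<in> components T" "maximal_ode_solution (vfield av) J X" "X ` J \<subseteq> K"
    show "blows_up J X" if "diffeo_R3 K" by (rule blow[OF K that])
    show "J = UNIV" if "diffeo_S1_R2 K" by (rule glob[OF K that])
  qed
  from b(2) show ?thesis
  proof
    assume n: "?n = 4"
    then have "\<exists>Q\<in>components CR. bounded_oval Q" by (simp only: b(1))
    then show ?thesis
      unfolding component_structure_def using card d(2) d(3)[unfolded n] all ode by simp
  next
    assume n: "?n = 2"
    then have "\<not> (\<exists>Q\<in>components CR. bounded_oval Q)" unfolding b(1) by simp
    then show ?thesis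
      unfolding component_structure_def using card d(2) d(3)[unfolded n] all ode by simp
  qed
qed

lemma (in cubic_data) component_structure_spectral:
  assumes \<sigma>: "\<sigma> \<in> {1, -1}" and w: "w1 = \<sigma> * (a $ 2 - a $ 3)" "w2 = \<sigma> * (a $ 3 - a $ 1)" "w3 = \<sigma> * (a $ 1 - a $ 2)"
    and \<kappa>: "\<kappa> = w1 * x1 + w2 * x2 + w3 * x3"
    and R: "R = {hpoint (cvec z) | z. z \<noteq> 0 \<and> Fc (a $ 1) (a $ 2) (a $ 3) x1 x2 x3 q1 q2 q3 g (cvec z) = 0}"
  shows "component_structure a R T"
proof -
  interpret spectral_cubic w1 w2 w3 q1 q2 q3 g \<kappa> x1 x2 x3 "a $ 1" "a $ 2" "a $ 3" \<sigma>
    by unfold_locales (use assms in auto)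
  have "R = CR"
    unfolding R CR_def F_def L1_def L2_def L3_def Fc_real of_real_eq_0_iff ..
  have av: "vector [a $ 1, a $ 2, a $ 3] = a" by (simp add: vec_eq_iff forall_3)
  obtain s3 b c where f: "\<And>s. D s = 4 * W * ((s - s3) * (s\<^sup>2 + b * s + c))" "\<And>s. s \<ge> s3 \<Longrightarrow> s\<^sup>2 + b * s + c > 0"
    "(\<forall>s. s\<^sup>2 + b * s + c > 0) \<or> (\<exists>s1 s2. s1 < s2 \<and> s2 < s3 \<and> (\<forall>s. s\<^sup>2 + b * s + c = (s - s1) * (s - s2)))"
    by (rule D_factor) (rule that; assumption)
  interpret factored_spectral w1 w2 w3 q1 q2 q3 g \<kappa> x1 x2 x3 s3 b c "a $ 1" "a $ 2" "a $ 3" \<sigma>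
    by unfold_locales (use f in auto)
  from f(3) show ?thesis
  proof
    assume "\<forall>s. s\<^sup>2 + b * s + c > 0"
    then have "component_structure av CR T" by (intro component_structure_one) (simp add: hq_def)
    then show ?thesis using av \<open>R = CR\<close> by (simp add: av_def)
  next
    assume "\<exists>s1 s2. s1 < s2 \<and> s2 < s3 \<and> (\<forall>s. s\<^sup>2 + b * s + c = (s - s1) * (s - s2))"
    then obtain s1 s2 where s: "s1 < s2" "s2 < s3" "\<And>s. s\<^sup>2 + b * s + c = (s - s1) * (s - s2)" by blast
    interpret split_spectral w1 w2 w3 q1 q2 q3 g \<kappa> x1 x2 x3 s3 b c s1 s2 "a $ 1" "a $ 2" "a $ 3" \<sigma>
      by unfold_locales (use s in auto)
    show ?thesis using component_structure_two av \<open>R = CR\<close> by (simp add: av_def)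
  qed
qed

theorem theorem2p5:
  fixes a :: "real^3" and A :: "real^3^3" and C :: "cp2 set" and T :: "(real^3^3) set"
  assumes A: "A = diag a" "inj (($) a)"
    and C: "smooth_cubic C" "real_curve C" "\<forall>i. infinity_pt a i \<in> C"
    and T: "T = isospectral_set A C"
  shows
    "(card (ovals C) = 1 \<longrightarrow>
        card (components T) = 4 \<and> (\<forall>K\<in>components T. diffeo_R3 K)) \<and>
     (card (ovals C) = 2 \<and> (\<exists>Q\<in>ovals C. bounded_oval Q) \<longrightarrow>
        card {K \<in> components T. diffeo_R3 K} = 4 \<and>
        card {K \<in> components T. diffeo_S1_R2 K} = 4 \<and>
        (\<forall>K\<in>components T. diffeo_R3 K \<or> diffeo_S1_R2 K)) \<and>
     (card (ovals C) = 2 \<and> (\<forall>Q\<in>ovals C. \<not> bounded_oval Q) \<longrightarrow>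
        card {K \<in> components T. diffeo_R3 K} = 4 \<and>
        card {K \<in> components T. diffeo_S1_R2 K} = 2 \<and>
        (\<forall>K\<in>components T. diffeo_R3 K \<or> diffeo_S1_R2 K)) \<and>
     (\<forall>K\<in>components T. \<forall>J X. maximal_solution A J X \<and> X ` J \<subseteq> K \<longrightarrow>
        (diffeo_R3 K \<longrightarrow> blows_up J X) \<and>
        (diffeo_S1_R2 K \<longrightarrow> J = UNIV))"
proof -
  obtain x1 x2 x3 q1 q2 g where F: "C = zero_locus (Fc (a $ 1) (a $ 2) (a $ 3) x1 x2 x3 q1 q2 0 g)"
    "\<And>z. z \<noteq> 0 \<Longrightarrow> Fc (a $ 1) (a $ 2) (a $ 3) x1 x2 x3 q1 q2 0 g z = 0 \<Longrightarrow>
      \<not> (Fc (a $ 1) (a $ 2) (a $ 3) x1 x2 x3 q1 q2 0 g has_derivative (\<lambda>_. 0)) (at z)"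
    by (rule smooth_cubic_normal_form[OF A(2) C]) (rule that; assumption)
  have a: "a $ 1 \<noteq> a $ 2" "a $ 1 \<noteq> a $ 3" "a $ 2 \<noteq> a $ 3" using A(2) by (auto simp: inj_eq)
  define p where "p = (a $ 2 - a $ 3) * (a $ 3 - a $ 1) * (a $ 1 - a $ 2)"
  \<comment> \<open>The relation between the \<open>L\<^sub>i\<close> fixes \<open>w\<close> up to a
    factor; this sign makes the product of its entries negative.\<close>
  define \<sigma> :: real where "\<sigma> = (if p < 0 then 1 else -1)"
  define w1 where "w1 = \<sigma> * (a $ 2 - a $ 3)"
  define w2 where "w2 = \<sigma> * (a $ 3 - a $ 1)"
  define w3 where "w3 = \<sigma> * (a $ 1 - a $ 2)"
  define \<kappa> where "\<kappa> = w1 * x1 + w2 * x2 + w3 * x3"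
  have \<sigma>: "\<sigma> \<in> {1, -1}" "\<sigma> \<noteq> 0" by (simp_all add: \<sigma>_def)
  have "p \<noteq> 0" using a by (simp add: p_def)
  moreover have "w1 * w2 * w3 = \<sigma> ^ 3 * p" by (simp add: w1_def w2_def w3_def p_def power3_eq_cube)
  ultimately have w: "w1 * w2 * w3 < 0" by (auto simp: \<sigma>_def)
  interpret cubic: cubic_data w1 w2 w3 q1 q2 0 g \<kappa> x1 x2 x3
  proof
    show "w1 + w2 + w3 = 0" by (simp add: w1_def w2_def w3_def algebra_simps)
    show "w1 * w2 * w3 < 0" by (rule w)
  next
    fix s assume "(g + \<kappa> * s)\<^sup>2 - 4 * ((q1 + s * w1) * (q2 + s * w2) * (0 + s * w3)) = 0"
    then show "2 * \<kappa> * (g + \<kappa> * s) - 4 * (w1 * (q2 + s * w2) * (0 + s * w3) + w2 * (q1 + s * w1) * (0 + s * w3)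
        + w3 * (q1 + s * w1) * (q2 + s * w2)) \<noteq> 0"
      by (intro discriminant_nonsingular[OF a \<sigma>(2) w1_def w2_def w3_def \<kappa>_def] F(2))
  qed
  have "C \<inter> RP2 = {hpoint (cvec z) | z. z \<noteq> 0 \<and> Fc (a $ 1) (a $ 2) (a $ 3) x1 x2 x3 q1 q2 0 g (cvec z) = 0}"
    unfolding F(1) RP2_cvec using zero_locus_Fc_iff cvec_eq_0_iff by blast
  from cubic.component_structure_spectral[OF \<sigma>(1) w1_def w2_def w3_def \<kappa>_def this]
  have str: "component_structure a (C \<inter> RP2) cubic.T" .
  moreover have "cubic.T = T"
  proof (rule set_eqI)
    fix X
    have "X \<in> T \<longleftrightarrow> zero_locus (\<lambda>z. det (\<chi> i j.
      z $ 3 * of_real (X $ i $ j) + z $ 1 * of_real (diag a $ i $ j) - z $ 2 * mat 1 $ i $ j)) = C"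
      unfolding T A(1) isospectral_set_def spectral_curve_def by simp
    also have "\<dots> \<longleftrightarrow> X \<in> cubic.T"
      unfolding det_Fc F(1) zero_locus_Fc_eq_iff[OF a \<sigma>(2) w1_def w2_def w3_def \<kappa>_def]
      by (simp add: cubic.T_def cubic.P1_def cubic.P2_def cubic.P3_def cubic.\<l>_def cubic.uX_def cubic.vX_def)
    finally show "X \<in> cubic.T \<longleftrightarrow> X \<in> T" ..
  qed
  moreover have "maximal_solution A J X \<longleftrightarrow> maximal_ode_solution (vfield a) J X" for J X
    unfolding maximal_solution_def maximal_ode_solution_def solution_def ode_solution_def vfield_def A(1) ..
  ultimately show ?thesis unfolding component_structure_def ovals_def by simp
qed

end
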